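(* Let $d\ge 2$, and suppose that the compact set $E\subset\mathbb{R}^d$ satisfies $\dim E=\beta$ for some $\beta>0$. Suppose that $0<\tau<1$ and that $2\tau+(d-1)/2<\beta<2\tau+d-1$. Then $$\dim\{x\in\mathbb{R}^d:\ \dim D_x(E)<\tau\}\le 2\tau-\beta+d-1 .$$
   Context: $\dim$ denotes Hausdorff dimension (with $\dim\emptyset=0$). For $E\subset\mathbb{R}^d$ and $x\in\mathbb{R}^d$, the pinned distance set of $E$ at $x$ is $D_x(E)=\{|x-y|: y\in E\}\subset[0,\infty)$. *)

theory Defs
  imports "HOL-Analysis.Analysis"
begin

text \<open>The \<open>s\<close>-th power of the diameter, with the usual conventions at \<open>s = 0\<close> (so that the
  \<open>0\<close>-dimensional Hausdorff measure is counting measure): the empty set contributes \<open>0\<close> and any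
  nonempty set contributes \<open>1\<close>. The case distinction is needed because \<open>0 powr 0 = 0\<close>.\<close>

definition diam_power :: "real \<Rightarrow> 'a::metric_space set \<Rightarrow> ennreal" where
  "diam_power s U = (if U = {} then 0 else if s = 0 then 1 else ennreal (diameter U powr s))"

text \<open>Covers are sequences of arbitrary sets; finite covers are included by padding with \<open>{}\<close>.
  Boundedness is required explicitly since \<^const>\<open>diameter\<close> is meaningless for unbounded sets.\<close>

definition hausdorff_content :: "real \<Rightarrow> real \<Rightarrow> 'a::metric_space set \<Rightarrow> ennreal" where
  "hausdorff_content s \<delta> A =
     Inf {(\<Sum>i. diam_power s (U i)) | U :: nat \<Rightarrow> 'a set.
            A \<subseteq> (\<Union>i. U i) \<and> (\<forall>i. bounded (U i) \<and> diameter (U i) \<le> \<delta>)}"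

definition hausdorff_measure :: "real \<Rightarrow> 'a::metric_space set \<Rightarrow> ennreal" where
  "hausdorff_measure s A = (SUP \<delta>\<in>{0<..}. hausdorff_content s \<delta> A)"

definition hausdorff_dim :: "'a::metric_space set \<Rightarrow> ereal" where
  "hausdorff_dim A = Inf (ereal ` {s. 0 \<le> s \<and> hausdorff_measure s A = 0})"

definition pinned_distance_set :: "'a::metric_space \<Rightarrow> 'a set \<Rightarrow> real set" where
  "pinned_distance_set x E = {dist x y | y. y \<in> E}"

lemma hausdorff_measure_empty: "hausdorff_measure s {} = 0"
proof -
  have "hausdorff_content s \<delta> ({} :: 'a set) = 0" if "\<delta> > 0" for \<delta>
  proof -
    have "hausdorff_content s \<delta> ({} :: 'a set) \<le> (\<Sum>i::nat. diam_power s ({} :: 'a set))"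
      unfolding hausdorff_content_def
      by (rule Inf_lower) (use that in \<open>auto intro!: exI[of _ "\<lambda>_. {}"]\<close>)
    then show ?thesis by (simp add: diam_power_def)
  qed
  then show ?thesis unfolding hausdorff_measure_def by (simp add: SUP_eq_const)
qed

lemma hausdorff_dim_empty: "hausdorff_dim {} = 0"
  unfolding hausdorff_dim_def
proof (rule antisym)
  show "Inf (ereal ` {s. 0 \<le> s \<and> hausdorff_measure s ({} :: 'a set) = 0}) \<le> 0"
    by (rule Inf_lower) (auto simp: hausdorff_measure_empty zero_ereal_def)
  show "0 \<le> Inf (ereal ` {s. 0 \<le> s \<and> hausdorff_measure s ({} :: 'a set) = 0})"
    by (rule Inf_greatest) auto
qed

end

theory Submission
  imports Defs "HOL-Probability.Probability"
begin

text \<open>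
  Suppose the exceptional set had dimension above the bound. For each exceptional pin \<open>x\<close> the set \<open>E\<close> is
  covered, over dyadic scales \<open>2\<^sup>-\<^sup>k\<close>, by at most \<open>O(2 powr (k \<tau>))\<close> annuli centred at \<open>x\<close>, so at some scale these
  annuli carry a mass of at least \<open>c \<theta>\<^sup>k\<close>, with \<open>\<theta> < 1\<close> as close to \<open>1\<close> as we like. By pigeonholing, one scale serves
  a set of pins of large Hausdorff content. Placing finitely supported Frostman weights on the pins and on \<open>E\<close>,
  this contradicts an incidence bound with a power gain.

  In dimension at least three, the incidence bound is Fourier analytic. A Fejer kernel majorises the annuli, which
  leaves the phases \<open>exp (i l (|x - y|\<^sup>2 - u))\<close>, to be integrated over dyadic shells \<open>\<Lambda> \<le> l \<le> 2 \<Lambda>\<close>. After convolution with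
  a Gaussian of width \<open>1 / \<Lambda>\<close>, Cauchy-Schwarz decouples the two weights. The square of the pin side expands into
  correlations of two pins, which are explicit complex Gaussian integrals: integrating in space yields the factor
  \<open>gauss_int (1 - i q) ^ d\<close> in the frequency difference \<open>q\<close>, and the remaining frequency integral has a quadratic phase,
  so that it gains from its second derivative. In the plane, Cauchy-Schwarz over pairs of pins and a direct count of
  two transversal annuli suffice.
\<close>

section \<open>Oscillatory integrals\<close>

text \<open>Squared distances are used because \<open>|z - x|^2\<close> has the same quadratic part
  in \<open>z\<close> for every pin \<open>x\<close>: in a product of two conjugate waves only the
  frequency difference \<open>q\<close> multiplies \<open>|z|^2\<close>, and every pair correlation
  stays Gaussian. The shell at \<Lambda> costs
  \<open>\<Lambda> powr ((d + 1 - \<beta> - \<sigma>) / 2)\<close> per radius, for any \<sigma> < s,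
  where \<open>s\<close> is the exponent of the weight on the pins. Multiplied by
  \<open>2 powr (n * \<tau>)\<close> radii and divided by the kernel height \<open>2 ^ n\<close>,
  this gains as soon as s + \<beta> > 2 \<tau> + d - 1, which is the threshold of the theorem.
  Integrability in \<open>q\<close> forces 2 \<sigma> < d - 1, and the lower bound on \<beta> is
  what leaves room for such exponents. For d = 2 the Gaussian factor decays only like
  \<open>1 / |q|\<close>, which is not integrable. The order of choices is the other obstacle: the
  scale that serves a pin must be fixed before \<open>E\<close> is replaced by a finite weight. A
  whole sequence of weights on \<open>E\<close> is therefore kept, pins are sorted by a cluster
  point of the set functions of these weights, and one weight is picked only after finitely many
  pins have been chosen.\<close>

lemma norm_add_le_bounds: "x = y + z \<Longrightarrow> norm y \<le> A \<Longrightarrow> norm z \<le> B \<Longrightarrow> A + B \<le> C \<Longrightarrow> norm x \<le> C"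
  by (metis add_mono norm_triangle_ineq order_trans)

text \<open>The second mean value theorem replaces a monotone real amplitude by its two endpoint
  values, each multiplying the integral of \<open>f\<close> over a subinterval. This costs
  \<open>2 * G * M\<close> for a real integrand, and real and imaginary parts double it.\<close>

lemma monotone_mult_integral_bound:
  fixes f :: "real \<Rightarrow> complex" and g :: "real \<Rightarrow> real"
  assumes "a \<le> b" and f: "continuous_on {a..b} f" and g: "continuous_on {a..b} g"
    and mono: "mono_on {a..b} g \<or> antimono_on {a..b} g"
    and G: "\<And>x. x \<in> {a..b} \<Longrightarrow> \<bar>g x\<bar> \<le> G"
    and M: "\<And>c d. a \<le> c \<Longrightarrow> c \<le> d \<Longrightarrow> d \<le> b \<Longrightarrow> norm (integral {c..d} f) \<le> M"
  shows "norm (integral {a..b} (\<lambda>x. of_real (g x) * f x)) \<le> 4 * G * M"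
proof -
  have G0: "G \<ge> 0" using G[of a] assms(1) by (meson abs_ge_zero atLeastAtMost_iff order_refl order_trans)
  have real_case: "\<bar>integral {a..b} (\<lambda>x. g x * h x)\<bar> \<le> 2 * G * M"
    if h: "continuous_on {a..b} h" and hM: "\<And>c d. a \<le> c \<Longrightarrow> c \<le> d \<Longrightarrow> d \<le> b \<Longrightarrow> \<bar>integral {c..d} h\<bar> \<le> M"
    for h :: "real \<Rightarrow> real"
  proof -
    have hi: "h integrable_on {a..b}" using h by (rule integrable_continuous_interval)
    have inc: "\<bar>integral {a..b} (\<lambda>x. k x * h x)\<bar> \<le> 2 * G * M"
      if k: "mono_on {a..b} k" and kG: "\<And>x. x \<in> {a..b} \<Longrightarrow> \<bar>k x\<bar> \<le> G" for k :: "real \<Rightarrow> real"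
    proof -
      obtain c where c: "c \<in> {a..b}"
        "integral {a..b} (\<lambda>x. k x * h x) = k a * integral {a..c} h + k b * integral {c..b} h"
        by (rule second_mean_value_theorem[OF hi \<open>a \<le> b\<close>, of k])
          (use k in \<open>auto simp: monotone_on_def\<close>)
      have "\<bar>k a * integral {a..c} h\<bar> \<le> G * M"
        unfolding abs_mult using kG[of a] hM[of a c] c(1) \<open>a \<le> b\<close> G0 by (intro mult_mono) auto
      moreover have "\<bar>k b * integral {c..b} h\<bar> \<le> G * M"
        unfolding abs_mult using kG[of b] hM[of c b] c(1) \<open>a \<le> b\<close> G0 by (intro mult_mono) auto
      ultimately show ?thesis unfolding c(2) by linarith
    qed
    show ?thesis
      using mono
    proof
      assume "mono_on {a..b} g"
      then show ?thesis using inc[of g] G by blast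
    next
      assume "antimono_on {a..b} g"
      then have "mono_on {a..b} (\<lambda>x. - g x)" by (auto simp: monotone_on_def)
      from inc[OF this] show ?thesis using G by simp
    qed
  qed
  have int: "(\<lambda>x. of_real (g x) * f x) integrable_on {a..b}"
    by (intro integrable_continuous_interval continuous_intros f g)
  have sub: "f integrable_on {c..d}" if "a \<le> c" "d \<le> b" for c d
    by (rule integrable_continuous_interval) (use that in \<open>auto intro: continuous_on_subset[OF f]\<close>)
  have "\<bar>integral {a..b} (\<lambda>x. g x * Re (f x))\<bar> \<le> 2 * G * M"
  proof (rule real_case)
    show "continuous_on {a..b} (\<lambda>x. Re (f x))" by (intro continuous_intros f)
    fix c d assume cd: "a \<le> c" "c \<le> d" "d \<le> b"
    have "integral {c..d} (\<lambda>x. Re (f x)) = Re (integral {c..d} f)"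
      using integral_linear[OF sub[of c d] bounded_linear_Re] cd by (simp add: o_def)
    then show "\<bar>integral {c..d} (\<lambda>x. Re (f x))\<bar> \<le> M"
      using M[OF cd] abs_Re_le_cmod by (metis order_trans)
  qed
  moreover have "\<bar>integral {a..b} (\<lambda>x. g x * Im (f x))\<bar> \<le> 2 * G * M"
  proof (rule real_case)
    show "continuous_on {a..b} (\<lambda>x. Im (f x))" by (intro continuous_intros f)
    fix c d assume cd: "a \<le> c" "c \<le> d" "d \<le> b"
    have "integral {c..d} (\<lambda>x. Im (f x)) = Im (integral {c..d} f)"
      using integral_linear[OF sub[of c d] bounded_linear_Im] cd by (simp add: o_def)
    then show "\<bar>integral {c..d} (\<lambda>x. Im (f x))\<bar> \<le> M"
      using M[OF cd] abs_Im_le_cmod by (metis order_trans)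
  qed
  moreover have "Re (integral {a..b} (\<lambda>x. of_real (g x) * f x)) = integral {a..b} (\<lambda>x. g x * Re (f x))"
    using integral_linear[OF int bounded_linear_Re] by (simp add: o_def)
  moreover have "Im (integral {a..b} (\<lambda>x. of_real (g x) * f x)) = integral {a..b} (\<lambda>x. g x * Im (f x))"
    using integral_linear[OF int bounded_linear_Im] by (simp add: o_def)
  ultimately show ?thesis
    using cmod_le[of "integral {a..b} (\<lambda>x. of_real (g x) * f x)"] by linarith
qed

text \<open>The second derivative test, done by hand. Up to \<open>1 / sqrt \<gamma>\<close> the
  length of the interval is the bound. Beyond it the phase has derivative at least
  \<open>2 * sqrt \<gamma>\<close>, and \<open>1 / (2 * \<gamma> * l)\<close> times an exact
  derivative leaves a decreasing amplitude.\<close>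

lemma fresnel_bound_nonneg:
  fixes \<gamma> :: real
  assumes "\<gamma> > 0" "0 \<le> a" "a \<le> b"
  shows "norm (integral {a..b} (\<lambda>l. cis (\<gamma> * l\<^sup>2))) \<le> 6 / sqrt \<gamma>"
proof -
  define r where "r = 1 / sqrt \<gamma>"
  have r: "r > 0" using assms by (simp add: r_def)
  have cont: "continuous_on S (\<lambda>l. cis (\<gamma> * l\<^sup>2))" for S :: "real set"
    by (intro continuous_intros)
  have far: "norm (integral {c..d} (\<lambda>l. cis (\<gamma> * l\<^sup>2))) \<le> 4 / sqrt \<gamma>" if "r \<le> c" "c \<le> d" for c d
  proof -
    \<comment> \<open>The exact derivative of \<open>cis (\<gamma> * l\<^sup>2)\<close>, so that all
      its integrals over subintervals have norm at most \<open>2\<close>.\<close>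
    define f where "f = (\<lambda>l. \<i> * of_real (2 * \<gamma> * l) * cis (\<gamma> * l\<^sup>2))"
    have prim: "(f has_integral (cis (\<gamma> * v\<^sup>2) - cis (\<gamma> * u\<^sup>2))) {u..v}" if "u \<le> v" for u v
      unfolding f_def
    proof (rule fundamental_theorem_of_calculus[OF that])
      fix x assume "x \<in> {u..v}"
      have "((\<lambda>z. exp (\<i> * (of_real \<gamma> * z\<^sup>2))) has_field_derivative
          exp (\<i> * (of_real \<gamma> * (of_real x)\<^sup>2)) * (\<i> * (of_real \<gamma> * (2 * of_real x)))) (at (of_real x))"
        by (auto intro!: derivative_eq_intros)
      from has_vector_derivative_real_field[OF this]
      show "((\<lambda>l. cis (\<gamma> * l\<^sup>2)) has_vector_derivative \<i> * of_real (2 * \<gamma> * x) * cis (\<gamma> * x\<^sup>2)) (at x within {u..v})"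
        by (simp add: cis_conv_exp mult_ac)
    qed
    have "norm (integral {c..d} (\<lambda>l. of_real (1 / (2 * \<gamma> * l)) * f l)) \<le> 4 * (1 / (2 * \<gamma> * r)) * 2"
    proof (rule monotone_mult_integral_bound)
      show "continuous_on {c..d} f" unfolding f_def by (intro continuous_intros)
      show "continuous_on {c..d} (\<lambda>l. 1 / (2 * \<gamma> * l))"
        using that r assms by (intro continuous_intros) auto
      show "mono_on {c..d} (\<lambda>l. 1 / (2 * \<gamma> * l)) \<or> antimono_on {c..d} (\<lambda>l. 1 / (2 * \<gamma> * l))"
        using that r assms by (intro disjI2) (auto simp: monotone_on_def intro!: divide_left_mono mult_left_mono)
      show "\<bar>1 / (2 * \<gamma> * x)\<bar> \<le> 1 / (2 * \<gamma> * r)" if "x \<in> {c..d}" for x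
        using that \<open>r \<le> c\<close> r assms by (auto simp: abs_mult intro!: divide_left_mono mult_left_mono)
      show "norm (integral {u..v} f) \<le> 2" if "c \<le> u" "u \<le> v" "v \<le> d" for u v
        using integral_unique[OF prim[OF that(2)]] norm_triangle_ineq4[of "cis (\<gamma> * v\<^sup>2)" "cis (\<gamma> * u\<^sup>2)"]
        by simp
    qed (use that in auto)
    also have "4 * (1 / (2 * \<gamma> * r)) * 2 = 4 / sqrt \<gamma>"
      using assms real_sqrt_mult_self[of \<gamma>] by (simp add: r_def field_simps)
    also have "integral {c..d} (\<lambda>l. of_real (1 / (2 * \<gamma> * l)) * f l) = - integral {c..d} (\<lambda>l. - \<i> * cis (\<gamma> * l\<^sup>2))"
      unfolding integral_neg[symmetric]
    proof (rule integral_cong)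
      fix x assume "x \<in> {c..d}"
      then have "x > 0" using that r by auto
      then show "of_real (1 / (2 * \<gamma> * x)) * f x = - (- \<i> * cis (\<gamma> * x\<^sup>2))"
        using assms(1) by (simp add: f_def)
    qed
    also have "norm \<dots> = norm (integral {c..d} (\<lambda>l. cis (\<gamma> * l\<^sup>2)))"
      by (simp add: norm_mult)
    finally show ?thesis .
  qed
  have near: "norm (integral {c..d} (\<lambda>l. cis (\<gamma> * l\<^sup>2))) \<le> 2 / sqrt \<gamma>" if "0 \<le> c" "c \<le> d" "d \<le> r" for c d
  proof -
    have "norm (integral {c..d} (\<lambda>l. cis (\<gamma> * l\<^sup>2))) \<le> 1 * (d - c)"
      by (rule integral_bound[OF \<open>c \<le> d\<close> cont]) auto
    also have "\<dots> \<le> 2 * r" using that r by simp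
    also have "\<dots> = 2 / sqrt \<gamma>" by (simp add: r_def)
    finally show ?thesis .
  qed
  have le: "2 / sqrt \<gamma> \<le> 6 / sqrt \<gamma>" "4 / sqrt \<gamma> \<le> 6 / sqrt \<gamma>"
    using assms(1) by (auto intro!: divide_right_mono)
  consider "b \<le> r" | "r \<le> a" | "a \<le> r" "r \<le> b" by linarith
  then show ?thesis
  proof cases
    case 1
    then show ?thesis using near[of a b] assms(2,3) le by linarith
  next
    case 2
    then show ?thesis using far[of a b] assms(2,3) le by linarith
  next
    case 3
    have eq: "integral {a..b} (\<lambda>l. cis (\<gamma> * l\<^sup>2)) = integral {a..r} (\<lambda>l. cis (\<gamma> * l\<^sup>2)) + integral {r..b} (\<lambda>l. cis (\<gamma> * l\<^sup>2))"
      by (rule Henstock_Kurzweil_Integration.integral_combine[symmetric])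
        (use 3 in \<open>auto intro: integrable_continuous_interval cont\<close>)
    show ?thesis
      by (rule norm_add_le_bounds[OF eq near[OF assms(2) 3(1) order_refl] far[OF order_refl 3(2)]])
        (simp flip: add_divide_distrib)
  qed
qed

text \<open>An interval that straddles \<open>0\<close> is cut there, which doubles the constant; a
  negative \<gamma> is handled by conjugation.\<close>

lemma fresnel_bound:
  fixes \<gamma> :: real
  assumes "\<gamma> \<noteq> 0" "a \<le> b"
  shows "norm (integral {a..b} (\<lambda>l. cis (\<gamma> * l\<^sup>2))) \<le> 12 / sqrt \<bar>\<gamma>\<bar>"
proof -
  have cont: "continuous_on S (\<lambda>l. cis (\<gamma> * l\<^sup>2))" for S :: "real set" and \<gamma>
    by (intro continuous_intros)
  have pos: "norm (integral {a..b} (\<lambda>l. cis (\<gamma> * l\<^sup>2))) \<le> 12 / sqrt \<gamma>" if "\<gamma> > 0" for \<gamma> :: real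
  proof -
    have s: "12 / sqrt \<gamma> = 6 / sqrt \<gamma> + 6 / sqrt \<gamma>" "0 < 6 / sqrt \<gamma>" using that by (auto simp: field_simps)
    have neg: "norm (integral {c..d} (\<lambda>l. cis (\<gamma> * l\<^sup>2))) \<le> 6 / sqrt \<gamma>" if "c \<le> d" "d \<le> 0" for c d
    proof -
      have "integral {c..d} (\<lambda>l. cis (\<gamma> * l\<^sup>2)) = integral {-d..-c} (\<lambda>l. cis (\<gamma> * l\<^sup>2))"
        using Henstock_Kurzweil_Integration.integral_reflect_real[of d c "\<lambda>l. cis (\<gamma> * l\<^sup>2)"] by simp
      then show ?thesis using fresnel_bound_nonneg[OF \<open>\<gamma> > 0\<close>, of "-d" "-c"] that by simp
    qed
    consider "0 \<le> a" | "b \<le> 0" | "a \<le> 0" "0 \<le> b" by linarith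
    then show ?thesis
    proof cases
      case 3
      have eq: "integral {a..b} (\<lambda>l. cis (\<gamma> * l\<^sup>2)) = integral {a..0} (\<lambda>l. cis (\<gamma> * l\<^sup>2)) + integral {0..b} (\<lambda>l. cis (\<gamma> * l\<^sup>2))"
        by (rule Henstock_Kurzweil_Integration.integral_combine[symmetric])
          (use 3 in \<open>auto intro: integrable_continuous_interval cont\<close>)
      show ?thesis
        by (rule norm_add_le_bounds[OF eq neg[OF 3(1) order_refl] fresnel_bound_nonneg[OF that order_refl 3(2)]])
          (simp flip: add_divide_distrib)
    next
      case 1
      then show ?thesis using fresnel_bound_nonneg[OF that, of a b] s assms(2) by linarith
    next
      case 2
      then show ?thesis using neg[of a b] s assms(2) by linarith
    qed
  qed
  show ?thesis
  proof (cases "\<gamma> > 0")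
    case True
    then show ?thesis using pos by simp
  next
    case False
    have "cnj (integral {a..b} (\<lambda>l. cis (- \<gamma> * l\<^sup>2))) = integral {a..b} (\<lambda>l. cis (\<gamma> * l\<^sup>2))"
      using integral_linear[OF integrable_continuous_interval[OF cont[where \<gamma> = "-\<gamma>" and S = "{a..b}"]] bounded_linear_cnj]
      by (simp add: o_def cis_cnj)
    then have "norm (integral {a..b} (\<lambda>l. cis (\<gamma> * l\<^sup>2))) = norm (integral {a..b} (\<lambda>l. cis (- \<gamma> * l\<^sup>2)))"
      by (metis complex_mod_cnj)
    then show ?thesis using pos[of "-\<gamma>"] False assms by simp
  qed
qed

lemma quadratic_phase_bound:
  fixes B0 B1 B2 :: real
  assumes "B2 \<noteq> 0" "a \<le> b"
  shows "norm (integral {a..b} (\<lambda>l. cis (B2 * l\<^sup>2 + B1 * l + B0))) \<le> 12 / sqrt \<bar>B2\<bar>"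
proof -
  define h where "h = B1 / (2 * B2)"
  have eq: "cis (B2 * l\<^sup>2 + B1 * l + B0) = cis (B0 - B2 * h\<^sup>2) * cis (B2 * (l + h)\<^sup>2)" for l
  proof -
    have "B2 * (2 * h) = B1" using assms(1) by (simp add: h_def)
    then have "B2 * l\<^sup>2 + B1 * l + B0 = (B0 - B2 * h\<^sup>2) + B2 * (l + h)\<^sup>2"
      by (auto simp: power2_eq_square algebra_simps)
    then show ?thesis by (simp only: cis_mult)
  qed
  have "integral {a..b} (\<lambda>l. cis (B2 * (l + h)\<^sup>2)) = integral {a+h..b+h} (\<lambda>l. cis (B2 * l\<^sup>2))"
  proof -
    have "((\<lambda>l. cis (B2 * l\<^sup>2)) has_integral integral {a+h..b+h} (\<lambda>l. cis (B2 * l\<^sup>2))) {a+h..b+h}"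
      by (intro integrable_integral integrable_continuous_interval continuous_intros)
    then have "((\<lambda>l. cis (B2 * (l + h)\<^sup>2)) has_integral integral {a+h..b+h} (\<lambda>l. cis (B2 * l\<^sup>2))) {a..b}"
      by (subst (asm) has_integral_shift_Icc_real[symmetric]) (simp add: o_def add.commute)
    then show ?thesis by (rule integral_unique)
  qed
  then show ?thesis
    unfolding eq using fresnel_bound[OF assms(1), of "a+h" "b+h"] assms(2) by (simp add: norm_mult)
qed

text \<open>Serves amplitudes \<open>exp p\<close> with \<open>p\<close> a real quadratic: they are
  monotone on either side of the vertex, so that two applications of the second mean value theorem
  suffice whatever the coefficients are.\<close>

lemma quadratic_monotone_split:
  fixes A0 A1 A2 :: real
  assumes "a \<le> b"
  obtains m where "a \<le> m" "m \<le> b"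
    "\<And>S. S = {a..m} \<or> S = {m..b} \<Longrightarrow> mono_on S (\<lambda>l. A2 * l\<^sup>2 + A1 * l + A0) \<or> antimono_on S (\<lambda>l. A2 * l\<^sup>2 + A1 * l + A0)"
proof -
  have diff: "(A2 * y\<^sup>2 + A1 * y + A0) - (A2 * x\<^sup>2 + A1 * x + A0) = (y - x) * (A2 * (x + y) + A1)" for x y
    by (simp add: power2_eq_square algebra_simps)
  have inc: "mono_on S (\<lambda>l. A2 * l\<^sup>2 + A1 * l + A0)" if "\<And>x. x \<in> S \<Longrightarrow> 2 * A2 * x + A1 \<ge> 0" for S
  proof (rule monotone_onI)
    fix x y assume xy: "x \<in> S" "y \<in> S" "x \<le> y"
    have "(y - x) * (A2 * (x + y) + A1) \<ge> 0"
      using that[OF xy(1)] that[OF xy(2)] xy(3) by (intro mult_nonneg_nonneg) (auto simp: algebra_simps)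
    then show "A2 * x\<^sup>2 + A1 * x + A0 \<le> A2 * y\<^sup>2 + A1 * y + A0" using diff[of y x] by linarith
  qed
  have dec: "antimono_on S (\<lambda>l. A2 * l\<^sup>2 + A1 * l + A0)" if "\<And>x. x \<in> S \<Longrightarrow> 2 * A2 * x + A1 \<le> 0" for S
  proof (rule monotone_onI)
    fix x y assume xy: "x \<in> S" "y \<in> S" "x \<le> y"
    have "(y - x) * (A2 * (x + y) + A1) \<le> 0"
      using that[OF xy(1)] that[OF xy(2)] xy(3) by (intro mult_nonneg_nonpos) (auto simp: algebra_simps)
    then show "A2 * x\<^sup>2 + A1 * x + A0 \<ge> A2 * y\<^sup>2 + A1 * y + A0" using diff[of y x] by linarith
  qed
  \<comment> \<open>The vertex, clamped to the interval. For \<open>A2 = 0\<close> the quotient is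
    \<open>0\<close> by convention and any point of the interval would do, the polynomial being
    monotone throughout.\<close>
  define m where "m = max a (min b (- A1 / (2 * A2)))"
  have m: "a \<le> m" "m \<le> b" using assms by (auto simp: m_def)
  consider "A2 = 0" | "A2 > 0" | "A2 < 0" by linarith
  then have "\<forall>S. S = {a..m} \<or> S = {m..b} \<longrightarrow> mono_on S (\<lambda>l. A2 * l\<^sup>2 + A1 * l + A0) \<or> antimono_on S (\<lambda>l. A2 * l\<^sup>2 + A1 * l + A0)"
  proof cases
    case 1
    then show ?thesis using inc dec by (cases "A1 \<ge> 0") auto
  next
    case 2
    have "antimono_on {a..m} (\<lambda>l. A2 * l\<^sup>2 + A1 * l + A0) \<or> a = m"
    proof (cases "a = m")
      case False
      then have "m \<le> - A1 / (2 * A2)" using m by (auto simp: m_def max_def min_def split: if_splits)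
      then have "2 * A2 * m + A1 \<le> 0" using 2 by (simp add: field_simps)
      moreover have "A2 * x \<le> A2 * m" if "x \<le> m" for x using that 2 by simp
      ultimately show ?thesis by (intro disjI1 dec) fastforce
    qed simp
    moreover have "mono_on {m..b} (\<lambda>l. A2 * l\<^sup>2 + A1 * l + A0) \<or> b = m"
    proof (cases "b = m")
      case False
      then have "m \<ge> - A1 / (2 * A2)" using m by (auto simp: m_def max_def min_def split: if_splits)
      then have "2 * A2 * m + A1 \<ge> 0" using 2 by (simp add: field_simps)
      moreover have "A2 * x \<ge> A2 * m" if "x \<ge> m" for x using that 2 by simp
      ultimately show ?thesis by (intro disjI1 inc) fastforce
    qed simp
    ultimately show ?thesis by (auto simp: monotone_on_def)
  next
    case 3
    have "mono_on {a..m} (\<lambda>l. A2 * l\<^sup>2 + A1 * l + A0) \<or> a = m"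
    proof (cases "a = m")
      case False
      then have "m \<le> - A1 / (2 * A2)" using m by (auto simp: m_def max_def min_def split: if_splits)
      then have "2 * A2 * m + A1 \<ge> 0" using 3 by (simp add: field_simps)
      moreover have "A2 * x \<ge> A2 * m" if "x \<le> m" for x using that 3 by simp
      ultimately show ?thesis by (intro disjI1 inc) fastforce
    qed simp
    moreover have "antimono_on {m..b} (\<lambda>l. A2 * l\<^sup>2 + A1 * l + A0) \<or> b = m"
    proof (cases "b = m")
      case False
      then have "m \<ge> - A1 / (2 * A2)" using m by (auto simp: m_def max_def min_def split: if_splits)
      then have "2 * A2 * m + A1 \<le> 0" using 3 by (simp add: field_simps)
      moreover have "A2 * x \<le> A2 * m" if "x \<ge> m" for x using that 3 by simp
      ultimately show ?thesis by (intro disjI1 dec) fastforce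
    qed simp
    ultimately show ?thesis by (auto simp: monotone_on_def)
  qed
  with m that show ?thesis by blast
qed

text \<open>The amplitude enters only through its bound \<open>K\<close>, having at most two
  monotone pieces; \<open>96 = 2 * 4 * 12\<close> counts the pieces, the mean value bound and the
  pure phase bound. The uniformity in the coefficients matters because the Gaussian amplitudes to
  come depend on the pair of pins.\<close>

lemma quadratic_exp_integral_bound:
  fixes A0 A1 A2 B0 B1 B2 K :: real
  assumes "B2 \<noteq> 0" "a \<le> b"
    and K: "\<And>l. a \<le> l \<Longrightarrow> l \<le> b \<Longrightarrow> exp (A2 * l\<^sup>2 + A1 * l + A0) \<le> K"
  shows "norm (integral {a..b} (\<lambda>l. of_real (exp (A2 * l\<^sup>2 + A1 * l + A0)) * cis (B2 * l\<^sup>2 + B1 * l + B0)))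
      \<le> 96 * K / sqrt \<bar>B2\<bar>"
proof -
  let ?p = "\<lambda>l. A2 * l\<^sup>2 + A1 * l + A0" and ?f = "\<lambda>l. cis (B2 * l\<^sup>2 + B1 * l + B0)"
  let ?h = "\<lambda>l. of_real (exp (?p l)) * ?f l"
  obtain m where m: "a \<le> m" "m \<le> b"
    and mono: "\<And>S. S = {a..m} \<or> S = {m..b} \<Longrightarrow> mono_on S ?p \<or> antimono_on S ?p"
    using quadratic_monotone_split[OF \<open>a \<le> b\<close>] by blast
  have part: "norm (integral {c..d} ?h) \<le> 4 * K * (12 / sqrt \<bar>B2\<bar>)"
    if "a \<le> c" "c \<le> d" "d \<le> b" "mono_on {c..d} ?p \<or> antimono_on {c..d} ?p" for c d
  proof (rule monotone_mult_integral_bound)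
    show "mono_on {c..d} (\<lambda>l. exp (?p l)) \<or> antimono_on {c..d} (\<lambda>l. exp (?p l))"
      using that(4) by (auto simp: monotone_on_def)
    show "norm (integral {u..v} ?f) \<le> 12 / sqrt \<bar>B2\<bar>" if "u \<le> v" for u v
      by (rule quadratic_phase_bound[OF assms(1) that])
    show "\<bar>exp (?p x)\<bar> \<le> K" if "x \<in> {c..d}" for x
      using K[of x] that \<open>a \<le> c\<close> \<open>d \<le> b\<close> by auto
  qed (use that in \<open>auto intro!: continuous_intros\<close>)
  have split: "integral {a..b} ?h = integral {a..m} ?h + integral {m..b} ?h"
    by (rule Henstock_Kurzweil_Integration.integral_combine[symmetric])
      (use m in \<open>auto intro!: integrable_continuous_interval continuous_intros\<close>)
  show ?thesis
  proof -
    have "norm (integral {a..m} ?h) \<le> 4 * K * (12 / sqrt \<bar>B2\<bar>)"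
      by (rule part[OF order_refl m mono[OF disjI1[OF refl]]])
    moreover have "norm (integral {m..b} ?h) \<le> 4 * K * (12 / sqrt \<bar>B2\<bar>)"
      by (rule part[OF m order_refl mono[OF disjI2[OF refl]]])
    moreover have "4 * K * (12 / sqrt \<bar>B2\<bar>) + 4 * K * (12 / sqrt \<bar>B2\<bar>) = 96 * K / sqrt \<bar>B2\<bar>"
      by (simp add: field_simps)
    ultimately show ?thesis
      unfolding split using norm_triangle_ineq[of "integral {a..m} ?h" "integral {m..b} ?h"] by linarith
  qed
qed

section \<open>Complex Gaussian integrals\<close>

text \<open>Completing the square turns the integrand into a multiple of the normal density with
  mean \<open>b / (2 * a)\<close> and variance \<open>1 / (2 * a)\<close>.\<close>

lemma integrable_exp_quadratic:
  fixes a b :: real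
  assumes "a > 0"
  shows "integrable lborel (\<lambda>z. exp (- a * z\<^sup>2 + b * z))"
    and "integral\<^sup>L lborel (\<lambda>z. exp (- a * z\<^sup>2)) = sqrt (pi / a)"
proof -
  define \<sigma> where "\<sigma> = sqrt (1 / (2 * a))"
  have \<sigma>: "\<sigma> > 0" "\<sigma>\<^sup>2 = 1 / (2 * a)" using assms by (auto simp: \<sigma>_def)
  have eq: "exp (- a * z\<^sup>2 + b * z) = exp (b\<^sup>2 / (4 * a)) * sqrt (pi / a) * normal_density (b / (2 * a)) \<sigma> z" for z b
  proof -
    have "- a * z\<^sup>2 + b * z = b\<^sup>2 / (4 * a) - (z - b / (2 * a))\<^sup>2 / (2 * \<sigma>\<^sup>2)"
      unfolding \<sigma>(2) using assms by (simp add: power2_eq_square field_simps)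
    then have "exp (- a * z\<^sup>2 + b * z) = exp (b\<^sup>2 / (4 * a)) * exp (- (z - b / (2 * a))\<^sup>2 / (2 * \<sigma>\<^sup>2))"
      by (simp flip: exp_add)
    moreover have "sqrt (2 * pi * \<sigma>\<^sup>2) = sqrt (pi / a)" unfolding \<sigma>(2) by simp
    moreover have "sqrt (pi / a) > 0" using assms by simp
    ultimately show ?thesis using assms by (simp add: normal_density_def)
  qed
  interpret prob_space "density lborel (normal_density (b / (2 * a)) \<sigma>)" for b
    by (rule prob_space_normal_density[OF \<sigma>(1)])
  have int: "integrable lborel (normal_density (b / (2 * a)) \<sigma>)" for b
    using integrable_normal_moment[OF \<sigma>(1), of "b / (2*a)" 0] by simp
  show "integrable lborel (\<lambda>z. exp (- a * z\<^sup>2 + b * z))"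
    unfolding eq by (intro integrable_mult_right int)
  have "integral\<^sup>L lborel (normal_density (0 / (2 * a)) \<sigma>) = 1"
    using integral_normal_density[OF \<sigma>(1)] by simp
  then show "integral\<^sup>L lborel (\<lambda>z. exp (- a * z\<^sup>2)) = sqrt (pi / a)"
    using eq[where b=0] by simp
qed

lemma integrable_cexp_quadratic:
  fixes D B :: complex
  assumes "Re D > 0"
  shows "integrable lborel (\<lambda>z::real. exp (- D * of_real (z\<^sup>2) + B * of_real z))"
proof (rule Bochner_Integration.integrable_bound[OF integrable_exp_quadratic(1)[OF assms, of "Re B"]])
  show "(\<lambda>z::real. exp (- D * of_real (z\<^sup>2) + B * of_real z)) \<in> borel_measurable lborel"
    unfolding measurable_lborel2 by (intro borel_measurable_continuous_onI continuous_intros)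
qed (auto simp: norm_exp_eq_Re intro!: AE_I2)

text \<open>This is \<open>sqrt (pi / D)\<close> for the branch of positive real part. It is kept as
  an integral so that no branch has to be chosen: its modulus is estimated for
  \<open>Re D = 1\<close> and its value computed for positive \<open>D\<close>.\<close>

definition gauss_int :: "complex \<Rightarrow> complex" where
  "gauss_int D = (LINT z|lborel. exp (- D * of_real (z\<^sup>2)))"

lemma gauss_int_of_real:
  assumes "a > 0"
  shows "gauss_int (of_real a) = of_real (sqrt (pi / a))"
proof -
  have "gauss_int (of_real a) = (LINT z|lborel. of_real (exp (- a * z\<^sup>2)))"
    unfolding gauss_int_def by (simp add: exp_of_real flip: of_real_mult of_real_minus of_real_power)
  also have "\<dots> = of_real (sqrt (pi / a))"
    using integrable_exp_quadratic(2)[OF assms] by (simp flip: integral_of_real)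
  finally show ?thesis .
qed

text \<open>As a function of \<open>b\<close> the integral \<open>F\<close> solves
  \<open>F' = - (2 * b / D) * F\<close>: differentiation under the integral produces a factor
  \<open>z\<close>, and integration by parts trades it for \<open>b\<close>. Hence
  \<open>F b * exp (b\<^sup>2 / D)\<close> is constant. No contour has to be shifted for complex
  \<open>D\<close>.\<close>

lemma gauss_int_fourier:
  fixes D :: complex and b :: real
  assumes D: "Re D > 0"
  shows "(LINT z|lborel. exp (- D * of_real (z\<^sup>2) - 2 * \<i> * of_real (b * z))) = gauss_int D * exp (- of_real (b\<^sup>2) / D)"
proof -
  define a where "a = Re D"
  have a: "a > 0" using D by (simp add: a_def)
  have D0: "D \<noteq> 0" using D by auto
  define f where "f = (\<lambda>b z. exp (- D * of_real (z\<^sup>2) - 2 * \<i> * of_real (b * z)))"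
  define F where "F = (\<lambda>b. integral\<^sup>L lborel (f b))"
  define F1 where "F1 = (\<lambda>b. LINT z|lborel. - 2 * \<i> * of_real z * f b z)"
  have nf: "norm (f b z) = exp (- a * z\<^sup>2)" for b z by (simp add: f_def norm_exp_eq_Re a_def)
  have meas [measurable]: "f b \<in> borel_measurable borel" for b
    unfolding f_def by (intro borel_measurable_continuous_onI continuous_intros)
  have if0: "integrable lborel (f b)" for b
    using integrable_cexp_quadratic[OF D, of "- 2 * \<i> * of_real b"] by (simp add: f_def algebra_simps)
  have dom: "integrable lborel (\<lambda>z::real. z\<^sup>2 * exp (- a * z\<^sup>2))"
  proof (rule Bochner_Integration.integrable_bound)
    show "integrable lborel (\<lambda>z. 2 / a * exp (- (a/2) * z\<^sup>2 + 0 * z))"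
      using a by (intro integrable_mult_right integrable_exp_quadratic) auto
    show "AE z in lborel. norm (z\<^sup>2 * exp (- a * z\<^sup>2)) \<le> norm (2 / a * exp (- (a/2) * z\<^sup>2 + 0 * z))"
    proof (intro AE_I2)
      fix z :: real
      have "(a/2) * z\<^sup>2 \<le> exp ((a/2) * z\<^sup>2)" using exp_ge_add_one_self[of "(a/2) * z\<^sup>2"] by linarith
      then have "z\<^sup>2 \<le> 2 / a * exp ((a/2) * z\<^sup>2)" using a by (simp add: field_simps)
      then have "z\<^sup>2 * exp (- a * z\<^sup>2) \<le> 2 / a * exp ((a/2) * z\<^sup>2) * exp (- a * z\<^sup>2)"
        by (intro mult_right_mono) auto
      also have "\<dots> = 2 / a * exp (- (a/2) * z\<^sup>2)" by (simp flip: exp_add)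
      finally show "norm (z\<^sup>2 * exp (- a * z\<^sup>2)) \<le> norm (2 / a * exp (- (a/2) * z\<^sup>2 + 0 * z))"
        using a by simp
    qed
  qed simp
  have dom1: "integrable lborel (\<lambda>z::real. \<bar>z\<bar> * exp (- a * z\<^sup>2))"
  proof (rule Bochner_Integration.integrable_bound)
    show "integrable lborel (\<lambda>z. exp (- a * z\<^sup>2 + 0 * z) + z\<^sup>2 * exp (- a * z\<^sup>2))"
      by (intro Bochner_Integration.integrable_add dom integrable_exp_quadratic(1) a)
    show "AE z in lborel. norm (\<bar>z\<bar> * exp (- a * z\<^sup>2)) \<le> norm (exp (- a * z\<^sup>2 + 0 * z) + z\<^sup>2 * exp (- a * z\<^sup>2))"
    proof (intro AE_I2)
      fix z :: real
      have "\<bar>z\<bar> \<le> 1 + z\<^sup>2" using zero_le_power2[of "\<bar>z\<bar> - 1"] zero_le_power2[of z] by (simp add: power2_eq_square algebra_simps)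
      then have "\<bar>z\<bar> * exp (- a * z\<^sup>2) \<le> (1 + z\<^sup>2) * exp (- a * z\<^sup>2)" by (intro mult_right_mono) auto
      then show "norm (\<bar>z\<bar> * exp (- a * z\<^sup>2)) \<le> norm (exp (- a * z\<^sup>2 + 0 * z) + z\<^sup>2 * exp (- a * z\<^sup>2))"
        by (simp add: algebra_simps)
    qed
  qed simp
  have if1: "integrable lborel (\<lambda>z. of_real z * f b z)" for b
    by (rule Bochner_Integration.integrable_bound[OF dom1]) (auto simp: norm_mult nf)
  define C where "C = (LINT z|lborel. 2 * (z\<^sup>2 * exp (- a * z\<^sup>2)))"
  \<comment> \<open>A quantitative form of differentiation under the integral: the second order
    Taylor remainder of the phase is at most \<open>2 * h\<^sup>2 * z\<^sup>2\<close>, integrable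
    against the Gaussian.\<close>
  have quad: "norm (F (b + h) - F b - of_real h * F1 b) \<le> h\<^sup>2 * C" for b h
  proof -
    have "F (b + h) - F b - of_real h * F1 b =
        (LINT z|lborel. f (b + h) z - f b z - of_real h * (- 2 * \<i> * of_real z * f b z))"
      unfolding F_def F1_def using if0 if1[of b] by (simp add: mult.assoc)
    also have "norm \<dots> \<le> (LINT z|lborel. h\<^sup>2 * (2 * (z\<^sup>2 * exp (- a * z\<^sup>2))))"
    proof (rule Bochner_Integration.integral_norm_bound_integral)
      fix z :: real
      have "f (b + h) z - f b z - of_real h * (- 2 * \<i> * of_real z * f b z) =
          f b z * (iexp (- 2 * h * z) - (\<Sum>k\<le>1. (\<i> * of_real (- 2 * h * z)) ^ k / fact k))"
        by (simp add: f_def algebra_simps flip: exp_add)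
      also have "norm \<dots> \<le> exp (- a * z\<^sup>2) * (\<bar>- 2 * h * z\<bar> ^ Suc 1 / fact (Suc 1))"
        unfolding norm_mult nf by (intro mult_left_mono iexp_approx1) auto
      also have "\<dots> = h\<^sup>2 * (2 * (z\<^sup>2 * exp (- a * z\<^sup>2)))"
        by (simp add: power2_eq_square abs_mult)
      finally show "norm (f (b + h) z - f b z - of_real h * (- 2 * \<i> * of_real z * f b z)) \<le> h\<^sup>2 * (2 * (z\<^sup>2 * exp (- a * z\<^sup>2)))" .
    next
      show "integrable lborel (\<lambda>z. f (b + h) z - f b z - of_real h * (- 2 * \<i> * of_real z * f b z))"
        using if0 if1[of b] by (auto simp: mult.assoc intro!: Bochner_Integration.integrable_diff integrable_mult_right)
      show "integrable lborel (\<lambda>z. h\<^sup>2 * (2 * (z\<^sup>2 * exp (- a * z\<^sup>2))))"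
        by (intro integrable_mult_right dom)
    qed
    also have "\<dots> = h\<^sup>2 * C" unfolding C_def by simp
    finally show ?thesis .
  qed
  have deriv: "(F has_vector_derivative F1 b) (at b)" for b
    unfolding has_vector_derivative_def has_derivative_at
  proof
    show "(\<lambda>h. norm (F (b + h) - F b - h *\<^sub>R F1 b) / norm h) \<midarrow>0\<rightarrow> 0"
    proof (rule Lim_null_comparison)
      show "\<forall>\<^sub>F h in at 0. norm (norm (F (b + h) - F b - h *\<^sub>R F1 b) / norm h) \<le> \<bar>h\<bar> * C"
      proof (intro eventuallyI)
        fix h :: real
        show "norm (norm (F (b + h) - F b - h *\<^sub>R F1 b) / norm h) \<le> \<bar>h\<bar> * C"
        proof (cases "h = 0")
          case False
          have "h\<^sup>2 * C / \<bar>h\<bar> = \<bar>h\<bar> * C"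
            using False by (simp add: power2_eq_square field_simps flip: abs_mult)
          moreover have "norm (F (b + h) - F b - h *\<^sub>R F1 b) / \<bar>h\<bar> \<le> h\<^sup>2 * C / \<bar>h\<bar>"
            using quad[of b h] by (intro divide_right_mono) (auto simp: scaleR_conv_of_real)
          ultimately show ?thesis by simp
        qed simp
      qed
      show "((\<lambda>h. \<bar>h\<bar> * C) \<longlongrightarrow> 0) (at 0)" by (auto intro!: tendsto_eq_intros)
    qed
  qed (rule bounded_linear_scaleR_left)
  have ibp: "F1 b = of_real (- 2 * b) / D * F b" for b
  proof -
    have lim: "((\<lambda>z. f b z) \<longlongrightarrow> 0) at_top" "((\<lambda>z. f b z) \<longlongrightarrow> 0) at_bot"
      by (rule tendsto_norm_zero_cancel, unfold nf, use a in real_asymp)+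
    \<comment> \<open>The integrand is the \<open>z\<close>-derivative of \<open>f b\<close>, which
      vanishes at both ends.\<close>
    have "(LBINT z=-\<infinity>..\<infinity>. (- 2 * D * of_real z - 2 * \<i> * of_real b) * f b z) = 0 - 0"
    proof (rule interval_integral_FTC_integrable)
      fix z :: real
      have "((\<lambda>w. exp (- D * w\<^sup>2 - 2 * \<i> * of_real b * w)) has_field_derivative
         exp (- D * (of_real z)\<^sup>2 - 2 * \<i> * of_real b * of_real z) * (- 2 * D * of_real z - 2 * \<i> * of_real b)) (at (of_real z))"
        by (auto intro!: derivative_eq_intros)
      from has_vector_derivative_real_field[OF this]
      show "(f b has_vector_derivative (- 2 * D * of_real z - 2 * \<i> * of_real b) * f b z) (at z)"
        by (simp add: f_def mult_ac)
      show "isCont (\<lambda>z. (- 2 * D * of_real z - 2 * \<i> * of_real b) * f b z) z"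
        unfolding f_def by (intro continuous_intros)
    next
      have "integrable lborel (\<lambda>z. - 2 * D * (of_real z * f b z) - 2 * \<i> * of_real b * f b z)"
        by (intro Bochner_Integration.integrable_diff integrable_mult_right if0 if1)
      then show "set_integrable lborel (einterval (- \<infinity>) \<infinity>) (\<lambda>z. (- 2 * D * of_real z - 2 * \<i> * of_real b) * f b z)"
        by (simp add: set_integrable_def algebra_simps)
      show "((f b \<circ> real_of_ereal) \<longlongrightarrow> 0) (at_right (- \<infinity>))"
        using lim(2) by (simp add: ereal_tendsto_simps)
      show "((f b \<circ> real_of_ereal) \<longlongrightarrow> 0) (at_left \<infinity>)"
        using lim(1) by (simp add: ereal_tendsto_simps)
    qed simp
    then have "(LINT z|lborel. - 2 * D * (of_real z * f b z) - 2 * \<i> * of_real b * f b z) = 0"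
      by (simp add: interval_lebesgue_integral_def set_lebesgue_integral_def algebra_simps)
    then have e: "- 2 * D * (LINT z|lborel. of_real z * f b z) - 2 * \<i> * of_real b * F b = 0"
      using if0[of b] if1[of b] by (simp add: F_def)
    define X where "X = (LINT z|lborel. of_real z * f b z)"
    define Y where "Y = \<i> * of_real b * F b"
    have e': "- 2 * D * X - 2 * Y = 0" using e unfolding X_def Y_def by (simp only: mult.assoc)
    have "2 * (D * X + Y) = - (- 2 * D * X - 2 * Y)" by (simp add: algebra_simps)
    also have "\<dots> = 0" unfolding e' by simp
    finally have "D * X + Y = 0" by (metis mult_eq_0_iff zero_neq_numeral)
    then have "D * X = - Y" by (metis eq_neg_iff_add_eq_0)
    then have "X = - Y / D" using D0 by (metis nonzero_mult_div_cancel_left)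
    then have "F1 b = - 2 * \<i> * (- Y / D)" unfolding F1_def X_def by (simp add: mult.assoc)
    moreover have "- 2 * \<i> * (- Y / D) = (\<i> * \<i>) * (2 * of_real b * F b) / D"
      unfolding Y_def by (simp only: mult_ac minus_mult_minus minus_mult_left[symmetric] times_divide_eq_right
          minus_mult_right[symmetric] minus_divide_left[symmetric] minus_minus)
    ultimately show ?thesis by simp
  qed
  define P where "P = (\<lambda>b. F b * exp (of_real (b\<^sup>2) / D))"
  have "(P has_vector_derivative 0) (at b)" for b
  proof -
    have "((\<lambda>w. exp (w\<^sup>2 / D)) has_field_derivative exp ((of_real b)\<^sup>2 / D) * (2 * of_real b / D)) (at (of_real b))"
      using D0 by (auto intro!: derivative_eq_intros)
    from has_vector_derivative_real_field[OF this]
    have "((\<lambda>b. exp (of_real (b\<^sup>2) / D)) has_vector_derivative exp (of_real (b\<^sup>2) / D) * (2 * of_real b / D)) (at b)"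
      by simp
    from has_vector_derivative_mult[OF deriv[of b] this]
    show ?thesis unfolding P_def ibp by (simp add: algebra_simps)
  qed
  then have "P b = P 0"
    by (metis has_vector_derivative_zero_constant[of UNIV P] convex_UNIV UNIV_I has_vector_derivative_at_within)
  then have "F b * exp (of_real (b\<^sup>2) / D) = gauss_int D"
    by (simp add: P_def F_def f_def gauss_int_def)
  then have "F b = gauss_int D * exp (- (of_real (b\<^sup>2) / D))"
    by (metis exp_minus_inverse mult.assoc mult.right_neutral)
  then show ?thesis by (simp add: F_def f_def)
qed

text \<open>The order \<open>|q| powr (- 1 / 2)\<close> is the true one. It is the second derivative
  bound for \<open>exp (- z\<^sup>2) * cis (q * z\<^sup>2)\<close> on growing intervals, combined
  with the trivial bound \<open>sqrt pi \<le> 2\<close> for small \<open>q\<close>.\<close>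

lemma gauss_int_bound:
  "norm (gauss_int (Complex 1 (- q))) \<le> 136 / sqrt (1 + \<bar>q\<bar>)"
proof -
  let ?D = "Complex 1 (- q)"
  define f where "f = (\<lambda>z::real. exp (- ?D * of_real (z\<^sup>2)))"
  have nf: "norm (f z) = exp (- z\<^sup>2)" for z by (simp add: f_def norm_exp_eq_Re)
  have fi: "integrable lborel f" using integrable_cexp_quadratic[of ?D 0] by (simp add: f_def)
  have triv: "norm (gauss_int ?D) \<le> 2"
  proof -
    have "norm (gauss_int ?D) \<le> (LINT z|lborel. norm (f z))"
      unfolding gauss_int_def f_def by (rule integral_norm_bound)
    also have "\<dots> = sqrt pi" using integrable_exp_quadratic(2)[of 1] by (simp add: nf)
    also have "\<dots> \<le> sqrt (2\<^sup>2)" using pi_less_4 by (intro real_sqrt_le_mono) simp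
    finally show ?thesis by simp
  qed
  have osc: "norm (gauss_int ?D) \<le> 96 / sqrt \<bar>q\<bar>" if "q \<noteq> 0"
  proof -
    have lim: "(\<lambda>n. LINT z|lborel. indicator {- real n..real n} z *\<^sub>R f z) \<longlonglongrightarrow> integral\<^sup>L lborel f"
    proof (rule integral_dominated_convergence[where w = "\<lambda>z. norm (f z)"])
      show "integrable lborel (\<lambda>z. norm (f z))" using fi by simp
      show "AE z in lborel. (\<lambda>n. indicator {- real n..real n} z *\<^sub>R f z) \<longlonglongrightarrow> f z"
      proof (intro AE_I2 tendsto_eventually)
        fix z :: real
        obtain N where "\<bar>z\<bar> \<le> real N" using real_arch_simple by blast
        then show "\<forall>\<^sub>F n in sequentially. indicator {- real n..real n} z *\<^sub>R f z = f z"
          by (intro eventually_sequentiallyI[of N]) (auto simp: indicator_def)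
      qed
    qed (use fi in \<open>auto simp: indicator_def\<close>)
    have "norm (LINT z|lborel. indicator {- real n..real n} z *\<^sub>R f z) \<le> 96 / sqrt \<bar>q\<bar>" for n
    proof -
      have "(LINT z|lborel. indicator {- real n..real n} z *\<^sub>R f z) = integral {- real n..real n} f"
        using set_borel_integral_eq_integral(2)[of "{- real n..real n}" f]
          integrable_mult_indicator[OF _ fi, of "{- real n..real n}"]
        by (simp add: set_integrable_def set_lebesgue_integral_def)
      moreover have feq: "f = (\<lambda>l. of_real (exp ((-1) * l\<^sup>2 + 0 * l + 0)) * cis (q * l\<^sup>2 + 0 * l + 0))"
      proof
        fix z
        have "- ?D * of_real (z\<^sup>2) = of_real (- z\<^sup>2) + \<i> * of_real (q * z\<^sup>2)" by (simp add: complex_eq_iff)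
        then show "f z = of_real (exp ((-1) * z\<^sup>2 + 0 * z + 0)) * cis (q * z\<^sup>2 + 0 * z + 0)"
          unfolding f_def by (simp only: exp_add) (simp add: cis_conv_exp flip: exp_of_real)
      qed
      moreover have "norm (integral {- real n..real n} f) \<le> 96 * 1 / sqrt \<bar>q\<bar>"
        unfolding feq by (rule quadratic_exp_integral_bound) (use that in auto)
      ultimately show ?thesis by simp
    qed
    then have "norm (integral\<^sup>L lborel f) \<le> 96 / sqrt \<bar>q\<bar>"
      by (intro LIMSEQ_le_const2[OF tendsto_norm[OF lim]]) auto
    then show ?thesis by (simp add: gauss_int_def f_def)
  qed
  show ?thesis
  proof (cases "\<bar>q\<bar> \<le> 1")
    case True
    have "sqrt (1 + \<bar>q\<bar>) \<le> sqrt (2\<^sup>2)" using True by (intro real_sqrt_le_mono) simp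
    then have "sqrt (1 + \<bar>q\<bar>) \<le> 2" by simp
    then have "2 \<le> 136 / sqrt (1 + \<bar>q\<bar>)" by (simp add: field_simps add_pos_nonneg)
    then show ?thesis using triv by linarith
  next
    case False
    \<comment> \<open>The constant of the lemma is \<open>136 = 96 * 17 / 12\<close>, since here
      \<open>1 + \<bar>q\<bar> \<le> 2 * \<bar>q\<bar>\<close>.\<close>
    have s2: "sqrt 2 \<le> 17/12" by (rule real_le_lsqrt) (auto simp: power2_eq_square)
    have "sqrt (1 + \<bar>q\<bar>) \<le> sqrt (2 * \<bar>q\<bar>)" using False by (intro real_sqrt_le_mono) simp
    also have "\<dots> \<le> 17/12 * sqrt \<bar>q\<bar>" unfolding real_sqrt_mult using s2 by (intro mult_right_mono) auto
    finally have "96 / sqrt \<bar>q\<bar> \<le> 136 / sqrt (1 + \<bar>q\<bar>)" using False by (simp add: field_simps)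
    then show ?thesis using osc False by fastforce
  qed
qed

text \<open>Lebesgue measure is the image of a product measure under the coordinate map, so a
  product of functions of single coordinates integrates factor by factor.\<close>

lemma lborel_integral_prod:
  fixes f :: "'a::euclidean_space \<Rightarrow> real \<Rightarrow> complex"
  assumes int: "\<And>b. b \<in> Basis \<Longrightarrow> integrable lborel (f b)"
  shows "integrable lborel (\<lambda>x::'a. \<Prod>b\<in>Basis. f b (x \<bullet> b))"
    and "(LINT x|lborel. (\<Prod>b\<in>Basis. f b (x \<bullet> b))) = (\<Prod>b\<in>Basis. integral\<^sup>L lborel (f b))"
proof -
  interpret product_sigma_finite "\<lambda>_::'a. lborel :: real measure" ..
  have meas [measurable]: "f b \<in> borel_measurable borel" if "b \<in> Basis" for b
    using borel_measurable_integrable[OF int[OF that]] by simp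
  have eq: "(\<Prod>b\<in>Basis. f b ((\<Sum>c\<in>Basis. g c *\<^sub>R c) \<bullet> b)) = (\<Prod>b\<in>Basis. f b (g b))" for g :: "'a \<Rightarrow> real"
    by (intro prod.cong refl) (simp add: inner_sum_left_Basis)
  have T: "(\<lambda>g. \<Sum>c\<in>Basis. g c *\<^sub>R c) \<in> (\<Pi>\<^sub>M b\<in>(Basis::'a set). (lborel :: real measure)) \<rightarrow>\<^sub>M (borel :: 'a measure)"
    by measurable
  have M: "(\<lambda>x::'a. \<Prod>b\<in>Basis. f b (x \<bullet> b)) \<in> borel_measurable borel" by measurable
  show "integrable lborel (\<lambda>x::'a. \<Prod>b\<in>Basis. f b (x \<bullet> b))"
    unfolding lborel_eq[where 'a='a] integrable_distr_eq[OF T M] eq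
    by (rule product_integrable_prod) (auto intro: int)
  show "(LINT x|lborel. (\<Prod>b\<in>Basis. f b (x \<bullet> b))) = (\<Prod>b\<in>Basis. integral\<^sup>L lborel (f b))"
    unfolding lborel_eq[where 'a='a] integral_distr[OF T M] eq
    by (rule product_integral_prod) (auto intro: int)
qed

lemma gauss_int_fourier_euclidean:
  fixes v :: "'a::euclidean_space" and D :: complex
  assumes D: "Re D > 0"
  shows "integrable lborel (\<lambda>z. exp (- D * of_real ((norm z)\<^sup>2) - 2 * \<i> * of_real (v \<bullet> z)))"
    and "(LINT z|lborel. exp (- D * of_real ((norm z)\<^sup>2) - 2 * \<i> * of_real (v \<bullet> z)))
        = gauss_int D ^ DIM('a) * exp (- of_real ((norm v)\<^sup>2) / D)"
proof -
  define f where "f = (\<lambda>b z. exp (- D * of_real (z\<^sup>2) - 2 * \<i> * of_real ((v \<bullet> b) * z)))"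
  have n2: "(norm u)\<^sup>2 = (\<Sum>b\<in>Basis. (u \<bullet> b)\<^sup>2)" for u :: 'a
    by (subst norm_eq_sqrt_inner, subst real_sqrt_pow2, simp, subst euclidean_inner) (simp add: power2_eq_square)
  have eq: "exp (- D * of_real ((norm z)\<^sup>2) - 2 * \<i> * of_real (v \<bullet> z)) = (\<Prod>b\<in>Basis. f b (z \<bullet> b))" for z
    unfolding f_def
    by (subst n2, subst euclidean_inner)
      (simp add: exp_sum[symmetric] sum_subtractf sum_distrib_left sum_negf)
  have int: "integrable lborel (f b)" for b
    using integrable_cexp_quadratic[OF D, of "- 2 * \<i> * of_real (v \<bullet> b)"] by (simp add: f_def algebra_simps)
  show "integrable lborel (\<lambda>z. exp (- D * of_real ((norm z)\<^sup>2) - 2 * \<i> * of_real (v \<bullet> z)))"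
    unfolding eq by (rule lborel_integral_prod(1)[OF int])
  have "(LINT z|lborel. exp (- D * of_real ((norm z)\<^sup>2) - 2 * \<i> * of_real (v \<bullet> z)))
      = (\<Prod>b\<in>(Basis::'a set). gauss_int D * exp (- of_real ((v \<bullet> b)\<^sup>2) / D))"
    unfolding eq lborel_integral_prod(2)[OF int] unfolding f_def by (intro prod.cong refl gauss_int_fourier[OF D])
  also have "\<dots> = gauss_int D ^ DIM('a) * exp (- of_real ((norm v)\<^sup>2) / D)"
    by (subst n2) (simp add: prod.distrib exp_sum[symmetric] sum_negf sum_divide_distrib)
  finally show "(LINT z|lborel. exp (- D * of_real ((norm z)\<^sup>2) - 2 * \<i> * of_real (v \<bullet> z)))
        = gauss_int D ^ DIM('a) * exp (- of_real ((norm v)\<^sup>2) / D)" .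
qed

section \<open>Wave packets and their correlations\<close>

text \<open>The factor \<open>exp (l\<^sup>2 |x|\<^sup>2 / \<Lambda>\<^sup>2)\<close> is the one that makes the average of the wave against the Gaussian
  \<open>exp (- \<Lambda>\<^sup>2 |z - y|\<^sup>2) cis (l (|y|\<^sup>2 - |z|\<^sup>2))\<close> a multiple of \<open>cis (l (|y - x|\<^sup>2 - u))\<close> that does not depend on \<open>x\<close>.\<close>

definition wave :: "'a::euclidean_space \<Rightarrow> real \<Rightarrow> real \<Rightarrow> 'a \<Rightarrow> real \<Rightarrow> complex" where
  "wave x u \<Lambda> z l = of_real (exp (l\<^sup>2 * (norm x)\<^sup>2 / \<Lambda>\<^sup>2)) * cis (l * ((dist z x)\<^sup>2 - u))"

lemma norm_wave: "norm (wave x u \<Lambda> z l) = exp (l\<^sup>2 * (norm x)\<^sup>2 / \<Lambda>\<^sup>2)"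
  by (simp add: wave_def norm_mult)

lemma dist_power2_expand: "(dist z x)\<^sup>2 = (norm z)\<^sup>2 - 2 * (x \<bullet> z) + (norm (x::'a::euclidean_space))\<^sup>2"
  by (simp add: dist_norm power2_norm_eq_inner inner_diff inner_commute)

text \<open>The two quadratic phases differ by \<open>q * |z|^2\<close> only, which joins the weight
  to give the Gaussian parameter \<open>1 - i q\<close>, independent of the pins and of
  \<open>l\<close>. What remains is linear in \<open>z\<close>, with frequency vector
  \<open>l (x - x') + q x\<close>, and the Fourier transform of the Gaussian makes real exponent and
  phase quadratic in \<open>l\<close>. Of the phase only the leading coefficient will be used, hence
  \<open>B0\<close> and \<open>B1\<close> are merely asserted to exist.\<close>

lemma wave_correlation:
  fixes x x' :: "'a::euclidean_space" and q \<Lambda> u u' :: real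
  defines "A \<equiv> \<lambda>l. - (norm (l *\<^sub>R (x - x') + q *\<^sub>R x))\<^sup>2 / (1 + q\<^sup>2)
      + ((l + q)\<^sup>2 * (norm x)\<^sup>2 + l\<^sup>2 * (norm x')\<^sup>2) / \<Lambda>\<^sup>2"
  obtains A0 A1 A2 B0 B1 where "\<And>l. A l = A2 * l\<^sup>2 + A1 * l + A0"
    and "\<And>l. (LINT z|lborel. of_real (exp (- (norm z)\<^sup>2)) * (wave x u \<Lambda> z (l + q) * cnj (wave x' u' \<Lambda> z l)))
       = gauss_int (Complex 1 (- q)) ^ DIM('a) *
         (of_real (exp (A l)) * cis (- (q * (dist x x')\<^sup>2 / (1 + q\<^sup>2)) * l\<^sup>2 + B1 * l + B0))"
proof -
  define s where "s = 1 / (1 + q\<^sup>2)"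
  define i where "i = 1 / \<Lambda>\<^sup>2"
  define v where "v = x - x'"
  define N where "N = (\<lambda>l. (norm (l *\<^sub>R v + q *\<^sub>R x))\<^sup>2)"
  let ?D = "Complex 1 (- q)"
  have N: "N l = l\<^sup>2 * (dist x x')\<^sup>2 + 2 * l * q * (v \<bullet> x) + q\<^sup>2 * (norm x)\<^sup>2" for l
    unfolding N_def dist_norm v_def[symmetric] power2_norm_eq_inner
    by (simp add: inner_add_left inner_add_right inner_commute power2_eq_square)
  have q1: "1 + q\<^sup>2 > 0" by (simp add: add_pos_nonneg)
  have A: "A l = (- s * (dist x x')\<^sup>2 + i * (norm x)\<^sup>2 + i * (norm x')\<^sup>2) * l\<^sup>2
      + (- 2 * s * q * (v \<bullet> x) + 2 * q * i * (norm x)\<^sup>2) * l + (- s * q\<^sup>2 * (norm x)\<^sup>2 + i * q\<^sup>2 * (norm x)\<^sup>2)" for l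
  proof -
    have "A l = - s * N l + i * ((l + q)\<^sup>2 * (norm x)\<^sup>2 + l\<^sup>2 * (norm x')\<^sup>2)"
      by (simp add: A_def N_def s_def i_def v_def)
    then show ?thesis unfolding N by (simp add: power2_eq_square algebra_simps)
  qed
  define B where "B = (\<lambda>l. (l + q) * ((norm x)\<^sup>2 - u) - l * ((norm x')\<^sup>2 - u') - q * s * N l)"
  have B: "B l = - (q * (dist x x')\<^sup>2 / (1 + q\<^sup>2)) * l\<^sup>2
      + ((norm x)\<^sup>2 - u - (norm x')\<^sup>2 + u' - 2 * q\<^sup>2 * s * (v \<bullet> x)) * l + (q * ((norm x)\<^sup>2 - u) - q ^ 3 * s * (norm x)\<^sup>2)" for l
  proof -
    have "q * (dist x x')\<^sup>2 / (1 + q\<^sup>2) = q * s * (dist x x')\<^sup>2" by (simp add: s_def)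
    then show ?thesis unfolding B_def N by (simp add: power2_eq_square power3_eq_cube algebra_simps)
  qed
  have "(LINT z|lborel. of_real (exp (- (norm z)\<^sup>2)) * (wave x u \<Lambda> z (l + q) * cnj (wave x' u' \<Lambda> z l)))
       = gauss_int ?D ^ DIM('a) * (of_real (exp (A l)) * cis (B l))" for l
  proof -
    define w where "w = l *\<^sub>R v + q *\<^sub>R x"
    define c where "c = of_real (exp (i * ((l + q)\<^sup>2 * (norm x)\<^sup>2 + l\<^sup>2 * (norm x')\<^sup>2))) * cis ((l + q) * ((norm x)\<^sup>2 - u) - l * ((norm x')\<^sup>2 - u'))"
    have pt: "of_real (exp (- (norm z)\<^sup>2)) * (wave x u \<Lambda> z (l + q) * cnj (wave x' u' \<Lambda> z l))
        = c * exp (- ?D * of_real ((norm z)\<^sup>2) - 2 * \<i> * of_real (w \<bullet> z))" for z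
    proof -
      have wz: "w \<bullet> z = (l + q) * (x \<bullet> z) - l * (x' \<bullet> z)" by (simp add: w_def v_def inner_add_left inner_diff_left algebra_simps)
      have e: "exp (- ?D * of_real ((norm z)\<^sup>2) - 2 * \<i> * of_real (w \<bullet> z)) =
          of_real (exp (- (norm z)\<^sup>2)) * cis (q * (norm z)\<^sup>2 - 2 * (w \<bullet> z))"
      proof -
        have "- ?D * of_real ((norm z)\<^sup>2) - 2 * \<i> * of_real (w \<bullet> z) = of_real (- (norm z)\<^sup>2) + \<i> * of_real (q * (norm z)\<^sup>2 - 2 * (w \<bullet> z))"
          by (simp add: complex_eq_iff)
        then show ?thesis by (simp only: exp_add exp_of_real cis_conv_exp)
      qed
      have c1: "(l + q) * ((dist z x)\<^sup>2 - u) + - (l * ((dist z x')\<^sup>2 - u'))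
          = ((l + q) * ((norm x)\<^sup>2 - u) - l * ((norm x')\<^sup>2 - u')) + (q * (norm z)\<^sup>2 - 2 * (w \<bullet> z))"
        unfolding dist_power2_expand wz by (simp add: algebra_simps)
      have "wave x u \<Lambda> z (l + q) * cnj (wave x' u' \<Lambda> z l)
          = of_real (exp ((l+q)\<^sup>2 * (norm x)\<^sup>2 / \<Lambda>\<^sup>2) * exp (l\<^sup>2 * (norm x')\<^sup>2 / \<Lambda>\<^sup>2)) *
            (cis ((l + q) * ((dist z x)\<^sup>2 - u)) * cis (- (l * ((dist z x')\<^sup>2 - u'))))"
        by (simp add: wave_def cis_cnj)
      also have "exp ((l+q)\<^sup>2 * (norm x)\<^sup>2 / \<Lambda>\<^sup>2) * exp (l\<^sup>2 * (norm x')\<^sup>2 / \<Lambda>\<^sup>2) = exp (i * ((l + q)\<^sup>2 * (norm x)\<^sup>2 + l\<^sup>2 * (norm x')\<^sup>2))"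
        by (simp add: i_def add_divide_distrib flip: exp_add)
      finally show ?thesis unfolding e c_def cis_mult c1 by (simp add: cis_mult[symmetric] mult_ac)
    qed
    have "(LINT z|lborel. of_real (exp (- (norm z)\<^sup>2)) * (wave x u \<Lambda> z (l + q) * cnj (wave x' u' \<Lambda> z l)))
        = c * (gauss_int ?D ^ DIM('a) * exp (- of_real ((norm w)\<^sup>2) / ?D))"
      unfolding pt using gauss_int_fourier_euclidean[of ?D w] by simp
    \<comment> \<open>Since \<open>1 / (1 - i q) = (1 + i q) / (1 + q^2)\<close>, the Gaussian in
      the frequency vector splits into a real decay and a phase that is \<open>q\<close> times as
      large.\<close>
    also have "exp (- of_real ((norm w)\<^sup>2) / ?D) = of_real (exp (- s * N l)) * cis (- (q * s * N l))"
    proof -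
      have s1: "s * (1 + q\<^sup>2) = 1" using q1 by (simp add: s_def)
      have "(of_real s + \<i> * of_real (q * s)) * ?D = of_real (s * (1 + q\<^sup>2))"
        by (simp add: complex_eq_iff power2_eq_square algebra_simps)
      then have "(of_real s + \<i> * of_real (q * s)) * ?D = 1" unfolding s1 by simp
      moreover have "?D \<noteq> 0" by (simp add: complex_eq_iff)
      ultimately have inv: "1 / ?D = of_real s + \<i> * of_real (q * s)" by (simp add: divide_eq_eq)
      have "- of_real ((norm w)\<^sup>2) / ?D = - of_real (N l) * (1 / ?D)" by (simp add: w_def N_def)
      also have "\<dots> = of_real (- s * N l) + \<i> * of_real (- (q * s * N l))"
        unfolding inv by (simp add: algebra_simps)
      finally have "- of_real ((norm w)\<^sup>2) / ?D = of_real (- s * N l) + \<i> * of_real (- (q * s * N l))" .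
      then show ?thesis by (simp only: exp_add exp_of_real cis_conv_exp)
    qed
    also have "c * (gauss_int ?D ^ DIM('a) * (of_real (exp (- s * N l)) * cis (- (q * s * N l))))
       = gauss_int ?D ^ DIM('a) * (of_real (exp (- s * N l) * exp (i * ((l + q)\<^sup>2 * (norm x)\<^sup>2 + l\<^sup>2 * (norm x')\<^sup>2)))
         * (cis ((l + q) * ((norm x)\<^sup>2 - u) - l * ((norm x')\<^sup>2 - u')) * cis (- (q * s * N l))))"
      by (simp add: c_def mult_ac)
    also have "exp (- s * N l) * exp (i * ((l + q)\<^sup>2 * (norm x)\<^sup>2 + l\<^sup>2 * (norm x')\<^sup>2)) = exp (A l)"
      by (simp add: A_def N_def s_def i_def v_def flip: exp_add)
    also have "cis ((l + q) * ((norm x)\<^sup>2 - u) - l * ((norm x')\<^sup>2 - u')) * cis (- (q * s * N l)) = cis (B l)"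
      by (simp add: B_def cis_mult)
    finally show ?thesis .
  qed
  then show thesis unfolding B by (rule that[OF A])
qed

text \<open>With \<open>y = 1 / (4 * X\<^sup>2)\<close> this is the boundedness of
  \<open>y powr (m / 2) * exp (- y)\<close>, which follows from \<open>ln v \<le> v - 1\<close> at
  \<open>v = y / p\<close>.\<close>

lemma powr_exp_neg_bound:
  fixes m :: real
  assumes "m \<ge> 0"
  obtains C where "C \<ge> 1" "\<And>X. X > 0 \<Longrightarrow> exp (- 1 / (4 * X\<^sup>2)) \<le> C * X powr m"
proof (cases "m = 0")
  case True
  show ?thesis by (rule that[of 1]) (use True in auto)
next
  case False
  define p where "p = m / 2"
  have p: "p > 0" using False assms by (simp add: p_def)
  \<comment> \<open>\<open>p * ln (4 * p)\<close> is what remains once \<open>ln y\<close> is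
    expressed through \<open>ln X\<close>; the summand \<open>m\<close> is slack.\<close>
  define C where "C = exp (p * ln (4 * p) + m)"
  have "exp (- 1 / (4 * X\<^sup>2)) \<le> C * X powr m" if "X > 0" for X
  proof -
    define y where "y = 1 / (4 * X\<^sup>2)"
    have y: "y > 0" using that by (simp add: y_def)
    have "ln (y / p) \<le> y / p - 1" using y p by (intro ln_le_minus_one) auto
    then have "p * (ln y - ln p) \<le> p * (y / p - 1)" using y p by (intro mult_left_mono) (auto simp: ln_div)
    then have 1: "p * ln y - p * ln p \<le> y - p" using p by (simp add: algebra_simps)
    have 2: "ln y = - ln 4 - 2 * ln X" using that by (simp add: y_def ln_div ln_mult ln_realpow)
    have 3: "- y \<le> p * ln p + p * ln 4 + m * ln X" using 1 p unfolding 2 p_def by (simp add: algebra_simps)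
    have "ln (4 * p) = ln 4 + ln p" using p by (simp add: ln_mult)
    then have "exp (- y) \<le> exp (p * ln (4 * p) + m + m * ln X)" using 3 assms by (simp add: algebra_simps)
    also have "\<dots> = C * X powr m" using that by (simp add: C_def powr_def exp_add)
    finally show ?thesis by (simp add: y_def)
  qed
  moreover have "exp (- 1 / (4 * X\<^sup>2)) \<le> max 1 C * X powr m" if "X > 0" for X
    using calculation[OF that] by (meson max.cobounded2 mult_right_mono order_trans powr_ge_zero)
  ultimately show ?thesis using that[of "max 1 C"] by simp
qed

text \<open>Decay in \<open>\<Lambda> * dist x x'\<close> has two sources. The Gaussian amplitude is
  small unless \<open>q x\<close> can cancel \<open>l (x - x')\<close>, which yields every power of
  \<open>X = (1 + |q|) / (\<Lambda> * dist x x')\<close>. The oscillation yields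
  \<open>|q| powr (- 1 / 2) * X\<close>, at most to the first power, but it alone brings decay in
  \<open>q\<close>. The exponent \<sigma> is split as \<open>(\<sigma> - a) + a\<close> between the
  two.\<close>

lemma oscillatory_kernel_bound:
  fixes R \<sigma> a :: real
  assumes "R > 0" "0 \<le> a" "a \<le> 1" "a \<le> \<sigma>"
  obtains C where "C > 0"
    "\<And>(x::'a::euclidean_space) x' q \<Lambda> c d A0 A1 A2 B0 B1.
      norm x \<le> R \<Longrightarrow> norm x' \<le> R \<Longrightarrow> x \<noteq> x' \<Longrightarrow> q \<noteq> 0 \<Longrightarrow> \<Lambda> \<ge> 1 \<Longrightarrow> \<Lambda> \<le> c \<Longrightarrow> d \<le> 2 * \<Lambda> \<Longrightarrow>
      \<Lambda> \<le> c + q \<Longrightarrow> d + q \<le> 2 * \<Lambda> \<Longrightarrow>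
      (\<And>l. - (norm (l *\<^sub>R (x - x') + q *\<^sub>R x))\<^sup>2 / (1 + q\<^sup>2)
          + ((l + q)\<^sup>2 * (norm x)\<^sup>2 + l\<^sup>2 * (norm x')\<^sup>2) / \<Lambda>\<^sup>2 = A2 * l\<^sup>2 + A1 * l + A0) \<Longrightarrow>
      norm (integral {c..d} (\<lambda>l. of_real (exp (A2 * l\<^sup>2 + A1 * l + A0)) *
        cis (- (q * (dist x x')\<^sup>2 / (1 + q\<^sup>2)) * l\<^sup>2 + B1 * l + B0)))
      \<le> C * \<Lambda> * (\<bar>q\<bar> powr (- a / 2) * ((1 + \<bar>q\<bar>) / (\<Lambda> * dist x x')) powr \<sigma>)"
proof -
  define m where "m = \<sigma> - a"
  have m: "m \<ge> 0" using assms by (simp add: m_def)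
  obtain C0 where C0: "C0 \<ge> 1" "\<And>X. X > 0 \<Longrightarrow> exp (- 1 / (4 * X\<^sup>2)) \<le> C0 * X powr m"
    using powr_exp_neg_bound[OF m] by blast
  define C1 where "C1 = max C0 ((2 * R) powr m)"
  have C1: "C1 > 0" using C0(1) by (simp add: C1_def)
  show thesis
  proof (rule that[of "96 * exp (8 * R\<^sup>2) * C1"])
    show "96 * exp (8 * R\<^sup>2) * C1 > 0" using C1 by simp
    fix x x' :: 'a and q \<Lambda> c d A0 A1 A2 B0 B1 :: real
    assume xR: "norm x \<le> R" "norm x' \<le> R" and ne: "x \<noteq> x'" and q: "q \<noteq> 0" and \<Lambda>: "\<Lambda> \<ge> 1"
      and cd: "\<Lambda> \<le> c" "d \<le> 2 * \<Lambda>" "\<Lambda> \<le> c + q" "d + q \<le> 2 * \<Lambda>"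
      and A: "\<And>l. - (norm (l *\<^sub>R (x - x') + q *\<^sub>R x))\<^sup>2 / (1 + q\<^sup>2)
          + ((l + q)\<^sup>2 * (norm x)\<^sup>2 + l\<^sup>2 * (norm x')\<^sup>2) / \<Lambda>\<^sup>2 = A2 * l\<^sup>2 + A1 * l + A0"
    define t where "t = dist x x'"
    have t: "t > 0" using ne by (simp add: t_def)
    define X where "X = (1 + \<bar>q\<bar>) / (\<Lambda> * t)"
    have X: "X > 0" using t \<Lambda> by (simp add: X_def add_pos_nonneg)
    have q1: "1 + q\<^sup>2 > 0" by (simp add: add_pos_nonneg)
    define K where "K = exp (8 * R\<^sup>2) * (C1 * X powr m)"
    have K0: "K \<ge> 0" using C1 by (simp add: K_def)
    let ?f = "\<lambda>l. of_real (exp (A2 * l\<^sup>2 + A1 * l + A0)) * cis (- (q * (dist x x')\<^sup>2 / (1 + q\<^sup>2)) * l\<^sup>2 + B1 * l + B0)"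
    have K: "exp (A2 * l\<^sup>2 + A1 * l + A0) \<le> K" if l: "c \<le> l" "l \<le> d" for l
    proof -
      have l': "\<Lambda> \<le> l" "l \<le> 2 * \<Lambda>" "\<Lambda> \<le> l + q" "l + q \<le> 2 * \<Lambda>" using l cd by auto
      have "l\<^sup>2 \<le> (2 * \<Lambda>)\<^sup>2" "(l + q)\<^sup>2 \<le> (2 * \<Lambda>)\<^sup>2"
        using l' \<Lambda> by (intro power_mono; linarith)+
      moreover have "(norm x)\<^sup>2 \<le> R\<^sup>2" "(norm x')\<^sup>2 \<le> R\<^sup>2" using xR by (auto intro: power_mono)
      ultimately have "l\<^sup>2 * (norm x')\<^sup>2 \<le> (2 * \<Lambda>)\<^sup>2 * R\<^sup>2" "(l + q)\<^sup>2 * (norm x)\<^sup>2 \<le> (2 * \<Lambda>)\<^sup>2 * R\<^sup>2"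
        by (auto intro!: mult_mono simp del: power_mult_distrib)
      then have "((l + q)\<^sup>2 * (norm x)\<^sup>2 + l\<^sup>2 * (norm x')\<^sup>2) / \<Lambda>\<^sup>2 \<le> (8 * R\<^sup>2 * \<Lambda>\<^sup>2) / \<Lambda>\<^sup>2"
        by (intro divide_right_mono) (auto simp: power_mult_distrib algebra_simps)
      \<comment> \<open>The growing factors of the waves are harmless: both frequencies are at most
        \<open>2 * \<Lambda>\<close> and both pins lie in the ball of radius
        \<open>R\<close>.\<close>
      then have e1: "((l + q)\<^sup>2 * (norm x)\<^sup>2 + l\<^sup>2 * (norm x')\<^sup>2) / \<Lambda>\<^sup>2 \<le> 8 * R\<^sup>2" using \<Lambda> by simp
      have "exp (- (norm (l *\<^sub>R (x - x') + q *\<^sub>R x))\<^sup>2 / (1 + q\<^sup>2)) \<le> C1 * X powr m"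
      \<comment> \<open>If the shift \<open>q x\<close> is at most half of
        \<open>\<Lambda> * t\<close>, the frequency vector has norm at least
        \<open>\<Lambda> * t / 2\<close>. Otherwise \<open>X\<close> is at least
        \<open>1 / (2 * R)\<close>, and the trivial bound \<open>1\<close> already has the required
        form.\<close>
      proof (cases "\<bar>q\<bar> * R \<le> \<Lambda> * t / 2")
        case True
        have "norm (l *\<^sub>R (x - x')) \<le> norm (l *\<^sub>R (x - x') + q *\<^sub>R x) + norm (q *\<^sub>R x)"
          using norm_triangle_ineq4[of "l *\<^sub>R (x - x') + q *\<^sub>R x" "q *\<^sub>R x"] by simp
        moreover have "norm (l *\<^sub>R (x - x')) \<ge> \<Lambda> * t"
          using l' \<Lambda> by (simp add: t_def dist_norm mult_right_mono)
        moreover have "norm (q *\<^sub>R x) \<le> \<bar>q\<bar> * R" using xR by (simp add: mult_left_mono)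
        ultimately have "\<Lambda> * t / 2 \<le> norm (l *\<^sub>R (x - x') + q *\<^sub>R x)" using True by linarith
        then have "(\<Lambda> * t / 2)\<^sup>2 \<le> (norm (l *\<^sub>R (x - x') + q *\<^sub>R x))\<^sup>2" using t \<Lambda> by (intro power_mono) auto
        then have "(\<Lambda> * t / 2)\<^sup>2 / (1 + \<bar>q\<bar>)\<^sup>2 \<le> (norm (l *\<^sub>R (x - x') + q *\<^sub>R x))\<^sup>2 / (1 + q\<^sup>2)"
          using q1 by (intro frac_le) (auto simp: power2_eq_square algebra_simps)
        moreover have "(\<Lambda> * t / 2)\<^sup>2 / (1 + \<bar>q\<bar>)\<^sup>2 = 1 / (4 * X\<^sup>2)"
          by (simp add: X_def power_divide power_mult_distrib)
        ultimately have "exp (- (norm (l *\<^sub>R (x - x') + q *\<^sub>R x))\<^sup>2 / (1 + q\<^sup>2)) \<le> exp (- 1 / (4 * X\<^sup>2))" by simp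
        also have "\<dots> \<le> C0 * X powr m" by (rule C0(2)[OF X])
        also have "\<dots> \<le> C1 * X powr m" by (intro mult_right_mono) (auto simp: C1_def)
        finally show ?thesis .
      next
        case False
        then have "\<Lambda> * t \<le> 2 * R * (1 + \<bar>q\<bar>)" using assms(1) by (simp add: algebra_simps)
        then have "1 \<le> 2 * R * X" using t \<Lambda> by (simp add: X_def field_simps)
        then have "1 \<le> (2 * R * X) powr m" using m by (intro ge_one_powr_ge_zero) auto
        also have "\<dots> = (2 * R) powr m * X powr m" using assms(1) X by (simp add: powr_mult)
        also have "\<dots> \<le> C1 * X powr m" by (intro mult_right_mono) (auto simp: C1_def)
        finally have "1 \<le> C1 * X powr m" .
        moreover have "exp (- (norm (l *\<^sub>R (x - x') + q *\<^sub>R x))\<^sup>2 / (1 + q\<^sup>2)) \<le> 1" using q1 by simp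
        ultimately show ?thesis by linarith
      qed
      then have "exp (8 * R\<^sup>2) * exp (- (norm (l *\<^sub>R (x - x') + q *\<^sub>R x))\<^sup>2 / (1 + q\<^sup>2)) \<le> K"
        unfolding K_def by (intro mult_left_mono) auto
      moreover have "exp (A2 * l\<^sup>2 + A1 * l + A0) \<le> exp (8 * R\<^sup>2 + (- (norm (l *\<^sub>R (x - x') + q *\<^sub>R x))\<^sup>2 / (1 + q\<^sup>2)))"
        unfolding A[symmetric] using e1 by simp
      ultimately show ?thesis unfolding exp_add[of "8 * R\<^sup>2"] by (rule order_trans[rotated])
    qed
    define Z where "Z = \<bar>q\<bar> powr (- 1 / 2) * X"
    have Z: "Z > 0" using q X by (simp add: Z_def)
    have "norm (integral {c..d} ?f) \<le> \<Lambda> * K * (96 * Z powr a)"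
    proof (cases "c \<le> d")
      case False
      then show ?thesis using K0 \<Lambda> by simp
    next
      case True
      have b1: "norm (integral {c..d} ?f) \<le> \<Lambda> * K"
      proof -
        have "norm (integral {c..d} ?f) \<le> K * (d - c)"
          by (rule integral_bound[OF True]) (use K q1 in \<open>auto intro!: continuous_intros simp: norm_mult\<close>)
        also have "\<dots> \<le> K * \<Lambda>" using cd K0 by (intro mult_left_mono) auto
        finally show ?thesis by (simp add: mult.commute)
      qed
      have b2: "norm (integral {c..d} ?f) \<le> \<Lambda> * K * (96 * Z)"
      proof -
        have nz: "- (q * (dist x x')\<^sup>2 / (1 + q\<^sup>2)) \<noteq> 0" using q ne q1 by simp
        have "norm (integral {c..d} ?f) \<le> 96 * K / sqrt \<bar>- (q * (dist x x')\<^sup>2 / (1 + q\<^sup>2))\<bar>"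
          by (rule quadratic_exp_integral_bound[OF nz True K])
        also have "sqrt \<bar>- (q * (dist x x')\<^sup>2 / (1 + q\<^sup>2))\<bar> = sqrt \<bar>q\<bar> * t / sqrt (1 + q\<^sup>2)"
          using q1 t by (simp add: abs_mult real_sqrt_mult real_sqrt_divide t_def)
        also have "96 * K / (sqrt \<bar>q\<bar> * t / sqrt (1 + q\<^sup>2)) = 96 * K / (sqrt \<bar>q\<bar> * t) * sqrt (1 + q\<^sup>2)" by simp
        also have "\<dots> \<le> 96 * K / (sqrt \<bar>q\<bar> * t) * (1 + \<bar>q\<bar>)"
          using K0 t by (intro mult_left_mono real_le_lsqrt) (auto simp: power2_eq_square algebra_simps)
        also have "\<dots> = \<Lambda> * K * (96 * Z)"
          using t \<Lambda> q by (simp add: Z_def X_def powr_minus powr_half_sqrt field_simps)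
        finally show ?thesis .
      qed
      \<comment> \<open>Interpolation between the trivial bound \<open>b1\<close> and the
        oscillatory bound \<open>b2\<close>; it rests on \<open>0 \<le> a\<close> and
        \<open>a \<le> 1\<close>.\<close>
      have "min 1 Z \<le> Z powr a"
      proof (cases "Z \<le> 1")
        case True
        then have "Z powr 1 \<le> Z powr a" using Z assms by (intro powr_mono') auto
        then show ?thesis using Z by simp
      next
        case False
        then show ?thesis using assms ge_one_powr_ge_zero[of Z a] by simp
      qed
      moreover have "\<Lambda> * K * min 1 (96 * Z) \<le> \<Lambda> * K * (96 * min 1 Z)"
        using \<Lambda> K0 Z by (intro mult_left_mono) auto
      moreover have "norm (integral {c..d} ?f) \<le> \<Lambda> * K * min 1 (96 * Z)" using b1 b2 by (simp add: min_def)
      moreover have "\<Lambda> * K * (96 * min 1 Z) \<le> \<Lambda> * K * (96 * Z powr a)"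
        using \<Lambda> K0 calculation(1) by (intro mult_left_mono) auto
      ultimately show ?thesis by linarith
    qed
    also have "Z powr a = \<bar>q\<bar> powr (- a / 2) * X powr a"
      using q X by (simp add: Z_def powr_mult powr_powr)
    also have "\<Lambda> * K * (96 * (\<bar>q\<bar> powr (- a / 2) * X powr a)) =
        96 * exp (8 * R\<^sup>2) * C1 * \<Lambda> * (\<bar>q\<bar> powr (- a / 2) * (X powr m * X powr a))"
      by (simp add: K_def)
    also have "X powr m * X powr a = X powr \<sigma>" by (simp add: m_def flip: powr_add)
    finally show "norm (integral {c..d} ?f) \<le> 96 * exp (8 * R\<^sup>2) * C1 * \<Lambda> *
        (\<bar>q\<bar> powr (- a / 2) * ((1 + \<bar>q\<bar>) / (\<Lambda> * dist x x')) powr \<sigma>)"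
      by (simp add: X_def t_def)
  qed
qed

text \<open>The exponent \<open>e1\<close> governs integrability at \<open>0\<close> and
  \<open>e1 + e2\<close> at infinity: \<open>(1 + q) powr e2\<close> is compared with
  \<open>1\<close> up to \<open>q = 1\<close> and with \<open>q powr e2\<close> beyond.\<close>

lemma integrable_powr_two_ends:
  fixes e1 e2 :: real
  assumes e: "- 1 < e1" "e2 \<le> 0" "e1 + e2 < - 1"
  shows "integrable lborel (\<lambda>q. \<bar>q\<bar> powr e1 * (1 + \<bar>q\<bar>) powr e2)"
proof -
  define h where "h = (\<lambda>q::real. indicator {0..} q * (q powr e1 * (1 + q) powr e2))"
  have [measurable]: "h \<in> borel_measurable borel" unfolding h_def by measurable
  have nn: "integrable lborel (\<lambda>q. indicator S q * q powr p)"
    if "((\<lambda>q. q powr p) has_integral c) S" "S \<in> sets borel" for S p and c :: real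
  proof -
    have "(\<lambda>q. q powr p) absolutely_integrable_on S"
      using that(1) by (intro nonnegative_absolutely_integrable_1) (auto simp: integrable_on_def)
    then have "integrable lebesgue (\<lambda>q. indicator S q *\<^sub>R q powr p)" by (simp add: set_integrable_def)
    moreover have "(\<lambda>q. indicator S q *\<^sub>R q powr p) \<in> borel_measurable lborel" using that(2) by measurable
    ultimately show ?thesis by (simp add: integrable_completion)
  qed
  have i1: "integrable lborel (\<lambda>q. indicator {0..1} q * q powr e1)"
    by (rule nn[OF has_integral_powr_from_0]) (use e in auto)
  have i2: "integrable lborel (\<lambda>q. indicator {1..} q * q powr (e1 + e2))"
    by (rule nn[OF has_integral_powr_to_inf]) (use e in auto)
  have hi: "integrable lborel h"
  proof (rule Bochner_Integration.integrable_bound[OF Bochner_Integration.integrable_add[OF i1 i2]])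
    show "AE q in lborel. norm (h q) \<le> norm (indicator {0..1} q * q powr e1 + indicator {1..} q * q powr (e1 + e2))"
    proof (intro AE_I2)
      fix q :: real
      consider "q < 0" | "0 \<le> q" "q \<le> 1" | "1 < q" by linarith
      then show "norm (h q) \<le> norm (indicator {0..1} q * q powr e1 + indicator {1..} q * q powr (e1 + e2))"
      proof cases
        case 1
        then show ?thesis by (simp add: h_def)
      next
        case 2
        then have "(1 + q) powr e2 \<le> (1 + q) powr 0" using e by (intro powr_mono) auto
        then have "q powr e1 * (1 + q) powr e2 \<le> q powr e1" using 2 by (intro mult_left_le) auto
        moreover have "0 \<le> indicator {1..} q * q powr (e1 + e2)" by simp
        ultimately show ?thesis using 2 by (simp add: h_def add_increasing2)
      next
        case 3
        then have "(1 + q) powr e2 \<le> q powr e2" using e by (intro powr_mono2') auto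
        then have "q powr e1 * (1 + q) powr e2 \<le> q powr e1 * q powr e2" by (intro mult_left_mono) auto
        then show ?thesis using 3 by (simp add: h_def powr_add)
      qed
    qed
  qed simp
  have "integrable lborel (\<lambda>q. h q + h (0 + (-1) * q))"
    by (intro Bochner_Integration.integrable_add hi lborel_integrable_real_affine) auto
  also have "(\<lambda>q. h q + h (0 + (-1) * q)) = (\<lambda>q. \<bar>q\<bar> powr e1 * (1 + \<bar>q\<bar>) powr e2)"
  proof
    fix q :: real
    show "h q + h (0 + (-1) * q) = \<bar>q\<bar> powr e1 * (1 + \<bar>q\<bar>) powr e2"
      by (cases "q = 0"; cases "q > 0") (auto simp: h_def indicator_def)
  qed
  finally show ?thesis .
qed

lemma integrable_pair_mult:
  fixes f :: "'a::euclidean_space \<Rightarrow> real" and g :: "'b::euclidean_space \<Rightarrow> real"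
  assumes f: "integrable lborel f" and g: "integrable lborel g"
  shows "integrable (lborel \<Otimes>\<^sub>M lborel) (\<lambda>(x, y). f x * g y)"
proof (rule lborel_pair.Fubini_integrable)
  have [measurable]: "f \<in> borel_measurable borel" "g \<in> borel_measurable borel"
    using borel_measurable_integrable[OF f] borel_measurable_integrable[OF g] by auto
  show "(\<lambda>(x, y). f x * g y) \<in> borel_measurable (lborel \<Otimes>\<^sub>M lborel)" by measurable
  have "(\<lambda>x. LINT y|lborel. norm (case (x, y) of (x, y) \<Rightarrow> f x * g y)) = (\<lambda>x. \<bar>f x\<bar> * (LINT y|lborel. \<bar>g y\<bar>))"
    by (simp add: abs_mult)
  then show "integrable lborel (\<lambda>x. LINT y|lborel. norm (case (x, y) of (x, y) \<Rightarrow> f x * g y))"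
    using f by simp
  show "AE x in lborel. integrable lborel (\<lambda>y. case (x, y) of (x, y) \<Rightarrow> f x * g y)"
    using g by simp
qed

text \<open>The measure preserving shear sending \<open>(q, l)\<close> to \<open>(l + q, l)\<close>.
  It organises a product of two frequency integrals by the frequency difference \<open>q\<close>, on
  which the Gaussian factor depends.\<close>

lemma integral_product_shear:
  fixes f g :: "real \<Rightarrow> complex"
  assumes f: "integrable lborel f" and g: "integrable lborel g"
  shows "(LINT p|lborel. f (snd p + fst p) * g (snd p)) = integral\<^sup>L lborel f * integral\<^sup>L lborel g"
proof -
  have [measurable]: "f \<in> borel_measurable borel" "g \<in> borel_measurable borel"
    using borel_measurable_integrable[OF f] borel_measurable_integrable[OF g] by auto
  have sh: "integrable lborel (\<lambda>q. f (l + q))" "(LINT q|lborel. f (l + q)) = integral\<^sup>L lborel f" for l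
    using lborel_integrable_real_affine[OF f, of 1 l] lborel_integral_real_affine[of 1 f l] by auto
  have nsh: "(LINT q|lborel. norm (f (l + q))) = (LINT q|lborel. norm (f q))" for l
    using lborel_integral_real_affine[of 1 "\<lambda>q. norm (f q)" l] by simp
  have int: "integrable (lborel \<Otimes>\<^sub>M lborel) (\<lambda>(l, q). f (l + q) * g l)"
  proof (rule lborel_pair.Fubini_integrable)
    show "(\<lambda>(l, q). f (l + q) * g l) \<in> borel_measurable (lborel \<Otimes>\<^sub>M lborel)" by measurable
    have "(\<lambda>l. LINT q|lborel. norm (case (l, q) of (l, q) \<Rightarrow> f (l + q) * g l)) = (\<lambda>l. (LINT q|lborel. norm (f q)) * norm (g l))"
      by (simp add: norm_mult nsh)
    then show "integrable lborel (\<lambda>l. LINT q|lborel. norm (case (l, q) of (l, q) \<Rightarrow> f (l + q) * g l))"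
      using g by simp
    show "AE l in lborel. integrable lborel (\<lambda>q. case (l, q) of (l, q) \<Rightarrow> f (l + q) * g l)"
      using sh by simp
  qed
  have "(LINT p|lborel. f (snd p + fst p) * g (snd p)) = integral\<^sup>L (lborel \<Otimes>\<^sub>M lborel) (\<lambda>(q, l). f (l + q) * g l)"
    by (simp add: lborel_prod case_prod_beta')
  also have "\<dots> = integral\<^sup>L (lborel \<Otimes>\<^sub>M lborel) (\<lambda>(l, q). f (l + q) * g l)"
    using lborel_pair.integral_product_swap[of "\<lambda>(l, q). f (l + q) * g l"] int by (simp add: case_prod_beta')
  also have "\<dots> = (LINT l|lborel. LINT q|lborel. f (l + q) * g l)"
    using lborel_pair.integral_fst'[OF int] by simp
  also have "\<dots> = integral\<^sup>L lborel f * integral\<^sup>L lborel g"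
    by (simp add: sh)
  finally show ?thesis .
qed

text \<open>The lower end \<kappa> of the frequency window is free because a later integration by
  parts in the frequency produces all tails of the shell
  \<open>{\<Lambda>..2 * \<Lambda>}\<close>.\<close>

definition packet :: "'a::euclidean_space \<Rightarrow> real \<Rightarrow> real \<Rightarrow> real \<Rightarrow> 'a \<Rightarrow> complex" where
  "packet x u \<Lambda> \<kappa> z = (LINT l|lborel. indicator {\<kappa>..2 * \<Lambda>} l *\<^sub>R wave x u \<Lambda> z l)"

lemma measurable_wave [measurable]:
  "(\<lambda>w. wave x u \<Lambda> (f w) (g w)) \<in> borel_measurable M"
  if [measurable]: "f \<in> borel_measurable M" "g \<in> borel_measurable M"
  for f :: "'b \<Rightarrow> 'a::euclidean_space" and g :: "'b \<Rightarrow> real"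
proof -
  have [measurable]: "cis \<in> borel_measurable borel" by (intro borel_measurable_continuous_onI continuous_intros)
  show ?thesis unfolding wave_def by measurable
qed

lemma integrable_wave: "integrable lborel (\<lambda>l. indicator {a..b} l *\<^sub>R wave x u \<Lambda> z l)"
proof -
  define c where "c = (norm x)\<^sup>2 / \<Lambda>\<^sup>2"
  have "wave x u \<Lambda> z = (\<lambda>l. of_real (exp (l\<^sup>2 * c)) * cis (l * ((dist z x)\<^sup>2 - u)))"
    by (simp add: wave_def c_def fun_eq_iff)
  then have "set_integrable lborel {a..b} (wave x u \<Lambda> z)"
    by (auto intro!: borel_integrable_atLeastAtMost' continuous_intros)
  then show ?thesis by (simp add: set_integrable_def)
qed

text \<open>Space is integrated first, then \<open>l\<close>, then \<open>q\<close>. For fixed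
  \<open>q\<close>, both \<open>l\<close> and \<open>l + q\<close> lie in the window exactly when
  \<open>l\<close> lies in the displayed interval. The bound may fail at \<open>q = 0\<close>, a
  null set.\<close>

lemma packet_correlation:
  fixes x x' :: "'a::euclidean_space" and u u' \<Lambda> :: real
  defines "E \<equiv> \<lambda>z q l. of_real (exp (- (norm z)\<^sup>2)) * (wave x u \<Lambda> z (l + q) * cnj (wave x' u' \<Lambda> z l))"
  assumes \<Lambda>: "\<Lambda> \<ge> 1" "\<Lambda> \<le> \<kappa>" and B: "integrable lborel B"
    and bound: "\<And>q. q \<noteq> 0 \<Longrightarrow>
      norm (LINT l|lborel. indicator {max \<kappa> (\<kappa> - q)..min (2 * \<Lambda>) (2 * \<Lambda> - q)} l *\<^sub>R (LINT z|lborel. E z q l)) \<le> B q"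
  shows "integrable lborel (\<lambda>z. of_real (exp (- (norm z)\<^sup>2)) * (packet x u \<Lambda> \<kappa> z * cnj (packet x' u' \<Lambda> \<kappa> z)))"
    and "norm (LINT z|lborel. of_real (exp (- (norm z)\<^sup>2)) * (packet x u \<Lambda> \<kappa> z * cnj (packet x' u' \<Lambda> \<kappa> z))) \<le> integral\<^sup>L lborel B"
proof -
  let ?I = "\<lambda>l. indicator {\<kappa>..2 * \<Lambda>} l :: real"
  define H where "H = (\<lambda>(z::'a) (p::real \<times> real). (?I (snd p + fst p) * ?I (snd p)) *\<^sub>R E z (fst p) (snd p))"
  define M where "M = exp (4 * (norm x)\<^sup>2) * exp (4 * (norm x')\<^sup>2)"
  have wb: "norm (wave y v \<Lambda> z l) \<le> exp (4 * (norm y)\<^sup>2)" if "l \<in> {\<kappa>..2 * \<Lambda>}" for y :: 'a and v z l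
  proof -
    have "l\<^sup>2 \<le> (2 * \<Lambda>)\<^sup>2" using that \<Lambda> by (intro power_mono) auto
    then have "l\<^sup>2 / \<Lambda>\<^sup>2 \<le> 4" using \<Lambda> by (simp add: field_simps)
    then have "l\<^sup>2 / \<Lambda>\<^sup>2 * (norm y)\<^sup>2 \<le> 4 * (norm y)\<^sup>2" by (intro mult_right_mono) auto
    then show ?thesis by (simp add: norm_wave)
  qed
  have "(\<lambda>w. H (fst w) (snd w)) \<in> borel_measurable (borel \<Otimes>\<^sub>M (borel \<Otimes>\<^sub>M borel))"
  proof -
    have [measurable]: "cnj \<in> borel_measurable borel" by (intro borel_measurable_continuous_onI continuous_intros)
    show ?thesis unfolding H_def E_def by measurable
  qed
  then have [measurable]: "(\<lambda>w. H (fst w) (snd w)) \<in> borel_measurable (borel \<Otimes>\<^sub>M borel)"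
    by (simp add: borel_prod)
  have gz: "integrable lborel (\<lambda>z::'a. exp (- (norm z)\<^sup>2))"
  proof -
    have "integrable lborel (\<lambda>z::'a. exp (- 1 * complex_of_real ((norm z)\<^sup>2) - 2 * \<i> * of_real (0 \<bullet> z)))"
      by (rule gauss_int_fourier_euclidean(1)) simp
    then have "integrable lborel (\<lambda>z::'a. Re (exp (- complex_of_real ((norm z)\<^sup>2))))"
      by (intro integrable_Re) simp
    then show ?thesis by (simp flip: of_real_power of_real_minus add: exp_of_real)
  qed
  have box: "integrable lborel (\<lambda>p. M * indicator ({- 2 * \<Lambda>..2 * \<Lambda>} \<times> {0..2 * \<Lambda>}) p :: real)"
  proof (rule integrable_mult_right)
    have "emeasure lborel ({- 2 * \<Lambda>..2 * \<Lambda>} \<times> {0..2 * \<Lambda>}) < \<infinity>"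
      using emeasure_lborel_cbox_finite[of "(- 2 * \<Lambda>, 0::real)" "(2 * \<Lambda>, 2 * \<Lambda>)"]
      by (simp only: cbox_Pair_eq box_real)
    moreover have "{- 2 * \<Lambda>..2 * \<Lambda>} \<times> {0..2 * \<Lambda>} \<in> sets (lborel :: (real \<times> real) measure)"
      by (simp add: borel_Times)
    ultimately show "integrable lborel (indicator ({- 2 * \<Lambda>..2 * \<Lambda>} \<times> {0..2 * \<Lambda>}) :: real \<times> real \<Rightarrow> real)"
      by (rule integrable_real_indicator[rotated])
  qed
  \<comment> \<open>The waves do not decay in \<open>z\<close>; integrability comes from the
    Gaussian weight in space and from the bounded box to which the window confines
    \<open>(q, l)\<close>.\<close>
  have Hint: "integrable (lborel \<Otimes>\<^sub>M lborel) (\<lambda>(z, p). H z p)"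
  proof (rule Bochner_Integration.integrable_bound[OF integrable_pair_mult[OF gz box]])
    show "(\<lambda>(z, p). H z p) \<in> borel_measurable (lborel \<Otimes>\<^sub>M lborel)" by measurable
    show "AE w in lborel \<Otimes>\<^sub>M lborel. norm (case w of (z, p) \<Rightarrow> H z p)
      \<le> norm (case w of (z, p) \<Rightarrow> exp (- (norm z)\<^sup>2) * (M * indicator ({- 2 * \<Lambda>..2 * \<Lambda>} \<times> {0..2 * \<Lambda>}) p))"
    proof (intro AE_I2, clarify)
      fix z :: 'a and q l :: real
      show "norm (H z (q, l)) \<le> norm (exp (- (norm z)\<^sup>2) * (M * indicator ({- 2 * \<Lambda>..2 * \<Lambda>} \<times> {0..2 * \<Lambda>}) (q, l)))"
      proof (cases "l + q \<in> {\<kappa>..2 * \<Lambda>} \<and> l \<in> {\<kappa>..2 * \<Lambda>}")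
        case True
        then have "norm (wave x u \<Lambda> z (l + q)) * norm (wave x' u' \<Lambda> z l) \<le> M"
          unfolding M_def by (intro mult_mono wb) auto
        moreover have "(q, l) \<in> {- 2 * \<Lambda>..2 * \<Lambda>} \<times> {0..2 * \<Lambda>}" using True \<Lambda> by auto
        ultimately show ?thesis using True by (simp add: H_def E_def norm_mult M_def)
      next
        case False
        then show ?thesis by (auto simp: H_def indicator_def)
      qed
    qed
  qed
  have inner: "(LINT p|lborel. H z p) = of_real (exp (- (norm z)\<^sup>2)) * (packet x u \<Lambda> \<kappa> z * cnj (packet x' u' \<Lambda> \<kappa> z))" for z
  proof -
    have "(LINT p|lborel. H z p) = (LINT p|lborel. of_real (exp (- (norm z)\<^sup>2)) *
        ((?I (snd p + fst p) *\<^sub>R wave x u \<Lambda> z (snd p + fst p)) * cnj (?I (snd p) *\<^sub>R wave x' u' \<Lambda> z (snd p))))"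
      by (intro Bochner_Integration.integral_cong refl) (simp add: H_def E_def scaleR_conv_of_real mult_ac)
    also have "\<dots> = of_real (exp (- (norm z)\<^sup>2)) * (packet x u \<Lambda> \<kappa> z * (LINT l|lborel. cnj (?I l *\<^sub>R wave x' u' \<Lambda> z l)))"
      unfolding packet_def
      using integral_product_shear[OF integrable_wave, of "\<lambda>l. cnj (?I l *\<^sub>R wave x' u' \<Lambda> z l)" \<kappa> "2 * \<Lambda>" x u \<Lambda> z]
        integrable_wave[of \<kappa> "2 * \<Lambda>" x' u' \<Lambda> z]
      by (simp only: integral_mult_right_zero integrable_cnj)
    also have "(LINT l|lborel. cnj (?I l *\<^sub>R wave x' u' \<Lambda> z l)) = cnj (packet x' u' \<Lambda> \<kappa> z)"
      unfolding packet_def by (rule Bochner_Integration.integral_cnj)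
    finally show ?thesis .
  qed
  show "integrable lborel (\<lambda>z. of_real (exp (- (norm z)\<^sup>2)) * (packet x u \<Lambda> \<kappa> z * cnj (packet x' u' \<Lambda> \<kappa> z)))"
    using lborel_pair.integrable_fst'[OF Hint] by (simp add: inner)
  define J where "J = (\<lambda>p. LINT z|lborel. H z p)"
  have Jint: "integrable lborel J"
    unfolding J_def by (rule lborel_pair.integrable_snd[OF Hint])
  have Jint': "integrable (lborel \<Otimes>\<^sub>M lborel) J" using Jint by (simp add: lborel_prod)
  have "(LINT z|lborel. of_real (exp (- (norm z)\<^sup>2)) * (packet x u \<Lambda> \<kappa> z * cnj (packet x' u' \<Lambda> \<kappa> z))) = integral\<^sup>L lborel J"
    unfolding inner[symmetric] J_def by (rule lborel_pair.Fubini_integral[OF Hint, symmetric])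
  also have "\<dots> = integral\<^sup>L (lborel \<Otimes>\<^sub>M lborel) J" by (simp add: lborel_prod)
  also have "\<dots> = (LINT q|lborel. LINT l|lborel. J (q, l))" using lborel_pair.integral_fst'[OF Jint'] by simp
  finally have eq: "(LINT z|lborel. of_real (exp (- (norm z)\<^sup>2)) * (packet x u \<Lambda> \<kappa> z * cnj (packet x' u' \<Lambda> \<kappa> z)))
      = (LINT q|lborel. LINT l|lborel. J (q, l))" .
  have Jq: "(LINT l|lborel. J (q, l)) = (LINT l|lborel. indicator {max \<kappa> (\<kappa> - q)..min (2 * \<Lambda>) (2 * \<Lambda> - q)} l *\<^sub>R (LINT z|lborel. E z q l))" for q
  proof (intro Bochner_Integration.integral_cong refl)
    fix l
    have "?I (l + q) * ?I l = indicator {max \<kappa> (\<kappa> - q)..min (2 * \<Lambda>) (2 * \<Lambda> - q)} l"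
      by (auto simp: indicator_def)
    then show "J (q, l) = indicator {max \<kappa> (\<kappa> - q)..min (2 * \<Lambda>) (2 * \<Lambda> - q)} l *\<^sub>R (LINT z|lborel. E z q l)"
      by (simp add: J_def H_def)
  qed
  have "norm (LINT q|lborel. LINT l|lborel. J (q, l)) \<le> (LINT q|lborel. norm (LINT l|lborel. J (q, l)))"
    by (rule integral_norm_bound)
  also have "\<dots> \<le> integral\<^sup>L lborel B"
  proof (rule integral_mono_AE)
    show "integrable lborel (\<lambda>q. norm (LINT l|lborel. J (q, l)))"
      using lborel_pair.integrable_fst'[OF Jint'] by simp
    show "AE q in lborel. norm (LINT l|lborel. J (q, l)) \<le> B q"
      using AE_lborel_singleton[of 0] by eventually_elim (use bound in \<open>simp add: Jq\<close>)
  qed (rule B)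
  finally show "norm (LINT z|lborel. of_real (exp (- (norm z)\<^sup>2)) * (packet x u \<Lambda> \<kappa> z * cnj (packet x' u' \<Lambda> \<kappa> z))) \<le> integral\<^sup>L lborel B"
    unfolding eq .
qed

text \<open>The power of the Gaussian integral supplies \<open>(1 + |q|) powr (- d / 2)\<close> and
  the oscillatory kernel \<open>|q| powr (- a / 2) * (1 + |q|) powr \<sigma>\<close>, so everything
  reduces to integrability in \<open>q\<close>. The radii \<open>u\<close> and \<open>u'\<close> do
  not affect the bound, as they only enter the linear part of the phase in \<open>l\<close> and its
  constant.\<close>

lemma packet_correlation_bound:
  fixes R \<sigma> :: real
  assumes R: "R > 0" and \<sigma>: "0 \<le> \<sigma>" "2 * \<sigma> < real DIM('a) - 1" and d: "DIM('a) \<ge> 3"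
  obtains C where "C > 0"
    "\<And>(x::'a::euclidean_space) x' u u' \<Lambda> \<kappa>. norm x \<le> R \<Longrightarrow> norm x' \<le> R \<Longrightarrow> \<Lambda> \<ge> 1 \<Longrightarrow> \<Lambda> \<le> \<kappa> \<Longrightarrow>
      integrable lborel (\<lambda>z. of_real (exp (- (norm z)\<^sup>2)) * (packet x u \<Lambda> \<kappa> z * cnj (packet x' u' \<Lambda> \<kappa> z)))"
    "\<And>(x::'a::euclidean_space) x' u u' \<Lambda> \<kappa>. norm x \<le> R \<Longrightarrow> norm x' \<le> R \<Longrightarrow> \<Lambda> \<ge> 1 \<Longrightarrow> \<Lambda> \<le> \<kappa> \<Longrightarrow>
      norm (LINT z|lborel. of_real (exp (- (norm z)\<^sup>2)) * (packet x u \<Lambda> \<kappa> z * cnj (packet x' u' \<Lambda> \<kappa> z)))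
        \<le> C * \<Lambda> * (if \<Lambda> * dist x x' \<le> 1 then 1 else (\<Lambda> * dist x x') powr (- \<sigma>))"
proof -
  define n where "n = DIM('a)"
  \<comment> \<open>The largest admissible share of the oscillation, hence the best decay in
    \<open>q\<close> at infinity.\<close>
  define a where "a = min 1 \<sigma>"
  have a: "0 \<le> a" "a \<le> 1" "a \<le> \<sigma>" using \<sigma> by (auto simp: a_def)
  show thesis
  proof (rule oscillatory_kernel_bound[OF R a])
  fix C1 :: real
  assume C1: "C1 > 0"
    "\<And>(x::'a) x' q \<Lambda> c d A0 A1 A2 B0 B1.
      norm x \<le> R \<Longrightarrow> norm x' \<le> R \<Longrightarrow> x \<noteq> x' \<Longrightarrow> q \<noteq> 0 \<Longrightarrow> \<Lambda> \<ge> 1 \<Longrightarrow> \<Lambda> \<le> c \<Longrightarrow> d \<le> 2 * \<Lambda> \<Longrightarrow>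
      \<Lambda> \<le> c + q \<Longrightarrow> d + q \<le> 2 * \<Lambda> \<Longrightarrow>
      (\<And>l. - (norm (l *\<^sub>R (x - x') + q *\<^sub>R x))\<^sup>2 / (1 + q\<^sup>2)
          + ((l + q)\<^sup>2 * (norm x)\<^sup>2 + l\<^sup>2 * (norm x')\<^sup>2) / \<Lambda>\<^sup>2 = A2 * l\<^sup>2 + A1 * l + A0) \<Longrightarrow>
      norm (integral {c..d} (\<lambda>l. of_real (exp (A2 * l\<^sup>2 + A1 * l + A0)) *
        cis (- (q * (dist x x')\<^sup>2 / (1 + q\<^sup>2)) * l\<^sup>2 + B1 * l + B0)))
      \<le> C1 * \<Lambda> * (\<bar>q\<bar> powr (- a / 2) * ((1 + \<bar>q\<bar>) / (\<Lambda> * dist x x')) powr \<sigma>)"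
  define W0 where "W0 = (\<lambda>q::real. \<bar>q\<bar> powr 0 * (1 + \<bar>q\<bar>) powr (- real n / 2))"
  define W where "W = (\<lambda>q::real. \<bar>q\<bar> powr (- a / 2) * (1 + \<bar>q\<bar>) powr (\<sigma> - real n / 2))"
  \<comment> \<open>For d = 2 the weight would be \<open>1 / (1 + |q|)\<close>, which is not
    integrable.\<close>
  have W0: "integrable lborel W0" unfolding W0_def
    by (rule integrable_powr_two_ends) (use d in \<open>auto simp: n_def\<close>)
  have W: "integrable lborel W" unfolding W_def
  proof (rule integrable_powr_two_ends)
    \<comment> \<open>For \<sigma> \<ge> 1 this reads \<open>2 * \<sigma> < d - 1\<close>. For
      \<sigma> \<le> 1 it reads \<open>\<sigma> < d - 2\<close>, which follows from the same
      inequality if d = 3 and is automatic for larger \<open>d\<close>.\<close>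
    show "- a / 2 + (\<sigma> - real n / 2) < - 1"
      using \<sigma> d by (cases "\<sigma> \<le> 1") (auto simp: a_def n_def min_def)
  qed (use a \<sigma> d in \<open>auto simp: n_def\<close>)
  define C where "C = 1 + 136 ^ n * exp (8 * R\<^sup>2) * integral\<^sup>L lborel W0 + 136 ^ n * C1 * integral\<^sup>L lborel W"
  have W0nn: "integral\<^sup>L lborel W0 \<ge> 0" and Wnn: "integral\<^sup>L lborel W \<ge> 0"
    by (auto intro!: Bochner_Integration.integral_nonneg simp: W_def W0_def)
  have C: "C > 0" using W0nn Wnn C1 by (auto simp: C_def intro!: add_pos_nonneg)
  define E where "E = (\<lambda>x (u::real) \<Lambda> x' (u'::real) (z::'a) q l. of_real (exp (- (norm z)\<^sup>2)) * (wave x u \<Lambda> z (l + q) * cnj (wave x' u' \<Lambda> z l)))"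
  have gauss: "norm (gauss_int (Complex 1 (- q)) ^ n) \<le> 136 ^ n * (1 + \<bar>q\<bar>) powr (- real n / 2)" for q
  proof -
    have "norm (gauss_int (Complex 1 (- q)) ^ n) \<le> (136 / sqrt (1 + \<bar>q\<bar>)) ^ n"
      unfolding norm_power by (intro power_mono gauss_int_bound) auto
    also have "136 / sqrt (1 + \<bar>q\<bar>) = 136 * (1 + \<bar>q\<bar>) powr (- (1 / 2))"
      by (subst powr_minus_divide, subst powr_half_sqrt) auto
    also have "(136 * (1 + \<bar>q\<bar>) powr (- (1 / 2))) ^ n = 136 ^ n * (1 + \<bar>q\<bar>) powr (real n * (- (1 / 2)))"
      unfolding power_mult_distrib by (subst powr_power) (auto simp: mult.commute)
    finally show ?thesis by simp
  qed
  have kernel: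
    "norm (LINT l|lborel. indicator {max \<kappa> (\<kappa> - q)..min (2 * \<Lambda>) (2 * \<Lambda> - q)} l *\<^sub>R (LINT z|lborel. E x u \<Lambda> x' u' z q l)) \<le> 136 ^ n * exp (8 * R\<^sup>2) * \<Lambda> * W0 q"
    "x \<noteq> x' \<Longrightarrow> norm (LINT l|lborel. indicator {max \<kappa> (\<kappa> - q)..min (2 * \<Lambda>) (2 * \<Lambda> - q)} l *\<^sub>R (LINT z|lborel. E x u \<Lambda> x' u' z q l)) \<le> 136 ^ n * C1 * \<Lambda> * (\<Lambda> * dist x x') powr (- \<sigma>) * W q"
    if xR: "norm x \<le> R" "norm x' \<le> R" and \<Lambda>: "\<Lambda> \<ge> 1" "\<Lambda> \<le> \<kappa>" and q: "q \<noteq> 0" for x x' u u' \<Lambda> \<kappa> q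
  proof -
    define c where "c = max \<kappa> (\<kappa> - q)"
    define d where "d = min (2 * \<Lambda>) (2 * \<Lambda> - q)"
    have cd: "\<Lambda> \<le> c" "d \<le> 2 * \<Lambda>" "\<Lambda> \<le> c + q" "d + q \<le> 2 * \<Lambda>" using \<Lambda> by (auto simp: c_def d_def)
    obtain A0 A1 A2 B0 B1 where
      A: "\<And>l. - (norm (l *\<^sub>R (x - x') + q *\<^sub>R x))\<^sup>2 / (1 + q\<^sup>2)
          + ((l + q)\<^sup>2 * (norm x)\<^sup>2 + l\<^sup>2 * (norm x')\<^sup>2) / \<Lambda>\<^sup>2 = A2 * l\<^sup>2 + A1 * l + A0"
      and Z: "\<And>l. (LINT z|lborel. E x u \<Lambda> x' u' z q l) = gauss_int (Complex 1 (- q)) ^ n *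
         (of_real (exp (- (norm (l *\<^sub>R (x - x') + q *\<^sub>R x))\<^sup>2 / (1 + q\<^sup>2)
          + ((l + q)\<^sup>2 * (norm x)\<^sup>2 + l\<^sup>2 * (norm x')\<^sup>2) / \<Lambda>\<^sup>2)) * cis (- (q * (dist x x')\<^sup>2 / (1 + q\<^sup>2)) * l\<^sup>2 + B1 * l + B0))"
      unfolding E_def n_def by (rule wave_correlation[of x x' q \<Lambda> u u']) blast
    define f where "f = (\<lambda>l. of_real (exp (A2 * l\<^sup>2 + A1 * l + A0)) * cis (- (q * (dist x x')\<^sup>2 / (1 + q\<^sup>2)) * l\<^sup>2 + B1 * l + B0))"
    have q1: "1 + q\<^sup>2 \<noteq> 0" by (metis add_pos_nonneg less_irrefl zero_le_power2 zero_less_one)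
    have fcont: "continuous_on {c..d} f" unfolding f_def using q1 by (auto intro!: continuous_intros)
    have eq: "(LINT l|lborel. indicator {c..d} l *\<^sub>R (LINT z|lborel. E x u \<Lambda> x' u' z q l)) = gauss_int (Complex 1 (- q)) ^ n * integral {c..d} f"
    proof -
      have "(LINT l|lborel. indicator {c..d} l *\<^sub>R (LINT z|lborel. E x u \<Lambda> x' u' z q l)) =
          (LINT l|lborel. gauss_int (Complex 1 (- q)) ^ n * (indicator {c..d} l *\<^sub>R f l))"
        unfolding Z A f_def by (simp only: scaleR_conv_of_real mult_ac)
      also have "\<dots> = gauss_int (Complex 1 (- q)) ^ n * (LINT l|lborel. indicator {c..d} l *\<^sub>R f l)"
        by (rule integral_mult_right_zero)
      also have "(LINT l|lborel. indicator {c..d} l *\<^sub>R f l) = integral {c..d} f"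
        using set_borel_integral_eq_integral(2)[OF borel_integrable_atLeastAtMost'[OF fcont]]
        by (simp add: set_lebesgue_integral_def)
      finally show ?thesis .
    qed
    have triv: "norm (integral {c..d} f) \<le> exp (8 * R\<^sup>2) * \<Lambda>"
    proof (cases "c \<le> d")
      case True
      have "norm (integral {c..d} f) \<le> exp (8 * R\<^sup>2) * (d - c)"
      proof (rule integral_bound[OF True fcont])
        fix l assume l: "l \<in> {c..d}"
        have "l\<^sup>2 \<le> (2 * \<Lambda>)\<^sup>2" "(l + q)\<^sup>2 \<le> (2 * \<Lambda>)\<^sup>2"
          using l cd \<Lambda> by (intro power_mono; auto)+
        moreover have "(norm x)\<^sup>2 \<le> R\<^sup>2" "(norm x')\<^sup>2 \<le> R\<^sup>2" using xR by (auto intro: power_mono)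
        ultimately have "l\<^sup>2 * (norm x')\<^sup>2 \<le> (2 * \<Lambda>)\<^sup>2 * R\<^sup>2" "(l + q)\<^sup>2 * (norm x)\<^sup>2 \<le> (2 * \<Lambda>)\<^sup>2 * R\<^sup>2"
          by (auto intro!: mult_mono simp del: power_mult_distrib)
        then have "((l + q)\<^sup>2 * (norm x)\<^sup>2 + l\<^sup>2 * (norm x')\<^sup>2) / \<Lambda>\<^sup>2 \<le> (8 * R\<^sup>2 * \<Lambda>\<^sup>2) / \<Lambda>\<^sup>2"
          by (intro divide_right_mono) (auto simp: power_mult_distrib algebra_simps)
        then have "((l + q)\<^sup>2 * (norm x)\<^sup>2 + l\<^sup>2 * (norm x')\<^sup>2) / \<Lambda>\<^sup>2 \<le> 8 * R\<^sup>2" using \<Lambda> by simp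
        moreover have "- (norm (l *\<^sub>R (x - x') + q *\<^sub>R x))\<^sup>2 / (1 + q\<^sup>2) \<le> 0" by (simp add: add_pos_nonneg)
        ultimately have "A2 * l\<^sup>2 + A1 * l + A0 \<le> 8 * R\<^sup>2" unfolding A[symmetric] by linarith
        then show "norm (f l) \<le> exp (8 * R\<^sup>2)" by (simp add: f_def norm_mult)
      qed
      also have "\<dots> \<le> exp (8 * R\<^sup>2) * \<Lambda>" using cd by (intro mult_left_mono) auto
      finally show ?thesis .
    qed (use \<Lambda> in simp)
    have "norm (LINT l|lborel. indicator {c..d} l *\<^sub>R (LINT z|lborel. E x u \<Lambda> x' u' z q l))
        \<le> (136 ^ n * (1 + \<bar>q\<bar>) powr (- real n / 2)) * (exp (8 * R\<^sup>2) * \<Lambda>)"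
      unfolding eq norm_mult by (intro mult_mono gauss triv) auto
    then show "norm (LINT l|lborel. indicator {max \<kappa> (\<kappa> - q)..min (2 * \<Lambda>) (2 * \<Lambda> - q)} l *\<^sub>R (LINT z|lborel. E x u \<Lambda> x' u' z q l)) \<le> 136 ^ n * exp (8 * R\<^sup>2) * \<Lambda> * W0 q"
      using q by (simp add: c_def d_def W0_def mult_ac)
    show "norm (LINT l|lborel. indicator {max \<kappa> (\<kappa> - q)..min (2 * \<Lambda>) (2 * \<Lambda> - q)} l *\<^sub>R (LINT z|lborel. E x u \<Lambda> x' u' z q l)) \<le> 136 ^ n * C1 * \<Lambda> * (\<Lambda> * dist x x') powr (- \<sigma>) * W q"
      if ne: "x \<noteq> x'"
    proof -
      have fb: "norm (integral {c..d} f) \<le> C1 * \<Lambda> * (\<bar>q\<bar> powr (- a / 2) * ((1 + \<bar>q\<bar>) / (\<Lambda> * dist x x')) powr \<sigma>)"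
        unfolding f_def by (rule C1(2)[OF xR ne q \<Lambda>(1) cd A])
      have "norm (LINT l|lborel. indicator {c..d} l *\<^sub>R (LINT z|lborel. E x u \<Lambda> x' u' z q l))
        \<le> (136 ^ n * (1 + \<bar>q\<bar>) powr (- real n / 2)) * (C1 * \<Lambda> * (\<bar>q\<bar> powr (- a / 2) * ((1 + \<bar>q\<bar>) / (\<Lambda> * dist x x')) powr \<sigma>))"
        unfolding eq norm_mult by (intro mult_mono gauss fb) auto
      also have "((1 + \<bar>q\<bar>) / (\<Lambda> * dist x x')) powr \<sigma> = (1 + \<bar>q\<bar>) powr \<sigma> * (\<Lambda> * dist x x') powr (- \<sigma>)"
        using \<Lambda> by (subst powr_divide) (auto simp: powr_minus_divide)
      also have "(136 ^ n * (1 + \<bar>q\<bar>) powr (- real n / 2)) * (C1 * \<Lambda> * (\<bar>q\<bar> powr (- a / 2) * ((1 + \<bar>q\<bar>) powr \<sigma> * (\<Lambda> * dist x x') powr (- \<sigma>))))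
         = 136 ^ n * C1 * \<Lambda> * (\<Lambda> * dist x x') powr (- \<sigma>) * (\<bar>q\<bar> powr (- a / 2) * ((1 + \<bar>q\<bar>) powr \<sigma> * (1 + \<bar>q\<bar>) powr (- real n / 2)))"
        by (simp only: mult_ac)
      also have "(1 + \<bar>q\<bar>) powr \<sigma> * (1 + \<bar>q\<bar>) powr (- real n / 2) = (1 + \<bar>q\<bar>) powr (\<sigma> - real n / 2)"
        by (simp flip: powr_add)
      finally show ?thesis by (simp add: c_def d_def W_def)
    qed
  qed
  show thesis
  proof (rule that[OF C])
    fix x x' :: 'a and u u' \<Lambda> \<kappa> :: real
    assume xR: "norm x \<le> R" "norm x' \<le> R" and \<Lambda>: "\<Lambda> \<ge> 1" "\<Lambda> \<le> \<kappa>"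
    let ?F = "\<lambda>z. of_real (exp (- (norm z)\<^sup>2)) * (packet x u \<Lambda> \<kappa> z * cnj (packet x' u' \<Lambda> \<kappa> z))"
    have i0: "integrable lborel (\<lambda>q. 136 ^ n * exp (8 * R\<^sup>2) * \<Lambda> * W0 q)" by (intro integrable_mult_right W0)
    note c0 = packet_correlation[OF \<Lambda> i0 kernel(1)[OF xR \<Lambda>, unfolded E_def]]
    show "integrable lborel ?F" by (rule c0(1))
    have b0: "norm (integral\<^sup>L lborel ?F) \<le> 136 ^ n * exp (8 * R\<^sup>2) * \<Lambda> * integral\<^sup>L lborel W0"
      using c0(2) by simp
    show "norm (integral\<^sup>L lborel ?F) \<le> C * \<Lambda> * (if \<Lambda> * dist x x' \<le> 1 then 1 else (\<Lambda> * dist x x') powr (- \<sigma>))"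
    proof (cases "\<Lambda> * dist x x' \<le> 1")
      case True
      have "136 ^ n * exp (8 * R\<^sup>2) * integral\<^sup>L lborel W0 * \<Lambda> \<le> C * \<Lambda>"
        using \<Lambda> Wnn C1 by (intro mult_right_mono) (auto simp: C_def)
      then show ?thesis using b0 True by (simp add: mult_ac)
    next
      case False
      then have ne: "x \<noteq> x'" by auto
      have i1: "integrable lborel (\<lambda>q. 136 ^ n * C1 * \<Lambda> * (\<Lambda> * dist x x') powr (- \<sigma>) * W q)" by (intro integrable_mult_right W)
      note c1 = packet_correlation(2)[OF \<Lambda> i1 kernel(2)[OF xR \<Lambda> _ ne, unfolded E_def]]
      have "norm (integral\<^sup>L lborel ?F) \<le> 136 ^ n * C1 * integral\<^sup>L lborel W * (\<Lambda> * (\<Lambda> * dist x x') powr (- \<sigma>))"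
        using c1 by (simp add: mult_ac)
      also have "\<dots> \<le> C * (\<Lambda> * (\<Lambda> * dist x x') powr (- \<sigma>))"
        using \<Lambda> W0nn by (intro mult_right_mono) (auto simp: C_def)
      finally show ?thesis using False by (simp add: mult_ac)
    qed
  qed
  qed
qed

section \<open>Discrete Frostman weights\<close>

text \<open>A Frostman measure seen at resolution \<delta>: a finitely supported weight cannot obey
  the ball condition at arbitrarily small radii, so it is asked for \<open>r \<ge> \<delta>\<close>
  only. Later constants depend on the weight through \<open>s\<close> and \<open>K\<close> alone,
  hence not on the resolution.\<close>

definition frostman :: "real \<Rightarrow> real \<Rightarrow> real \<Rightarrow> 'a::metric_space set \<Rightarrow> ('a \<Rightarrow> real) \<Rightarrow> bool" where
  "frostman s K \<delta> X w \<longleftrightarrow> finite X \<and> (\<forall>x\<in>X. 0 \<le> w x) \<and>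
     (\<forall>z r. \<delta> \<le> r \<longrightarrow> (\<Sum>x\<in>{x\<in>X. dist z x \<le> r}. w x) \<le> K * r powr s)"

text \<open>The kernel is dominated by dyadic steps, and the ball of radius
  \<open>2 ^ j / \<Lambda>\<close> has mass at most \<open>K * (2 ^ j / \<Lambda>) powr s\<close>.
  The geometric sum is left unevaluated because its two uses have ratios on opposite sides of
  \<open>1\<close>.\<close>

lemma frostman_layers:
  assumes fr: "frostman s K \<delta> X w" and \<Lambda>: "\<Lambda> > 0" "\<delta> * \<Lambda> \<le> 1" and \<rho>: "\<rho> \<ge> 0"
    and J: "\<And>x. x \<in> X \<Longrightarrow> \<Lambda> * dist z x \<le> 2 ^ J"
  shows "(\<Sum>x\<in>X. w x * (if \<Lambda> * dist z x \<le> 1 then 1 else (\<Lambda> * dist z x) powr (- \<rho>)))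
     \<le> K * \<Lambda> powr (- s) * 2 powr \<rho> * (\<Sum>j\<le>J. (2 powr (s - \<rho>)) ^ j)"
proof -
  have X: "finite X" and w: "\<And>x. x \<in> X \<Longrightarrow> 0 \<le> w x"
    and ball: "\<And>z r. \<delta> \<le> r \<Longrightarrow> (\<Sum>x\<in>{x\<in>X. dist z x \<le> r}. w x) \<le> K * r powr s"
    using fr by (auto simp: frostman_def)
  define \<phi> where "\<phi> = (\<lambda>x. if \<Lambda> * dist z x \<le> 1 then 1 else (\<Lambda> * dist z x) powr (- \<rho>))"
  \<comment> \<open>The factor is the kernel at \<open>2 powr (j - 1)\<close>, the inner radius of
    the \<open>j\<close>-th shell.\<close>
  define T where "T = (\<lambda>j x. 2 powr (\<rho> - real j * \<rho>) * (if \<Lambda> * dist z x \<le> 2 ^ j then 1 else 0) :: real)"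
  have T0: "T j x \<ge> 0" for j x by (simp add: T_def)
  have pt: "\<phi> x \<le> (\<Sum>j\<le>J. T j x)" if x: "x \<in> X" for x
  proof -
    define P where "P = (\<lambda>j. \<Lambda> * dist z x \<le> 2 ^ j)"
    have PJ: "P J" using J[OF x] by (simp add: P_def)
    define j where "j = (LEAST j. P j)"
    have Pj: "P j" and jJ: "j \<le> J" and least: "\<And>i. i < j \<Longrightarrow> \<not> P i"
      using PJ by (auto simp: j_def intro: LeastI Least_le dest: not_less_Least)
    have "\<phi> x \<le> T j x"
    proof (cases j)
      case 0
      then have "\<Lambda> * dist z x \<le> 1" using Pj by (simp add: P_def)
      then show ?thesis using 0 \<rho> by (simp add: \<phi>_def T_def ge_one_powr_ge_zero)
    next
      case (Suc i)
      then have far: "\<Lambda> * dist z x > 2 ^ i" using least[of i] by (simp add: P_def)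
      have "(1::real) \<le> 2 ^ i" by simp
      then have "\<not> \<Lambda> * dist z x \<le> 1" using far by linarith
      then have "\<phi> x = (\<Lambda> * dist z x) powr (- \<rho>)" by (simp add: \<phi>_def)
      also have "\<dots> \<le> (2 ^ i) powr (- \<rho>)" using far \<rho> by (intro powr_mono2') auto
      also have "\<dots> = 2 powr (\<rho> - real j * \<rho>)"
        by (simp add: Suc powr_powr flip: powr_realpow) (simp add: algebra_simps)
      finally show ?thesis using Pj by (simp add: T_def P_def)
    qed
    also have "\<dots> \<le> (\<Sum>j\<le>J. T j x)" using jJ by (intro member_le_sum) (auto simp: T0)
    finally show ?thesis .
  qed
  have "(\<Sum>x\<in>X. w x * \<phi> x) \<le> (\<Sum>x\<in>X. w x * (\<Sum>j\<le>J. T j x))"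
    by (intro sum_mono mult_left_mono pt w)
  also have "\<dots> = (\<Sum>j\<le>J. 2 powr (\<rho> - real j * \<rho>) * (\<Sum>x\<in>{x\<in>X. dist z x \<le> 2 ^ j / \<Lambda>}. w x))"
  proof -
    have "(\<Sum>x\<in>{x\<in>X. dist z x \<le> 2 ^ j / \<Lambda>}. w x) = (\<Sum>x\<in>X. w x * (if \<Lambda> * dist z x \<le> 2 ^ j then 1 else 0))" for j
    proof -
      have "(\<Lambda> * dist z x \<le> 2 ^ j) = (dist z x \<le> 2 ^ j / \<Lambda>)" for x using \<Lambda> by (simp add: field_simps)
      then show ?thesis using X by (auto simp: sum.If_cases Int_def if_distrib cong: if_cong)
    qed
    moreover have "(\<Sum>x\<in>X. w x * (\<Sum>j\<le>J. T j x)) = (\<Sum>j\<le>J. \<Sum>x\<in>X. w x * T j x)"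
      unfolding sum_distrib_left by (rule sum.swap)
    moreover have "(\<Sum>x\<in>X. w x * T j x) = 2 powr (\<rho> - real j * \<rho>) * (\<Sum>x\<in>X. w x * (if \<Lambda> * dist z x \<le> 2 ^ j then 1 else 0))" for j
      unfolding T_def sum_distrib_left by (simp only: mult.left_commute)
    ultimately show ?thesis by simp
  qed
  also have "\<dots> \<le> (\<Sum>j\<le>J. 2 powr (\<rho> - real j * \<rho>) * (K * (2 ^ j / \<Lambda>) powr s))"
  proof (intro sum_mono mult_left_mono ball)
    fix j
    have "\<delta> \<le> 1 / \<Lambda>" using \<Lambda> by (simp add: field_simps)
    also have "\<dots> \<le> 2 ^ j / \<Lambda>" using \<Lambda> by (intro divide_right_mono) auto
    finally show "\<delta> \<le> 2 ^ j / \<Lambda>" .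
  qed auto
  also have "\<dots> = K * \<Lambda> powr (- s) * 2 powr \<rho> * (\<Sum>j\<le>J. (2 powr (s - \<rho>)) ^ j)"
    unfolding sum_distrib_left
  proof (intro sum.cong refl)
    fix j
    have e1: "(2 ^ j / \<Lambda>) powr s = 2 powr (real j * s) * \<Lambda> powr (- s)"
      using \<Lambda> by (subst powr_divide) (auto simp: powr_minus_divide powr_powr simp flip: powr_realpow)
    have e2: "2 powr (\<rho> - real j * \<rho>) * 2 powr (real j * s) = 2 powr \<rho> * (2 powr (s - \<rho>)) ^ j"
      by (simp add: powr_power algebra_simps flip: powr_add)
    have "2 powr (\<rho> - real j * \<rho>) * (K * (2 ^ j / \<Lambda>) powr s) = K * \<Lambda> powr (- s) * (2 powr (\<rho> - real j * \<rho>) * 2 powr (real j * s))"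
      unfolding e1 by (simp only: mult_ac)
    then show "2 powr (\<rho> - real j * \<rho>) * (K * (2 ^ j / \<Lambda>) powr s) = K * \<Lambda> powr (- s) * 2 powr \<rho> * (2 powr (s - \<rho>)) ^ j"
      unfolding e2 by (simp only: mult_ac)
  qed
  finally show ?thesis by (simp add: \<phi>_def)
qed

text \<open>For \<rho> < s the layers grow geometrically, so the outermost one, at distance of order
  \<open>R\<close>, dominates. There are about \<open>log 2 (2 * R * \<Lambda>)\<close> layers,
  which turns \<open>\<Lambda> powr (- s)\<close> into
  \<open>\<Lambda> powr (- \<rho>)\<close>.\<close>

lemma frostman_energy:
  fixes R s \<rho> :: real
  assumes R: "R \<ge> 1" and \<rho>: "0 \<le> \<rho>" "\<rho> < s"
  obtains C where "C > 0"
    "\<And>(X::'a::real_normed_vector set) w K \<delta> \<Lambda> z. frostman s K \<delta> X w \<Longrightarrow> X \<subseteq> cball 0 R \<Longrightarrow> norm z \<le> R \<Longrightarrow>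
      K \<ge> 0 \<Longrightarrow> \<Lambda> \<ge> 1 \<Longrightarrow> \<delta> * \<Lambda> \<le> 1 \<Longrightarrow>
      (\<Sum>x\<in>X. w x * (if \<Lambda> * dist z x \<le> 1 then 1 else (\<Lambda> * dist z x) powr (- \<rho>))) \<le> C * K * \<Lambda> powr (- \<rho>)"
proof -
  define b where "b = 2 powr (s - \<rho>)"
  have b: "b > 1" using \<rho> by (simp add: b_def)
  define C where "C = 2 powr \<rho> * (b / (b - 1)) * (4 * R) powr (s - \<rho>)"
  show thesis
  proof (rule that[of C])
    show "C > 0" using b R by (simp add: C_def)
    fix X :: "'a set" and w K \<delta> \<Lambda> and z :: 'a
    assume fr: "frostman s K \<delta> X w" and X: "X \<subseteq> cball 0 R" and z: "norm z \<le> R" and K: "K \<ge> 0"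
      and \<Lambda>: "\<Lambda> \<ge> 1" "\<delta> * \<Lambda> \<le> 1"
    have R1: "2 * R * \<Lambda> \<ge> 1" using R \<Lambda> mult_mono[of 1 R 1 \<Lambda>] by simp
    define J where "J = nat \<lceil>log 2 (2 * R * \<Lambda>)\<rceil>"
    have l0: "log 2 (2 * R * \<Lambda>) \<ge> 0" using R1 by simp
    have J1: "log 2 (2 * R * \<Lambda>) \<le> real J" and J2: "real J \<le> log 2 (2 * R * \<Lambda>) + 1"
      using l0 by (auto simp: J_def of_nat_nat intro: less_imp_le)
    have "2 * R * \<Lambda> = 2 powr (log 2 (2 * R * \<Lambda>))" using R1 by simp
    also have "\<dots> \<le> 2 powr real J" using J1 by (intro powr_mono) auto
    finally have JR: "2 * R * \<Lambda> \<le> 2 ^ J" by (simp add: powr_realpow)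
    have "2 powr real J \<le> 2 powr (log 2 (2 * R * \<Lambda>) + 1)" using J2 by (intro powr_mono) auto
    also have "\<dots> = 4 * R * \<Lambda>" using R1 by (simp add: powr_add)
    finally have JR2: "2 powr real J \<le> 4 * R * \<Lambda>" .
    have dist: "\<Lambda> * dist z x \<le> 2 ^ J" if "x \<in> X" for x
    proof -
      have "dist z x \<le> 2 * R" using that X z dist_triangle3[of z x 0] by fastforce
      then have "\<Lambda> * dist z x \<le> \<Lambda> * (2 * R)" using \<Lambda> by (intro mult_left_mono) auto
      then show ?thesis using JR by (simp add: mult_ac)
    qed
    have "(\<Sum>j\<le>J. b ^ j) = (b ^ Suc J - 1) / (b - 1)"
      using b geometric_sum[of b "Suc J"] by (simp add: lessThan_Suc_atMost)
    also have "\<dots> \<le> b ^ Suc J / (b - 1)" using b by (intro divide_right_mono) auto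
    also have "\<dots> = b / (b - 1) * (2 powr real J) powr (s - \<rho>)"
      by (simp add: b_def powr_power powr_powr mult.commute)
    also have "\<dots> \<le> b / (b - 1) * (4 * R * \<Lambda>) powr (s - \<rho>)"
      using b \<rho> JR2 by (intro mult_left_mono powr_mono2) auto
    also have "(4 * R * \<Lambda>) powr (s - \<rho>) = (4 * R) powr (s - \<rho>) * \<Lambda> powr (s - \<rho>)"
      using R \<Lambda> by (simp add: powr_mult)
    finally have gs: "(\<Sum>j\<le>J. b ^ j) \<le> b / (b - 1) * ((4 * R) powr (s - \<rho>) * \<Lambda> powr (s - \<rho>))" .
    have "(\<Sum>x\<in>X. w x * (if \<Lambda> * dist z x \<le> 1 then 1 else (\<Lambda> * dist z x) powr (- \<rho>)))
       \<le> K * \<Lambda> powr (- s) * 2 powr \<rho> * (\<Sum>j\<le>J. b ^ j)"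
      unfolding b_def by (rule frostman_layers[OF fr]) (use \<Lambda> \<rho> dist in auto)
    also have "\<dots> \<le> K * \<Lambda> powr (- s) * 2 powr \<rho> * (b / (b - 1) * ((4 * R) powr (s - \<rho>) * \<Lambda> powr (s - \<rho>)))"
      using K by (intro mult_left_mono gs) auto
    also have "\<dots> = C * K * (\<Lambda> powr (- s) * \<Lambda> powr (s - \<rho>))" by (simp add: C_def)
    also have "\<Lambda> powr (- s) * \<Lambda> powr (s - \<rho>) = \<Lambda> powr (- \<rho>)" by (simp flip: powr_add)
    finally show "(\<Sum>x\<in>X. w x * (if \<Lambda> * dist z x \<le> 1 then 1 else (\<Lambda> * dist z x) powr (- \<rho>))) \<le> C * K * \<Lambda> powr (- \<rho>)" .
  qed
qed

text \<open>A Gaussian lies below a multiple of the power kernel with \<open>\<rho> = s + 1\<close>,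
  for which the layers decay with ratio \<open>1 / 2\<close>. The innermost ball decides, and the
  diameter of \<open>X\<close> does not enter the constant.\<close>

lemma frostman_gaussian:
  fixes s :: real
  assumes s: "s \<ge> 0"
  obtains C where "C > 0"
    "\<And>(X::'a::metric_space set) w K \<delta> \<Lambda> z. frostman s K \<delta> X w \<Longrightarrow> K \<ge> 0 \<Longrightarrow> \<Lambda> > 0 \<Longrightarrow> \<delta> * \<Lambda> \<le> 1 \<Longrightarrow>
      (\<Sum>x\<in>X. w x * exp (- (\<Lambda> * dist z x)\<^sup>2 / 2)) \<le> C * K * \<Lambda> powr (- s)"
proof -
  define \<rho> where "\<rho> = s + 1"
  obtain C0 where C0: "C0 \<ge> 1" "\<And>X. X > 0 \<Longrightarrow> exp (- 1 / (4 * X\<^sup>2)) \<le> C0 * X powr \<rho>"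
    using powr_exp_neg_bound[of \<rho>] s by (auto simp: \<rho>_def)
  show thesis
  proof (rule that[of "C0 * 2 powr \<rho> * 2"])
    show "C0 * 2 powr \<rho> * 2 > 0" using C0 by simp
    fix X :: "'a set" and w K \<delta> \<Lambda> and z :: 'a
    assume fr: "frostman s K \<delta> X w" and K: "K \<ge> 0" and \<Lambda>: "\<Lambda> > 0" "\<delta> * \<Lambda> \<le> 1"
    have X: "finite X" and w: "\<And>x. x \<in> X \<Longrightarrow> 0 \<le> w x" using fr by (auto simp: frostman_def)
    obtain J :: nat where J: "\<And>x. x \<in> X \<Longrightarrow> \<Lambda> * dist z x \<le> 2 ^ J"
    proof -
      obtain J :: nat where "Max (insert 0 ((\<lambda>x. \<Lambda> * dist z x) ` X)) < 2 ^ J"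
        using real_arch_pow[of 2 "Max (insert 0 ((\<lambda>x. \<Lambda> * dist z x) ` X))"] by auto
      then show thesis using X by (intro that[of J]) (auto simp: less_imp_le)
    qed
    have pt: "exp (- v\<^sup>2 / 2) \<le> C0 * (if v \<le> 1 then 1 else v powr (- \<rho>))" if v: "v \<ge> 0" for v :: real
    proof (cases "v \<le> 1")
      case True
      have "exp (- v\<^sup>2 / 2) \<le> 1" by simp
      then show ?thesis unfolding if_P[OF True] using C0(1) by linarith
    next
      case False
      have "exp (- v\<^sup>2 / 2) \<le> exp (- 1 / (4 * (1 / v)\<^sup>2))"
        using False by (simp add: power_divide)
      also have "\<dots> \<le> C0 * (1 / v) powr \<rho>" using False by (intro C0(2)) auto
      also have "(1 / v) powr \<rho> = v powr (- \<rho>)" using False by (simp add: powr_divide powr_minus_divide)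
      finally show ?thesis using False by simp
    qed
    have "(\<Sum>x\<in>X. w x * exp (- (\<Lambda> * dist z x)\<^sup>2 / 2)) \<le> (\<Sum>x\<in>X. w x * (C0 * (if \<Lambda> * dist z x \<le> 1 then 1 else (\<Lambda> * dist z x) powr (- \<rho>))))"
      using \<Lambda> by (intro sum_mono mult_left_mono pt w) auto
    also have "\<dots> = C0 * (\<Sum>x\<in>X. w x * (if \<Lambda> * dist z x \<le> 1 then 1 else (\<Lambda> * dist z x) powr (- \<rho>)))"
      by (simp only: sum_distrib_left mult.left_commute)
    also have "\<dots> \<le> C0 * (K * \<Lambda> powr (- s) * 2 powr \<rho> * (\<Sum>j\<le>J. (2 powr (s - \<rho>)) ^ j))"
      using C0 s by (intro mult_left_mono frostman_layers[OF fr \<Lambda>] J) (auto simp: \<rho>_def)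
    also have "\<dots> \<le> C0 * (K * \<Lambda> powr (- s) * 2 powr \<rho> * 2)"
    proof (intro mult_left_mono)
      have half: "(2::real) powr (s - \<rho>) = 1 / 2" by (simp add: \<rho>_def powr_minus_divide)
      have "(\<Sum>j\<le>J. (1 / 2 :: real) ^ j) = 2 - (1 / 2) ^ J" by (induction J) auto
      then show "(\<Sum>j\<le>J. (2 powr (s - \<rho>)) ^ j) \<le> 2" unfolding half by simp
    qed (use C0 K in auto)
    finally show "(\<Sum>x\<in>X. w x * exp (- (\<Lambda> * dist z x)\<^sup>2 / 2)) \<le> C0 * 2 powr \<rho> * 2 * K * \<Lambda> powr (- s)"
      by (simp add: mult_ac)
  qed
qed

section \<open>Cauchy-Schwarz, Gaussian averages and the reproducing identity\<close>

text \<open>Young's inequality with the weight \<open>t = sqrt b / sqrt a\<close>, which balances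
  the two terms; the same pointwise bound supplies integrability.\<close>

lemma integral_Cauchy_Schwarz_bound:
  fixes f g :: "'a \<Rightarrow> real"
  assumes [measurable]: "f \<in> borel_measurable M" "g \<in> borel_measurable M"
    and f: "integrable M (\<lambda>x. (f x)\<^sup>2)" "(LINT x|M. (f x)\<^sup>2) \<le> a" and a: "a > 0"
    and g: "integrable M (\<lambda>x. (g x)\<^sup>2)" "(LINT x|M. (g x)\<^sup>2) \<le> b" and b: "b > 0"
  shows "integrable M (\<lambda>x. f x * g x)" and "(LINT x|M. f x * g x) \<le> sqrt a * sqrt b"
proof -
  define t where "t = sqrt b / sqrt a"
  have t: "t > 0" using a b by (simp add: t_def)
  have pt: "\<bar>u * v\<bar> \<le> (t * u\<^sup>2 + v\<^sup>2 / t) / 2" for u v :: real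
  proof -
    have "0 \<le> (t * \<bar>u\<bar> - \<bar>v\<bar>)\<^sup>2 / t" using t by simp
    also have "\<dots> = t * u\<^sup>2 + v\<^sup>2 / t - 2 * \<bar>u * v\<bar>"
      using t by (simp add: power2_eq_square field_simps abs_mult)
    finally show ?thesis by simp
  qed
  have dom: "integrable M (\<lambda>x. (t * (f x)\<^sup>2 + (g x)\<^sup>2 / t) / 2)"
    using f(1) g(1) by (intro integrable_divide_zero Bochner_Integration.integrable_add integrable_mult_right) auto
  show fg: "integrable M (\<lambda>x. f x * g x)"
  proof (rule Bochner_Integration.integrable_bound[OF dom])
    show "AE x in M. norm (f x * g x) \<le> norm ((t * (f x)\<^sup>2 + (g x)\<^sup>2 / t) / 2)"
      using order_trans[OF pt abs_ge_self] by (intro AE_I2) simp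
  qed simp
  have "(LINT x|M. f x * g x) \<le> (LINT x|M. (t * (f x)\<^sup>2 + (g x)\<^sup>2 / t) / 2)"
    by (intro integral_mono fg dom) (use pt in \<open>smt (verit)\<close>)
  also have "\<dots> = (t * (LINT x|M. (f x)\<^sup>2) + (LINT x|M. (g x)\<^sup>2) / t) / 2"
    using f(1) g(1) by simp
  also have "\<dots> \<le> (t * a + b / t) / 2"
    using t f(2) g(2) by (intro divide_right_mono add_mono mult_left_mono) auto
  also have "\<dots> = sqrt a * sqrt b"
  proof -
    have "t * a = sqrt b * sqrt a" using a by (simp add: t_def real_div_sqrt flip: times_divide_eq_right)
    moreover have "b / t = sqrt b * sqrt a" using b by (simp add: t_def real_div_sqrt flip: times_divide_eq_left)
    ultimately show ?thesis by simp
  qed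
  finally show "(LINT x|M. f x * g x) \<le> sqrt a * sqrt b" .
qed

lemma lborel_integral_shift:
  fixes f :: "'a::euclidean_space \<Rightarrow> 'b::{banach,second_countable_topology}"
  assumes [measurable]: "f \<in> borel_measurable borel"
  shows "(LINT z|lborel. f (c + z)) = (LINT z|lborel. f z)"
    and "integrable lborel (\<lambda>z. f (c + z)) \<longleftrightarrow> integrable lborel f"
proof -
  have "(LINT z|lborel. f z) = (LINT z|distr lborel borel ((+) c). f z)" by (simp add: lborel_distr_plus)
  also have "\<dots> = (LINT z|lborel. f (c + z))" by (rule integral_distr) auto
  finally show "(LINT z|lborel. f (c + z)) = (LINT z|lborel. f z)" ..
  have "integrable lborel f \<longleftrightarrow> integrable (distr lborel borel ((+) c)) f" by (simp add: lborel_distr_plus)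
  also have "\<dots> \<longleftrightarrow> integrable lborel (\<lambda>z. f (c + z))" by (rule integrable_distr_eq) auto
  finally show "integrable lborel (\<lambda>z. f (c + z)) \<longleftrightarrow> integrable lborel f" ..
qed

lemma integrable_gaussian_euclidean:
  fixes y :: "'a::euclidean_space"
  assumes a: "a > 0"
  shows "integrable lborel (\<lambda>z. exp (- a * (dist z y)\<^sup>2))"
    and "(LINT z|lborel. exp (- a * (dist z y)\<^sup>2)) = sqrt (pi / a) ^ DIM('a)"
proof -
  let ?f = "\<lambda>z::'a. exp (- of_real a * complex_of_real ((norm z)\<^sup>2) - 2 * \<i> * of_real (0 \<bullet> z))"
  have f: "?f = (\<lambda>z. of_real (exp (- a * (norm z)\<^sup>2)))" by (auto simp: exp_of_real[symmetric])
  have int: "integrable lborel (\<lambda>z::'a. exp (- a * (norm z)\<^sup>2))"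
    using gauss_int_fourier_euclidean(1)[of "of_real a" "0::'a"] a unfolding f by (simp add: complex_of_real_integrable_eq)
  have "of_real (LINT z::'a|lborel. exp (- a * (norm z)\<^sup>2)) = (of_real (sqrt (pi / a) ^ DIM('a)) :: complex)"
    using gauss_int_fourier_euclidean(2)[of "of_real a" "0::'a"] a unfolding f
    by (simp add: gauss_int_of_real)
  then have val: "(LINT z::'a|lborel. exp (- a * (norm z)\<^sup>2)) = sqrt (pi / a) ^ DIM('a)"
    using of_real_eq_iff by blast
  let ?g = "\<lambda>z. exp (- a * (dist z y)\<^sup>2)"
  have g: "?g \<in> borel_measurable borel" by measurable
  have sh: "(\<lambda>z. ?g (y + z)) = (\<lambda>z. exp (- a * (norm z)\<^sup>2))" by (simp add: dist_norm)
  show "integrable lborel ?g" using lborel_integral_shift(2)[OF g, of y] int unfolding sh by simp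
  show "integral\<^sup>L lborel ?g = sqrt (pi / a) ^ DIM('a)"
    using lborel_integral_shift(1)[OF g, of y] val unfolding sh by simp
qed

text \<open>The factor \<open>cis (l * (|y|^2 - |z|^2))\<close> cancels the quadratic phase of the
  wave, so what is averaged has a phase affine in \<open>z\<close>. Averaging it against a Gaussian
  centred at \<open>y\<close> returns the value at \<open>y\<close> times
  \<open>exp (- l^2 |x|^2 / \<Lambda>^2)\<close>, and the amplitude of the wave cancels this
  factor.\<close>

lemma wave_reproducing:
  fixes x y :: "'a::euclidean_space" and l u \<Lambda> :: real
  assumes \<Lambda>: "\<Lambda> > 0"
  shows "integrable lborel (\<lambda>z. of_real (exp (- (\<Lambda> * dist z y)\<^sup>2)) * (cis (l * ((norm y)\<^sup>2 - (norm z)\<^sup>2)) * wave x u \<Lambda> z l))"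
    and "(LINT z|lborel. of_real (exp (- (\<Lambda> * dist z y)\<^sup>2)) * (cis (l * ((norm y)\<^sup>2 - (norm z)\<^sup>2)) * wave x u \<Lambda> z l))
      = of_real ((sqrt pi / \<Lambda>) ^ DIM('a)) * cis (l * ((dist y x)\<^sup>2 - u))"
proof -
  define c where "c = of_real (exp (l\<^sup>2 * (norm x)\<^sup>2 / \<Lambda>\<^sup>2)) * cis (l * ((dist y x)\<^sup>2 - u))"
  let ?D = "complex_of_real (\<Lambda>\<^sup>2)"
  let ?h = "\<lambda>z. of_real (exp (- (\<Lambda> * dist z y)\<^sup>2)) * (cis (l * ((norm y)\<^sup>2 - (norm z)\<^sup>2)) * wave x u \<Lambda> z l)"
  have D: "Re ?D > 0" using \<Lambda> by simp
  have sh: "(\<lambda>z. ?h (y + z)) = (\<lambda>z. c * exp (- ?D * of_real ((norm z)\<^sup>2) - 2 * \<i> * of_real ((l *\<^sub>R x) \<bullet> z)))"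
  proof
    fix z
    have e: "exp (- ?D * of_real ((norm z)\<^sup>2) - 2 * \<i> * of_real ((l *\<^sub>R x) \<bullet> z)) = of_real (exp (- (\<Lambda> * norm z)\<^sup>2)) * cis (- 2 * l * (x \<bullet> z))"
    proof -
      have "- ?D * of_real ((norm z)\<^sup>2) - 2 * \<i> * of_real ((l *\<^sub>R x) \<bullet> z) = of_real (- (\<Lambda> * norm z)\<^sup>2) + \<i> * of_real (- 2 * l * (x \<bullet> z))"
        by (simp add: complex_eq_iff power_mult_distrib)
      then show ?thesis by (simp only: exp_add exp_of_real cis_conv_exp)
    qed
    have p: "l * ((norm y)\<^sup>2 - (norm (y + z))\<^sup>2) + l * ((dist (y + z) x)\<^sup>2 - u) = l * ((dist y x)\<^sup>2 - u) + (- 2 * l * (x \<bullet> z))"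
      unfolding dist_power2_expand by (simp add: inner_add_right algebra_simps)
    have "?h (y + z) = of_real (exp (- (\<Lambda> * norm z)\<^sup>2)) * of_real (exp (l\<^sup>2 * (norm x)\<^sup>2 / \<Lambda>\<^sup>2)) *
        (cis (l * ((norm y)\<^sup>2 - (norm (y + z))\<^sup>2)) * cis (l * ((dist (y + z) x)\<^sup>2 - u)))"
      by (simp add: wave_def dist_norm)
    also have "cis (l * ((norm y)\<^sup>2 - (norm (y + z))\<^sup>2)) * cis (l * ((dist (y + z) x)\<^sup>2 - u)) = cis (l * ((dist y x)\<^sup>2 - u)) * cis (- 2 * l * (x \<bullet> z))"
      unfolding cis_mult p ..
    finally show "?h (y + z) = c * exp (- ?D * of_real ((norm z)\<^sup>2) - 2 * \<i> * of_real ((l *\<^sub>R x) \<bullet> z))"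
      unfolding e c_def by (simp add: mult_ac)
  qed
  have [measurable]: "cis \<in> borel_measurable borel" by (intro borel_measurable_continuous_onI continuous_intros)
  have meas: "?h \<in> borel_measurable borel" by measurable
  note G = gauss_int_fourier_euclidean[OF D, of "l *\<^sub>R x"]
  show "integrable lborel ?h"
    using lborel_integral_shift(2)[OF meas, of y] G(1) unfolding sh by simp
  have "integral\<^sup>L lborel ?h = c * (gauss_int ?D ^ DIM('a) * exp (- of_real ((norm (l *\<^sub>R x))\<^sup>2) / ?D))"
    using lborel_integral_shift(1)[OF meas, of y] G unfolding sh by simp
  also have "gauss_int ?D = of_real (sqrt pi / \<Lambda>)"
    using gauss_int_of_real[of "\<Lambda>\<^sup>2"] \<Lambda> by (simp add: real_sqrt_divide)
  also have "exp (- of_real ((norm (l *\<^sub>R x))\<^sup>2) / ?D) = of_real (exp (- (l\<^sup>2 * (norm x)\<^sup>2 / \<Lambda>\<^sup>2)))"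
    by (simp add: power_mult_distrib exp_of_real[symmetric])
  also have "c * (of_real (sqrt pi / \<Lambda>) ^ DIM('a) * of_real (exp (- (l\<^sup>2 * (norm x)\<^sup>2 / \<Lambda>\<^sup>2))))
     = of_real ((sqrt pi / \<Lambda>) ^ DIM('a)) * cis (l * ((dist y x)\<^sup>2 - u)) * of_real (exp (l\<^sup>2 * (norm x)\<^sup>2 / \<Lambda>\<^sup>2) * exp (- (l\<^sup>2 * (norm x)\<^sup>2 / \<Lambda>\<^sup>2)))"
    by (simp add: c_def)
  also have "exp (l\<^sup>2 * (norm x)\<^sup>2 / \<Lambda>\<^sup>2) * exp (- (l\<^sup>2 * (norm x)\<^sup>2 / \<Lambda>\<^sup>2)) = 1" by (simp flip: exp_add)
  finally show "integral\<^sup>L lborel ?h = of_real ((sqrt pi / \<Lambda>) ^ DIM('a)) * cis (l * ((dist y x)\<^sup>2 - u))" by simp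
qed

section \<open>Frequency shells\<close>

definition packet_sum :: "'a::euclidean_space set \<Rightarrow> ('a \<Rightarrow> real set) \<Rightarrow> ('a \<Rightarrow> real) \<Rightarrow> real \<Rightarrow> real \<Rightarrow> 'a \<Rightarrow> complex" where
  "packet_sum X U w \<Lambda> \<kappa> z = (\<Sum>x\<in>X. \<Sum>u\<in>U x. of_real (w x) * packet x u \<Lambda> \<kappa> z)"

lemma frostman_mass:
  assumes "frostman s K \<delta> X w" "X \<subseteq> cball 0 R" "\<delta> \<le> R"
  shows "sum w X \<le> K * R powr s"
proof -
  have "{x\<in>X. dist 0 x \<le> R} = X" using assms(2) by auto
  then show ?thesis using assms(1,3) unfolding frostman_def by metis
qed

text \<open>The square expands over pairs of indices \<open>(x, u)\<close> into correlations whose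
  bound does not see the radii. These are merely counted, with a factor \<open>N\<close> for each
  side, and what is left is the \<sigma>-energy of the weight, of size
  \<open>K * \<Lambda> powr (- \<sigma>)\<close> around each pin because \<sigma> < s.\<close>

lemma packet_sum_energy:
  fixes R s \<sigma> :: real
  assumes R: "R \<ge> 1" and \<sigma>: "0 \<le> \<sigma>" "\<sigma> < s" "2 * \<sigma> < real DIM('a) - 1" and d: "DIM('a) \<ge> 3"
  obtains C where "C > 0"
    "\<And>(X::'a::euclidean_space set) U w K \<delta> N \<Lambda> \<kappa>. frostman s K \<delta> X w \<Longrightarrow> X \<subseteq> cball 0 R \<Longrightarrow> K \<ge> 0 \<Longrightarrow> \<delta> \<le> R \<Longrightarrow>
      (\<And>x. x \<in> X \<Longrightarrow> finite (U x) \<and> real (card (U x)) \<le> N) \<Longrightarrow> \<Lambda> \<ge> 1 \<Longrightarrow> \<Lambda> \<le> \<kappa> \<Longrightarrow> \<delta> * \<Lambda> \<le> 1 \<Longrightarrow>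
      integrable lborel (\<lambda>z. exp (- (norm z)\<^sup>2) * (norm (packet_sum X U w \<Lambda> \<kappa> z))\<^sup>2) \<and>
      (LINT z|lborel. exp (- (norm z)\<^sup>2) * (norm (packet_sum X U w \<Lambda> \<kappa> z))\<^sup>2) \<le> C * (K * N)\<^sup>2 * \<Lambda> powr (1 - \<sigma>)"
proof -
  have Rp: "R > 0" using R by simp
  show thesis
  proof (rule packet_correlation_bound[OF Rp \<sigma>(1,3) d])
    fix C0 :: real
    assume C0: "C0 > 0" and int: "\<And>(x::'a) x' u u' \<Lambda> \<kappa>. norm x \<le> R \<Longrightarrow> norm x' \<le> R \<Longrightarrow> \<Lambda> \<ge> 1 \<Longrightarrow> \<Lambda> \<le> \<kappa> \<Longrightarrow>
        integrable lborel (\<lambda>z. of_real (exp (- (norm z)\<^sup>2)) * (packet x u \<Lambda> \<kappa> z * cnj (packet x' u' \<Lambda> \<kappa> z)))"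
      and corr: "\<And>(x::'a) x' u u' \<Lambda> \<kappa>. norm x \<le> R \<Longrightarrow> norm x' \<le> R \<Longrightarrow> \<Lambda> \<ge> 1 \<Longrightarrow> \<Lambda> \<le> \<kappa> \<Longrightarrow>
        norm (LINT z|lborel. of_real (exp (- (norm z)\<^sup>2)) * (packet x u \<Lambda> \<kappa> z * cnj (packet x' u' \<Lambda> \<kappa> z)))
          \<le> C0 * \<Lambda> * (if \<Lambda> * dist x x' \<le> 1 then 1 else (\<Lambda> * dist x x') powr (- \<sigma>))"
    show thesis
    proof (rule frostman_energy[OF R \<sigma>(1,2)])
      fix C1 :: real
      assume C1: "C1 > 0" and energy: "\<And>(X::'a set) w K \<delta> \<Lambda> z. frostman s K \<delta> X w \<Longrightarrow> X \<subseteq> cball 0 R \<Longrightarrow> norm z \<le> R \<Longrightarrow>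
        K \<ge> 0 \<Longrightarrow> \<Lambda> \<ge> 1 \<Longrightarrow> \<delta> * \<Lambda> \<le> 1 \<Longrightarrow>
        (\<Sum>x\<in>X. w x * (if \<Lambda> * dist z x \<le> 1 then 1 else (\<Lambda> * dist z x) powr (- \<sigma>))) \<le> C1 * K * \<Lambda> powr (- \<sigma>)"
      define C where "C = C0 * C1 * R powr s"
      show thesis
      proof (rule that[of C])
        show "C > 0" using C0 C1 R by (simp add: C_def)
        fix X :: "'a set" and U :: "'a \<Rightarrow> real set" and w K \<delta> N \<Lambda> \<kappa>
        assume fr: "frostman s K \<delta> X w" and XR: "X \<subseteq> cball 0 R" and K: "K \<ge> 0" and \<delta>: "\<delta> \<le> R"
          and U: "\<And>x. x \<in> X \<Longrightarrow> finite (U x) \<and> real (card (U x)) \<le> N"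
          and \<Lambda>: "\<Lambda> \<ge> 1" "\<Lambda> \<le> \<kappa>" "\<delta> * \<Lambda> \<le> 1"
        have X: "finite X" and w: "\<And>x. x \<in> X \<Longrightarrow> 0 \<le> w x" using fr by (auto simp: frostman_def)
        define I where "I = Sigma X U"
        define p where "p = (\<lambda>i. packet (fst i) (snd i) \<Lambda> \<kappa> :: 'a \<Rightarrow> complex)"
        define c where "c = (\<lambda>i::'a \<times> real. w (fst i))"
        define e where "e = (\<lambda>z::'a. complex_of_real (exp (- (norm z)\<^sup>2)))"
        have bI: "packet_sum X U w \<Lambda> \<kappa> z = (\<Sum>i\<in>I. of_real (c i) * p i z)" for z
          unfolding packet_sum_def I_def p_def c_def using X U by (subst sum.Sigma) (auto simp: case_prod_beta')
        have IR: "norm (fst i) \<le> R" if "i \<in> I" for i using that XR by (auto simp: I_def)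
        have ex: "complex_of_real (exp (- (norm z)\<^sup>2) * (norm (packet_sum X U w \<Lambda> \<kappa> z))\<^sup>2) =
            (\<Sum>i\<in>I. \<Sum>j\<in>I. of_real (c i * c j) * (e z * (p i z * cnj (p j z))))" for z
        proof -
          have "complex_of_real (exp (- (norm z)\<^sup>2) * (norm (packet_sum X U w \<Lambda> \<kappa> z))\<^sup>2) = e z * (packet_sum X U w \<Lambda> \<kappa> z * cnj (packet_sum X U w \<Lambda> \<kappa> z))"
            unfolding e_def of_real_mult complex_norm_square ..
          also have "\<dots> = (\<Sum>i\<in>I. \<Sum>j\<in>I. e z * ((of_real (c i) * p i z) * (of_real (c j) * cnj (p j z))))"
            unfolding bI cnj_sum sum_product by (simp add: sum_distrib_left)
          finally show ?thesis by (simp add: mult_ac)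
        qed
        have int_ij: "integrable lborel (\<lambda>z. e z * (p i z * cnj (p j z)))" if "i \<in> I" "j \<in> I" for i j
          unfolding e_def p_def by (rule int) (use IR that \<Lambda> in auto)
        have intc: "integrable lborel (\<lambda>z. complex_of_real (exp (- (norm z)\<^sup>2) * (norm (packet_sum X U w \<Lambda> \<kappa> z))\<^sup>2))"
          unfolding ex by (intro Bochner_Integration.integrable_sum integrable_mult_right int_ij)
        have intr: "integrable lborel (\<lambda>z. exp (- (norm z)\<^sup>2) * (norm (packet_sum X U w \<Lambda> \<kappa> z))\<^sup>2)"
          using intc by (simp only: complex_of_real_integrable_eq)
        define \<phi> where "\<phi> = (\<lambda>(x::'a) x'. if \<Lambda> * dist x x' \<le> 1 then 1 else (\<Lambda> * dist x x') powr (- \<sigma>))"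
        have \<phi>0: "\<phi> x x' \<ge> 0" for x x' :: 'a by (simp add: \<phi>_def)
        have "complex_of_real (LINT z|lborel. exp (- (norm z)\<^sup>2) * (norm (packet_sum X U w \<Lambda> \<kappa> z))\<^sup>2)
            = (LINT z|lborel. (\<Sum>i\<in>I. \<Sum>j\<in>I. of_real (c i * c j) * (e z * (p i z * cnj (p j z)))))"
          unfolding integral_complex_of_real[symmetric] ex ..
        also have "\<dots> = (\<Sum>i\<in>I. LINT z|lborel. (\<Sum>j\<in>I. of_real (c i * c j) * (e z * (p i z * cnj (p j z)))))"
          by (rule Bochner_Integration.integral_sum)
            (intro Bochner_Integration.integrable_sum integrable_mult_right int_ij)
        also have "\<dots> = (\<Sum>i\<in>I. \<Sum>j\<in>I. LINT z|lborel. of_real (c i * c j) * (e z * (p i z * cnj (p j z))))"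
          by (intro sum.cong refl Bochner_Integration.integral_sum integrable_mult_right int_ij)
        also have "\<dots> = (\<Sum>i\<in>I. \<Sum>j\<in>I. of_real (c i * c j) * (LINT z|lborel. e z * (p i z * cnj (p j z))))"
          by (intro sum.cong refl integral_mult_right_zero)
        finally have "complex_of_real (LINT z|lborel. exp (- (norm z)\<^sup>2) * (norm (packet_sum X U w \<Lambda> \<kappa> z))\<^sup>2)
            = (\<Sum>i\<in>I. \<Sum>j\<in>I. of_real (c i * c j) * (LINT z|lborel. e z * (p i z * cnj (p j z))))" .
        then have "\<bar>LINT z|lborel. exp (- (norm z)\<^sup>2) * (norm (packet_sum X U w \<Lambda> \<kappa> z))\<^sup>2\<bar> =
            norm (\<Sum>i\<in>I. \<Sum>j\<in>I. of_real (c i * c j) * (LINT z|lborel. e z * (p i z * cnj (p j z))))"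
          by (subst norm_of_real[symmetric, where 'a = complex]) (rule arg_cong[where f = norm])
        also have "\<dots> \<le> (\<Sum>i\<in>I. \<Sum>j\<in>I. c i * c j * (C0 * \<Lambda> * \<phi> (fst i) (fst j)))"
        proof (rule order_trans[OF norm_sum], rule sum_mono, rule order_trans[OF norm_sum], rule sum_mono)
          fix i j assume ij: "i \<in> I" "j \<in> I"
          have "c i \<ge> 0" "c j \<ge> 0" using ij w by (auto simp: I_def c_def)
          moreover have "norm (LINT z|lborel. e z * (p i z * cnj (p j z))) \<le> C0 * \<Lambda> * \<phi> (fst i) (fst j)"
            unfolding e_def p_def \<phi>_def by (rule corr) (use IR ij \<Lambda> in auto)
          ultimately show "norm (of_real (c i * c j) * (LINT z|lborel. e z * (p i z * cnj (p j z)))) \<le> c i * c j * (C0 * \<Lambda> * \<phi> (fst i) (fst j))"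
            unfolding norm_mult norm_of_real by (intro mult_mono) auto
        qed
        also have "\<dots> = C0 * \<Lambda> * (\<Sum>x\<in>X. real (card (U x)) * (w x * (\<Sum>x'\<in>X. real (card (U x')) * (w x' * \<phi> x x'))))"
        proof -
          have "(\<Sum>i\<in>I. h (fst i)) = (\<Sum>x\<in>X. real (card (U x)) * h x)" for h :: "'a \<Rightarrow> real"
          proof -
            have "(\<Sum>i\<in>I. h (fst i)) = (\<Sum>x\<in>X. \<Sum>u\<in>U x. h x)"
              unfolding I_def using X U by (subst sum.Sigma) (auto simp: case_prod_beta')
            then show ?thesis by simp
          qed
          note h = this
          have "(\<Sum>i\<in>I. \<Sum>j\<in>I. c i * c j * (C0 * \<Lambda> * \<phi> (fst i) (fst j))) = (\<Sum>i\<in>I. C0 * \<Lambda> * (w (fst i) * (\<Sum>j\<in>I. w (fst j) * \<phi> (fst i) (fst j))))"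
            by (simp add: c_def sum_distrib_left mult_ac)
          also have "\<dots> = (\<Sum>i\<in>I. C0 * \<Lambda> * (w (fst i) * (\<Sum>x'\<in>X. real (card (U x')) * (w x' * \<phi> (fst i) x'))))"
            by (subst h) simp
          also have "\<dots> = (\<Sum>x\<in>X. real (card (U x)) * (C0 * \<Lambda> * (w x * (\<Sum>x'\<in>X. real (card (U x')) * (w x' * \<phi> x x')))))"
            by (rule h)
          finally show ?thesis by (simp add: sum_distrib_left mult_ac)
        qed
        also have "\<dots> \<le> C0 * \<Lambda> * (\<Sum>x\<in>X. N * (w x * (N * (C1 * K * \<Lambda> powr (- \<sigma>)))))"
        proof (intro mult_left_mono sum_mono)
          fix x assume x: "x \<in> X"
          have N0: "N \<ge> 0" using U[OF x] by linarith
          have "(\<Sum>x'\<in>X. real (card (U x')) * (w x' * \<phi> x x')) \<le> (\<Sum>x'\<in>X. N * (w x' * \<phi> x x'))"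
            using U w \<phi>0 by (intro sum_mono mult_right_mono) auto
          also have "\<dots> = N * (\<Sum>x'\<in>X. w x' * \<phi> x x')" by (simp add: sum_distrib_left)
          also have "\<dots> \<le> N * (C1 * K * \<Lambda> powr (- \<sigma>))"
            unfolding \<phi>_def using x XR by (intro mult_left_mono energy[OF fr XR _ K \<Lambda>(1,3)] N0) auto
          finally have "w x * (\<Sum>x'\<in>X. real (card (U x')) * (w x' * \<phi> x x')) \<le> w x * (N * (C1 * K * \<Lambda> powr (- \<sigma>)))"
            using w[OF x] by (intro mult_left_mono)
          moreover have "0 \<le> w x * (\<Sum>x'\<in>X. real (card (U x')) * (w x' * \<phi> x x'))"
            using w x \<phi>0 by (intro mult_nonneg_nonneg sum_nonneg) auto
          ultimately show "real (card (U x)) * (w x * (\<Sum>x'\<in>X. real (card (U x')) * (w x' * \<phi> x x'))) \<le> N * (w x * (N * (C1 * K * \<Lambda> powr (- \<sigma>))))"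
            by (rule mult_mono[OF conjunct2[OF U[OF x]] _ N0])
        qed (use C0 \<Lambda> in auto)
        also have "\<dots> = C0 * C1 * K * N\<^sup>2 * (\<Lambda> * \<Lambda> powr (- \<sigma>)) * sum w X"
          by (simp add: sum_distrib_left sum_distrib_right power2_eq_square mult_ac)
        also have "\<dots> \<le> C0 * C1 * K * N\<^sup>2 * (\<Lambda> * \<Lambda> powr (- \<sigma>)) * (K * R powr s)"
          using C0 C1 K \<Lambda> by (intro mult_left_mono frostman_mass[OF fr XR \<delta>]) auto
        also have "\<Lambda> * \<Lambda> powr (- \<sigma>) = \<Lambda> powr (1 - \<sigma>)" using \<Lambda> by (simp add: powr_diff powr_minus_divide)
        also have "C0 * C1 * K * N\<^sup>2 * \<Lambda> powr (1 - \<sigma>) * (K * R powr s) = C * (K * N)\<^sup>2 * \<Lambda> powr (1 - \<sigma>)"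
          by (simp add: C_def power2_eq_square mult_ac)
        finally show "integrable lborel (\<lambda>z. exp (- (norm z)\<^sup>2) * (norm (packet_sum X U w \<Lambda> \<kappa> z))\<^sup>2) \<and>
            (LINT z|lborel. exp (- (norm z)\<^sup>2) * (norm (packet_sum X U w \<Lambda> \<kappa> z))\<^sup>2) \<le> C * (K * N)\<^sup>2 * \<Lambda> powr (1 - \<sigma>)"
          using intr by linarith
      qed
    qed
  qed
qed

lemma measurable_packet [measurable]:
  assumes [measurable]: "f \<in> borel_measurable M" "g \<in> borel_measurable M"
  shows "(\<lambda>w. packet x u \<Lambda> (f w) (g w)) \<in> borel_measurable M"
proof -
  have "(\<lambda>w. LINT l|lborel. (if f w \<le> l \<and> l \<le> 2 * \<Lambda> then wave x u \<Lambda> (g w) l else 0)) \<in> borel_measurable M"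
    by measurable
  also have "(\<lambda>w. LINT l|lborel. (if f w \<le> l \<and> l \<le> 2 * \<Lambda> then wave x u \<Lambda> (g w) l else 0)) = (\<lambda>w. packet x u \<Lambda> (f w) (g w))"
    by (intro ext, unfold packet_def, intro Bochner_Integration.integral_cong refl) (auto simp: indicator_def)
  finally show ?thesis .
qed

lemma measurable_packet_sum [measurable]:
  assumes [measurable]: "f \<in> borel_measurable M" "g \<in> borel_measurable M"
  shows "(\<lambda>y. packet_sum X U w \<Lambda> (f y) (g y)) \<in> borel_measurable M"
  unfolding packet_sum_def by measurable

text \<open>Integration by parts against the tail \<open>F \<kappa>\<close>, which vanishes at the
  upper end. In the application \<eta> depends on a point \<open>y\<close> of \<open>E\<close> and
  on the space variable \<open>z\<close> together. Trading \<open>cis (l * \<eta>)\<close> for its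
  derivative leaves moduli of tails that do not involve \<eta>, and this is what separates the two
  weights before Cauchy-Schwarz.\<close>

lemma abel_summation_bound:
  fixes h :: "real \<Rightarrow> complex" and \<eta> L a b :: real
  assumes ab: "0 \<le> a" "a \<le> b" "b \<le> L" and L: "L > 0" and h: "continuous_on {a..b} h"
  shows "norm (integral {a..b} (\<lambda>l. of_real (1 - l / L) * cis (l * \<eta>) * h l))
     \<le> norm (integral {a..b} h) + (1 / L + \<bar>\<eta>\<bar>) * integral {a..b} (\<lambda>\<kappa>. norm (integral {\<kappa>..b} h))"
proof -
  define F where "F = (\<lambda>\<kappa>. integral {\<kappa>..b} h)"
  define g where "g = (\<lambda>l. of_real (1 - l / L) * cis (l * \<eta>))"
  define g' where "g' = (\<lambda>l. (of_real (- 1 / L) + of_real (1 - l / L) * (\<i> * of_real \<eta>)) * cis (l * \<eta>))"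
  have F': "(F has_vector_derivative - h t) (at t within {a..b})" if "t \<in> {a..b}" for t
    unfolding F_def by (rule integral_has_vector_derivative'[OF h that])
  have Fc: "continuous_on {a..b} F"
    by (rule continuous_on_vector_derivative[OF F'])
  have g'd: "(g has_vector_derivative g' t) (at t within {a..b})" for t
  proof -
    have "((\<lambda>z. (1 - c * z) * exp (\<i> * (z * of_real \<eta>))) has_field_derivative
      (- c + (1 - c * of_real t) * (\<i> * of_real \<eta>)) * exp (\<i> * (of_real t * of_real \<eta>))) (at (of_real t))" for c
      by (auto intro!: derivative_eq_intros simp: algebra_simps)
    from has_vector_derivative_real_field[OF this[of "of_real (1 / L)"]]
    show ?thesis by (simp add: g_def g'_def cis_conv_exp)
  qed
  have gc: "continuous_on {a..b} g" and g'c: "continuous_on {a..b} g'"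
    unfolding g_def g'_def using L by (auto intro!: continuous_intros)
  have "((\<lambda>t. g t * (- h t) + g' t * F t) has_integral (g b * F b - g a * F a)) {a..b}"
    by (rule fundamental_theorem_of_calculus[OF ab(2)]) (intro has_vector_derivative_mult g'd F')
  then have i1: "integral {a..b} (\<lambda>t. g t * (- h t) + g' t * F t) = - g a * F a"
    by (simp add: integral_unique F_def)
  have i2: "integral {a..b} (\<lambda>t. g' t * F t) = integral {a..b} (\<lambda>t. g t * (- h t) + g' t * F t) + integral {a..b} (\<lambda>t. g t * h t)"
    by (subst Henstock_Kurzweil_Integration.integral_add[symmetric])
      (auto intro!: integrable_continuous_interval continuous_intros gc g'c h Fc)
  have eq: "integral {a..b} (\<lambda>t. g t * h t) = g a * F a + integral {a..b} (\<lambda>t. g' t * F t)"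
    using i1 i2 by simp
  have range: "0 \<le> 1 - t / L" "1 - t / L \<le> 1" if "t \<in> {a..b}" for t
    using that ab L by (auto simp: field_simps)
  have "norm (g a * F a) \<le> 1 * norm (F a)"
  proof -
    have "norm (g a) = \<bar>1 - a / L\<bar>" by (simp only: g_def norm_mult norm_of_real norm_cis mult_1_right)
    also have "\<dots> \<le> 1" using range[of a] ab by auto
    finally show ?thesis unfolding norm_mult by (rule mult_right_mono) simp
  qed
  moreover have "norm (integral {a..b} (\<lambda>t. g' t * F t)) \<le> integral {a..b} (\<lambda>t. (1 / L + \<bar>\<eta>\<bar>) * norm (F t))"
  proof (rule Henstock_Kurzweil_Integration.integral_norm_bound_integral)
    fix t assume t: "t \<in> {a..b}"
    have "norm (g' t) = norm (of_real (- 1 / L) + of_real (1 - t / L) * (\<i> * of_real \<eta>))"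
      unfolding g'_def by (subst norm_mult) (simp only: norm_cis mult_1_right)
    also have "\<dots> \<le> norm (of_real (- 1 / L) :: complex) + norm (of_real (1 - t / L) * (\<i> * of_real \<eta>))"
      by (rule norm_triangle_ineq)
    also have "\<dots> \<le> 1 / L + 1 * \<bar>\<eta>\<bar>"
    proof (rule add_mono)
      show "norm (of_real (- 1 / L) :: complex) \<le> 1 / L" unfolding norm_of_real using L by simp
      have "norm (of_real (1 - t / L) * (\<i> * of_real \<eta>)) = \<bar>1 - t / L\<bar> * \<bar>\<eta>\<bar>"
        by (simp only: norm_mult norm_of_real norm_ii mult_1_left)
      also have "\<dots> \<le> 1 * \<bar>\<eta>\<bar>" using range[OF t] by (intro mult_right_mono) auto
      finally show "norm (of_real (1 - t / L) * (\<i> * of_real \<eta>)) \<le> 1 * \<bar>\<eta>\<bar>" .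
    qed
    finally show "norm (g' t * F t) \<le> (1 / L + \<bar>\<eta>\<bar>) * norm (F t)"
      unfolding norm_mult by (intro mult_right_mono) auto
  qed (auto intro!: integrable_continuous_interval continuous_intros g'c Fc)
  ultimately show ?thesis
    unfolding eq[unfolded g_def] using norm_triangle_ineq[of "g a * F a" "integral {a..b} (\<lambda>t. g' t * F t)"]
    by (simp add: F_def g_def)
qed

text \<open>One factor of the square is bounded by its supremum, of order
  \<open>K * \<Lambda> powr (- \<beta>)\<close>; the other is integrated, giving the total mass
  times the volume \<open>\<Lambda> powr (- d)\<close> of a bump. The factor
  \<open>exp (|z|^2 / 2)\<close> is there to undo the weight \<open>exp (- |z|^2)\<close> of the
  packet energy.\<close>

lemma gaussian_sum_L2:
  fixes R \<beta> :: real
  assumes R: "R \<ge> 1" and \<beta>: "\<beta> \<ge> 0"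
  obtains C where "C > 0"
    "\<And>(Y::'a::euclidean_space set) m K \<delta> \<Lambda>. frostman \<beta> K \<delta> Y m \<Longrightarrow> Y \<subseteq> cball 0 R \<Longrightarrow> K \<ge> 0 \<Longrightarrow> \<Lambda> \<ge> 4 \<Longrightarrow> \<delta> * \<Lambda> \<le> 1 \<Longrightarrow>
      integrable lborel (\<lambda>z. ((\<Sum>y\<in>Y. m y * exp (- (\<Lambda> * dist z y)\<^sup>2 / 2)) * exp ((norm z)\<^sup>2 / 2))\<^sup>2) \<and>
      (LINT z|lborel. ((\<Sum>y\<in>Y. m y * exp (- (\<Lambda> * dist z y)\<^sup>2 / 2)) * exp ((norm z)\<^sup>2 / 2))\<^sup>2)
        \<le> C * K\<^sup>2 * \<Lambda> powr (- (\<beta> + real DIM('a)))"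
proof (rule frostman_gaussian[OF \<beta>])
  fix C0 :: real
  assume C0: "C0 > 0" and sup: "\<And>(X::'a set) w K \<delta> \<Lambda> z. frostman \<beta> K \<delta> X w \<Longrightarrow> K \<ge> 0 \<Longrightarrow> \<Lambda> > 0 \<Longrightarrow> \<delta> * \<Lambda> \<le> 1 \<Longrightarrow>
      (\<Sum>x\<in>X. w x * exp (- (\<Lambda> * dist z x)\<^sup>2 / 2)) \<le> C0 * K * \<Lambda> powr (- \<beta>)"
  define n where "n = DIM('a)"
  define C where "C = C0 * exp (2 * R\<^sup>2) * R powr \<beta> * sqrt (4 * pi) ^ n"
  show thesis
  proof (rule that[of C])
    show "C > 0" using C0 R by (simp add: C_def)
    fix Y :: "'a set" and m K \<delta> \<Lambda>
    assume fr: "frostman \<beta> K \<delta> Y m" and Y: "Y \<subseteq> cball 0 R" and K: "K \<ge> 0" and \<Lambda>: "\<Lambda> \<ge> 4" "\<delta> * \<Lambda> \<le> 1"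
    have m: "\<And>y. y \<in> Y \<Longrightarrow> m y \<ge> 0" and fin: "finite Y" using fr by (auto simp: frostman_def)
    have \<delta>: "\<delta> \<le> R"
    proof (cases "\<delta> \<le> 0")
      case False
      then have "\<delta> * 1 \<le> \<delta> * \<Lambda>" using \<Lambda> by (intro mult_left_mono) auto
      then show ?thesis using \<Lambda> R by simp
    qed (use R in simp)
    let ?M = "\<lambda>z. \<Sum>y\<in>Y. m y * exp (- (\<Lambda> * dist z y)\<^sup>2 / 2)"
    \<comment> \<open>Half of the decay rate \<open>\<Lambda>\<^sup>2 / 2\<close>. The other half
      absorbs \<open>exp (|z|^2)\<close>, as \<open>|z|^2 \<le> 2 |z - y|^2 + 2 R^2\<close> and
      \<open>\<Lambda> \<ge> 4\<close> gives \<open>2 \<le> a\<close>.\<close>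
    define a where "a = \<Lambda>\<^sup>2 / 4"
    have a: "a > 0" using \<Lambda> by (simp add: a_def)
    define S where "S = C0 * K * \<Lambda> powr (- \<beta>)"
    define D where "D = (\<lambda>z. S * exp (2 * R\<^sup>2) * (\<Sum>y\<in>Y. m y * exp (- a * (dist z y)\<^sup>2)))"
    have S0: "S \<ge> 0" using C0 K by (simp add: S_def)
    have M0: "?M z \<ge> 0" for z using m by (intro sum_nonneg) auto
    have MS: "?M z \<le> S" for z unfolding S_def by (rule sup[OF fr K]) (use \<Lambda> in auto)
    have Dint: "integrable lborel D"
      unfolding D_def by (intro integrable_mult_right Bochner_Integration.integrable_sum integrable_gaussian_euclidean(1)[OF a])
    have pt: "(?M z * exp ((norm z)\<^sup>2 / 2))\<^sup>2 \<le> D z" for z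
    proof -
      have "(?M z * exp ((norm z)\<^sup>2 / 2))\<^sup>2 = ?M z * (?M z * exp ((norm z)\<^sup>2))"
        by (simp add: power2_eq_square mult_ac flip: exp_add)
      also have "\<dots> \<le> S * (?M z * exp ((norm z)\<^sup>2))" using MS M0 by (intro mult_right_mono) auto
      also have "?M z * exp ((norm z)\<^sup>2) \<le> exp (2 * R\<^sup>2) * (\<Sum>y\<in>Y. m y * exp (- a * (dist z y)\<^sup>2))"
        unfolding sum_distrib_right sum_distrib_left
      proof (rule sum_mono)
        fix y assume y: "y \<in> Y"
        have "norm z \<le> dist z y + R" using y Y norm_triangle_sub[of z y] by (auto simp: dist_norm)
        then have "(norm z)\<^sup>2 \<le> (dist z y + R)\<^sup>2" by (intro power_mono) auto
        also have "\<dots> \<le> 2 * (dist z y)\<^sup>2 + 2 * R\<^sup>2"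
          using zero_le_power2[of "dist z y - R"] by (simp add: power2_eq_square algebra_simps)
        finally have "(norm z)\<^sup>2 \<le> 2 * (dist z y)\<^sup>2 + 2 * R\<^sup>2" .
        moreover have "(\<Lambda> * dist z y)\<^sup>2 / 2 = 2 * a * (dist z y)\<^sup>2" by (simp add: a_def power_mult_distrib)
        moreover have "2 * (dist z y)\<^sup>2 \<le> a * (dist z y)\<^sup>2"
        proof (rule mult_right_mono)
          have "(4::real)\<^sup>2 \<le> \<Lambda>\<^sup>2" using \<Lambda> by (intro power_mono) auto
          then show "2 \<le> a" by (simp add: a_def)
        qed simp
        ultimately have "- (\<Lambda> * dist z y)\<^sup>2 / 2 + (norm z)\<^sup>2 \<le> 2 * R\<^sup>2 + - a * (dist z y)\<^sup>2" by simp
        then have "exp (- (\<Lambda> * dist z y)\<^sup>2 / 2) * exp ((norm z)\<^sup>2) \<le> exp (2 * R\<^sup>2) * exp (- a * (dist z y)\<^sup>2)"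
          by (simp flip: exp_add)
        then have "m y * (exp (- (\<Lambda> * dist z y)\<^sup>2 / 2) * exp ((norm z)\<^sup>2)) \<le> m y * (exp (2 * R\<^sup>2) * exp (- a * (dist z y)\<^sup>2))"
          using m[OF y] by (rule mult_left_mono)
        then show "m y * exp (- (\<Lambda> * dist z y)\<^sup>2 / 2) * exp ((norm z)\<^sup>2) \<le> exp (2 * R\<^sup>2) * (m y * exp (- a * (dist z y)\<^sup>2))"
          by (simp only: mult_ac)
      qed
      finally show ?thesis using S0 by (simp add: D_def mult_left_mono mult.assoc)
    qed
    have int: "integrable lborel (\<lambda>z. (?M z * exp ((norm z)\<^sup>2 / 2))\<^sup>2)"
    proof (rule Bochner_Integration.integrable_bound[OF Dint])
      show "AE z in lborel. norm ((?M z * exp ((norm z)\<^sup>2 / 2))\<^sup>2) \<le> norm (D z)"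
        using order_trans[OF pt abs_ge_self] by (intro AE_I2) simp
    qed measurable
    have "(LINT z|lborel. (?M z * exp ((norm z)\<^sup>2 / 2))\<^sup>2) \<le> integral\<^sup>L lborel D"
      by (rule integral_mono[OF int Dint pt])
    also have "\<dots> = S * exp (2 * R\<^sup>2) * (\<Sum>y\<in>Y. m y * (LINT z|lborel. exp (- a * (dist z y)\<^sup>2)))"
      unfolding D_def
      by (simp only: integral_mult_right_zero)
        (subst Bochner_Integration.integral_sum, intro integrable_mult_right integrable_gaussian_euclidean(1)[OF a],
          simp only: integral_mult_right_zero)
    also have "\<dots> = S * exp (2 * R\<^sup>2) * (sum m Y * sqrt (pi / a) ^ n)"
      unfolding integrable_gaussian_euclidean(2)[OF a] n_def by (simp add: sum_distrib_right)
    also have "\<dots> \<le> S * exp (2 * R\<^sup>2) * ((K * R powr \<beta>) * sqrt (pi / a) ^ n)"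
      using S0 a by (intro mult_left_mono mult_right_mono frostman_mass[OF fr Y \<delta>]) auto
    also have "sqrt (pi / a) = sqrt (4 * pi) / \<Lambda>" using \<Lambda> by (simp add: a_def real_sqrt_divide real_sqrt_mult)
    also have "S * exp (2 * R\<^sup>2) * ((K * R powr \<beta>) * (sqrt (4 * pi) / \<Lambda>) ^ n) = C * K\<^sup>2 * (\<Lambda> powr (- \<beta>) * (1 / \<Lambda> ^ n))"
      by (simp add: S_def C_def power_divide power2_eq_square)
    also have "1 / \<Lambda> ^ n = \<Lambda> powr (- real n)" using \<Lambda> by (simp add: powr_minus_divide powr_realpow)
    also have "\<Lambda> powr (- \<beta>) * \<Lambda> powr (- real n) = \<Lambda> powr (- (\<beta> + real DIM('a)))" by (simp add: n_def flip: powr_add)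
    finally show "integrable lborel (\<lambda>z. (?M z * exp ((norm z)\<^sup>2 / 2))\<^sup>2) \<and>
      (LINT z|lborel. (?M z * exp ((norm z)\<^sup>2 / 2))\<^sup>2) \<le> C * K\<^sup>2 * \<Lambda> powr (- (\<beta> + real DIM('a)))"
      using int by blast
  qed
qed

lemma integrable_indicator_Icc: "integrable lborel (indicator {a..b::real} :: real \<Rightarrow> real)"
  by (rule integrable_real_indicator) (auto simp: emeasure_lborel_Icc_eq)

lemma norm_packet_le:
  assumes "\<Lambda> \<ge> 1" "0 \<le> \<kappa>"
  shows "norm (packet x u \<Lambda> \<kappa> z) \<le> 2 * \<Lambda> * exp (4 * (norm x)\<^sup>2)"
proof -
  have "norm (packet x u \<Lambda> \<kappa> z) \<le> (LINT l|lborel. exp (4 * (norm x)\<^sup>2) * indicator {0..2 * \<Lambda>} l)"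
    unfolding packet_def
  proof (rule Bochner_Integration.integral_norm_bound_integral[OF integrable_wave])
    fix l :: real
    show "norm (indicator {\<kappa>..2 * \<Lambda>} l *\<^sub>R wave x u \<Lambda> z l) \<le> exp (4 * (norm x)\<^sup>2) * indicator {0..2 * \<Lambda>} l"
    proof (cases "l \<in> {\<kappa>..2 * \<Lambda>}")
      case True
      then have "l\<^sup>2 \<le> (2 * \<Lambda>)\<^sup>2" using assms by (intro power_mono) auto
      then have "l\<^sup>2 / \<Lambda>\<^sup>2 \<le> 4" using assms by (simp add: field_simps)
      then have "l\<^sup>2 / \<Lambda>\<^sup>2 * (norm x)\<^sup>2 \<le> 4 * (norm x)\<^sup>2" by (intro mult_right_mono) auto
      then show ?thesis using True assms by (simp add: norm_wave)
    qed simp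
  qed (intro integrable_mult_right integrable_indicator_Icc)
  also have "\<dots> = 2 * \<Lambda> * exp (4 * (norm x)\<^sup>2)" using assms by simp
  finally show ?thesis .
qed

lemma packet_sum_eq_integral:
  "packet_sum X U w \<Lambda> \<kappa> z = integral {\<kappa>..2 * \<Lambda>} (\<lambda>l. \<Sum>x\<in>X. \<Sum>u\<in>U x. of_real (w x) * wave x u \<Lambda> z l)"
  and continuous_on_wave: "continuous_on S (wave x u \<Lambda> z)"
proof -
  show cont: "continuous_on S (wave x u \<Lambda> z)" for S and x :: 'a and u
  proof -
    define c where "c = (norm x)\<^sup>2 / \<Lambda>\<^sup>2"
    have "wave x u \<Lambda> z = (\<lambda>l. of_real (exp (l\<^sup>2 * c)) * cis (l * ((dist z x)\<^sup>2 - u)))"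
      by (simp add: wave_def c_def fun_eq_iff)
    then show ?thesis by (auto intro!: continuous_intros)
  qed
  have p: "packet x u \<Lambda> \<kappa> z = integral {\<kappa>..2 * \<Lambda>} (wave x u \<Lambda> z)" for x :: 'a and u
    using set_borel_integral_eq_integral(2)[OF borel_integrable_atLeastAtMost'[OF cont]]
    by (simp add: packet_def set_lebesgue_integral_def)
  have i: "(\<lambda>l. of_real (w x) * wave x u \<Lambda> z l) integrable_on {\<kappa>..2 * \<Lambda>}" for x u
    by (intro integrable_continuous_interval continuous_on_mult continuous_on_const cont)
  show "packet_sum X U w \<Lambda> \<kappa> z = integral {\<kappa>..2 * \<Lambda>} (\<lambda>l. \<Sum>x\<in>X. \<Sum>u\<in>U x. of_real (w x) * wave x u \<Lambda> z l)"
  proof (cases "finite X")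
    case True
    have "integral {\<kappa>..2 * \<Lambda>} (\<lambda>l. \<Sum>u\<in>U x. of_real (w x) * wave x u \<Lambda> z l) = (\<Sum>u\<in>U x. of_real (w x) * packet x u \<Lambda> \<kappa> z)
       \<and> (\<lambda>l. \<Sum>u\<in>U x. of_real (w x) * wave x u \<Lambda> z l) integrable_on {\<kappa>..2 * \<Lambda>}" for x
    proof (cases "finite (U x)")
      case fin: True
      show ?thesis
        by (subst Henstock_Kurzweil_Integration.integral_sum[OF fin i]) (auto simp: p intro!: Henstock_Kurzweil_Integration.integrable_sum fin i)
    qed (simp add: integrable_0)
    then show ?thesis
      unfolding packet_sum_def by (subst Henstock_Kurzweil_Integration.integral_sum[OF True]) auto
  qed (simp add: packet_sum_def)
qed

text \<open>The reproducing identity integrated over the shell: an exponential sum evaluated at the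
  point \<open>y\<close> becomes a Gaussian average over space. This makes L2 bounds applicable,
  although the weight on \<open>E\<close> is discrete.\<close>

lemma packet_sum_transfer:
  fixes X :: "'a::euclidean_space set" and U :: "'a \<Rightarrow> real set" and w :: "'a \<Rightarrow> real" and y :: 'a
  assumes \<Lambda>: "\<Lambda> \<ge> 1" and L: "2 * \<Lambda> \<le> L"
  defines "Q \<equiv> \<lambda>z. integral {\<Lambda>..2 * \<Lambda>} (\<lambda>l. of_real (1 - l / L) * cis (l * ((norm y)\<^sup>2 - (norm z)\<^sup>2)) *
      (\<Sum>x\<in>X. \<Sum>u\<in>U x. of_real (w x) * wave x u \<Lambda> z l))"
  shows "integrable lborel (\<lambda>z. of_real (exp (- (\<Lambda> * dist z y)\<^sup>2)) * Q z)"
    and "(LINT z|lborel. of_real (exp (- (\<Lambda> * dist z y)\<^sup>2)) * Q z) =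
      of_real ((sqrt pi / \<Lambda>) ^ DIM('a)) *
      integral {\<Lambda>..2 * \<Lambda>} (\<lambda>l. of_real (1 - l / L) * (\<Sum>x\<in>X. \<Sum>u\<in>U x. of_real (w x) * cis (l * ((dist y x)\<^sup>2 - u))))"
proof -
  define e where "e = (\<lambda>z. complex_of_real (exp (- (\<Lambda> * dist z y)\<^sup>2)))"
  define \<eta> where "\<eta> = (\<lambda>z::'a. (norm y)\<^sup>2 - (norm z)\<^sup>2)"
  define h where "h = (\<lambda>z l. \<Sum>x\<in>X. \<Sum>u\<in>U x. of_real (w x) * wave x u \<Lambda> z l)"
  define T where "T = (\<lambda>l. \<Sum>x\<in>X. \<Sum>u\<in>U x. of_real (w x) * cis (l * ((dist y x)\<^sup>2 - u)))"
  define c where "c = complex_of_real ((sqrt pi / \<Lambda>) ^ DIM('a))"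
  define g where "g = (\<lambda>l. complex_of_real (1 - l / L))"
  let ?I = "\<lambda>l. indicator {\<Lambda>..2 * \<Lambda>} l :: real"
  define P where "P = (\<lambda>(l, z). ?I l *\<^sub>R (g l * (e z * (cis (l * \<eta> z) * h z l))))"
  have Lp: "L > 0" using \<Lambda> L by simp
  have hc: "continuous_on S (h z)" for S z
    unfolding h_def by (intro continuous_on_sum continuous_on_mult continuous_on_const continuous_on_wave)
  have gc: "continuous_on S g" for S unfolding g_def using Lp by (auto intro!: continuous_intros)
  have Tc: "continuous_on S T" for S unfolding T_def by (auto intro!: continuous_intros)
  have [measurable]: "cis \<in> borel_measurable borel" by (intro borel_measurable_continuous_onI continuous_intros)
  have Pm: "P \<in> borel_measurable (lborel \<Otimes>\<^sub>M lborel)"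
    unfolding P_def g_def e_def \<eta>_def h_def by measurable
  define H where "H = (\<Sum>x\<in>X. \<Sum>u\<in>U x. \<bar>w x\<bar> * exp (4 * (norm x)\<^sup>2))"
  have hH: "norm (h z l) \<le> H" if "l \<in> {\<Lambda>..2 * \<Lambda>}" for z l
  proof -
    have "l\<^sup>2 \<le> (2 * \<Lambda>)\<^sup>2" using that \<Lambda> by (intro power_mono) auto
    then have "l\<^sup>2 / \<Lambda>\<^sup>2 \<le> 4" using \<Lambda> by (simp add: field_simps)
    then have n: "norm (wave x u \<Lambda> z l) \<le> exp (4 * (norm x)\<^sup>2)" for x :: 'a and u
      using mult_right_mono[of "l\<^sup>2 / \<Lambda>\<^sup>2" 4 "(norm x)\<^sup>2"] by (simp add: norm_wave)
    show ?thesis unfolding h_def H_def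
      by (intro order_trans[OF norm_sum] sum_mono) (auto simp: norm_mult intro!: mult_left_mono n)
  qed
  have H0: "H \<ge> 0" unfolding H_def by (intro sum_nonneg) auto
  have ge: "integrable lborel (\<lambda>z. H * exp (- (\<Lambda>\<^sup>2) * (dist z y)\<^sup>2))"
    using \<Lambda> by (intro integrable_mult_right integrable_gaussian_euclidean(1)) auto
  have Pint: "integrable (lborel \<Otimes>\<^sub>M lborel) P"
  proof (rule Bochner_Integration.integrable_bound[OF integrable_pair_mult[OF _ ge, of "indicator {\<Lambda>..2 * \<Lambda>}"] Pm])
    show "integrable lborel (indicator {\<Lambda>..2 * \<Lambda>} :: real \<Rightarrow> real)" by (rule integrable_indicator_Icc)
    show "AE p in lborel \<Otimes>\<^sub>M lborel. norm (P p) \<le> norm (case p of (l, z) \<Rightarrow> ?I l * (H * exp (- (\<Lambda>\<^sup>2) * (dist z y)\<^sup>2)))"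
    proof (intro AE_I2, clarify)
      fix l z
      show "norm (P (l, z)) \<le> norm (?I l * (H * exp (- (\<Lambda>\<^sup>2) * (dist z y)\<^sup>2)))"
      proof (cases "l \<in> {\<Lambda>..2 * \<Lambda>}")
        case True
        have "norm (g l) = \<bar>1 - l / L\<bar>" unfolding g_def by (rule norm_of_real)
        also have "\<dots> \<le> 1" using True \<Lambda> L Lp by (auto simp: abs_le_iff field_simps)
        finally have "norm (g l) * (exp (- (\<Lambda> * dist z y)\<^sup>2) * norm (h z l)) \<le> 1 * (exp (- (\<Lambda> * dist z y)\<^sup>2) * H)"
          using hH[OF True] by (intro mult_mono) auto
        then show ?thesis using True H0 by (simp add: P_def e_def norm_mult power_mult_distrib mult.commute)
      qed (simp add: P_def)
    qed
  qed
  have inner_l: "(LINT l|lborel. P (l, z)) = e z * Q z" for z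
  proof -
    define f where "f = (\<lambda>l. g l * cis (l * \<eta> z) * h z l)"
    have fc: "continuous_on {\<Lambda>..2 * \<Lambda>} f" unfolding f_def by (intro continuous_on_mult gc hc continuous_intros)
    have "(LINT l|lborel. P (l, z)) = (LINT l|lborel. e z * (?I l *\<^sub>R f l))"
      by (intro Bochner_Integration.integral_cong refl) (simp add: P_def f_def scaleR_conv_of_real mult_ac)
    also have "\<dots> = e z * (LINT l|lborel. ?I l *\<^sub>R f l)" by (rule integral_mult_right_zero)
    also have "(LINT l|lborel. ?I l *\<^sub>R f l) = integral {\<Lambda>..2 * \<Lambda>} f"
      using set_borel_integral_eq_integral(2)[OF borel_integrable_atLeastAtMost'[OF fc]] by (simp add: set_lebesgue_integral_def)
    finally show ?thesis by (simp add: Q_def f_def g_def h_def \<eta>_def)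
  qed
  have rep: "integrable lborel (\<lambda>z. e z * (cis (l * \<eta> z) * wave x u \<Lambda> z l))"
    "(LINT z|lborel. e z * (cis (l * \<eta> z) * wave x u \<Lambda> z l)) = c * cis (l * ((dist y x)\<^sup>2 - u))" for l x u
    unfolding e_def \<eta>_def c_def using wave_reproducing[of \<Lambda> y l x u] \<Lambda> by auto
  have inner_z: "(LINT z|lborel. P (l, z)) = c * (?I l *\<^sub>R (g l * T l))" for l
  proof -
    have "(LINT z|lborel. P (l, z)) = (LINT z|lborel. of_real (?I l) * g l * (\<Sum>x\<in>X. \<Sum>u\<in>U x. of_real (w x) * (e z * (cis (l * \<eta> z) * wave x u \<Lambda> z l))))"
      by (intro Bochner_Integration.integral_cong refl) (simp add: P_def h_def scaleR_conv_of_real sum_distrib_left mult_ac)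
    also have "\<dots> = of_real (?I l) * g l * (LINT z|lborel. (\<Sum>x\<in>X. \<Sum>u\<in>U x. of_real (w x) * (e z * (cis (l * \<eta> z) * wave x u \<Lambda> z l))))"
      by (rule integral_mult_right_zero)
    also have "(LINT z|lborel. (\<Sum>x\<in>X. \<Sum>u\<in>U x. of_real (w x) * (e z * (cis (l * \<eta> z) * wave x u \<Lambda> z l)))) = (\<Sum>x\<in>X. LINT z|lborel. (\<Sum>u\<in>U x. of_real (w x) * (e z * (cis (l * \<eta> z) * wave x u \<Lambda> z l))))"
      by (rule Bochner_Integration.integral_sum) (intro Bochner_Integration.integrable_sum integrable_mult_right rep(1))
    also have "\<dots> = (\<Sum>x\<in>X. \<Sum>u\<in>U x. LINT z|lborel. of_real (w x) * (e z * (cis (l * \<eta> z) * wave x u \<Lambda> z l)))"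
      by (intro sum.cong refl Bochner_Integration.integral_sum integrable_mult_right rep(1))
    also have "\<dots> = c * T l"
      unfolding T_def sum_distrib_left integral_mult_right_zero rep(2) by (simp only: mult.left_commute)
    finally show ?thesis by (simp add: scaleR_conv_of_real mult_ac)
  qed
  show "integrable lborel (\<lambda>z. of_real (exp (- (\<Lambda> * dist z y)\<^sup>2)) * Q z)"
    using lborel_pair.integrable_snd[of "\<lambda>l z. P (l, z)"] Pint inner_l by (simp add: e_def case_prod_beta')
  have "(LINT z|lborel. e z * Q z) = (LINT l|lborel. LINT z|lborel. P (l, z))"
    using lborel_pair.Fubini_integral[of "\<lambda>l z. P (l, z)"] Pint inner_l by (simp add: case_prod_beta')
  also have "\<dots> = c * (LINT l|lborel. ?I l *\<^sub>R (g l * T l))" unfolding inner_z by (rule integral_mult_right_zero)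
  also have "(LINT l|lborel. ?I l *\<^sub>R (g l * T l)) = integral {\<Lambda>..2 * \<Lambda>} (\<lambda>l. g l * T l)"
    using set_borel_integral_eq_integral(2)[OF borel_integrable_atLeastAtMost'[OF continuous_on_mult[OF gc Tc]]]
    by (simp add: set_lebesgue_integral_def)
  finally show "(LINT z|lborel. of_real (exp (- (\<Lambda> * dist z y)\<^sup>2)) * Q z) =
      of_real ((sqrt pi / \<Lambda>) ^ DIM('a)) *
      integral {\<Lambda>..2 * \<Lambda>} (\<lambda>l. of_real (1 - l / L) * (\<Sum>x\<in>X. \<Sum>u\<in>U x. of_real (w x) * cis (l * ((dist y x)\<^sup>2 - u))))"
    by (simp add: e_def c_def g_def T_def)
qed

text \<open>The two L2 norms are of order \<open>\<Lambda> powr (- (\<beta> + d) / 2)\<close> and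
  \<open>\<Lambda> powr ((1 - \<sigma>) / 2)\<close>. Division by the mass
  \<open>(sqrt pi / \<Lambda>) ^ d\<close> of the averaging Gaussian adds \<open>d\<close> to the
  exponent.\<close>

lemma frequency_shell_bound:
  fixes R s \<sigma> \<beta> :: real
  assumes R: "R \<ge> 1" and \<sigma>: "0 \<le> \<sigma>" "\<sigma> < s" "2 * \<sigma> < real DIM('a) - 1" and d: "DIM('a) \<ge> 3" and \<beta>: "\<beta> \<ge> 0"
  obtains C where "C > 0"
    "\<And>(X::'a::euclidean_space set) U w Y m K N L \<Lambda>. frostman s K (1 / L) X w \<Longrightarrow> frostman \<beta> K (1 / L) Y m \<Longrightarrow>
      X \<subseteq> cball 0 R \<Longrightarrow> Y \<subseteq> cball 0 R \<Longrightarrow> K > 0 \<Longrightarrow> N > 0 \<Longrightarrow>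
      (\<And>x. x \<in> X \<Longrightarrow> finite (U x) \<and> real (card (U x)) \<le> N) \<Longrightarrow> \<Lambda> \<ge> 4 \<Longrightarrow> 2 * \<Lambda> \<le> L \<Longrightarrow>
      norm (integral {\<Lambda>..2 * \<Lambda>} (\<lambda>l. of_real (1 - l / L) *
        (\<Sum>y\<in>Y. of_real (m y) * (\<Sum>x\<in>X. \<Sum>u\<in>U x. of_real (w x) * cis (l * ((dist y x)\<^sup>2 - u))))))
      \<le> C * K\<^sup>2 * N * \<Lambda> powr ((real DIM('a) + 1 - \<beta> - \<sigma>) / 2)"
proof (rule packet_sum_energy[OF R \<sigma> d], rule gaussian_sum_L2[OF R \<beta>, where 'a = 'a])
  fix C1 C2 :: real
  assume C1: "C1 > 0" and energy: "\<And>(X::'a set) U w K \<delta> N \<Lambda> \<kappa>. frostman s K \<delta> X w \<Longrightarrow> X \<subseteq> cball 0 R \<Longrightarrow> K \<ge> 0 \<Longrightarrow> \<delta> \<le> R \<Longrightarrow>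
      (\<And>x. x \<in> X \<Longrightarrow> finite (U x) \<and> real (card (U x)) \<le> N) \<Longrightarrow> \<Lambda> \<ge> 1 \<Longrightarrow> \<Lambda> \<le> \<kappa> \<Longrightarrow> \<delta> * \<Lambda> \<le> 1 \<Longrightarrow>
      integrable lborel (\<lambda>z. exp (- (norm z)\<^sup>2) * (norm (packet_sum X U w \<Lambda> \<kappa> z))\<^sup>2) \<and>
      (LINT z|lborel. exp (- (norm z)\<^sup>2) * (norm (packet_sum X U w \<Lambda> \<kappa> z))\<^sup>2) \<le> C1 * (K * N)\<^sup>2 * \<Lambda> powr (1 - \<sigma>)"
    and C2: "C2 > 0" and gauss: "\<And>(Y::'a set) m K \<delta> \<Lambda>. frostman \<beta> K \<delta> Y m \<Longrightarrow> Y \<subseteq> cball 0 R \<Longrightarrow> K \<ge> 0 \<Longrightarrow> \<Lambda> \<ge> 4 \<Longrightarrow> \<delta> * \<Lambda> \<le> 1 \<Longrightarrow>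
      integrable lborel (\<lambda>z. ((\<Sum>y\<in>Y. m y * exp (- (\<Lambda> * dist z y)\<^sup>2 / 2)) * exp ((norm z)\<^sup>2 / 2))\<^sup>2) \<and>
      (LINT z|lborel. ((\<Sum>y\<in>Y. m y * exp (- (\<Lambda> * dist z y)\<^sup>2 / 2)) * exp ((norm z)\<^sup>2 / 2))\<^sup>2)
        \<le> C2 * K\<^sup>2 * \<Lambda> powr (- (\<beta> + real DIM('a)))"
  define n where "n = DIM('a)"
  \<comment> \<open>\<open>4 + 2 * R\<close> bounds the coefficients of the integration by parts
    after Gaussian damping; the factor \<open>2\<close> counts the boundary term and the averaged
    tails.\<close>
  define C where "C = (4 + 2 * R) * 2 * (sqrt C2 * sqrt C1) / sqrt pi ^ n"
  show thesis
  proof (rule that[of C])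
    show "C > 0" using C1 C2 R by (simp add: C_def)
    fix X :: "'a set" and U :: "'a \<Rightarrow> real set" and w :: "'a \<Rightarrow> real" and Y :: "'a set" and m :: "'a \<Rightarrow> real" and K N L \<Lambda> :: real
    assume frX: "frostman s K (1 / L) X w" and frY: "frostman \<beta> K (1 / L) Y m"
      and XR: "X \<subseteq> cball 0 R" and YR: "Y \<subseteq> cball 0 R" and K: "K > 0" and N: "N > 0"
      and U: "\<And>x. x \<in> X \<Longrightarrow> finite (U x) \<and> real (card (U x)) \<le> N" and \<Lambda>: "\<Lambda> \<ge> 4" and L: "2 * \<Lambda> \<le> L"
    have m: "\<And>y. y \<in> Y \<Longrightarrow> m y \<ge> 0" using frY by (auto simp: frostman_def)
    have Lp: "L > 0" using \<Lambda> L by simp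
    have L1: "1 / L \<le> R" using R \<Lambda> L Lp mult_mono[of 1 R 1 L] by (simp add: field_simps)
    have L2: "1 / L * \<Lambda> \<le> 1" using \<Lambda> L Lp by (simp add: field_simps)
    \<comment> \<open>Only half of the Gaussian exponent is kept in \<open>M\<close>; the other half
      pays for the growth of \<open>\<bar>\<eta>\<bar>\<close> away from \<open>y\<close>.\<close>
    define M where "M = (\<lambda>z. \<Sum>y\<in>Y. m y * exp (- (\<Lambda> * dist z y)\<^sup>2 / 2))"
    define \<Phi> where "\<Phi> = (\<lambda>\<kappa> z. norm (packet_sum X U w \<Lambda> \<kappa> z))"
    have M0: "M z \<ge> 0" for z unfolding M_def using m by (intro sum_nonneg) auto
    have [measurable]: "M \<in> borel_measurable borel" unfolding M_def by measurable
    have \<Phi>m [measurable]: "(\<lambda>p. \<Phi> (f p) (g p)) \<in> borel_measurable A"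
      if [measurable]: "f \<in> borel_measurable A" "g \<in> borel_measurable A" for f :: "'c \<Rightarrow> real" and g A
      unfolding \<Phi>_def by measurable
    define D where "D = sqrt (C2 * K\<^sup>2 * \<Lambda> powr (- (\<beta> + real n))) * sqrt (C1 * (K * N)\<^sup>2 * \<Lambda> powr (1 - \<sigma>))"
    have cs: "integrable lborel (\<lambda>z. M z * \<Phi> \<kappa> z)" "(LINT z|lborel. M z * \<Phi> \<kappa> z) \<le> D" if "\<Lambda> \<le> \<kappa>" for \<kappa>
    proof -
      have g2: "(exp (- (norm z)\<^sup>2 / 2) * \<Phi> \<kappa> z)\<^sup>2 = exp (- (norm z)\<^sup>2) * (norm (packet_sum X U w \<Lambda> \<kappa> z))\<^sup>2" for z
        by (simp add: \<Phi>_def power_mult_distrib flip: exp_of_nat_mult)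
      \<comment> \<open>Reciprocal weights are inserted so that each factor is square integrable;
        the packets alone do not decay in \<open>z\<close>.\<close>
      have prod: "(M z * exp ((norm z)\<^sup>2 / 2)) * (exp (- (norm z)\<^sup>2 / 2) * \<Phi> \<kappa> z) = M z * \<Phi> \<kappa> z" for z
        by (simp add: mult.assoc exp_minus)
      note gg = gauss[OF frY YR less_imp_le[OF K] \<Lambda> L2]
      note ee = energy[OF frX XR less_imp_le[OF K] L1 U _ that L2]
      have a: "0 < C2 * K\<^sup>2 * \<Lambda> powr (- (\<beta> + real n))" using C2 K \<Lambda> by auto
      have b: "0 < C1 * (K * N)\<^sup>2 * \<Lambda> powr (1 - \<sigma>)" using C1 K N \<Lambda> by auto
      have f: "integrable lborel (\<lambda>z. (M z * exp ((norm z)\<^sup>2 / 2))\<^sup>2)"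
        "(LINT z|lborel. (M z * exp ((norm z)\<^sup>2 / 2))\<^sup>2) \<le> C2 * K\<^sup>2 * \<Lambda> powr (- (\<beta> + real n))"
        using gg unfolding M_def n_def by blast+
      have g: "integrable lborel (\<lambda>z. (exp (- (norm z)\<^sup>2 / 2) * \<Phi> \<kappa> z)\<^sup>2)"
        "(LINT z|lborel. (exp (- (norm z)\<^sup>2 / 2) * \<Phi> \<kappa> z)\<^sup>2) \<le> C1 * (K * N)\<^sup>2 * \<Lambda> powr (1 - \<sigma>)"
        using ee \<Lambda> unfolding g2 by auto
      have "integrable lborel (\<lambda>z. (M z * exp ((norm z)\<^sup>2 / 2)) * (exp (- (norm z)\<^sup>2 / 2) * \<Phi> \<kappa> z))"
        by (rule integral_Cauchy_Schwarz_bound(1)[OF _ _ f a g b]) auto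
      moreover have "(LINT z|lborel. (M z * exp ((norm z)\<^sup>2 / 2)) * (exp (- (norm z)\<^sup>2 / 2) * \<Phi> \<kappa> z)) \<le> D"
        unfolding D_def by (rule integral_Cauchy_Schwarz_bound(2)[OF _ _ f a g b]) auto
      ultimately have "integrable lborel (\<lambda>z. (M z * exp ((norm z)\<^sup>2 / 2)) * (exp (- (norm z)\<^sup>2 / 2) * \<Phi> \<kappa> z)) \<and>
         (LINT z|lborel. (M z * exp ((norm z)\<^sup>2 / 2)) * (exp (- (norm z)\<^sup>2 / 2) * \<Phi> \<kappa> z)) \<le> D" ..
      then show "integrable lborel (\<lambda>z. M z * \<Phi> \<kappa> z)" "(LINT z|lborel. M z * \<Phi> \<kappa> z) \<le> D"
        unfolding prod by auto
    qed
    \<comment> \<open>The tails integrated over the shell. Each tail obeys the Cauchy-Schwarz bound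
      \<open>D\<close>, so \<open>V\<close> costs a factor \<Lambda>, which the coefficient
      \<open>1 / \<Lambda>\<close> compensates below.\<close>
    define V where "V = (\<lambda>z. LINT \<kappa>|lborel. indicator {\<Lambda>..2 * \<Lambda>} \<kappa> * \<Phi> \<kappa> z)"
    have MV: "integrable lborel (\<lambda>z. M z * V z)" "(LINT z|lborel. M z * V z) \<le> \<Lambda> * D"
    proof -
      define B where "B = (\<Sum>x\<in>X. \<Sum>u\<in>U x. \<bar>w x\<bar> * (2 * \<Lambda> * exp (4 * (norm x)\<^sup>2)))"
      have \<Phi>B: "\<Phi> \<kappa> z \<le> B" if "\<kappa> \<ge> \<Lambda>" for \<kappa> z
        unfolding \<Phi>_def B_def packet_sum_def using that \<Lambda>
        by (intro order_trans[OF norm_sum] sum_mono) (auto simp: norm_mult intro!: mult_left_mono norm_packet_le)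
      have Mi: "integrable lborel (\<lambda>z. B * M z)"
      proof -
        have "integrable lborel (\<lambda>z. exp (- (\<Lambda> * dist z y)\<^sup>2 / 2))" for y :: 'a
          using integrable_gaussian_euclidean(1)[of "\<Lambda>\<^sup>2 / 2" y] \<Lambda> by (simp add: power_mult_distrib)
        then show ?thesis unfolding M_def by (intro integrable_mult_right Bochner_Integration.integrable_sum)
      qed
      have int: "integrable (lborel \<Otimes>\<^sub>M lborel) (\<lambda>(\<kappa>, z). indicator {\<Lambda>..2 * \<Lambda>} \<kappa> * (M z * \<Phi> \<kappa> z))"
      proof (rule Bochner_Integration.integrable_bound[OF integrable_pair_mult[OF _ Mi, of "indicator {\<Lambda>..2 * \<Lambda>}"]])
        show "integrable lborel (indicator {\<Lambda>..2 * \<Lambda>} :: real \<Rightarrow> real)" by (rule integrable_indicator_Icc)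
        show "(\<lambda>(\<kappa>, z). indicator {\<Lambda>..2 * \<Lambda>} \<kappa> * (M z * \<Phi> \<kappa> z)) \<in> borel_measurable (lborel \<Otimes>\<^sub>M lborel)" by measurable
        show "AE p in lborel \<Otimes>\<^sub>M lborel. norm (case p of (\<kappa>, z) \<Rightarrow> indicator {\<Lambda>..2 * \<Lambda>} \<kappa> * (M z * \<Phi> \<kappa> z))
          \<le> norm (case p of (\<kappa>, z) \<Rightarrow> indicator {\<Lambda>..2 * \<Lambda>} \<kappa> * (B * M z))"
        proof (intro AE_I2, clarify)
          fix \<kappa> :: real and z :: 'a
          show "norm (indicator {\<Lambda>..2 * \<Lambda>} \<kappa> * (M z * \<Phi> \<kappa> z)) \<le> norm (indicator {\<Lambda>..2 * \<Lambda>} \<kappa> * (B * M z))"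
          proof (cases "\<kappa> \<in> {\<Lambda>..2 * \<Lambda>}")
            case True
            then have "M z * \<Phi> \<kappa> z \<le> M z * B" using M0 by (intro mult_left_mono \<Phi>B) auto
            moreover have "0 \<le> M z * \<Phi> \<kappa> z" using M0 by (simp add: \<Phi>_def)
            ultimately show ?thesis using True by (simp add: mult.commute)
          qed simp
        qed
      qed
      have inner: "(LINT \<kappa>|lborel. indicator {\<Lambda>..2 * \<Lambda>} \<kappa> * (M z * \<Phi> \<kappa> z)) = M z * V z" for z
        unfolding V_def by (subst integral_mult_right_zero[symmetric]) (simp only: mult.left_commute)
      show "integrable lborel (\<lambda>z. M z * V z)"
        using lborel_pair.integrable_snd[OF int] unfolding inner .
      have "(LINT z|lborel. M z * V z) = (LINT \<kappa>|lborel. LINT z|lborel. indicator {\<Lambda>..2 * \<Lambda>} \<kappa> * (M z * \<Phi> \<kappa> z))"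
        using lborel_pair.Fubini_integral[OF int] unfolding inner .
      also have "\<dots> \<le> (LINT \<kappa>|lborel. indicator {\<Lambda>..2 * \<Lambda>} \<kappa> * D)"
      proof (rule integral_mono)
        show "integrable lborel (\<lambda>\<kappa>. LINT z|lborel. indicator {\<Lambda>..2 * \<Lambda>} \<kappa> * (M z * \<Phi> \<kappa> z))"
          using lborel_pair.integrable_fst[OF int] .
        show "integrable lborel (\<lambda>\<kappa>. indicator {\<Lambda>..2 * \<Lambda>} \<kappa> * D)"
          by (intro integrable_mult_left integrable_indicator_Icc)
        fix \<kappa> :: real
        show "(LINT z|lborel. indicator {\<Lambda>..2 * \<Lambda>} \<kappa> * (M z * \<Phi> \<kappa> z)) \<le> indicator {\<Lambda>..2 * \<Lambda>} \<kappa> * D"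
          unfolding integral_mult_right_zero using cs(2)[of \<kappa>] by (auto simp: indicator_def)
      qed
      also have "\<dots> = \<Lambda> * D" using \<Lambda> by simp
      finally show "(LINT z|lborel. M z * V z) \<le> \<Lambda> * D" .
    qed
    define Q where "Q = (\<lambda>(y::'a) z. integral {\<Lambda>..2 * \<Lambda>} (\<lambda>l. of_real (1 - l / L) * cis (l * ((norm y)\<^sup>2 - (norm z)\<^sup>2)) *
      (\<Sum>x\<in>X. \<Sum>u\<in>U x. of_real (w x) * wave x u \<Lambda> z l)))"
    define T where "T = (\<lambda>(y::'a) l. \<Sum>x\<in>X. \<Sum>u\<in>U x. of_real (w x) * cis (l * ((dist y x)\<^sup>2 - u)))"
    define c where "c = (sqrt pi / \<Lambda>) ^ n"
    have c: "c > 0" using \<Lambda> by (simp add: c_def)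
    have Lam1: "\<Lambda> \<ge> 1" using \<Lambda> by simp
    have tr: "integrable lborel (\<lambda>z. of_real (exp (- (\<Lambda> * dist z y)\<^sup>2)) * Q y z)"
      "(LINT z|lborel. of_real (exp (- (\<Lambda> * dist z y)\<^sup>2)) * Q y z) =
        of_real c * integral {\<Lambda>..2 * \<Lambda>} (\<lambda>l. of_real (1 - l / L) * T y l)" for y
      unfolding Q_def T_def c_def n_def by (rule packet_sum_transfer[OF Lam1 L])+
    define J where "J = integral {\<Lambda>..2 * \<Lambda>} (\<lambda>l. of_real (1 - l / L) * (\<Sum>y\<in>Y. of_real (m y) * T y l))"
    have "of_real c * J = (\<Sum>y\<in>Y. of_real (m y) * (of_real c * integral {\<Lambda>..2 * \<Lambda>} (\<lambda>l. of_real (1 - l / L) * T y l)))"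
    proof -
      have i: "(\<lambda>l. of_real (m y) * (of_real (1 - l / L) * T y l)) integrable_on {\<Lambda>..2 * \<Lambda>}" for y
        unfolding T_def using Lp by (intro integrable_continuous_interval) (auto intro!: continuous_intros)
      have "J = integral {\<Lambda>..2 * \<Lambda>} (\<lambda>l. \<Sum>y\<in>Y. of_real (m y) * (of_real (1 - l / L) * T y l))"
        unfolding J_def sum_distrib_left by (simp only: mult.left_commute)
      also have "\<dots> = (\<Sum>y\<in>Y. integral {\<Lambda>..2 * \<Lambda>} (\<lambda>l. of_real (m y) * (of_real (1 - l / L) * T y l)))"
        using frY by (intro Henstock_Kurzweil_Integration.integral_sum i) (simp add: frostman_def)
      finally show ?thesis by (simp add: sum_distrib_left mult_ac)
    qed
    also have "\<dots> = (LINT z|lborel. (\<Sum>y\<in>Y. of_real (m y) * (of_real (exp (- (\<Lambda> * dist z y)\<^sup>2)) * Q y z)))"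
      by (subst Bochner_Integration.integral_sum, intro integrable_mult_right tr(1))
        (simp only: integral_mult_right_zero tr(2))
    finally have cJ: "of_real c * J = (LINT z|lborel. (\<Sum>y\<in>Y. of_real (m y) * (of_real (exp (- (\<Lambda> * dist z y)\<^sup>2)) * Q y z)))" .
    have Qb: "exp (- (\<Lambda> * dist z y)\<^sup>2) * norm (Q y z) \<le> (4 + 2 * R) * exp (- (\<Lambda> * dist z y)\<^sup>2 / 2) * (\<Phi> \<Lambda> z + 1 / \<Lambda> * V z)"
      if y: "y \<in> Y" for y z
    proof -
      define v where "v = \<Lambda> * dist z y"
      have v: "v \<ge> 0" using \<Lambda> by (simp add: v_def)
      define \<eta> where "\<eta> = (norm y)\<^sup>2 - (norm z)\<^sup>2"
      have hc: "continuous_on S (\<lambda>l. \<Sum>x\<in>X. \<Sum>u\<in>U x. of_real (w x) * wave x u \<Lambda> z l)" for S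
        by (intro continuous_on_sum continuous_on_mult continuous_on_const continuous_on_wave)
      have Fc: "continuous_on {\<Lambda>..2 * \<Lambda>} (\<lambda>\<kappa>. \<Phi> \<kappa> z)"
        unfolding \<Phi>_def packet_sum_eq_integral
        by (intro continuous_on_norm continuous_on_vector_derivative[OF integral_has_vector_derivative'[OF hc]])
      have Vi: "integral {\<Lambda>..2 * \<Lambda>} (\<lambda>\<kappa>. \<Phi> \<kappa> z) = V z"
        using set_borel_integral_eq_integral(2)[OF borel_integrable_atLeastAtMost'[OF Fc]] by (simp add: V_def set_lebesgue_integral_def)
      have V0: "V z \<ge> 0" unfolding V_def by (intro Bochner_Integration.integral_nonneg) (auto simp: \<Phi>_def)
      define h where "h = (\<lambda>l. \<Sum>x\<in>X. \<Sum>u\<in>U x. of_real (w x) * wave x u \<Lambda> z l)"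
      have \<Phi>h: "\<Phi> \<kappa> z = norm (integral {\<kappa>..2 * \<Lambda>} h)" for \<kappa>
        unfolding \<Phi>_def packet_sum_eq_integral h_def ..
      have "norm (Q y z) \<le> norm (integral {\<Lambda>..2 * \<Lambda>} h) + (1 / L + \<bar>\<eta>\<bar>) * integral {\<Lambda>..2 * \<Lambda>} (\<lambda>\<kappa>. norm (integral {\<kappa>..2 * \<Lambda>} h))"
        unfolding Q_def \<eta>_def h_def using \<Lambda> by (intro abel_summation_bound L Lp hc) auto
      also have "\<dots> = \<Phi> \<Lambda> z + (1 / L + \<bar>\<eta>\<bar>) * V z"
        unfolding Vi[symmetric] \<Phi>h ..
      also have "\<dots> = \<Phi> \<Lambda> z + (\<Lambda> * (1 / L + \<bar>\<eta>\<bar>)) * (1 / \<Lambda> * V z)" using \<Lambda> by simp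
      also have "\<dots> \<le> (1 + \<Lambda> * (1 / L + \<bar>\<eta>\<bar>)) * \<Phi> \<Lambda> z + (1 + \<Lambda> * (1 / L + \<bar>\<eta>\<bar>)) * (1 / \<Lambda> * V z)"
      proof (rule add_mono)
        have k: "0 \<le> \<Lambda> * (1 / L + \<bar>\<eta>\<bar>)" using \<Lambda> Lp by simp
        have "1 * \<Phi> \<Lambda> z \<le> (1 + \<Lambda> * (1 / L + \<bar>\<eta>\<bar>)) * \<Phi> \<Lambda> z"
          using k by (intro mult_right_mono) (auto simp: \<Phi>_def)
        then show "\<Phi> \<Lambda> z \<le> (1 + \<Lambda> * (1 / L + \<bar>\<eta>\<bar>)) * \<Phi> \<Lambda> z" by simp
        show "\<Lambda> * (1 / L + \<bar>\<eta>\<bar>) * (1 / \<Lambda> * V z) \<le> (1 + \<Lambda> * (1 / L + \<bar>\<eta>\<bar>)) * (1 / \<Lambda> * V z)"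
          using \<Lambda> V0 by (intro mult_right_mono) auto
      qed
      also have "\<dots> = (1 + \<Lambda> * (1 / L + \<bar>\<eta>\<bar>)) * (\<Phi> \<Lambda> z + 1 / \<Lambda> * V z)" by (simp only: distrib_left)
      also have "\<dots> \<le> ((4 + 2 * R) * exp (v\<^sup>2 / 2)) * (\<Phi> \<Lambda> z + 1 / \<Lambda> * V z)"
      \<comment> \<open>With \<open>v = \<Lambda> * dist z y\<close>, the quantity
        \<open>\<Lambda> * \<bar>\<eta>\<bar>\<close> is at most quadratic in \<open>v\<close>,
        because the difference of squares factors and \<open>norm y \<le> R\<close>. A quadratic is
        absorbed by \<open>exp (v\<^sup>2 / 2)\<close>.\<close>
      proof (rule mult_right_mono)
        have yR: "norm y \<le> R" using y YR by auto
        have "\<bar>\<eta>\<bar> = \<bar>norm y - norm z\<bar> * (norm y + norm z)"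
        proof -
          have "\<eta> = (norm y - norm z) * (norm y + norm z)" by (simp add: \<eta>_def power2_eq_square algebra_simps)
          then show ?thesis by (simp add: abs_mult)
        qed
        also have "\<dots> \<le> dist z y * (dist z y + 2 * R)"
        proof (rule mult_mono)
          show "\<bar>norm y - norm z\<bar> \<le> dist z y" using norm_triangle_ineq3[of y z] by (simp add: dist_norm norm_minus_commute)
          then show "norm y + norm z \<le> dist z y + 2 * R" using yR by linarith
        qed auto
        finally have "\<Lambda> * \<bar>\<eta>\<bar> \<le> \<Lambda> * (dist z y * (dist z y + 2 * R))" using \<Lambda> by (intro mult_left_mono) auto
        also have "\<dots> = v\<^sup>2 / \<Lambda> + 2 * R * v" using \<Lambda> by (simp add: v_def power2_eq_square algebra_simps)
        also have "\<dots> \<le> v\<^sup>2 + R * (1 + v\<^sup>2)"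
        proof (rule add_mono)
          have "v\<^sup>2 / \<Lambda> \<le> v\<^sup>2 / 1" using \<Lambda> by (intro divide_left_mono) auto
          then show "v\<^sup>2 / \<Lambda> \<le> v\<^sup>2" by simp
          have "2 * v \<le> 1 + v\<^sup>2" using zero_le_power2[of "v - 1"] by (simp add: power2_eq_square algebra_simps)
          then have "R * (2 * v) \<le> R * (1 + v\<^sup>2)" using R by (intro mult_left_mono) auto
          then show "2 * R * v \<le> R * (1 + v\<^sup>2)" by (simp add: mult_ac)
        qed
        finally have "1 + \<Lambda> * (1 / L + \<bar>\<eta>\<bar>) \<le> 2 + v\<^sup>2 + R * (1 + v\<^sup>2)" using L2 by (simp add: algebra_simps)
        also have "\<dots> \<le> (4 + 2 * R) * (1 + v\<^sup>2 / 2)"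
          using R zero_le_power2[of v] by (simp add: algebra_simps)
        also have "\<dots> \<le> (4 + 2 * R) * exp (v\<^sup>2 / 2)" using R by (intro mult_left_mono exp_ge_add_one_self) auto
        finally show "1 + \<Lambda> * (1 / L + \<bar>\<eta>\<bar>) \<le> (4 + 2 * R) * exp (v\<^sup>2 / 2)" .
        show "0 \<le> \<Phi> \<Lambda> z + 1 / \<Lambda> * V z" using \<Lambda> V0 by (simp add: \<Phi>_def)
      qed
      finally have "exp (- v\<^sup>2) * norm (Q y z) \<le> exp (- v\<^sup>2) * (((4 + 2 * R) * exp (v\<^sup>2 / 2)) * (\<Phi> \<Lambda> z + 1 / \<Lambda> * V z))"
        by (intro mult_left_mono) auto
      also have "\<dots> = (4 + 2 * R) * (exp (- v\<^sup>2) * exp (v\<^sup>2 / 2)) * (\<Phi> \<Lambda> z + 1 / \<Lambda> * V z)" by (simp only: mult_ac)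
      also have "exp (- v\<^sup>2) * exp (v\<^sup>2 / 2) = exp (- v\<^sup>2 / 2)" by (simp flip: exp_add)
      finally show ?thesis by (simp add: v_def)
    qed
    have "c * norm J = norm (of_real c * J)" using c by (simp add: norm_mult)
    also have "\<dots> \<le> (LINT z|lborel. (4 + 2 * R) * (M z * \<Phi> \<Lambda> z + 1 / \<Lambda> * (M z * V z)))"
      unfolding cJ
    proof (rule Bochner_Integration.integral_norm_bound_integral)
      show "integrable lborel (\<lambda>z. \<Sum>y\<in>Y. of_real (m y) * (of_real (exp (- (\<Lambda> * dist z y)\<^sup>2)) * Q y z))"
        by (intro Bochner_Integration.integrable_sum integrable_mult_right tr(1))
      show "integrable lborel (\<lambda>z. (4 + 2 * R) * (M z * \<Phi> \<Lambda> z + 1 / \<Lambda> * (M z * V z)))"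
        by (intro integrable_mult_right Bochner_Integration.integrable_add MV(1) cs(1) order_refl)
      fix z :: 'a
      have "norm (\<Sum>y\<in>Y. of_real (m y) * (of_real (exp (- (\<Lambda> * dist z y)\<^sup>2)) * Q y z)) \<le> (\<Sum>y\<in>Y. m y * (exp (- (\<Lambda> * dist z y)\<^sup>2) * norm (Q y z)))"
        using m by (intro order_trans[OF norm_sum] sum_mono) (simp add: norm_mult)
      also have "\<dots> \<le> (\<Sum>y\<in>Y. m y * ((4 + 2 * R) * exp (- (\<Lambda> * dist z y)\<^sup>2 / 2) * (\<Phi> \<Lambda> z + 1 / \<Lambda> * V z)))"
        using m by (intro sum_mono mult_left_mono Qb)
      also have "\<dots> = (4 + 2 * R) * (M z * (\<Phi> \<Lambda> z + 1 / \<Lambda> * V z))"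
        unfolding M_def by (simp add: sum_distrib_left sum_distrib_right mult_ac)
      also have "M z * (\<Phi> \<Lambda> z + 1 / \<Lambda> * V z) = M z * \<Phi> \<Lambda> z + 1 / \<Lambda> * (M z * V z)" by (simp add: algebra_simps)
      finally show "norm (\<Sum>y\<in>Y. of_real (m y) * (of_real (exp (- (\<Lambda> * dist z y)\<^sup>2)) * Q y z)) \<le> (4 + 2 * R) * (M z * \<Phi> \<Lambda> z + 1 / \<Lambda> * (M z * V z))" .
    qed
    also have "\<dots> = (4 + 2 * R) * ((LINT z|lborel. M z * \<Phi> \<Lambda> z) + 1 / \<Lambda> * (LINT z|lborel. M z * V z))"
      using MV(1) cs(1)[OF order_refl] by simp
    also have "\<dots> \<le> (4 + 2 * R) * (D + 1 / \<Lambda> * (\<Lambda> * D))"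
      using R \<Lambda> by (intro mult_left_mono add_mono cs(2) MV(2)) auto
    also have "\<dots> = (4 + 2 * R) * 2 * D" using \<Lambda> by simp
    finally have cJD: "c * norm J \<le> (4 + 2 * R) * 2 * D" .
    have Dv: "D = (sqrt C2 * sqrt C1) * (K\<^sup>2 * N) * \<Lambda> powr ((1 - \<sigma> - \<beta> - real n) / 2)"
    proof -
      have "sqrt (\<Lambda> powr p) = \<Lambda> powr (p / 2)" for p using \<Lambda> by (simp add: powr_half_sqrt[symmetric] powr_powr)
      moreover have "\<Lambda> powr (- (\<beta> + real n) / 2) * \<Lambda> powr ((1 - \<sigma>) / 2) = \<Lambda> powr ((1 - \<sigma> - \<beta> - real n) / 2)"
      proof -
        have "- (\<beta> + real n) / 2 + (1 - \<sigma>) / 2 = (1 - \<sigma> - \<beta> - real n) / 2" by (simp add: field_simps)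
        then show ?thesis by (simp only: powr_add[symmetric])
      qed
      ultimately show ?thesis using K N
        by (simp add: D_def real_sqrt_mult power2_eq_square mult_ac)
    qed
    have ci: "1 / c = \<Lambda> powr real n / sqrt pi ^ n"
      using \<Lambda> by (simp add: c_def power_divide powr_realpow)
    have "norm J \<le> (4 + 2 * R) * 2 * D * (1 / c)" using cJD c by (simp add: field_simps)
    also have "\<dots> = C * K\<^sup>2 * N * (\<Lambda> powr real n * \<Lambda> powr ((1 - \<sigma> - \<beta> - real n) / 2))"
      unfolding ci Dv C_def by simp
    also have "\<Lambda> powr real n * \<Lambda> powr ((1 - \<sigma> - \<beta> - real n) / 2) = \<Lambda> powr ((real n + 1 - \<beta> - \<sigma>) / 2)"
    proof -
      have "real n + (1 - \<sigma> - \<beta> - real n) / 2 = (real n + 1 - \<beta> - \<sigma>) / 2" by (simp add: field_simps)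
      then show ?thesis by (simp only: powr_add[symmetric])
    qed
    finally show "norm (integral {\<Lambda>..2 * \<Lambda>} (\<lambda>l. of_real (1 - l / L) *
        (\<Sum>y\<in>Y. of_real (m y) * (\<Sum>x\<in>X. \<Sum>u\<in>U x. of_real (w x) * cis (l * ((dist y x)\<^sup>2 - u))))))
      \<le> C * K\<^sup>2 * N * \<Lambda> powr ((real DIM('a) + 1 - \<beta> - \<sigma>) / 2)"
      by (simp add: J_def T_def n_def)
  qed
qed

section \<open>Incidences of annuli\<close>

text \<open>For \<open>v \<noteq> 0\<close> the value is
  \<open>(1 - cos (L * v)) / (L * v\<^sup>2)\<close>, a Fejer kernel, hence nonnegative. For
  \<open>\<bar>v\<bar> \<le> 1 / L\<close> the cosine is at least \<open>1 / 2\<close> on the whole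
  range, and \<open>L / 4\<close> is half of the area under the triangle
  \<open>1 - l / L\<close>.\<close>

lemma fejer_integral:
  fixes L v :: real
  assumes L: "L > 0"
  shows "integral {0..L} (\<lambda>l. (1 - l / L) * cos (l * v)) \<ge> 0"
    and "\<bar>v\<bar> \<le> 1 / L \<Longrightarrow> integral {0..L} (\<lambda>l. (1 - l / L) * cos (l * v)) \<ge> L / 4"
proof -
  define c where "c = 1 / L"
  have int: "(\<lambda>l. (1 - l / L) * cos (l * v)) integrable_on {0..L}"
    using L by (intro integrable_continuous_interval) (auto intro!: continuous_intros)
  have lin: "((\<lambda>l. (1 - l / L) * (1 / 2)) has_integral L / 4) {0..L}"
  proof -
    have "((\<lambda>l. (1 - l / L) * (1 / 2)) has_integral ((L - L\<^sup>2 / (2 * L)) / 2 - (0 - 0\<^sup>2 / (2 * L)) / 2)) {0..L}"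
      using L by (intro fundamental_theorem_of_calculus)
        (auto intro!: derivative_eq_intros simp: field_simps simp flip: has_real_derivative_iff_has_vector_derivative)
    then show ?thesis using L by (simp add: power2_eq_square field_simps)
  qed
  show near: "integral {0..L} (\<lambda>l. (1 - l / L) * cos (l * v)) \<ge> L / 4" if v: "\<bar>v\<bar> \<le> 1 / L"
  proof -
    have "integral {0..L} (\<lambda>l. (1 - l / L) * (1 / 2)) \<le> integral {0..L} (\<lambda>l. (1 - l / L) * cos (l * v))"
    proof (rule integral_le[OF has_integral_integrable[OF lin] int])
      fix l assume l: "l \<in> {0..L}"
      have "\<bar>l * v\<bar> \<le> L * (1 / L)" unfolding abs_mult using l v L by (intro mult_mono) auto
      then have a: "\<bar>l * v / 2\<bar> \<le> 1 / 2" using L by simp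
      have "\<bar>sin (l * v / 2)\<bar> \<le> 1 / 2" using abs_sin_x_le_abs_x[of "l * v / 2"] a by linarith
      then have "\<bar>sin (l * v / 2)\<bar>\<^sup>2 \<le> (1 / 2)\<^sup>2" by (intro power_mono) auto
      moreover have "cos (l * v) = 1 - 2 * (sin (l * v / 2))\<^sup>2" using cos_double_sin[of "l * v / 2"] by simp
      ultimately have "1 / 2 \<le> cos (l * v)" by (simp add: power2_eq_square)
      then show "(1 - l / L) * (1 / 2) \<le> (1 - l / L) * cos (l * v)"
        using l L by (intro mult_left_mono) (auto simp: field_simps)
    qed
    then show ?thesis using integral_unique[OF lin] by simp
  qed
  show "integral {0..L} (\<lambda>l. (1 - l / L) * cos (l * v)) \<ge> 0"
  proof (cases "v = 0")
    case True
    then show ?thesis using near L by (auto intro: order_trans[of _ "L / 4"])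
  next
    case False
    define F where "F = (\<lambda>l. (1 - c * l) * sin (l * v) / v - c * cos (l * v) / v\<^sup>2)"
    have "((\<lambda>l. (1 - c * l) * cos (l * v)) has_integral (F L - F 0)) {0..L}"
      unfolding F_def using L False
      by (intro fundamental_theorem_of_calculus)
        (auto intro!: derivative_eq_intros simp: field_simps power2_eq_square simp flip: has_real_derivative_iff_has_vector_derivative)
    moreover have "F L - F 0 = c * (1 - cos (L * v)) / v\<^sup>2"
      using L False by (simp add: F_def c_def field_simps)
    ultimately show ?thesis using L by (simp add: c_def integral_unique)
  qed
qed

text \<open>The kernel exceeds \<open>L / 4\<close> on the annuli, where \<open>L = 2 ^ n\<close>,
  so the incidence sum is at most \<open>4 / L\<close> times an integral over frequencies up to
  \<open>L\<close>. The shells contribute \<open>2 powr (n * e')\<close> in total and the radii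
  \<open>2 powr (n * \<tau>)\<close>, which leaves the exponent \<open>\<tau> + e' - 1 < 0\<close>.
  In the factor \<open>K ^ 3\<close>, two powers come from the weights and one from the number of
  radii.\<close>

lemma annuli_incidence_bound_high:
  fixes R s \<beta> \<tau> :: real
  assumes R: "R \<ge> 1" and d: "DIM('a) \<ge> 3" and s: "0 < s" "2 * s < real DIM('a) - 1" and \<beta>: "\<beta> \<ge> 0"
    and \<tau>: "0 < \<tau>" "\<tau> < 1" and sum: "s + \<beta> > 2 * \<tau> + real DIM('a) - 1"
  obtains \<eta> C where "\<eta> > 0" "C > 0"
    "\<And>(X::'a::euclidean_space set) U w Y m K n. n \<ge> 2 \<Longrightarrow> frostman s K (1 / 2 ^ n) X w \<Longrightarrow> frostman \<beta> K (1 / 2 ^ n) Y m \<Longrightarrow>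
      X \<subseteq> cball 0 R \<Longrightarrow> Y \<subseteq> cball 0 R \<Longrightarrow> K \<ge> 1 \<Longrightarrow>
      (\<And>x. x \<in> X \<Longrightarrow> finite (U x) \<and> real (card (U x)) \<le> K * 2 powr (real n * \<tau>)) \<Longrightarrow>
      (\<Sum>x\<in>X. w x * (\<Sum>y\<in>{y\<in>Y. \<exists>u\<in>U x. \<bar>(dist y x)\<^sup>2 - u\<bar> \<le> 1 / 2 ^ n}. m y)) \<le> C * K ^ 3 * 2 powr (- \<eta> * real n)"
proof -
  define \<gamma> where "\<gamma> = s + \<beta> - (2 * \<tau> + real DIM('a) - 1)"
  \<comment> \<open>Half of the surplus \<gamma> is given up to obtain \<sigma> < s, as the energy
    bound requires; the other half keeps \<open>e < 1 - \<tau>\<close>.\<close>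
  define \<sigma> where "\<sigma> = max 0 (s - \<gamma> / 2)"
  have \<gamma>: "\<gamma> > 0" using sum by (simp add: \<gamma>_def)
  have \<sigma>: "0 \<le> \<sigma>" "\<sigma> < s" "\<sigma> \<ge> s - \<gamma> / 2" using s \<gamma> by (auto simp: \<sigma>_def)
  have \<sigma>3: "2 * \<sigma> < real DIM('a) - 1" using \<sigma> s by linarith
  define e where "e = (real DIM('a) + 1 - \<beta> - \<sigma>) / 2"
  have e: "e < 1 - \<tau>" using \<sigma>(3) \<gamma> by (simp add: e_def \<gamma>_def field_simps)
  \<comment> \<open>Raised if necessary to a positive exponent still below
    \<open>1 - \<tau>\<close>, so that the sum over shells is geometric with ratio above
    \<open>1\<close> and the last shell dominates.\<close>
  define e' where "e' = max e ((1 - \<tau>) / 2)"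
  have e': "e' > 0" "e' < 1 - \<tau>" "e \<le> e'"
  proof -
    have "(1 - \<tau>) / 2 > 0" "(1 - \<tau>) / 2 < 1 - \<tau>" using \<tau> by auto
    then show "e' > 0" "e' < 1 - \<tau>" "e \<le> e'" using e unfolding e'_def by linarith+
  qed
  define \<eta> where "\<eta> = 1 - \<tau> - e'"
  have \<eta>: "\<eta> > 0" using e' by (simp add: \<eta>_def)
  define b where "b = (2::real) powr e'"
  have b: "b > 1" using e' by (simp add: b_def)
  show thesis
  proof (rule frequency_shell_bound[OF R \<sigma>(1,2) \<sigma>3 d \<beta>])
    fix C0 :: real
    assume C0: "C0 > 0" and shell: "\<And>(X::'a set) U w Y m K N L \<Lambda>. frostman s K (1 / L) X w \<Longrightarrow> frostman \<beta> K (1 / L) Y m \<Longrightarrow>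
      X \<subseteq> cball 0 R \<Longrightarrow> Y \<subseteq> cball 0 R \<Longrightarrow> K > 0 \<Longrightarrow> N > 0 \<Longrightarrow>
      (\<And>x. x \<in> X \<Longrightarrow> finite (U x) \<and> real (card (U x)) \<le> N) \<Longrightarrow> \<Lambda> \<ge> 4 \<Longrightarrow> 2 * \<Lambda> \<le> L \<Longrightarrow>
      norm (integral {\<Lambda>..2 * \<Lambda>} (\<lambda>l. of_real (1 - l / L) *
        (\<Sum>y\<in>Y. of_real (m y) * (\<Sum>x\<in>X. \<Sum>u\<in>U x. of_real (w x) * cis (l * ((dist y x)\<^sup>2 - u))))))
      \<le> C0 * K\<^sup>2 * N * \<Lambda> powr ((real DIM('a) + 1 - \<beta> - \<sigma>) / 2)"
    define C where "C = 4 * (4 * (R powr \<beta> * R powr s) + C0 / (b - 1))"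
    have C: "C > 0" using C0 b R by (auto simp: C_def intro!: add_pos_pos)
    show thesis
    proof (rule that[OF \<eta> C])
      fix X :: "'a set" and U :: "'a \<Rightarrow> real set" and w :: "'a \<Rightarrow> real" and Y :: "'a set" and m :: "'a \<Rightarrow> real" and K and n :: nat
      assume n: "n \<ge> 2" and frX: "frostman s K (1 / 2 ^ n) X w" and frY: "frostman \<beta> K (1 / 2 ^ n) Y m"
        and XR: "X \<subseteq> cball 0 R" and YR: "Y \<subseteq> cball 0 R" and K: "K \<ge> 1"
        and U: "\<And>x. x \<in> X \<Longrightarrow> finite (U x) \<and> real (card (U x)) \<le> K * 2 powr (real n * \<tau>)"
      have w: "\<And>x. x \<in> X \<Longrightarrow> w x \<ge> 0" and X: "finite X" using frX by (auto simp: frostman_def)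
      have m: "\<And>x. x \<in> Y \<Longrightarrow> m x \<ge> 0" and Y: "finite Y" using frY by (auto simp: frostman_def)
      define L where "L = (2::real) ^ n"
      define N where "N = K * 2 powr (real n * \<tau>)"
      have L: "L > 0" by (simp add: L_def)
      have N: "N > 0" using K by (simp add: N_def)
      define S where "S = (\<lambda>l. \<Sum>y\<in>Y. of_real (m y) * (\<Sum>x\<in>X. \<Sum>u\<in>U x. of_real (w x) * cis (l * ((dist y x)\<^sup>2 - u))))"
      define f where "f = (\<lambda>l. of_real (1 - l / L) * S l)"
      have fc: "continuous_on A f" for A unfolding f_def S_def using L by (auto intro!: continuous_intros)
      define k where "k = (\<lambda>(y::'a) x u. integral {0..L} (\<lambda>l. (1 - l / L) * cos (l * ((dist y x)\<^sup>2 - u))))"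
      have k0: "k y x u \<ge> 0" for y x :: 'a and u unfolding k_def by (rule fejer_integral(1)[OF L])
      \<comment> \<open>Nonnegativity of the kernel lets the sum over all radii majorise the
        indicator of a single hit.\<close>
      have pt: "L / 4 * (if \<exists>u\<in>U x. \<bar>(dist y x)\<^sup>2 - u\<bar> \<le> 1 / L then 1 else 0) \<le> (\<Sum>u\<in>U x. k y x u)" if x: "x \<in> X" for x y
      proof (cases "\<exists>u\<in>U x. \<bar>(dist y x)\<^sup>2 - u\<bar> \<le> 1 / L")
        case True
        then obtain u where u: "u \<in> U x" "\<bar>(dist y x)\<^sup>2 - u\<bar> \<le> 1 / L" by blast
        have "L / 4 \<le> k y x u" unfolding k_def by (rule fejer_integral(2)[OF L u(2)])
        also have "\<dots> \<le> (\<Sum>u\<in>U x. k y x u)" using u U[OF x] k0 by (intro member_le_sum) auto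
        finally show ?thesis using True by simp
      qed (auto intro!: sum_nonneg k0)
      have Ref: "Re (integral {0..L} f) = (\<Sum>x\<in>X. w x * (\<Sum>y\<in>Y. m y * (\<Sum>u\<in>U x. k y x u)))"
      proof -
        have "Re (integral {0..L} f) = integral {0..L} (\<lambda>l. Re (f l))"
          using integral_linear[OF integrable_continuous_interval[OF fc] bounded_linear_Re] by (simp add: o_def)
        also have "(\<lambda>l. Re (f l)) = (\<lambda>l. \<Sum>x\<in>X. \<Sum>y\<in>Y. \<Sum>u\<in>U x. w x * m y * ((1 - l / L) * cos (l * ((dist y x)\<^sup>2 - u))))"
        proof
          fix l
          have "Re (f l) = (\<Sum>y\<in>Y. \<Sum>x\<in>X. \<Sum>u\<in>U x. w x * m y * ((1 - l / L) * cos (l * ((dist y x)\<^sup>2 - u))))"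
          proof -
            have r: "Re (of_real a * z) = a * Re z" for a z by simp
            show ?thesis unfolding f_def S_def by (simp only: r Re_sum cis.sel sum_distrib_left mult_ac)
          qed
          then show "Re (f l) = (\<Sum>x\<in>X. \<Sum>y\<in>Y. \<Sum>u\<in>U x. w x * m y * ((1 - l / L) * cos (l * ((dist y x)\<^sup>2 - u))))"
            by (subst sum.swap)
        qed
        also have "integral {0..L} \<dots> = (\<Sum>x\<in>X. \<Sum>y\<in>Y. \<Sum>u\<in>U x. w x * m y * k y x u)"
        proof -
          have c: "continuous_on {0..L} (\<lambda>l. (1 - l / L) * cos (l * v))" for v using L by (auto intro!: continuous_intros)
          have i0: "(\<lambda>l. w x * m y * ((1 - l / L) * cos (l * ((dist y x)\<^sup>2 - u)))) integrable_on {0..L}" for x y u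
            by (intro integrable_continuous_interval continuous_on_mult continuous_on_const c)
          have i1: "(\<lambda>l. \<Sum>u\<in>U x. w x * m y * ((1 - l / L) * cos (l * ((dist y x)\<^sup>2 - u)))) integrable_on {0..L}" if "x \<in> X" for x y
            using U[OF that] by (intro Henstock_Kurzweil_Integration.integrable_sum i0) auto
          have i2: "(\<lambda>l. \<Sum>y\<in>Y. \<Sum>u\<in>U x. w x * m y * ((1 - l / L) * cos (l * ((dist y x)\<^sup>2 - u)))) integrable_on {0..L}" if "x \<in> X" for x
            by (intro Henstock_Kurzweil_Integration.integrable_sum i1 Y that)
          show ?thesis
          proof (subst Henstock_Kurzweil_Integration.integral_sum[OF X i2], assumption, intro sum.cong refl)
            fix x assume x: "x \<in> X"
            show "integral {0..L} (\<lambda>l. \<Sum>y\<in>Y. \<Sum>u\<in>U x. w x * m y * ((1 - l / L) * cos (l * ((dist y x)\<^sup>2 - u)))) = (\<Sum>y\<in>Y. \<Sum>u\<in>U x. w x * m y * k y x u)"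
            proof (subst Henstock_Kurzweil_Integration.integral_sum[OF Y i1[OF x]], intro sum.cong refl)
              fix y
              show "integral {0..L} (\<lambda>l. \<Sum>u\<in>U x. w x * m y * ((1 - l / L) * cos (l * ((dist y x)\<^sup>2 - u)))) = (\<Sum>u\<in>U x. w x * m y * k y x u)"
                using U[OF x] by (subst Henstock_Kurzweil_Integration.integral_sum[OF _ i0]) (auto simp: k_def)
            qed
          qed
        qed
        finally show ?thesis by (simp add: sum_distrib_left mult_ac)
      qed
      define T where "T = (\<Sum>x\<in>X. w x * (\<Sum>y\<in>{y\<in>Y. \<exists>u\<in>U x. \<bar>(dist y x)\<^sup>2 - u\<bar> \<le> 1 / L}. m y))"
      have "L / 4 * T = (\<Sum>x\<in>X. w x * (\<Sum>y\<in>Y. m y * (L / 4 * (if \<exists>u\<in>U x. \<bar>(dist y x)\<^sup>2 - u\<bar> \<le> 1 / L then 1 else 0))))"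
      proof -
        have "(\<Sum>y\<in>{y\<in>Y. P y}. m y) = (\<Sum>y\<in>Y. m y * (if P y then 1 else 0))" for P
          using Y by (auto simp: sum.If_cases Int_def if_distrib cong: if_cong)
        then show ?thesis unfolding T_def by (simp add: sum_distrib_left mult_ac)
      qed
      also have "\<dots> \<le> (\<Sum>x\<in>X. w x * (\<Sum>y\<in>Y. m y * (\<Sum>u\<in>U x. k y x u)))"
        by (intro sum_mono mult_left_mono pt w m)
      also have "\<dots> \<le> norm (integral {0..L} f)" unfolding Ref[symmetric] by (rule complex_Re_le_cmod)
      finally have T1: "L / 4 * T \<le> norm (integral {0..L} f)" .
      have mass: "sum w X \<le> K * R powr s" "sum m Y \<le> K * R powr \<beta>"
      proof -
        have "(1::real) / 2 ^ n \<le> 1" by simp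
        then have "1 / 2 ^ n \<le> R" using R by linarith
        then show "sum w X \<le> K * R powr s" "sum m Y \<le> K * R powr \<beta>"
          using frostman_mass[OF frX XR] frostman_mass[OF frY YR] by auto
      qed
      have L4: "L \<ge> 4"
      proof -
        have "(2::real) ^ 2 \<le> 2 ^ n" using n by (intro power_increasing) auto
        then show ?thesis by (simp add: L_def)
      qed
      \<comment> \<open>The shell bound starts at \<Lambda> = 4; below that only total masses are
        used.\<close>
      have low: "norm (integral {0..4} f) \<le> K\<^sup>2 * (R powr \<beta> * R powr s) * N * (4 - 0)"
      proof (rule integral_bound)
        fix l :: real assume l: "l \<in> {0..4}"
        have "norm (S l) \<le> (\<Sum>y\<in>Y. m y * (\<Sum>x\<in>X. w x * N))"
          unfolding S_def
        proof (rule order_trans[OF norm_sum], rule sum_mono)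
          fix y assume y: "y \<in> Y"
          have "norm (\<Sum>x\<in>X. \<Sum>u\<in>U x. of_real (w x) * cis (l * ((dist y x)\<^sup>2 - u))) \<le> (\<Sum>x\<in>X. w x * N)"
          proof (rule order_trans[OF norm_sum], rule sum_mono)
            fix x assume x: "x \<in> X"
            have "norm (\<Sum>u\<in>U x. of_real (w x) * cis (l * ((dist y x)\<^sup>2 - u))) \<le> (\<Sum>u\<in>U x. w x)"
              using w[OF x] by (intro order_trans[OF norm_sum] sum_mono) (auto simp: norm_mult)
            also have "\<dots> = w x * real (card (U x))" by simp
            also have "\<dots> \<le> w x * N" using U[OF x] w[OF x] unfolding N_def by (intro mult_left_mono) auto
            finally show "norm (\<Sum>u\<in>U x. of_real (w x) * cis (l * ((dist y x)\<^sup>2 - u))) \<le> w x * N" .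
          qed
          then show "norm (of_real (m y) * (\<Sum>x\<in>X. \<Sum>u\<in>U x. of_real (w x) * cis (l * ((dist y x)\<^sup>2 - u)))) \<le> m y * (\<Sum>x\<in>X. w x * N)"
            using m[OF y] by (simp add: norm_mult mult_left_mono)
        qed
        also have "\<dots> = sum m Y * sum w X * N" by (simp only: sum_distrib_right[symmetric] mult.assoc)
        also have "\<dots> \<le> (K * R powr \<beta>) * (K * R powr s) * N"
          using mass N K w m by (intro mult_right_mono mult_mono) (auto intro!: sum_nonneg)
        also have "\<dots> = K\<^sup>2 * (R powr \<beta> * R powr s) * N" by (simp add: power2_eq_square)
        finally have Sb: "norm (S l) \<le> K\<^sup>2 * (R powr \<beta> * R powr s) * N" .
        have "norm (f l) = \<bar>1 - l / L\<bar> * norm (S l)" unfolding f_def norm_mult norm_of_real ..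
        also have "\<dots> \<le> 1 * norm (S l)" using l L4 by (intro mult_right_mono) (auto simp: abs_le_iff field_simps)
        finally show "norm (f l) \<le> K\<^sup>2 * (R powr \<beta> * R powr s) * N" using Sb by linarith
      qed (use fc in auto)
      have steps: "norm (integral {0..2 ^ j} f) \<le> K\<^sup>2 * (R powr \<beta> * R powr s) * N * 4 + (\<Sum>i=2..<j. C0 * K\<^sup>2 * N * b ^ i)"
        if "2 \<le> j" "j \<le> n" for j
        using that
      proof (induction j rule: dec_induct)
        case base
        then show ?case using low by simp
      next
        case (step j)
        have j4: "(4::real) \<le> 2 ^ j" using power_increasing[of 2 j "2::real"] step by simp
        have jL: "2 * 2 ^ j \<le> L" using power_increasing[of "Suc j" n "2::real"] step by (simp add: L_def)
        have "norm (integral {2 ^ j..2 * 2 ^ j} f) \<le> C0 * K\<^sup>2 * N * (2 ^ j) powr e"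
          unfolding f_def S_def e_def using K N U frX frY
          by (intro shell XR YR j4 jL) (auto simp: L_def N_def)
        also have "\<dots> \<le> C0 * K\<^sup>2 * N * (2 ^ j) powr e'"
          using C0 N e' by (intro mult_left_mono powr_mono) auto
        also have "(2 ^ j) powr e' = b ^ j" by (simp add: b_def powr_power powr_powr mult.commute flip: powr_realpow)
        finally have A: "norm (integral {2 ^ j..2 * 2 ^ j} f) \<le> C0 * K\<^sup>2 * N * b ^ j" .
        have "integral {0..2 * 2 ^ j} f = integral {0..2 ^ j} f + integral {2 ^ j..2 * 2 ^ j} f"
          by (rule Henstock_Kurzweil_Integration.integral_combine[symmetric]) (auto intro: integrable_continuous_interval fc)
        then have "norm (integral {0..2 ^ Suc j} f) \<le> norm (integral {0..2 ^ j} f) + norm (integral {2 ^ j..2 * 2 ^ j} f)"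
          by (simp add: norm_triangle_ineq)
        then show ?case using A step by simp
      qed
      have "(\<Sum>i=2..<n. C0 * K\<^sup>2 * N * b ^ i) \<le> C0 * K\<^sup>2 * N * (b ^ n / (b - 1))"
      proof -
        have "(\<Sum>i=2..<n. b ^ i) \<le> (\<Sum>i<n. b ^ i)" using b by (intro sum_mono2) auto
        also have "\<dots> = (b ^ n - 1) / (b - 1)" using b geometric_sum[of b n] by simp
        also have "\<dots> \<le> b ^ n / (b - 1)" using b by (intro divide_right_mono) auto
        finally show ?thesis unfolding sum_distrib_left[symmetric] using C0 N by (intro mult_left_mono) auto
      qed
      then have "L / 4 * T \<le> K\<^sup>2 * (R powr \<beta> * R powr s) * N * 4 + C0 * K\<^sup>2 * N * (b ^ n / (b - 1))"
        using T1 steps[OF n order_refl] unfolding L_def by linarith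
      also have "\<dots> \<le> K\<^sup>2 * (R powr \<beta> * R powr s) * N * 4 * b ^ n + C0 * K\<^sup>2 * N * (b ^ n / (b - 1))"
      proof (rule add_right_mono)
        have "K\<^sup>2 * (R powr \<beta> * R powr s) * N * 4 * 1 \<le> K\<^sup>2 * (R powr \<beta> * R powr s) * N * 4 * b ^ n"
          using b N by (intro mult_left_mono) auto
        then show "K\<^sup>2 * (R powr \<beta> * R powr s) * N * 4 \<le> K\<^sup>2 * (R powr \<beta> * R powr s) * N * 4 * b ^ n" by simp
      qed
      also have "\<dots> = C / 4 * (K\<^sup>2 * N * b ^ n)" by (simp add: C_def algebra_simps)
      finally have "T \<le> C * (K\<^sup>2 * N * b ^ n) / L" using L by (simp add: field_simps)
      also have "b ^ n = 2 powr (real n * e')" by (simp add: b_def powr_power)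
      also have "L = 2 powr real n" by (simp add: L_def powr_realpow)
      also have "C * (K\<^sup>2 * N * 2 powr (real n * e')) / 2 powr real n = C * K ^ 3 * (2 powr (real n * \<tau>) * 2 powr (real n * e') / 2 powr real n)"
        by (simp add: N_def power2_eq_square power3_eq_cube)
      also have "2 powr (real n * \<tau>) * 2 powr (real n * e') / 2 powr real n = 2 powr (- \<eta> * real n)"
        by (simp add: \<eta>_def algebra_simps flip: powr_add powr_diff)
      finally show "(\<Sum>x\<in>X. w x * (\<Sum>y\<in>{y\<in>Y. \<exists>u\<in>U x. \<bar>(dist y x)\<^sup>2 - u\<bar> \<le> 1 / 2 ^ n}. m y)) \<le> C * K ^ 3 * 2 powr (- \<eta> * real n)"
        by (simp add: T_def L_def)
    qed
  qed
qed

section \<open>The plane: intersections of two annuli\<close>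

lemma card_floor_image_le:
  fixes S :: "real set"
  assumes S: "finite S" and \<rho>: "\<rho> > 0" and diam: "\<And>a b. a \<in> S \<Longrightarrow> b \<in> S \<Longrightarrow> b - a \<le> d" and d: "d \<ge> 0"
  shows "real (card ((\<lambda>a. \<lfloor>a / \<rho>\<rfloor>) ` S)) \<le> d / \<rho> + 2"
proof (cases "S = {}")
  case False
  define a where "a = Min S"
  have a: "a \<in> S" "\<And>b. b \<in> S \<Longrightarrow> a \<le> b" using S False by (auto simp: a_def)
  have "(\<lambda>a. \<lfloor>a / \<rho>\<rfloor>) ` S \<subseteq> {\<lfloor>a / \<rho>\<rfloor>..\<lfloor>(a + d) / \<rho>\<rfloor>}"
  proof clarify
    fix b assume b: "b \<in> S"
    have "a \<le> b" "b \<le> a + d" using a(2)[OF b] diam[OF a(1) b] by auto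
    then show "\<lfloor>b / \<rho>\<rfloor> \<in> {\<lfloor>a / \<rho>\<rfloor>..\<lfloor>(a + d) / \<rho>\<rfloor>}"
      using \<rho> by (auto intro!: floor_mono divide_right_mono)
  qed
  then have "card ((\<lambda>a. \<lfloor>a / \<rho>\<rfloor>) ` S) \<le> card {\<lfloor>a / \<rho>\<rfloor>..\<lfloor>(a + d) / \<rho>\<rfloor>}" by (intro card_mono) auto
  then have "real (card ((\<lambda>a. \<lfloor>a / \<rho>\<rfloor>) ` S)) \<le> real (nat (\<lfloor>(a + d) / \<rho>\<rfloor> - \<lfloor>a / \<rho>\<rfloor> + 1))" by simp
  also have "\<dots> = real_of_int (\<lfloor>(a + d) / \<rho>\<rfloor> - \<lfloor>a / \<rho>\<rfloor> + 1)"
    using \<rho> d floor_mono[of "a / \<rho>" "(a + d) / \<rho>"] by (simp add: divide_right_mono)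
  also have "\<dots> \<le> (a + d) / \<rho> - (a / \<rho> - 1) + 1"
    by (simp, linarith)
  also have "\<dots> = d / \<rho> + 2" by (simp add: add_divide_distrib)
  finally show ?thesis .
qed (use assms in simp)

lemma plane_coordinates:
  fixes e :: "'a::euclidean_space"
  assumes d: "DIM('a) = 2" and e: "norm e = 1"
  obtains f where "\<And>z. (norm z)\<^sup>2 = (z \<bullet> e)\<^sup>2 + (z \<bullet> f)\<^sup>2"
proof -
  obtain S where S: "e \<in> S" "pairwise orthogonal S" "\<And>x. x \<in> S \<Longrightarrow> norm x = 1" "card S = DIM('a)" "span S = UNIV"
    using vector_in_orthonormal_basis[OF e] by metis
  have finS: "finite S" using S(4) by (metis card.infinite DIM_positive less_numeral_extra(3))
  have "card (S - {e}) = 1" using S(1,4) d finS by simp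
  then obtain f where f: "S - {e} = {f}" by (auto simp: card_1_singleton_iff)
  then have S2: "S = {e, f}" "e \<noteq> f" using S(1) by auto
  have "(norm z)\<^sup>2 = (z \<bullet> e)\<^sup>2 + (z \<bullet> f)\<^sup>2" for z
  proof -
    have "(\<Sum>i\<in>S. (z \<bullet> i) *\<^sub>R i) = z"
      by (rule orthonormal_basis_expand) (use S finS in auto)
    then have z: "z = (z \<bullet> e) *\<^sub>R e + (z \<bullet> f) *\<^sub>R f" using S2 by simp
    have "(norm z)\<^sup>2 = z \<bullet> ((z \<bullet> e) *\<^sub>R e + (z \<bullet> f) *\<^sub>R f)" using z by (simp add: power2_norm_eq_inner)
    then show ?thesis by (simp add: inner_add_right power2_eq_square)
  qed
  then show thesis by (rule that)
qed

text \<open>For equal signs \<open>\<bar>b - a\<bar> \<le> \<bar>b + a\<bar>\<close>. The square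
  root is attained near \<open>0\<close>, that is for tangent circles, and it accounts for the loss
  of \<open>1 / 2\<close> in the exponent of the plane case.\<close>

lemma abs_diff_le_sqrt:
  fixes a b c :: real
  assumes "\<bar>a\<^sup>2 - b\<^sup>2\<bar> \<le> c" "0 \<le> a \<and> 0 \<le> b \<or> a \<le> 0 \<and> b \<le> 0"
  shows "b - a \<le> sqrt c"
proof -
  have "(b - a)\<^sup>2 \<le> \<bar>a\<^sup>2 - b\<^sup>2\<bar>"
  proof -
    have "\<bar>b - a\<bar> * \<bar>b - a\<bar> \<le> \<bar>b - a\<bar> * \<bar>b + a\<bar>" using assms(2) by (intro mult_left_mono) auto
    then show ?thesis by (simp add: power2_eq_square algebra_simps flip: abs_mult)
  qed
  then have "\<bar>b - a\<bar> \<le> sqrt c" using assms(1) by (intro real_le_rsqrt) simp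
  then show ?thesis by linarith
qed

text \<open>In coordinates along and across \<open>x' - x\<close>, the difference of the two annulus conditions confines the first
  coordinate to an interval of length \<open>O(\<delta> / |x - x'|)\<close>, and then the second one to two intervals of length
  \<open>O(sqrt (\<delta> / |x - x'|))\<close>.\<close>

lemma two_annuli_mass:
  fixes x x' :: "'a::euclidean_space" and R \<beta> K \<delta> u u' :: real
  assumes d: "DIM('a) = 2" and R: "R \<ge> 1" and xR: "norm x \<le> R" "norm x' \<le> R" and YR: "Y \<subseteq> cball 0 R"
    and fr: "frostman \<beta> K \<delta> Y m" and K: "K \<ge> 0" and \<beta>: "\<beta> \<ge> 0" and \<delta>: "0 < \<delta>" "\<delta> \<le> dist x x'"
  shows "(\<Sum>y\<in>{y\<in>Y. \<bar>(dist y x)\<^sup>2 - u\<bar> \<le> \<delta> \<and> \<bar>(dist y x')\<^sup>2 - u'\<bar> \<le> \<delta>}. m y)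
     \<le> 2 * (sqrt (12 * R) + 2) * (3 + 2 * R) powr \<beta> * K * (\<delta> / dist x x') powr (\<beta> - 1 / 2)"
proof -
  define t where "t = dist x x'"
  have t: "t > 0" "t \<le> 2 * R" using \<delta> xR norm_triangle_ineq4[of x x'] by (auto simp: t_def dist_norm)
  define \<rho> where "\<rho> = \<delta> / t"
  have \<rho>: "0 < \<rho>" "\<rho> \<le> 1" using \<delta> t by (auto simp: \<rho>_def t_def)
  have \<delta>\<rho>: "\<delta> \<le> 2 * R * \<rho>" using t \<delta> by (simp add: \<rho>_def field_simps)
  define W where "W = {y\<in>Y. \<bar>(dist y x)\<^sup>2 - u\<bar> \<le> \<delta> \<and> \<bar>(dist y x')\<^sup>2 - u'\<bar> \<le> \<delta>}"
  have Y: "finite Y" and m: "\<And>y. y \<in> Y \<Longrightarrow> m y \<ge> 0" using fr by (auto simp: frostman_def)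
  have W: "finite W" "W \<subseteq> Y" using Y by (auto simp: W_def)
  define e where "e = (x' - x) /\<^sub>R t"
  have e: "norm e = 1" using t by (simp add: e_def t_def dist_norm norm_minus_commute)
  obtain f where f: "\<And>z. (norm z)\<^sup>2 = (z \<bullet> e)\<^sup>2 + (z \<bullet> f)\<^sup>2"
    using plane_coordinates[OF d e] by blast
  define a where "a = (\<lambda>y. (y - x) \<bullet> e)"
  define h where "h = (\<lambda>y. (y - x) \<bullet> f)"
  have ah: "(dist y x)\<^sup>2 = (a y)\<^sup>2 + (h y)\<^sup>2" for y by (simp add: a_def h_def dist_norm f[of "y - x"])
  have aR: "\<bar>a y\<bar> \<le> 2 * R" if "y \<in> W" for y
  proof -
    have "\<bar>a y\<bar> \<le> norm (y - x) * norm e" unfolding a_def by (rule Cauchy_Schwarz_ineq2)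
    also have "\<dots> \<le> norm y + norm x" using e norm_triangle_ineq4[of y x] by simp
    finally show ?thesis using that W YR xR by (auto simp: subset_iff)
  qed
  have x': "x' = x + t *\<^sub>R e" using t by (simp add: e_def)
  \<comment> \<open>The law of cosines: the coordinate along the axis is affine in the difference of
    the squared distances, which the two annuli fix up to \<open>2 * \<delta>\<close> on either
    side.\<close>
  have ta: "2 * t * a y = (dist y x)\<^sup>2 - (dist y x')\<^sup>2 + t\<^sup>2" for y
  proof -
    have ee: "e \<bullet> e = 1" using e by (simp add: norm_eq_1)
    have sq: "(z - t *\<^sub>R e) \<bullet> (z - t *\<^sub>R e) = z \<bullet> z - 2 * t * (z \<bullet> e) + t\<^sup>2" for z
      by (simp add: inner_diff_left inner_diff_right ee inner_commute[of e z] power2_eq_square algebra_simps)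
    have "y - x' = (y - x) - t *\<^sub>R e" unfolding x' by simp
    then have "(dist y x')\<^sup>2 = (y - x) \<bullet> (y - x) - 2 * t * ((y - x) \<bullet> e) + t\<^sup>2"
      unfolding dist_norm power2_norm_eq_inner by (simp only: sq)
    then have "2 * t * ((y - x) \<bullet> e) = (y - x) \<bullet> (y - x) - (dist y x')\<^sup>2 + t\<^sup>2" by linarith
    then show ?thesis unfolding a_def dist_norm[of y x] power2_norm_eq_inner[of "y - x"] .
  qed
  have a_close: "\<bar>a y - a y'\<bar> \<le> 2 * \<rho>" if "y \<in> W" "y' \<in> W" for y y'
  proof -
    have "\<bar>2 * t * a y - 2 * t * a y'\<bar> \<le> 4 * \<delta>" unfolding ta using that by (auto simp: W_def abs_le_iff)
    also have "2 * t * a y - 2 * t * a y' = 2 * t * (a y - a y')" by (simp add: algebra_simps)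
    finally have "t * \<bar>a y - a y'\<bar> \<le> 2 * \<delta>" using t by (simp add: abs_mult)
    then show ?thesis using t by (simp add: \<rho>_def field_simps)
  qed
  have h_close: "\<bar>(h y)\<^sup>2 - (h y')\<^sup>2\<bar> \<le> 12 * R * \<rho>" if yy: "y \<in> W" "y' \<in> W" for y y'
  proof -
    have "(h y)\<^sup>2 - (h y')\<^sup>2 = ((dist y x)\<^sup>2 - (dist y' x)\<^sup>2) - (a y - a y') * (a y + a y')"
      unfolding ah by (simp add: power2_eq_square algebra_simps)
    also have "\<bar>\<dots>\<bar> \<le> \<bar>(dist y x)\<^sup>2 - (dist y' x)\<^sup>2\<bar> + \<bar>a y - a y'\<bar> * \<bar>a y + a y'\<bar>"
      using abs_triangle_ineq4 by (simp flip: abs_mult)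
    also have "\<dots> \<le> 2 * \<delta> + 2 * \<rho> * (4 * R)"
    proof (intro add_mono mult_mono a_close yy)
      show "\<bar>(dist y x)\<^sup>2 - (dist y' x)\<^sup>2\<bar> \<le> 2 * \<delta>" using yy by (auto simp: W_def abs_le_iff)
      show "\<bar>a y + a y'\<bar> \<le> 4 * R" using aR[OF yy(1)] aR[OF yy(2)] by linarith
    qed (use \<rho> in auto)
    also have "\<dots> \<le> 12 * R * \<rho>" using \<delta>\<rho> by (simp add: algebra_simps)
    finally show ?thesis .
  qed
  \<comment> \<open>At least \<open>3 * \<rho>\<close>, which bounds the diameter of a cell, and at
    least \<delta>, so that the Frostman condition applies.\<close>
  define r where "r = (3 + 2 * R) * \<rho>"
  have r: "\<delta> \<le> r" using \<delta>\<rho> \<rho> by (simp add: r_def algebra_simps)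
  define c where "c = (\<lambda>y. \<lfloor>h y / \<rho>\<rfloor>)"
  have cell: "(\<Sum>y\<in>{y\<in>W. c y = k}. m y) \<le> K * r powr \<beta>" for k
  proof (cases "{y\<in>W. c y = k} = {}")
    case False
    then obtain y0 where y0: "y0 \<in> W" "c y0 = k" by blast
    have "dist y0 y \<le> r" if y: "y \<in> W" "c y = k" for y
    proof -
      have "c y0 = c y" using y0 y by simp
      then have "\<bar>h y0 / \<rho> - h y / \<rho>\<bar> \<le> 1" unfolding c_def by linarith
      then have hh: "\<bar>h y0 - h y\<bar> \<le> \<rho>" using \<rho> by (simp add: field_simps flip: diff_divide_distrib)
      have "(norm (y0 - y))\<^sup>2 = (a y0 - a y)\<^sup>2 + (h y0 - h y)\<^sup>2"
        unfolding f a_def h_def by (simp add: inner_diff_left)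
      also have "\<dots> \<le> (2 * \<rho>)\<^sup>2 + \<rho>\<^sup>2"
        using a_close[OF y0(1) y(1)] hh \<rho> by (intro add_mono; subst power2_abs[symmetric]; intro power_mono) auto
      also have "\<dots> \<le> (3 * \<rho>)\<^sup>2" by (simp add: power2_eq_square)
      finally have "norm (y0 - y) \<le> 3 * \<rho>" using \<rho> by (intro power2_le_imp_le[of "norm (y0 - y)"]) auto
      also have "\<dots> \<le> r" using R \<rho> by (simp add: r_def)
      finally show ?thesis by (simp add: dist_norm)
    qed
    then have "(\<Sum>y\<in>{y\<in>W. c y = k}. m y) \<le> (\<Sum>y\<in>{y\<in>Y. dist y0 y \<le> r}. m y)"
      using Y W m by (intro sum_mono2) auto
    also have "\<dots> \<le> K * r powr \<beta>" using fr r by (auto simp: frostman_def)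
    finally show ?thesis .
  next
    case True
    show ?thesis unfolding True using K by simp
  qed
  \<comment> \<open>Only \<open>(h y)\<^sup>2\<close> is confined; the square can be inverted on
    each side of the axis separately.\<close>
  have card_c: "real (card (c ` V)) \<le> sqrt (12 * R * \<rho>) / \<rho> + 2"
    if V: "V \<subseteq> W" and sgn: "(\<forall>y\<in>V. 0 \<le> h y) \<or> (\<forall>y\<in>V. h y \<le> 0)" for V
  proof -
    have "c ` V = (\<lambda>b. \<lfloor>b / \<rho>\<rfloor>) ` (h ` V)" by (auto simp: c_def)
    moreover have "real (card ((\<lambda>b. \<lfloor>b / \<rho>\<rfloor>) ` (h ` V))) \<le> sqrt (12 * R * \<rho>) / \<rho> + 2"
    proof (rule card_floor_image_le)
      show "finite (h ` V)" using V W finite_subset by blast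
      fix p q assume "p \<in> h ` V" "q \<in> h ` V"
      then obtain y y' where y: "y \<in> V" "y' \<in> V" "p = h y" "q = h y'" by blast
      show "q - p \<le> sqrt (12 * R * \<rho>)"
        unfolding y by (rule abs_diff_le_sqrt[OF h_close]) (use y V sgn in auto)
    qed (use \<rho> R in auto)
    ultimately show ?thesis by simp
  qed
  have "c ` W = c ` {y\<in>W. 0 \<le> h y} \<union> c ` {y\<in>W. h y \<le> 0}" by force
  then have "card (c ` W) \<le> card (c ` {y\<in>W. 0 \<le> h y}) + card (c ` {y\<in>W. h y \<le> 0})"
    by (metis card_Un_le)
  then have cW: "real (card (c ` W)) \<le> 2 * (sqrt (12 * R * \<rho>) / \<rho> + 2)"
    using card_c[of "{y\<in>W. 0 \<le> h y}"] card_c[of "{y\<in>W. h y \<le> 0}"] by fastforce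
  have "sqrt (12 * R * \<rho>) / \<rho> = sqrt (12 * R) * \<rho> powr (- 1 / 2)"
  proof -
    have "sqrt \<rho> / \<rho> = 1 / sqrt \<rho>" using \<rho> by (simp add: real_div_sqrt field_simps)
    moreover have "\<rho> powr (- (1 / 2)) = 1 / sqrt \<rho>" using \<rho> by (subst powr_minus_divide, subst powr_half_sqrt) auto
    ultimately show ?thesis by (simp add: real_sqrt_mult flip: times_divide_eq_right)
  qed
  moreover have "1 \<le> \<rho> powr (- 1 / 2)"
    using \<rho> powr_mono2'[of "-1/2" \<rho> 1] by simp
  \<comment> \<open>About \<open>\<rho> powr (- 1 / 2)\<close> cells, each of mass
    \<open>O (\<rho> powr \<beta>)\<close>, give the exponent
    \<open>\<beta> - 1 / 2\<close>.\<close>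
  ultimately have cW': "real (card (c ` W)) \<le> 2 * (sqrt (12 * R) + 2) * \<rho> powr (- 1 / 2)"
    using cW by (simp add: algebra_simps)
  have "(\<Sum>y\<in>W. m y) = (\<Sum>k\<in>c ` W. \<Sum>y\<in>{y\<in>W. c y = k}. m y)"
    using sum.image_gen[OF W(1)] by (simp add: conj_commute)
  also have "\<dots> \<le> (\<Sum>k\<in>c ` W. K * r powr \<beta>)" by (intro sum_mono cell)
  also have "\<dots> = real (card (c ` W)) * (K * r powr \<beta>)" by simp
  also have "\<dots> \<le> (2 * (sqrt (12 * R) + 2) * \<rho> powr (- 1 / 2)) * (K * r powr \<beta>)"
    using K by (intro mult_right_mono cW') auto
  also have "r powr \<beta> = (3 + 2 * R) powr \<beta> * \<rho> powr \<beta>" using R \<rho> by (simp add: r_def powr_mult)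
  also have "(2 * (sqrt (12 * R) + 2) * \<rho> powr (- 1 / 2)) * (K * ((3 + 2 * R) powr \<beta> * \<rho> powr \<beta>)) =
     2 * (sqrt (12 * R) + 2) * (3 + 2 * R) powr \<beta> * K * (\<rho> powr \<beta> * \<rho> powr (- 1 / 2))" by (simp only: mult_ac)
  also have "\<rho> powr \<beta> * \<rho> powr (- 1 / 2) = \<rho> powr (\<beta> - 1 / 2)" by (simp flip: powr_add)
  finally show ?thesis by (simp add: W_def \<rho>_def t_def)
qed

text \<open>Pairs of pins closer than \<open>\<delta> powr \<epsilon>\<close> carry little mass by
  the Frostman condition on \<open>X\<close>. For the other pairs each of at most \<open>N^2\<close>
  pairs of annuli has common mass \<open>O (\<delta> powr ((1 - \<epsilon>) * \<kappa>))\<close>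
  with \<open>\<kappa> = \<beta> - 1 / 2\<close>, and \<kappa> > 2 \<tau> beats the count
  \<open>N^2\<close>, which is of order \<open>\<delta> powr (- 2 * \<tau>)\<close>.\<close>

lemma annuli_incidence_bound_plane:
  fixes R s \<beta> \<tau> :: real
  assumes R: "R \<ge> 1" and d: "DIM('a) = 2" and s: "0 < s" and \<tau>: "0 < \<tau>" and \<beta>: "2 * \<tau> + 1 / 2 < \<beta>"
  obtains \<eta> C where "\<eta> > 0" "C > 0"
    "\<And>(X::'a::euclidean_space set) U w Y m K n. frostman s K (1 / 2 ^ n) X w \<Longrightarrow> frostman \<beta> K (1 / 2 ^ n) Y m \<Longrightarrow>
      X \<subseteq> cball 0 R \<Longrightarrow> Y \<subseteq> cball 0 R \<Longrightarrow> K \<ge> 1 \<Longrightarrow>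
      (\<And>x. x \<in> X \<Longrightarrow> finite (U x) \<and> real (card (U x)) \<le> K * 2 powr (real n * \<tau>)) \<Longrightarrow>
      (\<Sum>x\<in>X. w x * (\<Sum>y\<in>{y\<in>Y. \<exists>u\<in>U x. \<bar>(dist y x)\<^sup>2 - u\<bar> \<le> 1 / 2 ^ n}. m y)) \<le> C * K ^ 3 * 2 powr (- \<eta> * real n)"
proof -
  define \<kappa> where "\<kappa> = \<beta> - 1 / 2"
  have \<kappa>: "\<kappa> > 2 * \<tau>" "\<kappa> > 0" using \<beta> \<tau> by (auto simp: \<kappa>_def)
  \<comment> \<open>Chosen to spend exactly half of the surplus \<open>\<kappa> - 2 * \<tau>\<close>
    on the separation of the pins.\<close>
  define \<epsilon> where "\<epsilon> = (\<kappa> - 2 * \<tau>) / (2 * \<kappa>)"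
  have \<epsilon>: "\<epsilon> > 0" "\<epsilon> \<le> 1" using \<kappa> \<tau> by (auto simp: \<epsilon>_def field_simps)
  have \<epsilon>\<kappa>: "(1 - \<epsilon>) * \<kappa> - 2 * \<tau> = (\<kappa> - 2 * \<tau>) / 2" using \<kappa> by (simp add: \<epsilon>_def field_simps)
  define \<eta>0 where "\<eta>0 = min (\<epsilon> * s) ((\<kappa> - 2 * \<tau>) / 2)"
  have \<eta>0: "\<eta>0 > 0" "\<eta>0 \<le> \<epsilon> * s" "\<eta>0 \<le> (1 - \<epsilon>) * \<kappa> - 2 * \<tau>" unfolding \<epsilon>\<kappa> \<eta>0_def
    using \<epsilon> s \<kappa> by (simp_all only: min.cobounded1 min.cobounded2 min_less_iff_conj) auto
  define A where "A = 2 * (sqrt (12 * R) + 2) * (3 + 2 * R) powr \<beta>"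
  have A: "A > 0" using R by (auto simp: A_def intro!: mult_pos_pos add_nonneg_pos)
  define C2 where "C2 = R powr \<beta> * R powr s * (R powr \<beta> + A * R powr s)"
  have C2: "C2 > 0" using R A by (auto simp: C2_def intro!: mult_pos_pos add_pos_pos)
  show thesis
  proof (rule that[of "\<eta>0 / 2" "sqrt C2"])
    show "\<eta>0 / 2 > 0" "sqrt C2 > 0" using \<eta>0 C2 by auto
    fix X :: "'a set" and U :: "'a \<Rightarrow> real set" and w :: "'a \<Rightarrow> real" and Y :: "'a set" and m :: "'a \<Rightarrow> real" and K and n :: nat
    assume frX: "frostman s K (1 / 2 ^ n) X w" and frY: "frostman \<beta> K (1 / 2 ^ n) Y m"
      and XR: "X \<subseteq> cball 0 R" and YR: "Y \<subseteq> cball 0 R" and K: "K \<ge> 1"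
      and U: "\<And>x. x \<in> X \<Longrightarrow> finite (U x) \<and> real (card (U x)) \<le> K * 2 powr (real n * \<tau>)"
    have w: "\<And>x. x \<in> X \<Longrightarrow> w x \<ge> 0" and X: "finite X" using frX by (auto simp: frostman_def)
    have m: "\<And>x. x \<in> Y \<Longrightarrow> m x \<ge> 0" and Y: "finite Y" using frY by (auto simp: frostman_def)
    define \<delta> where "\<delta> = 1 / (2::real) ^ n"
    have \<delta>: "0 < \<delta>" "\<delta> \<le> 1" by (auto simp: \<delta>_def)
    have \<delta>p: "2 powr (- p * real n) = \<delta> powr p" for p
      by (simp add: \<delta>_def powr_divide powr_minus_divide powr_powr mult.commute flip: powr_realpow)
    have mass: "sum w X \<le> K * R powr s" "sum m Y \<le> K * R powr \<beta>"
    proof -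
      have "1 / 2 ^ n \<le> R" using \<delta>(2) R unfolding \<delta>_def by linarith
      then show "sum w X \<le> K * R powr s" "sum m Y \<le> K * R powr \<beta>"
        using frostman_mass[OF frX XR] frostman_mass[OF frY YR] by auto
    qed
    have wX0: "sum w X \<ge> 0" and mY0: "sum m Y \<ge> 0" using w m by (auto intro: sum_nonneg)
    define P where "P = (\<lambda>x y. \<exists>u\<in>U x. \<bar>(dist y x)\<^sup>2 - u\<bar> \<le> \<delta>)"
    define M where "M = (\<lambda>x x'. \<Sum>y\<in>Y. if P x y \<and> P x' y then m y else 0)"
    define T where "T = (\<Sum>x\<in>X. w x * (\<Sum>y\<in>{y\<in>Y. P x y}. m y))"
    have "T\<^sup>2 \<le> sum m Y * (\<Sum>x\<in>X. \<Sum>x'\<in>X. w x * w x' * M x x')"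
    proof -
      define g where "g = (\<lambda>y. \<Sum>x\<in>X. w x * (if P x y then 1 else 0))"
      have "T = (\<Sum>x\<in>X. \<Sum>y\<in>Y. m y * (w x * (if P x y then 1 else 0)))"
      proof -
        have "(\<Sum>y\<in>{y\<in>Y. P x y}. m y) = (\<Sum>y\<in>Y. m y * (if P x y then 1 else 0))" for x
          using Y by (auto simp: sum.If_cases Int_def if_distrib cong: if_cong)
        then show ?thesis unfolding T_def by (simp only: sum_distrib_left mult.left_commute)
      qed
      also have "\<dots> = (\<Sum>y\<in>Y. m y * g y)" unfolding g_def sum_distrib_left by (rule sum.swap)
      also have "\<dots> = (\<Sum>y\<in>Y. sqrt (m y) * (sqrt (m y) * g y))"
        using m by (intro sum.cong refl) (simp flip: mult.assoc)
      finally have "T\<^sup>2 \<le> (\<Sum>y\<in>Y. (sqrt (m y))\<^sup>2) * (\<Sum>y\<in>Y. (sqrt (m y) * g y)\<^sup>2)"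
        using Cauchy_Schwarz_ineq_sum[of "\<lambda>y. sqrt (m y)" "\<lambda>y. sqrt (m y) * g y" Y] by simp
      also have "(\<Sum>y\<in>Y. (sqrt (m y))\<^sup>2) = sum m Y" using m by (intro sum.cong) auto
      also have "(\<Sum>y\<in>Y. (sqrt (m y) * g y)\<^sup>2) = (\<Sum>y\<in>Y. \<Sum>x\<in>X. \<Sum>x'\<in>X. w x * w x' * (if P x y \<and> P x' y then m y else 0))"
      proof (intro sum.cong refl)
        fix y assume y: "y \<in> Y"
        have "(sqrt (m y) * g y)\<^sup>2 = m y * (g y * g y)" using m[OF y] by (simp add: power2_eq_square mult_ac)
        also have "\<dots> = (\<Sum>x\<in>X. \<Sum>x'\<in>X. m y * ((w x * (if P x y then 1 else 0)) * (w x' * (if P x' y then 1 else 0))))"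
          unfolding g_def sum_product by (simp only: sum_distrib_left)
        also have "\<dots> = (\<Sum>x\<in>X. \<Sum>x'\<in>X. w x * w x' * (if P x y \<and> P x' y then m y else 0))"
          by (intro sum.cong refl) auto
        finally show "(sqrt (m y) * g y)\<^sup>2 = (\<Sum>x\<in>X. \<Sum>x'\<in>X. w x * w x' * (if P x y \<and> P x' y then m y else 0))" .
      qed
      also have "\<dots> = (\<Sum>x\<in>X. \<Sum>x'\<in>X. w x * w x' * M x x')"
        unfolding M_def sum_distrib_left
        by (rule trans[OF sum.swap]) (intro sum.cong refl sum.swap)
      finally show ?thesis .
    qed
    also have "(\<Sum>x\<in>X. \<Sum>x'\<in>X. w x * w x' * M x x') \<le> (\<Sum>x\<in>X. w x * (K ^ 4 * \<delta> powr \<eta>0 * (R powr \<beta> + A * R powr s)))"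
    proof (rule sum_mono)
      fix x assume x: "x \<in> X"
      define D where "D = A * K * (K * 2 powr (real n * \<tau>))\<^sup>2 * \<delta> powr ((1 - \<epsilon>) * \<kappa>)"
      have D0: "D \<ge> 0" using A K by (simp add: D_def)
      have M_le: "M x x' \<le> (if dist x x' \<le> \<delta> powr \<epsilon> then sum m Y else 0) + D" if x': "x' \<in> X" for x'
      proof (cases "dist x x' \<le> \<delta> powr \<epsilon>")
        case True
        have "M x x' \<le> sum m Y" unfolding M_def using m by (intro sum_mono) auto
        then show ?thesis using True D0 by simp
      next
        case False
        have \<delta>\<epsilon>: "\<delta> \<le> \<delta> powr \<epsilon>" using powr_mono'[of \<epsilon> 1 \<delta>] \<delta> \<epsilon> by simp
        have sep: "\<delta> \<le> dist x x'" using False \<delta>\<epsilon> by linarith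
        define q where "q = A * K * (\<delta> / dist x x') powr \<kappa>"
        have q0: "q \<ge> 0" using A K by (simp add: q_def)
        have piece: "(\<Sum>y\<in>Y. if \<bar>(dist y x)\<^sup>2 - u\<bar> \<le> \<delta> \<and> \<bar>(dist y x')\<^sup>2 - u'\<bar> \<le> \<delta> then m y else 0) \<le> q" for u u'
          using two_annuli_mass[OF d R _ _ YR frY[folded \<delta>_def] _ _ \<delta>(1) sep, of u u'] x x' XR K \<beta> \<tau> Y
          by (auto simp: q_def A_def \<kappa>_def sum.If_cases Int_def subset_iff)
        have "M x x' \<le> (\<Sum>y\<in>Y. \<Sum>u\<in>U x. \<Sum>u'\<in>U x'. if \<bar>(dist y x)\<^sup>2 - u\<bar> \<le> \<delta> \<and> \<bar>(dist y x')\<^sup>2 - u'\<bar> \<le> \<delta> then m y else 0)"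
          unfolding M_def
        proof (rule sum_mono)
          fix y assume y: "y \<in> Y"
          let ?t = "\<lambda>u u'. if \<bar>(dist y x)\<^sup>2 - u\<bar> \<le> \<delta> \<and> \<bar>(dist y x')\<^sup>2 - u'\<bar> \<le> \<delta> then m y else 0"
          have t0: "?t u u' \<ge> 0" for u u' using m[OF y] by simp
          show "(if P x y \<and> P x' y then m y else 0) \<le> (\<Sum>u\<in>U x. \<Sum>u'\<in>U x'. ?t u u')"
          proof (cases "P x y \<and> P x' y")
            case True
            then obtain u u' where u: "u \<in> U x" "\<bar>(dist y x)\<^sup>2 - u\<bar> \<le> \<delta>" "u' \<in> U x'" "\<bar>(dist y x')\<^sup>2 - u'\<bar> \<le> \<delta>"
              by (auto simp: P_def)
            have "m y = ?t u u'" using u by simp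
            also have "\<dots> \<le> (\<Sum>u'\<in>U x'. ?t u u')"
              by (rule member_le_sum[of u' "U x'" "?t u", OF u(3) t0]) (use U[OF x'] in auto)
            also have "\<dots> \<le> (\<Sum>u\<in>U x. \<Sum>u'\<in>U x'. ?t u u')"
              by (rule member_le_sum[of u "U x" "\<lambda>u. \<Sum>u'\<in>U x'. ?t u u'", OF u(1) sum_nonneg[OF t0]]) (use U[OF x] in auto)
            finally show ?thesis using True by simp
          next
            case False
            then show ?thesis unfolding if_not_P[OF False] by (intro sum_nonneg t0)
          qed
        qed
        also have "\<dots> = (\<Sum>u\<in>U x. \<Sum>u'\<in>U x'. \<Sum>y\<in>Y. if \<bar>(dist y x)\<^sup>2 - u\<bar> \<le> \<delta> \<and> \<bar>(dist y x')\<^sup>2 - u'\<bar> \<le> \<delta> then m y else 0)"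
          by (rule trans[OF sum.swap]) (intro sum.cong refl sum.swap)
        also have "\<dots> \<le> (\<Sum>u\<in>U x. \<Sum>u'\<in>U x'. q)" by (intro sum_mono piece)
        also have "\<dots> = real (card (U x)) * real (card (U x')) * q" by simp
        also have "\<dots> \<le> (K * 2 powr (real n * \<tau>)) * (K * 2 powr (real n * \<tau>)) * q"
          using U[OF x] U[OF x'] K q0 by (intro mult_right_mono mult_mono) auto
        also have "\<dots> \<le> (K * 2 powr (real n * \<tau>)) * (K * 2 powr (real n * \<tau>)) * (A * K * \<delta> powr ((1 - \<epsilon>) * \<kappa>))"
        proof -
          have "\<delta> / dist x x' \<le> \<delta> / \<delta> powr \<epsilon>" using False \<delta> by (intro divide_left_mono) (auto intro!: mult_pos_pos)
          also have "\<dots> = \<delta> powr (1 - \<epsilon>)" using \<delta> by (simp add: powr_diff)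
          finally have "(\<delta> / dist x x') powr \<kappa> \<le> (\<delta> powr (1 - \<epsilon>)) powr \<kappa>" using \<kappa> \<delta> by (intro powr_mono2) auto
          then have "(\<delta> / dist x x') powr \<kappa> \<le> \<delta> powr ((1 - \<epsilon>) * \<kappa>)" by (simp add: powr_powr)
          then show ?thesis unfolding q_def using A K by (intro mult_left_mono) auto
        qed
        also have "\<dots> = D" by (simp add: D_def power2_eq_square mult_ac)
        finally show ?thesis using False by simp
      qed
      have ball: "(\<Sum>x'\<in>{x'\<in>X. dist x x' \<le> \<delta> powr \<epsilon>}. w x') \<le> K * \<delta> powr (\<epsilon> * s)"
      proof -
        have "\<delta> \<le> \<delta> powr \<epsilon>" using powr_mono'[of \<epsilon> 1 \<delta>] \<delta> \<epsilon> by simp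
        then have "(\<Sum>x'\<in>{x'\<in>X. dist x x' \<le> \<delta> powr \<epsilon>}. w x') \<le> K * (\<delta> powr \<epsilon>) powr s"
          using frX unfolding frostman_def \<delta>_def[symmetric] by blast
        then show ?thesis by (simp add: powr_powr)
      qed
      have "(\<Sum>x'\<in>X. w x' * M x x') \<le> (\<Sum>x'\<in>X. w x' * ((if dist x x' \<le> \<delta> powr \<epsilon> then sum m Y else 0) + D))"
        by (intro sum_mono mult_left_mono M_le w)
      also have "\<dots> = (\<Sum>x'\<in>X. w x' * (if dist x x' \<le> \<delta> powr \<epsilon> then sum m Y else 0)) + sum w X * D"
        by (simp add: distrib_left sum.distrib sum_distrib_right)
      also have "(\<Sum>x'\<in>X. w x' * (if dist x x' \<le> \<delta> powr \<epsilon> then sum m Y else 0)) = (\<Sum>x'\<in>{x'\<in>X. dist x x' \<le> \<delta> powr \<epsilon>}. w x') * sum m Y"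
      proof -
        have "(\<Sum>x'\<in>X. w x' * (if dist x x' \<le> \<delta> powr \<epsilon> then c else 0)) = (\<Sum>x'\<in>{x'\<in>X. dist x x' \<le> \<delta> powr \<epsilon>}. w x') * c" for c
          using X by (simp add: sum.If_cases Int_def if_distrib sum_distrib_right cong: if_cong)
        then show ?thesis .
      qed
      also have "\<dots> + sum w X * D \<le> (K * \<delta> powr (\<epsilon> * s)) * (K * R powr \<beta>) + (K * R powr s) * D"
        using K mY0 D0 by (intro add_mono mult_mono ball mass) auto
      \<comment> \<open>Both contributions are rounded up to a common
        \<open>K ^ 4 * \<delta> powr \<eta>0\<close>; together with the two total masses this makes
        \<open>K ^ 6\<close>, a square.\<close>
      also have "\<dots> \<le> K ^ 4 * \<delta> powr \<eta>0 * R powr \<beta> + K ^ 4 * \<delta> powr \<eta>0 * (A * R powr s)"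
      proof (rule add_mono)
        have "K\<^sup>2 * \<delta> powr (\<epsilon> * s) \<le> K ^ 4 * \<delta> powr \<eta>0"
          using K \<delta> \<eta>0 by (intro mult_mono power_increasing powr_mono') auto
        then have "K\<^sup>2 * \<delta> powr (\<epsilon> * s) * R powr \<beta> \<le> K ^ 4 * \<delta> powr \<eta>0 * R powr \<beta>" by (intro mult_right_mono) auto
        then show "(K * \<delta> powr (\<epsilon> * s)) * (K * R powr \<beta>) \<le> K ^ 4 * \<delta> powr \<eta>0 * R powr \<beta>"
          by (simp add: power2_eq_square mult_ac)
        have "2 powr (real n * \<tau>) = \<delta> powr (- \<tau>)" using \<delta>p[of "- \<tau>"] by (simp add: mult.commute)
        then have "(2 powr (real n * \<tau>))\<^sup>2 * \<delta> powr ((1 - \<epsilon>) * \<kappa>) = \<delta> powr ((1 - \<epsilon>) * \<kappa> - 2 * \<tau>)"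
          by (simp add: power2_eq_square flip: powr_add)
        also have "\<dots> \<le> \<delta> powr \<eta>0" using \<delta> \<eta>0 by (intro powr_mono') auto
        finally have "A * K ^ 4 * R powr s * ((2 powr (real n * \<tau>))\<^sup>2 * \<delta> powr ((1 - \<epsilon>) * \<kappa>)) \<le> A * K ^ 4 * R powr s * \<delta> powr \<eta>0"
          using A K by (intro mult_left_mono) auto
        then show "(K * R powr s) * D \<le> K ^ 4 * \<delta> powr \<eta>0 * (A * R powr s)"
          by (simp add: D_def power_mult_distrib power2_eq_square eval_nat_numeral mult_ac)
      qed
      also have "\<dots> = K ^ 4 * \<delta> powr \<eta>0 * (R powr \<beta> + A * R powr s)" by (simp add: distrib_left)
      finally have "w x * (\<Sum>x'\<in>X. w x' * M x x') \<le> w x * (K ^ 4 * \<delta> powr \<eta>0 * (R powr \<beta> + A * R powr s))"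
        using w[OF x] by (intro mult_left_mono)
      then show "(\<Sum>x'\<in>X. w x * w x' * M x x') \<le> w x * (K ^ 4 * \<delta> powr \<eta>0 * (R powr \<beta> + A * R powr s))"
        by (simp add: sum_distrib_left mult.assoc)
    qed
    also have "\<dots> = sum w X * (K ^ 4 * \<delta> powr \<eta>0 * (R powr \<beta> + A * R powr s))" by (simp add: sum_distrib_right)
    also have "sum m Y * \<dots> \<le> (K * R powr \<beta>) * ((K * R powr s) * (K ^ 4 * \<delta> powr \<eta>0 * (R powr \<beta> + A * R powr s)))"
      using K A mass wX0 by (intro mult_mono mult_nonneg_nonneg) auto
    also have "\<dots> = (sqrt C2 * K ^ 3 * \<delta> powr (\<eta>0 / 2))\<^sup>2"
    proof -
      have "(sqrt C2 * K ^ 3 * \<delta> powr (\<eta>0 / 2))\<^sup>2 = C2 * (K ^ 3)\<^sup>2 * (\<delta> powr (\<eta>0 / 2))\<^sup>2"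
        using C2 by (simp add: power_mult_distrib)
      also have "(\<delta> powr (\<eta>0 / 2))\<^sup>2 = \<delta> powr \<eta>0" by (simp add: power2_eq_square flip: powr_add)
      also have "(K ^ 3)\<^sup>2 = K * (K * K ^ 4)" by (simp add: eval_nat_numeral)
      finally show ?thesis by (simp add: C2_def mult_ac)
    qed
    finally have T2: "(\<And>x y. x \<le> y \<Longrightarrow> sum m Y * x \<le> sum m Y * y) \<Longrightarrow> T\<^sup>2 \<le> (sqrt C2 * K ^ 3 * \<delta> powr (\<eta>0 / 2))\<^sup>2" .
    have "T\<^sup>2 \<le> (sqrt C2 * K ^ 3 * \<delta> powr (\<eta>0 / 2))\<^sup>2"
      by (rule T2) (rule mult_left_mono[OF _ mY0])
    moreover have "0 \<le> sqrt C2 * K ^ 3 * \<delta> powr (\<eta>0 / 2)" using C2 K by (intro mult_nonneg_nonneg) auto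
    ultimately have "T \<le> sqrt C2 * K ^ 3 * \<delta> powr (\<eta>0 / 2)" by (rule power2_le_imp_le)
    then show "(\<Sum>x\<in>X. w x * (\<Sum>y\<in>{y\<in>Y. \<exists>u\<in>U x. \<bar>(dist y x)\<^sup>2 - u\<bar> \<le> 1 / 2 ^ n}. m y)) \<le> sqrt C2 * K ^ 3 * 2 powr (- (\<eta>0 / 2) * real n)"
      unfolding \<delta>p T_def P_def \<delta>_def[symmetric] .
  qed
qed

section \<open>Hausdorff content and the construction of Frostman weights\<close>

text \<open>A lower bound for Hausdorff content, where covers may have any diameter. A predicate
  with a real constant is convenient because constants will be multiplied by pigeonhole
  weights.\<close>

definition content_ge :: "real \<Rightarrow> real \<Rightarrow> 'a::metric_space set \<Rightarrow> bool" where
  "content_ge s c A \<longleftrightarrow> (\<forall>U::nat \<Rightarrow> 'a set. A \<subseteq> (\<Union>i. U i) \<longrightarrow> (\<forall>i. bounded (U i)) \<longrightarrow> ennreal c \<le> (\<Sum>i. diam_power s (U i)))"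

text \<open>Below the dimension the measure is nonzero, hence so is the content at some scale
  \<delta>. A cover that ignores this scale contains a set of diameter above \<delta>, which alone
  costs \<open>\<delta> powr s\<close>. The minimum with \<open>1\<close> keeps the constant
  finite.\<close>

lemma content_ge_of_dim:
  assumes s: "0 < s" and dim: "ereal s < hausdorff_dim A"
  obtains c where "0 < c" "c \<le> 1" "content_ge s c A"
proof -
  have "hausdorff_measure s A \<noteq> 0"
  proof
    assume "hausdorff_measure s A = 0"
    then have "hausdorff_dim A \<le> ereal s" unfolding hausdorff_dim_def using s by (intro Inf_lower) auto
    then show False using dim by simp
  qed
  then obtain \<delta> where \<delta>: "\<delta> > 0" "hausdorff_content s \<delta> A \<noteq> 0"
    unfolding hausdorff_measure_def by (metis (no_types, lifting) SUP_bot_conv(2) bot_ennreal greaterThan_iff)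
  define c0 where "c0 = min (hausdorff_content s \<delta> A) (min (ennreal (\<delta> powr s)) 1)"
  have c0: "c0 > 0" "c0 \<le> 1"
    using \<delta> unfolding c0_def by (simp_all add: zero_less_iff_neq_zero min.coboundedI2)
  define c where "c = enn2real c0"
  have cc: "ennreal c = c0" using c0 unfolding c_def by (intro ennreal_enn2real) (auto intro: le_less_trans)
  have "content_ge s c A"
    unfolding content_ge_def cc
  proof (intro allI impI)
    fix U :: "nat \<Rightarrow> 'a set"
    assume cov: "A \<subseteq> (\<Union>i. U i)" and bd: "\<forall>i. bounded (U i)"
    show "c0 \<le> (\<Sum>i. diam_power s (U i))"
    proof (cases "\<forall>i. diameter (U i) \<le> \<delta>")
      case True
      have "hausdorff_content s \<delta> A \<le> (\<Sum>i. diam_power s (U i))"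
        unfolding hausdorff_content_def using cov bd True by (intro Inf_lower) blast
      then show ?thesis by (auto simp: c0_def intro: min.coboundedI1)
    next
      case False
      then obtain i where i: "diameter (U i) > \<delta>" by (auto simp: not_le)
      have "ennreal (\<delta> powr s) \<le> ennreal (diameter (U i) powr s)"
        using i \<delta> s by (intro ennreal_leI powr_mono2) auto
      also have "\<dots> \<le> diam_power s (U i)" using s i \<delta> by (auto simp: diam_power_def)
      also have "\<dots> \<le> (\<Sum>i. diam_power s (U i))"
        using sum_le_suminf[of "\<lambda>i. diam_power s (U i)" "{i}"] by simp
      finally show ?thesis by (auto simp: c0_def intro: min.coboundedI2 min.coboundedI1)
    qed
  qed
  moreover have "c > 0" using c0 cc by (metis ennreal_eq_0_iff not_less zero_less_iff_neq_zero)
  moreover have "c \<le> 1" using c0 cc by (metis ennreal_le_1)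
  ultimately show thesis using that by blast
qed

lemma content_ge_mono: "content_ge s c A \<Longrightarrow> A \<subseteq> B \<Longrightarrow> content_ge s c B"
  unfolding content_ge_def by blast

text \<open>A pigeonhole principle: if every \<open>A k\<close> had a cover cheaper than
  \<open>c * w k\<close>, all of them together would cover the union at a cost of at most
  \<open>c * suminf w < c\<close>.\<close>

lemma content_ge_Union:
  assumes A: "content_ge s c (\<Union>k. A k)" and c: "c > 0" and w: "\<And>k. w k \<ge> 0" "summable w" "suminf w < 1"
  obtains k where "content_ge s (c * w k) (A k)"
proof -
  have "\<exists>k. content_ge s (c * w k) (A k)"
  proof (rule ccontr)
    assume "\<not> (\<exists>k. content_ge s (c * w k) (A k))"
    then have "\<forall>k. \<exists>U::nat \<Rightarrow> 'a set. A k \<subseteq> (\<Union>i. U i) \<and> (\<forall>i. bounded (U i)) \<and> (\<Sum>i. diam_power s (U i)) < ennreal (c * w k)"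
      unfolding content_ge_def by (simp add: not_le)
    then obtain U :: "nat \<Rightarrow> nat \<Rightarrow> 'a set" where U: "\<And>k. A k \<subseteq> (\<Union>i. U k i)" "\<And>k i. bounded (U k i)"
      "\<And>k. (\<Sum>i. diam_power s (U k i)) < ennreal (c * w k)" by metis
    define V where "V = (\<lambda>i. case prod_decode i of (k, j) \<Rightarrow> U k j)"
    have "(\<Union>k. A k) \<subseteq> (\<Union>i. V i)"
    proof
      fix x assume "x \<in> (\<Union>k. A k)"
      then obtain k j where "x \<in> U k j" using U(1) by blast
      then have "x \<in> V (prod_encode (k, j))" by (simp add: V_def)
      then show "x \<in> (\<Union>i. V i)" by blast
    qed
    moreover have "bounded (V i)" for i using U(2) by (simp add: V_def split: prod.split)
    ultimately have "ennreal c \<le> (\<Sum>i. diam_power s (V i))" using A unfolding content_ge_def by blast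
    also have "\<dots> = (\<Sum>i. (\<lambda>(k, j). diam_power s (U k j)) (prod_decode i))"
      by (intro suminf_cong) (simp add: V_def split: prod.split)
    also have "\<dots> = (\<Sum>k. \<Sum>j. diam_power s (U k j))" by (rule suminf_ennreal_2dimen) simp
    also have "\<dots> \<le> (\<Sum>k. ennreal (c * w k))" using U(3) by (intro suminf_le) (auto intro: less_imp_le)
    also have "\<dots> = ennreal (c * suminf w)"
      using w c by (subst suminf_ennreal2) (auto intro: summable_mult simp: suminf_mult)
    finally have "c \<le> c * suminf w" using c w suminf_nonneg[OF w(2,1)] by (subst (asm) ennreal_le_iff) auto
    then show False using c w by simp
  qed
  then show thesis using that by blast
qed

text \<open>The pigeonhole principle for an exhaustion by balls, with weights of sum
  \<open>1 / 2\<close>.\<close>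

lemma content_ge_bounded_part:
  fixes A :: "'a::real_normed_vector set"
  assumes A: "content_ge s c A" and c: "0 < c" "c \<le> 1"
  obtains R c' where "R \<ge> 1" "0 < c'" "c' \<le> 1" "content_ge s c' (A \<inter> cball 0 R)"
proof -
  have "A = (\<Union>k. A \<inter> cball 0 (real k + 1))"
  proof (intro equalityI subsetI)
    fix x assume "x \<in> A"
    moreover obtain k :: nat where "norm x \<le> real k" using real_arch_simple by blast
    then have "x \<in> cball 0 (real k + 1)" by simp
    ultimately show "x \<in> (\<Union>k. A \<inter> cball 0 (real k + 1))" by blast
  qed auto
  then have "content_ge s c (\<Union>k. A \<inter> cball 0 (real k + 1))" using A by simp
  moreover have "summable (\<lambda>k. (1 / 4) * (1 / 2 :: real) ^ k)" by (intro summable_mult summable_geometric) auto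
  moreover have "(\<Sum>k. (1 / 4) * (1 / 2 :: real) ^ k) < 1"
    by (subst suminf_mult) (auto simp: suminf_geometric intro: summable_geometric)
  ultimately obtain k where k: "content_ge s (c * ((1 / 4) * (1 / 2) ^ k)) (A \<inter> cball 0 (real k + 1))"
    using content_ge_Union[of s c "\<lambda>k. A \<inter> cball 0 (real k + 1)" "\<lambda>k. (1 / 4) * (1 / 2) ^ k"] c by auto
  show thesis
  proof (rule that[OF _ _ _ k])
    have "(1 / 4) * (1 / 2 :: real) ^ k \<le> 1 * 1" by (intro mult_mono power_le_one) auto
    then have "c * ((1 / 4) * (1 / 2) ^ k) \<le> 1 * 1" using c by (intro mult_mono) auto
    then show "c * ((1 / 4) * (1 / 2) ^ k) \<le> 1" by simp
  qed (use c in auto)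
qed

section \<open>Finite max-flow and the discrete Frostman lemma\<close>

lemma sum_UN_le:
  fixes f :: "'b \<Rightarrow> real"
  assumes "finite I" "\<And>i. i \<in> I \<Longrightarrow> finite (Q i)" "\<And>q. f q \<ge> 0"
  shows "sum f (\<Union>i\<in>I. Q i) \<le> (\<Sum>i\<in>I. sum f (Q i))"
  using assms(1,2)
proof (induction I rule: finite_induct)
  case (insert i I)
  have fin: "finite (Q i)" "finite (\<Union>i\<in>I. Q i)" using insert by auto
  have "sum f (Q i \<union> (\<Union>i\<in>I. Q i)) + sum f (Q i \<inter> (\<Union>i\<in>I. Q i)) = sum f (Q i) + sum f (\<Union>i\<in>I. Q i)"
    by (rule sum.union_inter[OF fin])
  moreover have "sum f (Q i \<inter> (\<Union>i\<in>I. Q i)) \<ge> 0" using assms(3) by (intro sum_nonneg)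
  ultimately show ?case using insert by simp
qed simp

text \<open>Max-flow min-cut on a finite tree of nested cells, with \<open>Q\<close> the cut.\<close>

lemma tree_flow:
  fixes cl :: "nat \<Rightarrow> 'a \<Rightarrow> 'b" and g :: "nat \<Rightarrow> real"
  assumes refine: "\<And>i x y. cl (Suc i) x = cl (Suc i) y \<Longrightarrow> cl i x = cl i y"
    and fin: "\<And>i. finite (cl i ` A)" and g: "\<And>i. g i > 0" and jm: "j \<le> m"
  shows "\<exists>X w Q. finite X \<and> X \<subseteq> {x\<in>A. cl j x = a} \<and> (\<forall>x. w x \<ge> 0) \<and>
    (\<forall>i\<in>{j..m}. \<forall>b. sum w {x\<in>X. cl i x = b} \<le> g i) \<and> finite Q \<and> fst ` Q \<subseteq> {j..m} \<and>
    (\<forall>x\<in>A. cl j x = a \<longrightarrow> (\<exists>i. (i, cl i x) \<in> Q)) \<and> (\<Sum>q\<in>Q. g (fst q)) \<le> sum w X"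
  using jm
proof (induction j arbitrary: a rule: inc_induct)
  case base
  show ?case
  proof (cases "{x\<in>A. cl m x = a} = {}")
    case True
    then show ?thesis by (intro exI[of _ "{}"] exI[of _ "\<lambda>_. 0"]) (auto intro: less_imp_le[OF g])
  next
    case False
    \<comment> \<open>A nonempty leaf cell carries one atom of full capacity and is its own
      cut.\<close>
    then obtain x0 where x0: "x0 \<in> A" "cl m x0 = a" by blast
    have "sum (\<lambda>_. g m) {x\<in>{x0}. cl m x = b} \<le> g m" for b
    proof -
      have "{x\<in>{x0}. cl m x = b} = (if a = b then {x0} else {})" using x0 by auto
      then show ?thesis using g[of m] by simp
    qed
    then show ?thesis
      using x0 less_imp_le[OF g[of m]] by (intro exI[of _ "{x0}"] exI[of _ "\<lambda>_. g m"] exI[of _ "{(m, a)}"]) auto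
  qed
next
  case (step j)
  define B where "B = cl (Suc j) ` {x\<in>A. cl j x = a}"
  have B: "finite B" unfolding B_def by (rule finite_subset[OF image_mono fin]) auto
  define F where "F = (\<lambda>b X w Q. finite X \<and> X \<subseteq> {x\<in>A. cl (Suc j) x = b} \<and> (\<forall>x. w x \<ge> 0) \<and>
    (\<forall>i\<in>{Suc j..m}. \<forall>c. sum w {x\<in>X. cl i x = c} \<le> g i) \<and> finite Q \<and> fst ` Q \<subseteq> {Suc j..m} \<and>
    (\<forall>x\<in>A. cl (Suc j) x = b \<longrightarrow> (\<exists>i. (i, cl i x) \<in> Q)) \<and> (\<Sum>q\<in>Q. g (fst q)) \<le> sum w X)"
  have "\<forall>b. \<exists>X w Q. F b X w Q"
    unfolding F_def by (rule allI, rule step.IH)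
  then obtain X W Q where F: "\<And>b. F b (X b) (W b) (Q b)" by metis
  have Xf: "finite (X b)" and XA: "X b \<subseteq> {x\<in>A. cl (Suc j) x = b}" and W0: "W b x \<ge> 0"
    and Qf: "finite (Q b)" and Qlev: "fst ` Q b \<subseteq> {Suc j..m}"
    and Qcost: "(\<Sum>q\<in>Q b. g (fst q)) \<le> sum (W b) (X b)" for b x
    using F[of b] unfolding F_def by simp_all
  have cap: "sum (W b) {x\<in>X b. cl i x = c} \<le> g i" if "i \<in> {Suc j..m}" for b i c
    using F[of b] that unfolding F_def by simp
  have Qcov: "\<exists>i. (i, cl i x) \<in> Q b" if "x \<in> A" "cl (Suc j) x = b" for b x
    using F[of b] that unfolding F_def by simp
  define Z where "Z = (\<Union>b\<in>B. X b)"
  \<comment> \<open>The weights of the children are glued; supports do not overlap because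
    \<open>cl (Suc j) x\<close> determines the child.\<close>
  define w where "w = (\<lambda>x. W (cl (Suc j) x) x)"
  have Z: "finite Z" using B Xf by (auto simp: Z_def)
  have wX: "w x = W b x" if "x \<in> X b" for x b using that XA[of b] by (auto simp: w_def)
  have w0: "w x \<ge> 0" for x by (simp add: w_def W0)
  have ZA: "Z \<subseteq> {x\<in>A. cl j x = a}"
  proof
    fix x assume "x \<in> Z"
    then obtain b where b: "b \<in> B" "x \<in> X b" by (auto simp: Z_def)
    then obtain y where y: "y \<in> A" "cl j y = a" "cl (Suc j) y = b" by (auto simp: B_def)
    have "x \<in> A" "cl (Suc j) x = cl (Suc j) y" using b XA[of b] y by auto
    then show "x \<in> {x\<in>A. cl j x = a}" using refine[of j x y] y by simp
  qed
  have Zb: "x \<in> X (cl (Suc j) x)" if "x \<in> Z" for x using that XA by (fastforce simp: Z_def)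
  define S where "S = sum w Z"
  have S: "S = (\<Sum>b\<in>B. sum (W b) (X b))"
  proof -
    have "S = (\<Sum>b\<in>B. sum w (X b))"
      unfolding S_def Z_def using B Xf XA by (intro sum.UNION_disjoint) (auto, blast)
    then show ?thesis using wX by (simp cong: sum.cong)
  qed
  have lower: "cl (Suc j) x = cl (Suc j) y" if "cl i x = cl i y" "Suc j \<le> i" for i x y
    using that(2,1)
  proof (induction i rule: dec_induct)
    case (step i)
    then show ?case using refine by blast
  qed
  have capZ: "sum w {x\<in>Z. cl i x = c} \<le> g i" if i: "i \<in> {Suc j..m}" for i c
  proof (cases "{x\<in>Z. cl i x = c} = {}")
    case False
    then obtain x0 where x0: "x0 \<in> Z" "cl i x0 = c" by blast
    define b where "b = cl (Suc j) x0"
    have sub: "{x\<in>Z. cl i x = c} \<subseteq> {x\<in>X b. cl i x = c}"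
    proof clarify
      fix x assume x: "x \<in> Z" "c = cl i x"
      then have "cl (Suc j) x = b" using lower[of i x x0] x0 i by (auto simp: b_def)
      then show "x \<in> X b \<and> cl i x = cl i x" using Zb[OF x(1)] by simp
    qed
    have "sum w {x\<in>Z. cl i x = c} \<le> sum w {x\<in>X b. cl i x = c}"
      using sub Xf w0 by (intro sum_mono2) auto
    also have "\<dots> = sum (W b) {x\<in>X b. cl i x = c}" using wX by (intro sum.cong) auto
    also have "\<dots> \<le> g i" by (rule cap[OF i])
    finally show ?thesis .
  next
    case True
    show ?thesis unfolding True using g[of i] by simp
  qed
  show ?case
  proof (cases "S \<le> g j")
    \<comment> \<open>The flow of the children passes through the cell, and the union of their cuts
      is a cut.\<close>
    case True
    show ?thesis
    proof (rule exI[of _ Z], rule exI[of _ w], rule exI[of _ "\<Union>b\<in>B. Q b"], intro conjI)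
      show "\<forall>i\<in>{j..m}. \<forall>c. sum w {x\<in>Z. cl i x = c} \<le> g i"
      proof (intro ballI allI)
        fix i c assume i: "i \<in> {j..m}"
        show "sum w {x\<in>Z. cl i x = c} \<le> g i"
        proof (cases "i = j")
          case True
          have "sum w {x\<in>Z. cl i x = c} \<le> S" unfolding S_def using Z w0 by (intro sum_mono2) auto
          then show ?thesis using True \<open>S \<le> g j\<close> by simp
        qed (use capZ i in auto)
      qed
      show "fst ` (\<Union>b\<in>B. Q b) \<subseteq> {j..m}" using Qlev by fastforce
      show "\<forall>x\<in>A. cl j x = a \<longrightarrow> (\<exists>i. (i, cl i x) \<in> (\<Union>b\<in>B. Q b))"
      proof (intro ballI impI)
        fix x assume x: "x \<in> A" "cl j x = a"
        then have "cl (Suc j) x \<in> B" by (auto simp: B_def)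
        then show "\<exists>i. (i, cl i x) \<in> (\<Union>b\<in>B. Q b)" using Qcov[OF x(1) refl] by blast
      qed
      have "(\<Sum>q\<in>(\<Union>b\<in>B. Q b). g (fst q)) \<le> (\<Sum>b\<in>B. \<Sum>q\<in>Q b. g (fst q))"
        using B Qf g by (intro sum_UN_le) (auto intro: less_imp_le)
      also have "\<dots> \<le> S" unfolding S by (intro sum_mono Qcost)
      finally show "(\<Sum>q\<in>(\<Union>b\<in>B. Q b). g (fst q)) \<le> sum w Z" by (simp add: S_def)
    qed (use Z ZA w0 B Qf in auto)
  next
    case False
    \<comment> \<open>The children send more than the cell can carry. Scaling down saturates the
      cell, which then forms the cut alone.\<close>
    define r where "r = g j / S"
    have r: "0 \<le> r" "r \<le> 1" "r * S = g j" using False g[of j] by (auto simp: r_def field_simps)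
    have sc: "sum (\<lambda>x. r * w x) V = r * sum w V" for V by (simp add: sum_distrib_left)
    show ?thesis
    proof (rule exI[of _ Z], rule exI[of _ "\<lambda>x. r * w x"], rule exI[of _ "{(j, a)}"], intro conjI)
      show "\<forall>i\<in>{j..m}. \<forall>c. sum (\<lambda>x. r * w x) {x\<in>Z. cl i x = c} \<le> g i"
      proof (intro ballI allI)
        fix i c assume i: "i \<in> {j..m}"
        have nn: "sum w {x\<in>Z. cl i x = c} \<ge> 0" using w0 by (intro sum_nonneg)
        show "sum (\<lambda>x. r * w x) {x\<in>Z. cl i x = c} \<le> g i"
        proof (cases "i = j")
          case True
          have "sum w {x\<in>Z. cl i x = c} \<le> S" unfolding S_def using Z w0 by (intro sum_mono2) auto
          then have "r * sum w {x\<in>Z. cl i x = c} \<le> r * S" using r by (intro mult_left_mono) auto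
          then show ?thesis unfolding sc using True r by simp
        next
          case False
          then have "r * sum w {x\<in>Z. cl i x = c} \<le> 1 * g i" using capZ[of i c] i r nn by (intro mult_mono) auto
          then show ?thesis unfolding sc by simp
        qed
      qed
      show "(\<Sum>q\<in>{(j, a)}. g (fst q)) \<le> sum (\<lambda>x. r * w x) Z" unfolding sc S_def[symmetric] r by simp
    qed (use Z ZA w0 r step in auto)
  qed
qed

text \<open>A cell is represented by the integer coordinates of its corner at scale
  \<open>2 ^ i\<close>. The restriction makes labels extensional, so that bounded sets have labels
  in a finite function space.\<close>

definition dyadic_cell :: "nat \<Rightarrow> 'a::euclidean_space \<Rightarrow> 'a \<Rightarrow> int" where
  "dyadic_cell i x = restrict (\<lambda>b. \<lfloor>2 ^ i * (x \<bullet> b)\<rfloor>) Basis"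

lemma dyadic_cell_refine:
  assumes "dyadic_cell (Suc i) x = dyadic_cell (Suc i) y"
  shows "dyadic_cell i x = dyadic_cell i y"
proof -
  have "\<lfloor>2 ^ i * (x \<bullet> b)\<rfloor> = \<lfloor>2 ^ i * (y \<bullet> b)\<rfloor>" if b: "b \<in> Basis" for b
  proof -
    have half: "\<lfloor>2 ^ i * (z \<bullet> b)\<rfloor> = \<lfloor>2 ^ Suc i * (z \<bullet> b)\<rfloor> div 2" for z :: 'a
      using floor_divide_real_eq_div[of 2 "2 ^ Suc i * (z \<bullet> b)"] by simp
    have "\<lfloor>2 ^ Suc i * (x \<bullet> b)\<rfloor> = \<lfloor>2 ^ Suc i * (y \<bullet> b)\<rfloor>"
      using fun_cong[OF assms, of b] b by (simp add: dyadic_cell_def)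
    then show ?thesis unfolding half by simp
  qed
  then show ?thesis by (auto simp: dyadic_cell_def restrict_def fun_eq_iff)
qed

lemma card_dyadic_cell_cball:
  fixes z :: "'a::euclidean_space"
  assumes r: "2 ^ i * r \<le> 1"
  shows "finite (dyadic_cell i ` cball z r)" "card (dyadic_cell i ` cball z r) \<le> 3 ^ DIM('a)"
proof -
  define P where "P = (\<Pi>\<^sub>E b\<in>(Basis::'a set). {\<lfloor>2 ^ i * (z \<bullet> b)\<rfloor> - 1..\<lfloor>2 ^ i * (z \<bullet> b)\<rfloor> + 1})"
  have fP: "finite P" unfolding P_def by (intro finite_PiE) auto
  have cP: "card P = 3 ^ DIM('a)" unfolding P_def by (subst card_PiE) auto
  have sub: "dyadic_cell i ` cball z r \<subseteq> P"
  proof clarify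
    fix x assume x: "x \<in> cball z r"
    have "\<lfloor>2 ^ i * (x \<bullet> b)\<rfloor> \<in> {\<lfloor>2 ^ i * (z \<bullet> b)\<rfloor> - 1..\<lfloor>2 ^ i * (z \<bullet> b)\<rfloor> + 1}" if b: "b \<in> Basis" for b
    proof -
      have "\<bar>(x - z) \<bullet> b\<bar> \<le> r" using Basis_le_norm[OF b, of "x - z"] x by (simp add: dist_norm norm_minus_commute)
      then have "2 ^ i * \<bar>(x - z) \<bullet> b\<bar> \<le> 2 ^ i * r" by (intro mult_left_mono) auto
      moreover have "2 ^ i * \<bar>(x - z) \<bullet> b\<bar> = \<bar>2 ^ i * (x \<bullet> b) - 2 ^ i * (z \<bullet> b)\<bar>"
        by (simp add: inner_diff_left abs_mult flip: right_diff_distrib)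
      ultimately have "\<bar>2 ^ i * (x \<bullet> b) - 2 ^ i * (z \<bullet> b)\<bar> \<le> 1" using r by linarith
      then show ?thesis by simp linarith
    qed
    then show "dyadic_cell i x \<in> P" by (auto simp: P_def dyadic_cell_def)
  qed
  show "finite (dyadic_cell i ` cball z r)" by (rule finite_subset[OF sub fP])
  show "card (dyadic_cell i ` cball z r) \<le> 3 ^ DIM('a)" using card_mono[OF fP sub] cP by simp
qed

lemma finite_dyadic_cell:
  fixes A :: "'a::euclidean_space set"
  assumes "A \<subseteq> cball 0 R"
  shows "finite (dyadic_cell i ` A)"
proof -
  define P where "P = (\<Pi>\<^sub>E b\<in>(Basis::'a set). {- \<lceil>2 ^ i * R\<rceil> - 1..\<lceil>2 ^ i * R\<rceil>})"
  have "finite P" unfolding P_def by (intro finite_PiE) auto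
  moreover have "dyadic_cell i ` A \<subseteq> P"
  proof clarify
    fix x assume x: "x \<in> A"
    have "\<lfloor>2 ^ i * (x \<bullet> b)\<rfloor> \<in> {- \<lceil>2 ^ i * R\<rceil> - 1..\<lceil>2 ^ i * R\<rceil>}" if b: "b \<in> Basis" for b
    proof -
      have "\<bar>x \<bullet> b\<bar> \<le> R" using Basis_le_norm[OF b, of x] x assms by auto
      then have "2 ^ i * \<bar>x \<bullet> b\<bar> \<le> 2 ^ i * R" by (intro mult_left_mono) auto
      then have "\<bar>2 ^ i * (x \<bullet> b)\<bar> \<le> 2 ^ i * R" by (simp add: abs_mult)
      then show ?thesis by simp linarith
    qed
    then show "dyadic_cell i x \<in> P" by (auto simp: P_def dyadic_cell_def)
  qed
  ultimately show ?thesis by (rule finite_subset[rotated])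
qed

lemma diameter_dyadic_cell:
  fixes A :: "'a::euclidean_space set"
  shows "bounded {x\<in>A. dyadic_cell i x = a}" "diameter {x\<in>A. dyadic_cell i x = a} \<le> real DIM('a) / 2 ^ i"
proof -
  have d: "dist x y \<le> real DIM('a) / 2 ^ i" if eq: "dyadic_cell i x = a" "dyadic_cell i y = a" for x y :: 'a
  proof -
    have "\<bar>(x - y) \<bullet> b\<bar> \<le> 1 / 2 ^ i" if b: "b \<in> Basis" for b
    proof -
      have "\<lfloor>2 ^ i * (x \<bullet> b)\<rfloor> = \<lfloor>2 ^ i * (y \<bullet> b)\<rfloor>"
      proof -
        have "dyadic_cell i x b = dyadic_cell i y b" using eq by simp
        then show ?thesis using b by (simp add: dyadic_cell_def)
      qed
      then have "\<bar>2 ^ i * (x \<bullet> b) - 2 ^ i * (y \<bullet> b)\<bar> \<le> 1" by linarith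
      then have "2 ^ i * \<bar>(x - y) \<bullet> b\<bar> \<le> 1" by (simp add: inner_diff_left abs_mult flip: right_diff_distrib)
      then show ?thesis by (simp add: field_simps)
    qed
    then have "(\<Sum>b\<in>(Basis::'a set). \<bar>(x - y) \<bullet> b\<bar>) \<le> (\<Sum>b\<in>(Basis::'a set). 1 / 2 ^ i)" by (intro sum_mono)
    then show ?thesis using norm_le_l1[of "x - y"] by (simp add: dist_norm)
  qed
  show "bounded {x\<in>A. dyadic_cell i x = a}"
  proof (cases "{x\<in>A. dyadic_cell i x = a} = {}")
    case False
    then obtain x0 where "dyadic_cell i x0 = a" by blast
    then show ?thesis unfolding bounded_def using d by (intro exI[of _ x0] exI[of _ "real DIM('a) / 2 ^ i"]) auto
  next
    case True
    show ?thesis unfolding True by simp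
  qed
  show "diameter {x\<in>A. dyadic_cell i x = a} \<le> real DIM('a) / 2 ^ i"
    by (rule diameter_le) (use d in \<open>auto simp: dist_norm\<close>)
qed

lemma content_ge_finite_cover:
  assumes A: "content_ge s c A" and Q: "finite Q" and cov: "A \<subseteq> (\<Union>q\<in>Q. V q)" and bd: "\<And>q. q \<in> Q \<Longrightarrow> bounded (V q)"
    and s: "s > 0" and f: "\<And>q. q \<in> Q \<Longrightarrow> diameter (V q) powr s \<le> f q"
  shows "c \<le> sum f Q"
proof -
  obtain h where h: "bij_betw h {..<card Q} Q" using Q by (metis ex_bij_betw_nat_finite atLeast0LessThan)
  define U where "U = (\<lambda>i. if i < card Q then V (h i) else {})"
  have f0: "f q \<ge> 0" if "q \<in> Q" for q using f[OF that] by (meson order_trans powr_ge_zero)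
  have "A \<subseteq> (\<Union>i. U i)"
  proof
    fix x assume "x \<in> A"
    then obtain q where q: "q \<in> Q" "x \<in> V q" using cov by blast
    then obtain i where "i < card Q" "h i = q"
      using bij_betw_imp_surj_on[OF h] by (metis imageE lessThan_iff)
    then have "x \<in> U i" using q by (simp add: U_def)
    then show "x \<in> (\<Union>i. U i)" by blast
  qed
  moreover have "\<forall>i. bounded (U i)" using bd h by (auto simp: U_def bij_betw_def)
  ultimately have "ennreal c \<le> (\<Sum>i. diam_power s (U i))" using A unfolding content_ge_def by blast
  also have "\<dots> = (\<Sum>i<card Q. diam_power s (U i))" by (intro suminf_finite) (auto simp: U_def diam_power_def)
  also have "\<dots> \<le> (\<Sum>i<card Q. ennreal (f (h i)))"
    using f h s by (intro sum_mono) (auto simp: U_def diam_power_def bij_betw_def intro!: ennreal_leI)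
  also have "\<dots> = ennreal (\<Sum>i<card Q. f (h i))" using f0 h by (intro sum_ennreal) (auto simp: bij_betw_def)
  also have "(\<Sum>i<card Q. f (h i)) = sum f Q" by (rule sum.reindex_bij_betw[OF h])
  finally show ?thesis using f0 by (subst (asm) ennreal_le_iff) (auto intro: sum_nonneg)
qed

text \<open>The flow has total mass at least the cost of a cut, and a cut avoiding the root is a
  cover of \<open>A\<close>, whose cost is bounded below by the content. Capacities
  \<open>2 powr (- s * i)\<close> are the ball condition on cells; a ball of radius about
  \<open>2 powr (- i)\<close> meets at most \<open>3 ^ d\<close> cells, and rounding the radius
  costs \<open>2 powr s\<close>. Neither the mass nor the constant depends on the resolution
  \<open>m\<close>.\<close>

lemma discrete_frostman:
  fixes A :: "'a::euclidean_space set"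
  assumes A: "content_ge s c A" and c: "0 < c" "c \<le> 1" and AR: "A \<subseteq> cball 0 R" and s: "s > 0"
  obtains X w where "X \<subseteq> A" "sum w X = c / real DIM('a) powr s" "frostman s (3 ^ DIM('a) * 2 powr s) (1 / 2 ^ m) X w"
proof -
  define d where "d = real DIM('a)"
  have d: "d \<ge> 1" by (simp add: d_def)
  define c' where "c' = c / d powr s"
  have ds: "d powr s \<ge> 1" using d s by (intro ge_one_powr_ge_zero) auto
  have ds0: "d powr s > 0" using ds by linarith
  have c': "0 < c'" "c' \<le> 1" using c ds ds0 by (simp_all add: c'_def divide_le_eq)
  \<comment> \<open>An artificial root above the dyadic levels, a single cell of capacity
    \<open>c'\<close>, caps the total mass. Dyadic level \<open>i\<close> thus has index
    \<open>Suc i\<close> in the tree.\<close>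
  define cl where "cl = (\<lambda>i. case i of 0 \<Rightarrow> (\<lambda>x::'a. (\<lambda>b::'a. 0::int)) | Suc i \<Rightarrow> dyadic_cell i)"
  define g where "g = (\<lambda>i. case i of 0 \<Rightarrow> c' | Suc i \<Rightarrow> 2 powr (- s * real i))"
  have "\<exists>X w Q. finite X \<and> X \<subseteq> {x\<in>A. cl 0 x = (\<lambda>b. 0)} \<and> (\<forall>x. w x \<ge> 0) \<and>
    (\<forall>i\<in>{0..Suc m}. \<forall>b. sum w {x\<in>X. cl i x = b} \<le> g i) \<and> finite Q \<and> fst ` Q \<subseteq> {0..Suc m} \<and>
    (\<forall>x\<in>A. cl 0 x = (\<lambda>b. 0) \<longrightarrow> (\<exists>i. (i, cl i x) \<in> Q)) \<and> (\<Sum>q\<in>Q. g (fst q)) \<le> sum w X"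
  proof (rule tree_flow)
    show "cl i x = cl i y" if "cl (Suc i) x = cl (Suc i) y" for i x y
      using that dyadic_cell_refine by (cases i) (auto simp: cl_def)
    show "finite (cl i ` A)" for i using finite_dyadic_cell[OF AR] by (cases i) (auto simp: cl_def image_constant_conv)
    show "0 < g i" for i using c' by (cases i) (auto simp: g_def)
  qed simp
  then obtain X w Q where X: "finite X" and XA: "X \<subseteq> {x\<in>A. cl 0 x = (\<lambda>b. 0)}" and w': "\<forall>x. w x \<ge> 0"
    and cap': "\<forall>i\<in>{0..Suc m}. \<forall>b. sum w {x\<in>X. cl i x = b} \<le> g i" and Q: "finite Q"
    and cov': "\<forall>x\<in>A. cl 0 x = (\<lambda>b. 0) \<longrightarrow> (\<exists>i. (i, cl i x) \<in> Q)" and cost: "(\<Sum>q\<in>Q. g (fst q)) \<le> sum w X"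
    by (elim exE conjE)
  have cl0: "cl 0 x = (\<lambda>b. 0)" for x by (simp add: cl_def)
  have X: "finite X" "X \<subseteq> A" using X XA by auto
  have w: "w x \<ge> 0" for x using w' by blast
  have cap: "sum w {x\<in>X. cl i x = b} \<le> g i" if "i \<le> Suc m" for i b using cap' that by simp
  have cov: "\<exists>i. (i, cl i x) \<in> Q" if "x \<in> A" for x using cov' cl0 that by blast
  have g0: "g i \<ge> 0" for i using c' by (cases i) (auto simp: g_def)
  have upper: "sum w X \<le> c'"
    using cap[of 0 "\<lambda>b. 0"] by (simp add: cl_def g_def)
  \<comment> \<open>A cut through the root costs \<open>c'\<close> outright. Otherwise its cells
    cover \<open>A\<close> with diameters at most \<open>d / 2 ^ i\<close>; the factor
    \<open>d powr s\<close> lost here is the one divided out in \<open>c'\<close>.\<close>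
  have lower: "c' \<le> (\<Sum>q\<in>Q. g (fst q))"
  proof (cases "\<exists>a. (0, a) \<in> Q")
    case True
    then obtain a where "(0, a) \<in> Q" by blast
    then have "g (fst (0::nat, a)) \<le> (\<Sum>q\<in>Q. g (fst q))" using Q g0 by (intro member_le_sum) auto
    then show ?thesis by (simp add: g_def)
  next
    case False
    have "c \<le> (\<Sum>q\<in>Q. d powr s * g (fst q))"
    proof (rule content_ge_finite_cover[OF A Q _ _ s])
      show "A \<subseteq> (\<Union>q\<in>Q. {x\<in>A. cl (fst q) x = snd q})" using cov by fastforce
      fix q assume q: "q \<in> Q"
      obtain i where i: "fst q = Suc i" using False q by (metis not0_implies_Suc prod.collapse)
      show "bounded {x\<in>A. cl (fst q) x = snd q}" unfolding i cl_def using diameter_dyadic_cell(1) by simp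
      have "diameter {x\<in>A. cl (fst q) x = snd q} powr s \<le> (d / 2 ^ i) powr s"
        unfolding i cl_def d_def using diameter_dyadic_cell(2)[of A i "snd q"] s diameter_ge_0[OF diameter_dyadic_cell(1)]
        by (intro powr_mono2) auto
      also have "\<dots> = d powr s * g (fst q)"
        unfolding i using d by (simp add: g_def powr_divide powr_minus_divide powr_powr mult.commute flip: powr_realpow)
      finally show "diameter {x\<in>A. cl (fst q) x = snd q} powr s \<le> d powr s * g (fst q)" .
    qed
    then show ?thesis using ds0 unfolding sum_distrib_left[symmetric] c'_def by (simp add: divide_le_eq mult.commute)
  qed
  have total: "sum w X = c'" using upper lower cost by linarith
  have "frostman s (3 ^ DIM('a) * 2 powr s) (1 / 2 ^ m) X w"
    unfolding frostman_def
  proof (intro conjI ballI allI impI)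
    fix z :: 'a and r :: real assume r: "1 / 2 ^ m \<le> r"
    have r0: "r > 0" using r by (meson divide_pos_pos less_le_trans zero_less_one zero_less_numeral zero_less_power)
    have K1: "3 ^ DIM('a) * 2 powr s \<ge> (1::real)" using s mult_mono[of 1 "3 ^ DIM('a) :: real" 1 "2 powr s"] by (simp add: ge_one_powr_ge_zero)
    show "(\<Sum>x\<in>{x\<in>X. dist z x \<le> r}. w x) \<le> 3 ^ DIM('a) * 2 powr s * r powr s"
    proof (cases "r \<ge> 1")
      case True
      have "(\<Sum>x\<in>{x\<in>X. dist z x \<le> r}. w x) \<le> sum w X" using X w by (intro sum_mono2) auto
      also have "\<dots> \<le> 1 * 1" using total c' by simp
      also have "\<dots> \<le> 3 ^ DIM('a) * 2 powr s * r powr s"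
        using K1 True s by (intro mult_mono ge_one_powr_ge_zero) auto
      finally show ?thesis .
    next
      case False
      \<comment> \<open>The first failing index is \<open>Suc i\<close> with
        \<open>2 ^ i * r \<le> 1 < 2 ^ Suc i * r\<close>, so the cells of level \<open>i\<close>
        have side between \<open>r\<close> and \<open>2 * r\<close>. The assumption on
        \<open>r\<close> guarantees \<open>i \<le> m\<close>, a level that the flow
        controls.\<close>
      define P where "P = (\<lambda>i::nat. 2 ^ i * r > 1)"
      have ex: "\<exists>i. P i"
      proof -
        obtain i :: nat where "1 / r < 2 ^ i" using real_arch_pow[of 2 "1 / r"] by auto
        then show ?thesis using r0 by (auto simp: P_def field_simps)
      qed
      define k where "k = (LEAST i. P i)"
      have Pk: "P k" unfolding k_def using ex by (rule LeastI_ex)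
      have "k \<noteq> 0" using Pk False by (auto simp: P_def intro: ccontr)
      then obtain i where i: "k = Suc i" by (metis not0_implies_Suc)
      have "\<not> P i" using not_less_Least[of i P] i by (simp add: k_def)
      then have ir: "2 ^ i * r \<le> 1" by (simp add: P_def)
      have ir2: "1 < 2 * 2 ^ i * r" using Pk by (simp add: P_def i)
      have im: "i \<le> m"
      proof (rule ccontr)
        assume "\<not> i \<le> m"
        then have "(2::real) ^ Suc m \<le> 2 ^ i" by (intro power_increasing) auto
        then have "2 * (2 ^ m * r) \<le> 2 ^ i * r" using r0 by (simp add: mult_right_mono)
        moreover have "1 \<le> 2 ^ m * r" using r by (simp add: field_simps)
        ultimately show False using ir by linarith
      qed
      define B where "B = {x\<in>X. dist z x \<le> r}"
      have B: "finite B" using X by (simp add: B_def)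
      have "sum w B = (\<Sum>k\<in>dyadic_cell i ` B. sum w {x\<in>B. dyadic_cell i x = k})"
        using sum.image_gen[OF B, of w "dyadic_cell i"] by (simp add: conj_commute)
      also have "\<dots> \<le> (\<Sum>k\<in>dyadic_cell i ` B. g (Suc i))"
      proof (rule sum_mono)
        fix k
        have "sum w {x\<in>B. dyadic_cell i x = k} \<le> sum w {x\<in>X. cl (Suc i) x = k}"
          using X w by (intro sum_mono2) (auto simp: B_def cl_def)
        also have "\<dots> \<le> g (Suc i)" using im by (intro cap) auto
        finally show "sum w {x\<in>B. dyadic_cell i x = k} \<le> g (Suc i)" .
      qed
      also have "\<dots> = real (card (dyadic_cell i ` B)) * g (Suc i)" by simp
      also have "\<dots> \<le> 3 ^ DIM('a) * g (Suc i)"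
      proof (rule mult_right_mono[OF _ g0])
        have "dyadic_cell i ` B \<subseteq> dyadic_cell i ` cball z r" by (auto simp: B_def)
        then have "card (dyadic_cell i ` B) \<le> 3 ^ DIM('a)"
          using card_mono[OF card_dyadic_cell_cball(1)[OF ir]] card_dyadic_cell_cball(2)[OF ir] by (meson order_trans)
        then show "real (card (dyadic_cell i ` B)) \<le> 3 ^ DIM('a)"
          by (metis of_nat_le_iff of_nat_numeral of_nat_power)
      qed
      also have "g (Suc i) \<le> 2 powr s * r powr s"
      proof -
        have "(1 / 2 ^ i) powr s \<le> (2 * r) powr s"
          using ir2 s r0 by (intro powr_mono2) (auto simp: field_simps)
        then show ?thesis using r0 by (simp add: g_def powr_mult powr_divide powr_minus_divide powr_powr mult.commute flip: powr_realpow)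
      qed
      finally show ?thesis by (simp add: B_def mult.assoc)
    qed
  qed (use X w in auto)
  then show thesis using that[OF X(2) _] total by (simp add: c'_def d_def)
qed

text \<open>Applied to the set functions of a sequence of discrete measures, this (Tychonoff) replaces the passage to a
  weak limit.\<close>

lemma bounded_functions_cluster_point:
  fixes f :: "nat \<Rightarrow> 'i \<Rightarrow> real"
  assumes f: "\<And>n i. 0 \<le> f n i" "\<And>n i. f n i \<le> c"
  obtains L where "\<And>I \<epsilon> N. finite I \<Longrightarrow> \<epsilon> > 0 \<Longrightarrow> \<exists>n\<ge>N. \<forall>i\<in>I. \<bar>f n i - L i\<bar> < \<epsilon>"
proof -
  define C where "C = (PiE UNIV (\<lambda>_::'i. {0..c}))"
  have "compactin (product_topology (\<lambda>_::'i. euclidean) UNIV) C"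
    unfolding C_def compactin_PiE by simp
  then have comp: "compact C" by (simp add: euclidean_product_topology)
  \<comment> \<open>A cluster point and not a convergent subsequence: a cube with uncountably many
    factors need not be sequentially compact.\<close>
  have "\<exists>L\<in>C. inf (nhds L) (filtermap f sequentially) \<noteq> bot"
  proof -
    have "eventually (\<lambda>g. g \<in> C) (filtermap f sequentially)"
      using f by (simp add: C_def eventually_filtermap PiE_iff)
    moreover have "filtermap f sequentially \<noteq> bot" by (simp add: filtermap_bot_iff)
    ultimately show ?thesis using comp unfolding compact_filter by blast
  qed
  then obtain L where L: "inf (nhds L) (filtermap f sequentially) \<noteq> bot" by blast
  show thesis
  proof (rule that[of L])
    fix I :: "'i set" and \<epsilon> :: real and N :: nat
    assume I: "finite I" and \<epsilon>: "\<epsilon> > 0"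
    have "eventually (\<lambda>g. \<forall>i\<in>I. \<bar>g i - L i\<bar> < \<epsilon>) (nhds L)"
    proof (rule eventually_ball_finite[OF I], rule ballI)
      fix i
      have "continuous_on UNIV (\<lambda>g::'i \<Rightarrow> real. g i)" by (rule continuous_on_product_coordinates)
      then have "((\<lambda>g. g i) \<longlongrightarrow> L i) (nhds L)"
        using tendsto_at_iff_tendsto_nhds[of "\<lambda>g. g i" L] by (simp add: continuous_on_def)
      then have "eventually (\<lambda>g. dist (g i) (L i) < \<epsilon>) (nhds L)" using \<epsilon> by (rule tendstoD)
      then show "eventually (\<lambda>g. \<bar>g i - L i\<bar> < \<epsilon>) (nhds L)" by (simp add: dist_real_def)
    qed
    moreover have "eventually (\<lambda>g. \<exists>n\<ge>N. g = f n) (filtermap f sequentially)"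
      unfolding eventually_filtermap using eventually_ge_at_top[of N] by eventually_elim blast
    ultimately have "eventually (\<lambda>g. (\<forall>i\<in>I. \<bar>g i - L i\<bar> < \<epsilon>) \<and> (\<exists>n\<ge>N. g = f n)) (inf (nhds L) (filtermap f sequentially))"
      unfolding eventually_inf by blast
    from eventually_happens'[OF L this] show "\<exists>n\<ge>N. \<forall>i\<in>I. \<bar>f n i - L i\<bar> < \<epsilon>" by blast
  qed
qed

section \<open>Exceptional pins\<close>

lemma dyadic_scale:
  fixes r :: real
  assumes "0 < r" "r \<le> 1 / 2 ^ k0"
  obtains k where "k \<ge> k0" "1 / 2 ^ Suc k < r" "r \<le> 1 / 2 ^ k"
proof -
  define P where "P = (\<lambda>k. k0 \<le> k \<and> 1 / 2 ^ Suc k < r)"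
  have ex: "\<exists>k. P k"
  proof -
    obtain i :: nat where i: "1 / r < 2 ^ i" using real_arch_pow[of 2 "1 / r"] by auto
    have "(2::real) ^ i \<le> 2 ^ Suc (max i k0)" by (intro power_increasing) auto
    then have "1 / r < 2 ^ Suc (max i k0)" using i by linarith
    then have "P (max i k0)" using assms by (simp add: P_def field_simps)
    then show ?thesis ..
  qed
  define k where "k = (LEAST k. P k)"
  have Pk: "P k" unfolding k_def using ex by (rule LeastI_ex)
  have "r \<le> 1 / 2 ^ k"
  proof (cases "k = k0")
    case False
    then obtain j where j: "k = Suc j" "k0 \<le> j" using Pk by (cases k) (auto simp: P_def)
    then have "\<not> P j" using not_less_Least[of j P] by (simp add: k_def)
    then show ?thesis using j by (simp add: P_def)
  qed (use assms in simp)
  then show thesis using that[of k] Pk by (simp add: P_def)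
qed

text \<open>A cover with small \<open>\<tau>'\<close>-sum for some \<tau>' < \<tau> is thickened to
  open intervals, made finite by compactness, and sorted by dyadic length. Since the
  \<open>\<tau>\<close>-sum of the lengths stays below \<open>4\<close>, at most
  \<open>8 * 2 powr (k * \<tau>)\<close> intervals have scale \<open>k\<close>. That finitely many
  scales occur is essential later, when a cluster point is approximated on finitely many
  sets.\<close>

lemma pinned_distance_cover:
  fixes E :: "'a::metric_space set"
  assumes E: "compact E" and \<tau>: "0 < \<tau>" "\<tau> < 1" and dim: "hausdorff_dim (pinned_distance_set x E) < ereal \<tau>"
  obtains K :: nat and P where "\<And>k. finite (P k)" "\<And>k. real (card (P k)) \<le> 8 * 2 powr (real k * \<tau>)"
    "\<And>y. y \<in> E \<Longrightarrow> \<exists>k\<in>{k0..K}. \<exists>p\<in>P k. \<bar>dist x y - p\<bar> < 1 / 2 ^ k"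
proof -
  define D where "D = pinned_distance_set x E"
  have D: "D = dist x ` E" by (auto simp: D_def pinned_distance_set_def)
  have compD: "compact D" unfolding D by (intro compact_continuous_image continuous_intros E)
  obtain \<tau>' where \<tau>': "0 \<le> \<tau>'" "\<tau>' < \<tau>" "hausdorff_measure \<tau>' D = 0"
    using dim unfolding hausdorff_dim_def D_def[symmetric] Inf_less_iff by auto
  \<comment> \<open>One dyadic step below \<open>1 / 2 ^ k0\<close>, since the thickening doubles
    the diameters.\<close>
  define \<delta> where "\<delta> = 1 / (2::real) ^ Suc k0"
  have "(1::real) \<le> 2 ^ Suc k0" by (rule one_le_power) simp
  then have \<delta>: "0 < \<delta>" "\<delta> \<le> 1" by (simp_all add: \<delta>_def divide_le_eq del: power_Suc)
  have "hausdorff_content \<tau>' \<delta> D \<le> hausdorff_measure \<tau>' D"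
    unfolding hausdorff_measure_def using \<delta> by (intro SUP_upper) auto
  then have "hausdorff_content \<tau>' \<delta> D < 1" using \<tau>' by simp
  then obtain U :: "nat \<Rightarrow> real set" where U: "D \<subseteq> (\<Union>i. U i)" "\<And>i. bounded (U i)" "\<And>i. diameter (U i) \<le> \<delta>"
    and sumU: "(\<Sum>i. diam_power \<tau>' (U i)) < 1"
    unfolding hausdorff_content_def Inf_less_iff by auto
  define dm where "dm = (\<lambda>i. diameter (U i))"
  have dm0: "dm i \<ge> 0" for i unfolding dm_def using U(2) by (rule diameter_ge_0)
  \<comment> \<open>Diameters are at most \<open>1\<close>, so raising the exponent from \<tau>' to
    \<tau> does not increase the power. For \<tau>' = 0 a nonempty set contributes \<open>1\<close>
    by convention.\<close>
  have dmp: "ennreal (dm i powr \<tau>) \<le> diam_power \<tau>' (U i)" for i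
  proof (cases "U i = {}")
    case False
    have d1: "dm i \<le> 1" using U(3)[of i] \<delta> by (simp add: dm_def)
    show ?thesis
    proof (cases "\<tau>' = 0")
      case True
      have "dm i powr \<tau> \<le> 1 powr \<tau>" using d1 dm0 \<tau> by (intro powr_mono2) auto
      then show ?thesis using False True by (simp add: diam_power_def ennreal_le_1)
    next
      case nz: False
      have "dm i powr \<tau> \<le> dm i powr \<tau>'" using \<tau>' d1 dm0 by (intro powr_mono') auto
      then show ?thesis using False nz by (simp add: diam_power_def dm_def ennreal_leI)
    qed
  qed (simp add: dm_def)
  \<comment> \<open>Minimal radii whose \<open>\<tau>\<close>-sum is at most \<open>1\<close>; they
    give an open neighbourhood also to sets of diameter \<open>0\<close>.\<close>
  define e where "e = (\<lambda>i::nat. min \<delta> (((1 / 2) ^ Suc i) powr (1 / \<tau>)))"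
  have e: "e i > 0" "e i \<le> \<delta>" for i using \<delta> by (auto simp: e_def)
  have ep: "e i powr \<tau> \<le> (1 / 2) ^ Suc i" for i
  proof -
    have "e i powr \<tau> \<le> (((1 / 2) ^ Suc i) powr (1 / \<tau>)) powr \<tau>"
      using e(1)[of i] \<tau> by (intro powr_mono2) (auto simp: e_def)
    then show ?thesis using \<tau> by (simp add: powr_powr)
  qed
  define r where "r = (\<lambda>i. 2 * max (dm i) (e i))"
  have r: "r i > 0" "r i > dm i" "r i \<le> 1 / 2 ^ k0" for i
  proof -
    show "r i > 0" using e(1)[of i] by (simp add: r_def less_max_iff_disj)
    show "r i > dm i" using e(1)[of i] dm0[of i] unfolding r_def by linarith
    have "max (dm i) (e i) \<le> \<delta>" using U(3)[of i] e(2)[of i] by (simp add: dm_def)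
    moreover have "2 * \<delta> = 1 / 2 ^ k0" by (simp add: \<delta>_def)
    ultimately show "r i \<le> 1 / 2 ^ k0" unfolding r_def by linarith
  qed
  \<comment> \<open>An arbitrary real if \<open>U i\<close> is empty; the ball it then contributes
    is harmless, as its radius is still counted.\<close>
  define p where "p = (\<lambda>i. SOME t. t \<in> U i)"
  have cov: "D \<subseteq> (\<Union>i\<in>UNIV. ball (p i) (r i))"
  proof
    fix t assume "t \<in> D"
    then obtain i where i: "t \<in> U i" using U(1) by blast
    then have "p i \<in> U i" unfolding p_def by (rule someI)
    then have "dist (p i) t \<le> dm i" unfolding dm_def using i U(2) by (intro diameter_bounded_bound)
    then show "t \<in> (\<Union>i\<in>UNIV. ball (p i) (r i))" using r(2)[of i] by (intro UN_I[of i]) auto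
  qed
  obtain I where I: "finite I" "D \<subseteq> (\<Union>i\<in>I. ball (p i) (r i))"
    using compactE_image[OF compD _ cov] by auto
  have "\<forall>i. \<exists>k\<ge>k0. 1 / 2 ^ Suc k < r i \<and> r i \<le> 1 / 2 ^ k"
    using dyadic_scale[OF r(1,3)] by metis
  then obtain kk where kk: "\<And>i. kk i \<ge> k0" "\<And>i. 1 / 2 ^ Suc (kk i) < r i" "\<And>i. r i \<le> 1 / 2 ^ kk i" by metis
  have rsum: "(\<Sum>i\<in>I. r i powr \<tau>) \<le> 4"
  proof -
    have "ennreal (\<Sum>i\<in>I. dm i powr \<tau>) = (\<Sum>i\<in>I. ennreal (dm i powr \<tau>))" by (intro sum_ennreal[symmetric]) auto
    also have "\<dots> \<le> (\<Sum>i\<in>I. diam_power \<tau>' (U i))" by (intro sum_mono dmp)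
    also have "\<dots> \<le> (\<Sum>i. diam_power \<tau>' (U i))" by (intro sum_le_suminf I) auto
    finally have "ennreal (\<Sum>i\<in>I. dm i powr \<tau>) \<le> 1" using sumU by (meson le_less_trans less_imp_le)
    then have s1: "(\<Sum>i\<in>I. dm i powr \<tau>) \<le> 1" by (simp add: ennreal_le_1)
    have "(\<Sum>i\<in>I. e i powr \<tau>) \<le> (\<Sum>i\<in>I. (1 / 2) ^ Suc i)" by (intro sum_mono ep)
    also have "\<dots> \<le> (\<Sum>i. (1 / 2 :: real) ^ Suc i)"
      by (intro sum_le_suminf I) (auto intro: summable_geometric simp del: power_Suc simp: summable_Suc_iff)
    also have "\<dots> = 1" using power_half_series sums_unique by force
    finally have s2: "(\<Sum>i\<in>I. e i powr \<tau>) \<le> 1" .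
    have "r i powr \<tau> \<le> 2 * (dm i powr \<tau> + e i powr \<tau>)" for i
    proof -
      have "r i powr \<tau> = 2 powr \<tau> * (max (dm i) (e i)) powr \<tau>"
        unfolding r_def by (rule powr_mult)
      also have "\<dots> \<le> 2 * (dm i powr \<tau> + e i powr \<tau>)"
      proof (rule mult_mono)
        have "2 powr \<tau> \<le> (2::real) powr 1" using \<tau> by (intro powr_mono) auto
        then show "2 powr \<tau> \<le> (2::real)" by simp
        show "(max (dm i) (e i)) powr \<tau> \<le> dm i powr \<tau> + e i powr \<tau>" by (simp add: max_def)
      qed auto
      finally show ?thesis .
    qed
    then have "(\<Sum>i\<in>I. r i powr \<tau>) \<le> (\<Sum>i\<in>I. 2 * (dm i powr \<tau> + e i powr \<tau>))" by (intro sum_mono)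
    also have "\<dots> = 2 * ((\<Sum>i\<in>I. dm i powr \<tau>) + (\<Sum>i\<in>I. e i powr \<tau>))" by (simp add: sum_distrib_left sum.distrib)
    also have "\<dots> \<le> 2 * (1 + 1)" by (rule mult_left_mono[OF add_mono[OF s1 s2]]) simp
    finally show ?thesis by simp
  qed
  define P where "P = (\<lambda>k. p ` {i\<in>I. kk i = k})"
  show thesis
  proof (rule that[of P "Max (insert 0 (kk ` I))"])
    show "finite (P k)" for k using I by (simp add: P_def)
    show "real (card (P k)) \<le> 8 * 2 powr (real k * \<tau>)" for k
    proof -
      define J where "J = {i\<in>I. kk i = k}"
      have J: "finite J" using I by (simp add: J_def)
      have "real (card J) * 2 powr (- (real k + 1) * \<tau>) = (\<Sum>i\<in>J. (1 / 2 ^ Suc k) powr \<tau>)"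
      proof -
        have "(1 / 2 ^ Suc k :: real) = 2 powr (- (real k + 1))"
          by (simp only: powr_minus_divide powr_add powr_realpow[symmetric] of_nat_Suc) (simp add: powr_add powr_realpow)
        then show ?thesis by (simp add: powr_powr)
      qed
      also have "\<dots> \<le> (\<Sum>i\<in>J. r i powr \<tau>)"
        using kk(2) \<tau> by (intro sum_mono powr_mono2) (auto simp: J_def intro: less_imp_le)
      also have "\<dots> \<le> (\<Sum>i\<in>I. r i powr \<tau>)" using I by (intro sum_mono2) (auto simp: J_def)
      also have "\<dots> \<le> 4" by (rule rsum)
      finally have "real (card J) * 2 powr (- (real k + 1) * \<tau>) * 2 powr ((real k + 1) * \<tau>) \<le> 4 * 2 powr ((real k + 1) * \<tau>)"
        by (rule mult_right_mono) simp
      moreover have "2 powr (- (real k + 1) * \<tau>) * 2 powr ((real k + 1) * \<tau>) = (1::real)"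
        by (simp add: algebra_simps flip: powr_add)
      ultimately have "real (card J) \<le> 4 * 2 powr ((real k + 1) * \<tau>)" by (simp only: mult.assoc mult_1_right)
      also have "\<dots> = 4 * (2 powr (real k * \<tau>) * 2 powr \<tau>)" by (simp add: algebra_simps flip: powr_add)
      also have "\<dots> \<le> 4 * (2 powr (real k * \<tau>) * 2)"
      proof (intro mult_left_mono)
        have "2 powr \<tau> \<le> (2::real) powr 1" using \<tau> by (intro powr_mono) auto
        then show "2 powr \<tau> \<le> (2::real)" by simp
      qed auto
      finally have "real (card J) \<le> 8 * 2 powr (real k * \<tau>)" by simp
      moreover have "card (P k) \<le> card J" unfolding P_def J_def[symmetric] by (rule card_image_le[OF J])
      ultimately show ?thesis by linarith
    qed
    fix y assume "y \<in> E"
    then have "dist x y \<in> D" by (auto simp: D)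
    then obtain i where i: "i \<in> I" "dist (p i) (dist x y) < r i" using I(2) by auto
    have "\<bar>dist x y - p i\<bar> < 1 / 2 ^ kk i" using i(2) kk(3)[of i] by (simp add: dist_real_def abs_minus_commute)
    moreover have "kk i \<in> {k0..Max (insert 0 (kk ` I))}" using i(1) I kk(1)[of i] by simp
    moreover have "p i \<in> P (kk i)" using i(1) by (auto simp: P_def)
    ultimately show "\<exists>k\<in>{k0..Max (insert 0 (kk ` I))}. \<exists>p\<in>P k. \<bar>dist x y - p\<bar> < 1 / 2 ^ k" by blast
  qed
qed

section \<open>Pigeonholing the pins and the final contradiction\<close>

lemma frostman_mono:
  assumes "frostman s K \<delta> X w" "K \<le> K'" "\<delta> \<le> \<delta>'"
  shows "frostman s K' \<delta>' X w"
  unfolding frostman_def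
proof (intro conjI allI impI)
  fix z r assume "\<delta>' \<le> r"
  then have "(\<Sum>x\<in>{x\<in>X. dist z x \<le> r}. w x) \<le> K * r powr s" using assms by (auto simp: frostman_def)
  also have "\<dots> \<le> K' * r powr s" using assms by (intro mult_right_mono) auto
  finally show "(\<Sum>x\<in>{x\<in>X. dist z x \<le> r}. w x) \<le> K' * r powr s" .
qed (use assms in \<open>auto simp: frostman_def\<close>)

lemma annuli_incidence_bound:
  fixes R s \<beta> \<tau> :: real
  assumes R: "R \<ge> 1" and d: "DIM('a) \<ge> 2" and s: "0 < s" "2 * s < real DIM('a) - 1" and \<tau>: "0 < \<tau>" "\<tau> < 1"
    and \<beta>: "2 * \<tau> + (real DIM('a) - 1) / 2 < \<beta>" and sum: "s + \<beta> > 2 * \<tau> + real DIM('a) - 1"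
  obtains \<eta> C where "\<eta> > 0" "C > 0"
    "\<And>(X::'a::euclidean_space set) U w Y m K n. n \<ge> 2 \<Longrightarrow> frostman s K (1 / 2 ^ n) X w \<Longrightarrow> frostman \<beta> K (1 / 2 ^ n) Y m \<Longrightarrow>
      X \<subseteq> cball 0 R \<Longrightarrow> Y \<subseteq> cball 0 R \<Longrightarrow> K \<ge> 1 \<Longrightarrow>
      (\<And>x. x \<in> X \<Longrightarrow> finite (U x) \<and> real (card (U x)) \<le> K * 2 powr (real n * \<tau>)) \<Longrightarrow>
      (\<Sum>x\<in>X. w x * (\<Sum>y\<in>{y\<in>Y. \<exists>u\<in>U x. \<bar>(dist y x)\<^sup>2 - u\<bar> \<le> 1 / 2 ^ n}. m y)) \<le> C * K ^ 3 * 2 powr (- \<eta> * real n)"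
proof (cases "DIM('a) = 2")
  case True
  have \<beta>2: "2 * \<tau> + 1 / 2 < \<beta>" using \<beta> True by simp
  show thesis
  proof (rule annuli_incidence_bound_plane[where 'a = 'a, OF R True s(1) \<tau>(1) \<beta>2])
    fix \<eta> C :: real
    assume pos: "\<eta> > 0" "C > 0" and bound: "\<And>(X::'a set) U w Y m K n. frostman s K (1 / 2 ^ n) X w \<Longrightarrow> frostman \<beta> K (1 / 2 ^ n) Y m \<Longrightarrow>
        X \<subseteq> cball 0 R \<Longrightarrow> Y \<subseteq> cball 0 R \<Longrightarrow> K \<ge> 1 \<Longrightarrow>
        (\<And>x. x \<in> X \<Longrightarrow> finite (U x) \<and> real (card (U x)) \<le> K * 2 powr (real n * \<tau>)) \<Longrightarrow>
        (\<Sum>x\<in>X. w x * (\<Sum>y\<in>{y\<in>Y. \<exists>u\<in>U x. \<bar>(dist y x)\<^sup>2 - u\<bar> \<le> 1 / 2 ^ n}. m y)) \<le> C * K ^ 3 * 2 powr (- \<eta> * real n)"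
    show thesis by (rule that[OF pos]) (rule bound)
  qed
next
  case False
  then have d3: "DIM('a) \<ge> 3" using d by simp
  have "0 \<le> (real DIM('a) - 1) / 2" using d by simp
  then have \<beta>0: "\<beta> \<ge> 0" using \<beta> \<tau>(1) by linarith
  show thesis
  proof (rule annuli_incidence_bound_high[where 'a = 'a, OF R d3 s \<beta>0 \<tau> sum])
    fix \<eta> C :: real
    assume pos: "\<eta> > 0" "C > 0" and bound: "\<And>(X::'a set) U w Y m K n. n \<ge> 2 \<Longrightarrow> frostman s K (1 / 2 ^ n) X w \<Longrightarrow> frostman \<beta> K (1 / 2 ^ n) Y m \<Longrightarrow>
        X \<subseteq> cball 0 R \<Longrightarrow> Y \<subseteq> cball 0 R \<Longrightarrow> K \<ge> 1 \<Longrightarrow>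
        (\<And>x. x \<in> X \<Longrightarrow> finite (U x) \<and> real (card (U x)) \<le> K * 2 powr (real n * \<tau>)) \<Longrightarrow>
        (\<Sum>x\<in>X. w x * (\<Sum>y\<in>{y\<in>Y. \<exists>u\<in>U x. \<bar>(dist y x)\<^sup>2 - u\<bar> \<le> 1 / 2 ^ n}. m y)) \<le> C * K ^ 3 * 2 powr (- \<eta> * real n)"
    show thesis by (rule that[OF pos]) (rule bound)
  qed
qed

theorem exceptional_pins_dim_le:
  fixes E :: "'a::euclidean_space set" and \<beta> \<tau> :: real
  assumes dim: "DIM('a) \<ge> 2" and E: "compact E" and dimE: "hausdorff_dim E = ereal \<beta>"
    and \<tau>: "0 < \<tau>" "\<tau> < 1" and \<beta>1: "2 * \<tau> + (real DIM('a) - 1) / 2 < \<beta>" and \<beta>2: "\<beta> < 2 * \<tau> + real DIM('a) - 1"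
  shows "hausdorff_dim {x::'a. hausdorff_dim (pinned_distance_set x E) < ereal \<tau>} \<le> ereal (2 * \<tau> - \<beta> + real DIM('a) - 1)"
proof (rule ccontr)
  define F where "F = {x::'a. hausdorff_dim (pinned_distance_set x E) < ereal \<tau>}"
  define d where "d = real DIM('a)"
  define b where "b = 2 * \<tau> - \<beta> + d - 1"
  assume "\<not> ?thesis"
  \<comment> \<open>The lower bound on \<beta> says precisely \<open>b < (d - 1) / 2\<close>, so an
    exponent \<open>s\<close> can be found that the incidence bound admits.\<close>
  then have "ereal b < min (hausdorff_dim F) (ereal ((d - 1) / 2))"
    using \<beta>1 by (simp add: F_def b_def d_def field_simps)
  then obtain s where s: "ereal b < ereal s" "ereal s < min (hausdorff_dim F) (ereal ((d - 1) / 2))"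
    using ereal_dense2 by blast
  have b0: "b > 0" using \<beta>2 by (simp add: b_def d_def)
  have s0: "s > b" "s > 0" "2 * s < d - 1" using s b0 by auto
  \<comment> \<open>At the exponent \<beta> itself \<open>E\<close> may have measure zero. The
    exponent is lowered by so little that both strict inequalities of the incidence bound
    survive.\<close>
  obtain \<mu> where \<mu>: "\<mu> > 0" "\<mu> < s - b" "\<mu> < \<beta> - 2 * \<tau> - (d - 1) / 2"
    using field_lbound_gt_zero[of "s - b" "\<beta> - 2 * \<tau> - (d - 1) / 2"] s0 \<beta>1 by (auto simp: d_def field_simps)
  define \<beta>' where "\<beta>' = \<beta> - \<mu>"
  have \<beta>': "\<beta>' < \<beta>" "2 * \<tau> + (d - 1) / 2 < \<beta>'" "s + \<beta>' > 2 * \<tau> + d - 1"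
    using \<mu> by (simp_all add: \<beta>'_def b_def)
  have d1: "d \<ge> 1" using dim by (simp add: d_def)
  have \<beta>'0: "\<beta>' > 0"
  proof -
    have "0 \<le> (d - 1) / 2" using d1 by simp
    then show ?thesis using \<beta>'(2) \<tau>(1) by linarith
  qed
  have "ereal \<beta>' < hausdorff_dim E" using dimE \<beta>' by simp
  then obtain cE where cE: "0 < cE" "cE \<le> 1" "content_ge \<beta>' cE E"
    using content_ge_of_dim[OF \<beta>'0] by blast
  have "ereal s < hausdorff_dim F" using s by simp
  then obtain cF0 where cF0: "0 < cF0" "cF0 \<le> 1" "content_ge s cF0 F"
    using content_ge_of_dim[OF s0(2)] by blast
  obtain RF cF where RF: "RF \<ge> 1" and cF: "0 < cF" "cF \<le> 1" "content_ge s cF (F \<inter> cball 0 RF)"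
    using content_ge_bounded_part[OF cF0(3,1,2)] by blast
  obtain RE where RE: "E \<subseteq> cball 0 RE" using compact_imp_bounded[OF E] by (auto simp: bounded_iff subset_iff)
  define R where "R = max RF RE"
  have R: "R \<ge> 1" using RF by (simp add: R_def)
  have ER: "E \<subseteq> cball 0 R" using RE by (auto simp: R_def)
  define F' where "F' = F \<inter> cball 0 RF"
  have F'R: "F' \<subseteq> cball 0 R" by (auto simp: F'_def R_def)
  define KE where "KE = (3::real) ^ DIM('a) * 2 powr \<beta>'"
  define KF where "KF = (3::real) ^ DIM('a) * 2 powr s"
  define c' where "c' = cE / d powr \<beta>'"
  have c'0: "c' > 0" using cE d1 by (simp add: c'_def)
  have "\<exists>Y m. Y \<subseteq> E \<and> sum m Y = c' \<and> frostman \<beta>' KE (1 / 2 ^ k) Y m" for k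
    using discrete_frostman[OF cE(3,1,2) ER \<beta>'0, of k] unfolding c'_def d_def KE_def by metis
  then obtain Y m where Y: "\<And>k. Y k \<subseteq> E" "\<And>k. sum (m k) (Y k) = c'" "\<And>k. frostman \<beta>' KE (1 / 2 ^ k) (Y k) (m k)"
    by metis
  have Yfin: "finite (Y k)" and m0: "y \<in> Y k \<Longrightarrow> m k y \<ge> 0" for k y using Y(3)[of k] by (auto simp: frostman_def)
  define f where "f = (\<lambda>k S. sum (m k) (Y k \<inter> S))"
  have f0: "0 \<le> f k S" for k S unfolding f_def using m0 by (intro sum_nonneg) auto
  have fc: "f k S \<le> c'" for k S
    unfolding f_def Y(2)[of k, symmetric] using m0 Yfin by (intro sum_mono2) auto
  obtain L where L: "\<And>I \<epsilon> N. finite I \<Longrightarrow> \<epsilon> > 0 \<Longrightarrow> \<exists>n\<ge>N. \<forall>S\<in>I. \<bar>f n S - L S\<bar> < \<epsilon>"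
  proof (rule bounded_functions_cluster_point[of f c', OF f0 fc])
    fix L
    assume L: "\<And>I \<epsilon> N. finite I \<Longrightarrow> \<epsilon> > 0 \<Longrightarrow> \<exists>n\<ge>N. \<forall>i\<in>I. \<bar>f n i - L i\<bar> < \<epsilon>"
    show thesis by (rule that) (rule L)
  qed
  have d2: "2 * s < real DIM('a) - 1" using s0 by (simp add: d_def)
  have \<beta>'2: "2 * \<tau> + (real DIM('a) - 1) / 2 < \<beta>'" "s + \<beta>' > 2 * \<tau> + real DIM('a) - 1" using \<beta>' by (auto simp: d_def)
  show False
  proof (rule annuli_incidence_bound[where 'a = 'a, OF R dim s0(2) d2 \<tau> \<beta>'2])
    fix \<eta> C :: real
    assume \<eta>: "\<eta> > 0" and C: "C > 0" and core: "\<And>(X::'a set) U w Y m K n. n \<ge> 2 \<Longrightarrow> frostman s K (1 / 2 ^ n) X w \<Longrightarrow> frostman \<beta>' K (1 / 2 ^ n) Y m \<Longrightarrow>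
      X \<subseteq> cball 0 R \<Longrightarrow> Y \<subseteq> cball 0 R \<Longrightarrow> K \<ge> 1 \<Longrightarrow>
      (\<And>x. x \<in> X \<Longrightarrow> finite (U x) \<and> real (card (U x)) \<le> K * 2 powr (real n * \<tau>)) \<Longrightarrow>
      (\<Sum>x\<in>X. w x * (\<Sum>y\<in>{y\<in>Y. \<exists>u\<in>U x. \<bar>(dist y x)\<^sup>2 - u\<bar> \<le> 1 / 2 ^ n}. m y)) \<le> C * K ^ 3 * 2 powr (- \<eta> * real n)"
    \<comment> \<open>Passing from \<open>p\<close> to \<open>p\<^sup>2\<close> enlarges errors by
      at most \<open>4 * R + 1\<close>, hence costs \<open>q\<close> dyadic scales.\<close>
    obtain q :: nat where q: "4 * R + 1 < 2 ^ q" using real_arch_pow[of 2 "4 * R + 1"] by auto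
    \<comment> \<open>Absorbs both Frostman constants and the factor
      \<open>8 * 2 powr (q * \<tau>)\<close>, which arises when the number of radii at scale
      \<open>n + q\<close> is compared with \<open>2 powr (n * \<tau>)\<close>.\<close>
    define K where "K = max (max 1 (8 * 2 powr (real q * \<tau>))) (max KE KF)"
    have K: "K \<ge> 1" "K \<ge> 8 * 2 powr (real q * \<tau>)" "K \<ge> KE" "K \<ge> KF" by (auto simp: K_def)
    \<comment> \<open>With \<open>\<theta> = 2 powr (- \<eta> / 4)\<close> the gain of the incidence
      bound is \<open>\<theta> ^ (4 * k)\<close> up to constants. The pigeonholing on the pins and
      on \<open>E\<close> loses at most \<open>\<theta> ^ (2 * k)\<close>, so
      \<open>\<theta> ^ (2 * k)\<close> is left.\<close>
    define \<eta>' where "\<eta>' = \<eta> / 4"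
    define \<theta> where "\<theta> = (2::real) powr (- \<eta>')"
    have \<theta>: "0 < \<theta>" "\<theta> < 1" using \<eta> powr_less_mono[of "- \<eta>'" 0 2] by (auto simp: \<theta>_def \<eta>'_def)
    \<comment> \<open>Normalises the pigeonhole weights to have sum \<open>1 / 2\<close>.\<close>
    define a where "a = (1 - \<theta>) / 2"
    have a: "a > 0" using \<theta> by (simp add: a_def)
    define \<omega> where "\<omega> = (\<lambda>k. a * \<theta> ^ k)"
    have \<omega>: "\<omega> k > 0" for k using a \<theta> by (simp add: \<omega>_def)
    have "(\<lambda>k. a * \<theta> ^ k) sums (a * (1 / (1 - \<theta>)))" using \<theta> by (intro sums_mult geometric_sums) auto
    moreover have "a * (1 / (1 - \<theta>)) = 1 / 2" using \<theta> by (simp add: a_def)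
    ultimately have "\<omega> sums (1 / 2)" by (simp only: \<omega>_def)
    then have \<omega>s: "summable \<omega>" "suminf \<omega> = 1 / 2" by (auto simp: sums_iff)
    \<comment> \<open>\<open>B * \<theta> ^ (2 * k)\<close> will bound the incidence sum from below
      and \<open>G * \<theta> ^ (4 * k)\<close> from above.\<close>
    define B where "B = (cF * a / d powr s) * (c' * a / 2)"
    have B: "B > 0" using cF a c'0 d1 by (simp add: B_def)
    define G where "G = C * K ^ 3 * 2 powr (\<eta> * real q)"
    have "\<exists>k0. G * (\<theta> ^ 2) ^ k0 < B"
    proof -
      have "\<theta> ^ 2 < 1" using \<theta> by (simp add: power_less_one_iff)
      then have "(\<lambda>k. G * (\<theta> ^ 2) ^ k) \<longlonglongrightarrow> G * 0" using \<theta> by (intro tendsto_mult tendsto_const LIMSEQ_power_zero) auto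
      then have "eventually (\<lambda>k. G * (\<theta> ^ 2) ^ k < B) sequentially" using B by (intro order_tendstoD(2)) auto
      then show ?thesis by (rule eventually_happens'[OF sequentially_bot])
    qed
    then obtain k1 where k1: "G * (\<theta> ^ 2) ^ k1 < B" by blast
    define k0 where "k0 = max k1 (q + 2)"
    define S where "S = (\<lambda>(k::nat) x P. {y\<in>E. \<exists>p\<in>P. \<bar>dist x y - p\<bar> < 1 / 2 ^ k})"
    \<comment> \<open>Membership is decided by \<open>L\<close> and not by any single weight, so
      that \<open>H j\<close> does not depend on a resolution; the resolution can be chosen after
      the scale and the pins.\<close>
    define H where "H = (\<lambda>j. {x\<in>F'. \<exists>P. finite P \<and> real (card P) \<le> 8 * 2 powr (real (k0 + j) * \<tau>) \<and> c' * \<omega> (k0 + j) \<le> L (S (k0 + j) x P)})"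
    have "F' \<subseteq> (\<Union>j. H j)"
    proof
      fix x assume x: "x \<in> F'"
      then have "hausdorff_dim (pinned_distance_set x E) < ereal \<tau>" by (simp add: F'_def F_def)
      then obtain M P where P: "\<And>k. finite (P k)" "\<And>k. real (card (P k)) \<le> 8 * 2 powr (real k * \<tau>)"
        "\<And>y. y \<in> E \<Longrightarrow> \<exists>k\<in>{k0..M}. \<exists>p\<in>P k. \<bar>dist x y - p\<bar> < 1 / 2 ^ k"
      proof (rule pinned_distance_cover[OF E \<tau>, of x k0])
        fix M P
        assume P: "\<And>k. finite (P k)" "\<And>k. real (card (P k)) \<le> 8 * 2 powr (real k * \<tau>)"
          "\<And>y. y \<in> E \<Longrightarrow> \<exists>k\<in>{k0..M}. \<exists>p\<in>P k. \<bar>dist x y - p\<bar> < 1 / 2 ^ k"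
        show thesis by (rule that) (rule P(1), rule P(2), rule P(3))
      qed
      show "x \<in> (\<Union>j. H j)"
      proof (rule ccontr)
        assume no: "x \<notin> (\<Union>j. H j)"
        have small: "L (S k x (P k)) < c' * \<omega> k" if k: "k \<ge> k0" for k
        proof (rule ccontr)
          assume "\<not> ?thesis"
          then have "x \<in> H (k - k0)" using x P(1,2)[of k] k unfolding H_def by auto
          then show False using no by blast
        qed
        \<comment> \<open>The approximation errors add up to at most \<open>c' / 4\<close> and the
          values of \<open>L\<close> to at most \<open>c' / 2\<close>, too little for the total mass
          \<open>c'\<close>.\<close>
        define \<epsilon> where "\<epsilon> = c' / (4 * (real (card {k0..M}) + 1))"
        have \<epsilon>: "\<epsilon> > 0" using c'0 by (simp add: \<epsilon>_def add_nonneg_pos)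
        obtain n where n: "\<forall>T\<in>(\<lambda>k. S k x (P k)) ` {k0..M}. \<bar>f n T - L T\<bar> < \<epsilon>"
          using L[of "(\<lambda>k. S k x (P k)) ` {k0..M}" \<epsilon> 0] \<epsilon> by auto
        have "Y n \<subseteq> (\<Union>k\<in>{k0..M}. Y n \<inter> S k x (P k))"
          using Y(1)[of n] P(3) by (fastforce simp: S_def)
        then have "c' \<le> sum (m n) (\<Union>k\<in>{k0..M}. Y n \<inter> S k x (P k))"
          unfolding Y(2)[of n, symmetric] using Yfin m0 by (intro sum_mono2) auto
        also have "\<dots> \<le> (\<Sum>k\<in>{k0..M}. f n (S k x (P k)))"
        proof -
          \<comment> \<open>The weight is known to be nonnegative on \<open>Y n\<close> only;
            truncation makes it nonnegative everywhere without changing the sums.\<close>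
          have "sum (m n) (\<Union>k\<in>{k0..M}. Y n \<inter> S k x (P k)) = sum (\<lambda>y. max 0 (m n y)) (\<Union>k\<in>{k0..M}. Y n \<inter> S k x (P k))"
            using m0 by (intro sum.cong) auto
          also have "\<dots> \<le> (\<Sum>k\<in>{k0..M}. sum (\<lambda>y. max 0 (m n y)) (Y n \<inter> S k x (P k)))"
            using Yfin by (intro sum_UN_le) auto
          also have "\<dots> = (\<Sum>k\<in>{k0..M}. f n (S k x (P k)))"
            unfolding f_def using m0 by (intro sum.cong) auto
          finally show ?thesis .
        qed
        also have "\<dots> \<le> (\<Sum>k\<in>{k0..M}. c' * \<omega> k + \<epsilon>)"
        proof (rule sum_mono)
          fix k assume k: "k \<in> {k0..M}"
          have "\<bar>f n (S k x (P k)) - L (S k x (P k))\<bar> < \<epsilon>" using n k by blast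
          then show "f n (S k x (P k)) \<le> c' * \<omega> k + \<epsilon>" using small[of k] k by simp
        qed
        also have "\<dots> = c' * (\<Sum>k\<in>{k0..M}. \<omega> k) + real (card {k0..M}) * \<epsilon>" by (simp add: sum.distrib sum_distrib_left)
        finally have le: "c' \<le> c' * (\<Sum>k\<in>{k0..M}. \<omega> k) + real (card {k0..M}) * \<epsilon>" .
        have "(\<Sum>k\<in>{k0..M}. \<omega> k) \<le> 1 / 2"
          unfolding \<omega>s(2)[symmetric] using \<omega> by (intro sum_le_suminf \<omega>s(1)) (auto intro: less_imp_le)
        then have half: "c' * (\<Sum>k\<in>{k0..M}. \<omega> k) \<le> c' * (1 / 2)" using c'0 by (intro mult_left_mono) auto
        have "real (card {k0..M}) * \<epsilon> \<le> (real (card {k0..M}) + 1) * \<epsilon>" using \<epsilon> by (intro mult_right_mono) auto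
        also have "\<dots> = c' / 4"
        proof -
          have "(t + 1) * (c' / (4 * (t + 1))) = c' / 4" if "t \<ge> 0" for t :: real using that by (simp add: divide_simps)
          then show ?thesis unfolding \<epsilon>_def by simp
        qed
        finally show False using le half c'0 by linarith
      qed
    qed
    then have "content_ge s cF (\<Union>j. H j)" using cF(3) content_ge_mono unfolding F'_def by blast
    then obtain j where j: "content_ge s (cF * \<omega> j) (H j)"
      using content_ge_Union[of s cF H \<omega>] cF(1) less_imp_le[OF \<omega>] \<omega>s by fastforce
    define k where "k = k0 + j"
    have kq: "k \<ge> q + 2" "k \<ge> k1" by (auto simp: k_def k0_def)
    \<comment> \<open>Squaring the distances takes place at scale \<open>n\<close>, which is coarser
      than \<open>k\<close> by \<open>q\<close> steps; the start \<open>k0 \<ge> q + 2\<close>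
      ensures \<open>n \<ge> 2\<close>.\<close>
    define n where "n = k - q"
    have n2: "n \<ge> 2" and kn: "k = n + q" using kq by (auto simp: n_def)
    have \<omega>1: "\<omega> i \<le> 1" for i
    proof -
      have "\<omega> i \<le> 1 * 1" unfolding \<omega>_def a_def using \<theta> by (intro mult_mono power_le_one) auto
      then show ?thesis by simp
    qed
    have cj: "0 < cF * \<omega> j" "cF * \<omega> j \<le> 1" using cF \<omega>[of j] \<omega>1[of j] mult_mono[of cF 1 "\<omega> j" 1] by auto
    have HR: "H j \<subseteq> cball 0 R" using F'R by (auto simp: H_def)
    obtain X w where X: "X \<subseteq> H j" "sum w X = cF * \<omega> j / d powr s" "frostman s KF (1 / 2 ^ k) X w"
      using discrete_frostman[OF j cj HR s0(2), of k] unfolding d_def KF_def by metis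
    have Xfin: "finite X" and w0: "x \<in> X \<Longrightarrow> w x \<ge> 0" for x using X(3) by (auto simp: frostman_def)
    have "\<forall>x\<in>X. \<exists>P. finite P \<and> real (card P) \<le> 8 * 2 powr (real k * \<tau>) \<and> c' * \<omega> k \<le> L (S k x P)"
      using X(1) by (auto simp: H_def k_def)
    then obtain P where P: "\<And>x. x \<in> X \<Longrightarrow> finite (P x)" "\<And>x. x \<in> X \<Longrightarrow> real (card (P x)) \<le> 8 * 2 powr (real k * \<tau>)"
      "\<And>x. x \<in> X \<Longrightarrow> c' * \<omega> k \<le> L (S k x (P x))" by metis
    have "c' * \<omega> k / 2 > 0" using c'0 \<omega> by simp
    \<comment> \<open>The weight on \<open>E\<close> is selected only now, fine enough for scale
      \<open>k\<close> and close to \<open>L\<close> on the finitely many sets attached to the pins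
      in \<open>X\<close>.\<close>
    then obtain M where M: "M \<ge> k" "\<forall>T\<in>(\<lambda>x. S k x (P x)) ` X. \<bar>f M T - L T\<bar> < c' * \<omega> k / 2"
      using L[of "(\<lambda>x. S k x (P x)) ` X" "c' * \<omega> k / 2" k] Xfin by auto
    define U where "U = (\<lambda>x. (\<lambda>p. p\<^sup>2) ` P x)"
    have scale: "(1::real) / 2 ^ k \<le> 1 / 2 ^ n" "(1::real) / 2 ^ M \<le> 1 / 2 ^ n"
      using kn M(1) by (auto intro!: divide_left_mono power_increasing)
    have XR: "X \<subseteq> cball 0 R" using X(1) HR by blast
    have YR: "Y M \<subseteq> cball 0 R" using Y(1) ER by blast
    have lower: "c' * \<omega> k / 2 \<le> (\<Sum>y\<in>{y\<in>Y M. \<exists>u\<in>U x. \<bar>(dist y x)\<^sup>2 - u\<bar> \<le> 1 / 2 ^ n}. m M y)" if x: "x \<in> X" for x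
    proof -
      have "\<bar>f M (S k x (P x)) - L (S k x (P x))\<bar> < c' * \<omega> k / 2" using M(2) x by blast
      then have "c' * \<omega> k / 2 \<le> f M (S k x (P x))" using P(3)[OF x] by linarith
      also have "\<dots> \<le> (\<Sum>y\<in>{y\<in>Y M. \<exists>u\<in>U x. \<bar>(dist y x)\<^sup>2 - u\<bar> \<le> 1 / 2 ^ n}. m M y)"
        unfolding f_def
      proof (rule sum_mono2)
        show "Y M \<inter> S k x (P x) \<subseteq> {y\<in>Y M. \<exists>u\<in>U x. \<bar>(dist y x)\<^sup>2 - u\<bar> \<le> 1 / 2 ^ n}"
        proof
          fix y assume y: "y \<in> Y M \<inter> S k x (P x)"
          then obtain p where p: "p \<in> P x" "\<bar>dist x y - p\<bar> < 1 / 2 ^ k" by (auto simp: S_def)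
          have d2R: "dist x y \<le> 2 * R"
          proof -
            have "norm x \<le> R" "norm y \<le> R" using x XR y YR by auto
            then show ?thesis using norm_triangle_ineq4[of x y] by (simp add: dist_norm)
          qed
          have k1': "(1::real) / 2 ^ k \<le> 1" by simp
          have "\<bar>(dist y x)\<^sup>2 - p\<^sup>2\<bar> = \<bar>dist x y - p\<bar> * \<bar>dist x y + p\<bar>"
            by (simp add: dist_commute[of y x] power2_eq_square square_diff_square_factored abs_mult mult.commute)
          also have "\<dots> \<le> (1 / 2 ^ k) * (4 * R + 1)"
          proof (rule mult_mono)
            have "\<bar>dist x y + p\<bar> \<le> 2 * dist x y + \<bar>dist x y - p\<bar>" using zero_le_dist[of x y] by linarith
            also have "\<dots> \<le> 2 * (2 * R) + 1" using d2R less_imp_le[OF less_le_trans[OF p(2) k1']]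
              by (intro add_mono mult_left_mono) auto
            finally show "\<bar>dist x y + p\<bar> \<le> 4 * R + 1" by simp
          qed (use p in auto)
          also have "\<dots> \<le> (1 / 2 ^ k) * 2 ^ q" using q by (intro mult_left_mono) auto
          also have "\<dots> = 1 / 2 ^ n" by (simp add: kn power_add)
          finally have "\<bar>(dist y x)\<^sup>2 - p\<^sup>2\<bar> \<le> 1 / 2 ^ n" .
          then show "y \<in> {y\<in>Y M. \<exists>u\<in>U x. \<bar>(dist y x)\<^sup>2 - u\<bar> \<le> 1 / 2 ^ n}" using y p(1) by (auto simp: U_def)
        qed
      qed (use Yfin m0 in auto)
      finally show ?thesis .
    qed
    have "sum w X * (c' * \<omega> k / 2) \<le> (\<Sum>x\<in>X. w x * (\<Sum>y\<in>{y\<in>Y M. \<exists>u\<in>U x. \<bar>(dist y x)\<^sup>2 - u\<bar> \<le> 1 / 2 ^ n}. m M y))"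
      unfolding sum_distrib_right by (intro sum_mono mult_left_mono lower w0)
    also have "\<dots> \<le> C * K ^ 3 * 2 powr (- \<eta> * real n)"
    proof (rule core[OF n2 _ _ XR YR K(1)])
      show "frostman s K (1 / 2 ^ n) X w" by (rule frostman_mono[OF X(3) K(4) scale(1)])
      show "frostman \<beta>' K (1 / 2 ^ n) (Y M) (m M)" by (rule frostman_mono[OF Y(3) K(3) scale(2)])
      fix x assume x: "x \<in> X"
      have "real (card (U x)) \<le> real (card (P x))" unfolding U_def using card_image_le[OF P(1)[OF x]] by simp
      also have "\<dots> \<le> 8 * 2 powr (real k * \<tau>)" by (rule P(2)[OF x])
      also have "\<dots> = 8 * 2 powr (real q * \<tau>) * 2 powr (real n * \<tau>)" by (simp add: kn algebra_simps flip: powr_add)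
      also have "\<dots> \<le> K * 2 powr (real n * \<tau>)" using K(2) by (intro mult_right_mono) auto
      finally show "finite (U x) \<and> real (card (U x)) \<le> K * 2 powr (real n * \<tau>)" using P(1)[OF x] by (simp add: U_def)
    qed
    also have "2 powr (- \<eta> * real n) = 2 powr (\<eta> * real q) * (\<theta> ^ 2) ^ k * (\<theta> ^ 2) ^ k"
    proof -
      have "(\<theta> ^ 2) ^ k = 2 powr (- \<eta> * real k / 2)"
        by (simp add: \<theta>_def \<eta>'_def powr_power mult.commute flip: power_mult)
      then show ?thesis by (simp add: kn algebra_simps flip: powr_add)
    qed
    also have "C * K ^ 3 * (2 powr (\<eta> * real q) * (\<theta> ^ 2) ^ k * (\<theta> ^ 2) ^ k) = (G * (\<theta> ^ 2) ^ k) * (\<theta> ^ 2) ^ k"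
      by (simp add: G_def)
    also have "\<dots> < B * (\<theta> ^ 2) ^ k"
    proof (rule mult_strict_right_mono)
      have "(\<theta> ^ 2) ^ k \<le> (\<theta> ^ 2) ^ k1" using \<theta> kq by (intro power_decreasing) (auto simp: power_le_one)
      then have "G * (\<theta> ^ 2) ^ k \<le> G * (\<theta> ^ 2) ^ k1" using C K by (intro mult_left_mono) (auto simp: G_def)
      then show "G * (\<theta> ^ 2) ^ k < B" using k1 by linarith
    qed (use \<theta> in simp)
    \<comment> \<open>The pins were pigeonholed with index \<open>j\<close> and not
      \<open>k = k0 + j\<close>; as \<theta> < 1, the weight \<open>\<omega> j\<close> is at least
      \<open>\<omega> k\<close>.\<close>
    also have "\<dots> \<le> sum w X * (c' * \<omega> k / 2)"
    proof -
      have "\<theta> ^ k \<le> \<theta> ^ j" using \<theta> by (intro power_decreasing) (auto simp: k_def)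
      then have "(cF * a / d powr s) * \<theta> ^ k * ((c' * a / 2) * \<theta> ^ k) \<le> (cF * a / d powr s) * \<theta> ^ j * ((c' * a / 2) * \<theta> ^ k)"
        using cF a c'0 \<theta> by (intro mult_right_mono mult_left_mono) auto
      then show ?thesis by (simp add: B_def X(2) \<omega>_def power2_eq_square power_mult_distrib mult_ac)
    qed
    finally show False by simp
  qed
qed

theorem theorem2p2:
  fixes E :: "(real ^ 'n) set" and \<beta> \<tau> :: real
  assumes "CARD('n) \<ge> 2"
    and "compact E"
    and "\<beta> > 0"
    and "hausdorff_dim E = ereal \<beta>"
    and "0 < \<tau>" and "\<tau> < 1"
    and "2 * \<tau> + (real CARD('n) - 1) / 2 < \<beta>"
    and "\<beta> < 2 * \<tau> + real CARD('n) - 1"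
  shows "hausdorff_dim {x :: real ^ 'n. hausdorff_dim (pinned_distance_set x E) < ereal \<tau>}
           \<le> ereal (2 * \<tau> - \<beta> + real CARD('n) - 1)"
  using exceptional_pins_dim_le[of E \<beta> \<tau>] assms by simp

end
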